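(* Let $\chi\in\widehat{\mathcal O_{\mathbb E}^\times}$ with $\chi^2=1$ and put $\eta=\chi|_{\mathcal O_{\mathbb F}^\times}$. (1) For $s\in(\frac14,\frac12)$ and $t=2s-\frac12$, the intertwining operator $(C_{-s,-t}^{\chi,\eta})^\vee:J(\eta,t)^{-\infty}\to I(\chi,s)^{-\infty}$ restricts to an isometric embedding (up to a scalar) $J(\eta,t)\hookrightarrow I(\chi,s)$. In particular, the restriction of the irreducible unitarizable representation $\pi_{\chi,s}$ of $G$ to $G'$ contains $\tau_{\eta,t}$ as a direct summand. (2) For $s=t=\frac12$, the intertwining operator $(C_{-s,-t}^{\chi,\eta})^\vee:J(\eta,t)^{-\infty}\to I(\chi,s)^{-\infty}$ restricts to an isometric embedding (up to a scalar) $J(\eta,t)_0\hookrightarrow I(\chi,s)_0$. In particular, the restriction of the irreducible unitarizable representation $\pi_{\chi,s}^0$ of $G$ to $G'$ contains $\tau_{\eta,t}^0$ as a direct summand.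
   Context: Fields. $\mathbb E/\mathbb F$ is a quadratic extension of non-archimedean local fields, $\mathbb E=\mathbb F(\alpha)$ with $\alpha\in\mathbb E\setminus\mathbb F$, $\alpha^2\in\mathbb F^\times\setminus\mathbb F^{\times2}$. For $k\in\{\mathbb E,\mathbb F\}$: $\mathcal O_k$, $\mathcal O_k^\times$, $\varpi_k$, $q_k$, $\nu_k$ are the ring of integers, units, a chosen uniformizer, residue cardinality, valuation; $|\cdot|_k$ is the absolute value with $d(ax)=|a|_k\,dx$ for Haar measure on $k$. After possibly multiplying $\alpha$ by a power of $\varpi_{\mathbb F}$, either $\alpha^2\in\mathcal O_{\mathbb F}^\times$ (unramified case) or $\alpha^2\in\varpi_{\mathbb F}\mathcal O_{\mathbb F}^\times$ (ramified case). Write $x=x_1+x_2\alpha\in\mathbb E$, $x_i\in\mathbb F$, $dx=dx_1dx_2$. For a (continuous) character $\chi\in\widehat{\mathcal O_k^\times}$ and $s\in\mathbb C$, $\chi_s(x)=\chi(\varpi_k^{-\nu_k(x)}x)|x|_k^s$ on $k^\times$. Representations. $G=\mathrm{PGL}(2,\mathbb E)\supseteq G'=\mathrm{PGL}(2,\mathbb F)$, upper triangular Borel subgroups $B,B'$, $\chi_s\begin{pmatrix}a&b\\ 0&1\end{pmatrix}=\chi_s(a)$; $\pi_{\chi,s}$ is left translation on $\operatorname{Ind}_B^G(\chi_s)=\{f:G\to\mathbb C\text{ locally constant}:f(gb)=\chi_{s+\frac12}(b)^{-1}f(g)\ \forall g\in G,b\in B\}$; $\tau_{\eta,t}$ likewise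 for $G',B',\eta_t$. With $\overline n_x=\begin{pmatrix}1&0\\ x&1\end{pmatrix}$, $I(\chi,s)^\infty=\{x\mapsto f(\overline n_x)\ (x\in\mathbb E): f\in\operatorname{Ind}_B^G(\chi_s)\}$ with the transported $G$-action. The $G$-invariant non-degenerate pairing $(f_1,f_2)\mapsto\int_{\mathbb E}f_1f_2\,dx$ on $I(\chi,s)^\infty\times I(\overline\chi,-s)^\infty$ embeds $I(\chi,s)^\infty$ into $I(\chi,s)^{-\infty}:=(I(\overline\chi,-s)^\infty)^\vee$ (algebraic dual). Since $C_c^\infty(\mathbb E)$ (locally constant compactly supported functions) is contained in $I(\overline\chi,-s)^\infty$, $I(\chi,s)^{-\infty}$ is viewed as a subspace of $\mathcal D'(\mathbb E)$, the space of all linear functionals on $C_c^\infty(\mathbb E)$. Unitary structures ($\chi^2=1$). Fix a non-trivial additive character $\psi$ of $\mathbb F$, extended by $\psi(x_1+x_2\alpha)=\psi(x_1)$, and let $\widehat f(x)=\int_{\mathbb E}\psi(xy)f(y)\,dy$, extended to distributions by duality. For $s\in(0,\frac12)$, the $G$-invariant form $\langle f_1,f_2\rangle_{\chi,s}=\int_{\mathbb E}\int_{\mathbb E}|x-x'|_{\mathbb E}^{2s-1}f_1(x)\overline{f_2(x')}\,dx\,dx'$ on $I(\chi,s)^\infty$, a constant multiple of $\int_{\mathbb E}\widehat f_1\overline{\widehat f_2}|x|_{\mathbb E}^{-2s}dx$, is positive definite, and $I(\chi,s)=\{f\in\mathcal D'(\mathbb E):\widehat f\in L^2(\mathbb E,|x|_{\mathbb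 E}^{-2s}dx)\}$ is the completion; $I(\chi,s)^\infty\subseteq I(\chi,s)\subseteq I(\chi,s)^{-\infty}$. For $s=\frac12$, $I(\chi,\frac12)_0^\infty=\{f\in I(\chi,\frac12)^\infty:\int_{\mathbb E}f\,dx=0\}$ (Steinberg representation $\pi_{\chi,\frac12}^0$) carries the invariant inner product given, up to a positive constant, by $\int_{\mathbb E}\widehat f_1\overline{\widehat f_2}|x|_{\mathbb E}^{-1}dx$; its completion is $I(\chi,\frac12)_0=\{f\in\mathcal D'(\mathbb E):\widehat f\in L^2(\mathbb E,|x|_{\mathbb E}^{-1}dx)\}$. $J(\eta,t)^{\pm\infty}$, $J(\eta,t)$, $J(\eta,\frac12)_0$, $\tau^0_{\eta,\frac12}$ are the analogous objects for $G'$ and $\mathbb F$. The operator. For $\eta=\chi|_{\mathcal O_{\mathbb F}^\times}$ and $t'=2s'+\frac12$, the restriction $C_{s',t'}^{\chi,\eta}:I(\chi,s')^\infty\to J(\eta,t')^\infty$, $f\mapsto f|_{\mathbb F}$, is $G'$-intertwining; its transpose is $(C_{s',t'}^{\chi,\eta})^\vee:J(\overline\eta,-t')^{-\infty}\to I(\overline\chi,-s')^{-\infty}$, $f\mapsto f(x_1)\delta(x_2)$, where $\delta$ is the Dirac distribution at $0\in\mathbb F$. The operator in the claim is the case $s'=-s$, $t'=-t$. "Direct summand" is meant in the sense of unitary representations on the Hilbert space completions (closed $G'$-invariant subspace unitarily equivalent to the given one). "Isometric up to a scalar" means a non-zero constant multiple of an isometry.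
   Formalization: The chosen uniformizers are assumed compatible, i.e. χ_0(ϖ_F)=1 with χ_0 formed using ϖ_E; otherwise (e.g. E/F unramified, ϖ_E=uϖ_F with χ(u)=-1) restriction to F is not G'-intertwining for η=χ|O_F^×. *)

theory Defs
  imports "HOL-Analysis.Analysis" "HOL-Algebra.Coset"
begin

text \<open>
  A non-archimedean local field is a field complete with respect to a discrete valuation with
  finite residue field. The normalized valuation \<open>val\<close> is determined by the topological field, so
  it is no additional datum; its value at 0 is unspecified. The base 2 of the metric is an
  arbitrary choice which affects neither the topology nor completeness; the normalized absolute
  value is \<open>absval\<close> below.
\<close>

class nonarch_local_field = field + complete_space +
  fixes val :: "'a \<Rightarrow> int"
  assumes val_mult: "x \<noteq> 0 \<Longrightarrow> y \<noteq> 0 \<Longrightarrow> val (x * y) = val x + val y"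
    and val_add: "x \<noteq> 0 \<Longrightarrow> y \<noteq> 0 \<Longrightarrow> x + y \<noteq> 0 \<Longrightarrow> min (val x) (val y) \<le> val (x + y)"
    and val_normalized: "\<exists>x. x \<noteq> 0 \<and> val x = 1"
    and dist_val: "dist x y = (if x = y then 0 else 2 powi (- val (x - y)))"
    and finite_residue_field:
      "finite ({x. x = 0 \<or> 0 \<le> val x} //
        {(x, y). (x = 0 \<or> 0 \<le> val x) \<and> (y = 0 \<or> 0 \<le> val y) \<and> (x = y \<or> 1 \<le> val (x - y))})"

definition unit_group :: "'k::nonarch_local_field set" where
  "unit_group = {x. x \<noteq> 0 \<and> val x = 0}"

definition uniformizer :: "'k::nonarch_local_field \<Rightarrow> bool" where
  "uniformizer w \<longleftrightarrow> w \<noteq> 0 \<and> val w = 1"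

text \<open>On a local field (second countable, locally compact) a Borel measure that is finite on
  compact sets is automatically regular.\<close>

definition haar_measure :: "'k::{topological_space, ab_group_add} measure \<Rightarrow> bool" where
  "haar_measure M \<longleftrightarrow> sets M = sets borel
     \<and> (\<forall>a. \<forall>A\<in>sets borel. emeasure M ((+) a ` A) = emeasure M A)
     \<and> (\<forall>C. compact C \<longrightarrow> emeasure M C < \<infinity>)
     \<and> (\<forall>U. open U \<and> U \<noteq> {} \<longrightarrow> emeasure M U > 0)"

definition absval :: "'k::nonarch_local_field \<Rightarrow> real" where
  "absval a = (THE c. 0 \<le> c \<and> (\<forall>M. haar_measure M \<longrightarrow>
     (\<forall>A\<in>sets borel. emeasure M ((*) a ` A) = ennreal c * emeasure M A)))"

definition unit_character :: "('k::nonarch_local_field \<Rightarrow> complex) \<Rightarrow> bool" where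
  "unit_character chi \<longleftrightarrow> continuous_on unit_group chi
     \<and> (\<forall>x\<in>unit_group. \<forall>y\<in>unit_group. chi (x * y) = chi x * chi y)
     \<and> (\<forall>x\<in>unit_group. norm (chi x) = 1)"

definition additive_character :: "('k::nonarch_local_field \<Rightarrow> complex) \<Rightarrow> bool" where
  "additive_character \<psi> \<longleftrightarrow> continuous_on UNIV \<psi>
     \<and> (\<forall>x y. \<psi> (x + y) = \<psi> x * \<psi> y) \<and> (\<forall>x. norm (\<psi> x) = 1)"

record 'k field_data =
  haar :: "'k measure"
  addchar :: "'k \<Rightarrow> complex"
  unif :: 'k

definition field_data :: "'k::nonarch_local_field field_data \<Rightarrow> bool" where
  "field_data K \<longleftrightarrow> haar_measure (haar K)
     \<and> additive_character (addchar K) \<and> (\<exists>x. addchar K x \<noteq> 1)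
     \<and> uniformizer (unif K)"

text \<open>This depends on the chosen uniformizer. For a field extension, \<open>mult_char E chi s\<close> restricts
  to \<open>mult_char F (chi \<circ> \<iota>) (2 * s)\<close> on the smaller field F only if the two uniformizers are
  compatible in the sense that \<open>mult_char E chi 0 (\<iota> (unif F)) = 1\<close>.\<close>

definition mult_char ::
  "'k::nonarch_local_field field_data \<Rightarrow> ('k \<Rightarrow> complex) \<Rightarrow> complex \<Rightarrow> 'k \<Rightarrow> complex" where
  "mult_char K chi s x = chi (unif K powi (- val x) * x) * complex_of_real (absval x) powr s"

text \<open>The smaller field is embedded by \<open>\<iota>\<close>; a continuous homomorphism between local fields
  automatically is a homeomorphism onto its image.\<close>

definition quadratic_extension ::
  "('f::nonarch_local_field \<Rightarrow> 'e::nonarch_local_field) \<Rightarrow> 'e \<Rightarrow> bool" where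
  "quadratic_extension \<iota> \<alpha> \<longleftrightarrow>
     (\<forall>x y. \<iota> (x + y) = \<iota> x + \<iota> y) \<and> (\<forall>x y. \<iota> (x * y) = \<iota> x * \<iota> y) \<and> \<iota> 1 = 1
     \<and> continuous_on UNIV \<iota>
     \<and> (\<forall>x. \<exists>x1 x2. x = \<iota> x1 + \<iota> x2 * \<alpha>) \<and> \<alpha> \<notin> range \<iota>
     \<and> (\<exists>d. \<alpha>\<^sup>2 = \<iota> d \<and> d \<noteq> 0 \<and> (\<nexists>y. d = y\<^sup>2) \<and> (val d = 0 \<or> val d = 1))"

definition from_coords ::
  "('f::nonarch_local_field \<Rightarrow> 'e::nonarch_local_field) \<Rightarrow> 'e \<Rightarrow> 'f \<times> 'f \<Rightarrow> 'e" where
  "from_coords \<iota> \<alpha> = (\<lambda>(x1, x2). \<iota> x1 + \<iota> x2 * \<alpha>)"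

definition extension_data ::
  "('f::nonarch_local_field \<Rightarrow> 'e::nonarch_local_field) \<Rightarrow> 'e \<Rightarrow> 'f field_data \<Rightarrow> 'e \<Rightarrow> 'e field_data"
where
  "extension_data \<iota> \<alpha> F w =
     \<lparr> haar = distr (haar F \<Otimes>\<^sub>M haar F) borel (from_coords \<iota> \<alpha>),
       addchar = (\<lambda>x. addchar F (fst (inv_into UNIV (from_coords \<iota> \<alpha>) x))),
       unif = w \<rparr>"

definition GL2 :: "('k::field^2^2) monoid" where
  "GL2 = \<lparr> carrier = {A. det A \<noteq> 0}, monoid.mult = (**), one = mat 1 \<rparr>"

definition scalar_matrices :: "('k::field^2^2) set" where
  "scalar_matrices = {mat c | c. c \<noteq> 0}"

definition PGL2 :: "('k::field^2^2) set monoid" where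
  "PGL2 = GL2 Mod scalar_matrices"

definition pgl_class :: "'k::field^2^2 \<Rightarrow> ('k^2^2) set" where
  "pgl_class A = scalar_matrices #>\<^bsub>GL2\<^esub> A"

text \<open>The quotient topology of GL(2).\<close>

definition PGL2_topology :: "('k::{field, topological_space}^2^2) set topology" where
  "PGL2_topology = topology (\<lambda>U. U \<subseteq> carrier PGL2 \<and> open {A. det A \<noteq> 0 \<and> pgl_class A \<in> U})"

definition pgl_map :: "('f::field \<Rightarrow> 'e::field) \<Rightarrow> ('f^2^2) set \<Rightarrow> ('e^2^2) set" where
  "pgl_map \<iota> C = scalar_matrices <#>\<^bsub>GL2\<^esub> ((\<lambda>A. \<chi> i j. \<iota> (A $ i $ j)) ` C)"

definition borel_elt :: "'k::field \<Rightarrow> 'k \<Rightarrow> ('k^2^2) set" where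
  "borel_elt a b = pgl_class (vector [vector [a, b], vector [0, 1]])"

definition nbar :: "'k::field \<Rightarrow> ('k^2^2) set" where
  "nbar x = pgl_class (vector [vector [1, 0], vector [x, 1]])"

definition Ind ::
  "'k::nonarch_local_field field_data \<Rightarrow> ('k \<Rightarrow> complex) \<Rightarrow> complex \<Rightarrow> (('k^2^2) set \<Rightarrow> complex) set"
where
  "Ind K chi s = {f \<in> extensional (carrier PGL2).
     (\<forall>g\<in>carrier PGL2. \<exists>U. openin PGL2_topology U \<and> g \<in> U \<and> (\<forall>h\<in>U. f h = f g))
     \<and> (\<forall>g\<in>carrier PGL2. \<forall>a b. a \<noteq> 0 \<longrightarrow>
          f (g \<otimes>\<^bsub>PGL2\<^esub> borel_elt a b) = inverse (mult_char K chi (s + 1/2) a) * f g)}"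

definition nbar_restrict :: "(('k::field^2^2) set \<Rightarrow> complex) \<Rightarrow> 'k \<Rightarrow> complex" where
  "nbar_restrict f = (\<lambda>x. f (nbar x))"

definition left_translate ::
  "('k::field^2^2) set \<Rightarrow> (('k^2^2) set \<Rightarrow> complex) \<Rightarrow> ('k^2^2) set \<Rightarrow> complex" where
  "left_translate g f = restrict (\<lambda>h. f (m_inv PGL2 g \<otimes>\<^bsub>PGL2\<^esub> h)) (carrier PGL2)"

definition I_smooth ::
  "'k::nonarch_local_field field_data \<Rightarrow> ('k \<Rightarrow> complex) \<Rightarrow> complex \<Rightarrow> ('k \<Rightarrow> complex) set" where
  "I_smooth K chi s = nbar_restrict ` Ind K chi s"

definition smooth_action ::
  "'k::nonarch_local_field field_data \<Rightarrow> ('k \<Rightarrow> complex) \<Rightarrow> complex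
    \<Rightarrow> ('k^2^2) set \<Rightarrow> ('k \<Rightarrow> complex) \<Rightarrow> 'k \<Rightarrow> complex" where
  "smooth_action K chi s g f =
     nbar_restrict (left_translate g (the_inv_into (Ind K chi s) nbar_restrict f))"

definition I_smooth0 ::
  "'k::nonarch_local_field field_data \<Rightarrow> ('k \<Rightarrow> complex) \<Rightarrow> ('k \<Rightarrow> complex) set" where
  "I_smooth0 K chi = {f \<in> I_smooth K chi (1/2). (\<integral>x. f x \<partial>haar K) = 0}"

definition Cc_smooth :: "('k::topological_space \<Rightarrow> complex) set" where
  "Cc_smooth = {\<phi>. (\<forall>x. \<exists>U. open U \<and> x \<in> U \<and> (\<forall>y\<in>U. \<phi> y = \<phi> x)) \<and> compact (closure {x. \<phi> x \<noteq> 0})}"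

text \<open>Linear functionals on a space of functions, extended by 0 off that space (so that
  pointwise sums and multiples of functionals are again of this form).\<close>

definition algebraic_dual :: "('a \<Rightarrow> complex) set \<Rightarrow> (('a \<Rightarrow> complex) \<Rightarrow> complex) set" where
  "algebraic_dual V = {T. (\<forall>f. f \<notin> V \<longrightarrow> T f = 0)
     \<and> (\<forall>f\<in>V. \<forall>g\<in>V. T (\<lambda>x. f x + g x) = T f + T g)
     \<and> (\<forall>c. \<forall>f\<in>V. T (\<lambda>x. c * f x) = c * T f)}"

definition distributions :: "(('k::topological_space \<Rightarrow> complex) \<Rightarrow> complex) set" where
  "distributions = algebraic_dual Cc_smooth"

definition I_dual ::
  "'k::nonarch_local_field field_data \<Rightarrow> ('k \<Rightarrow> complex) \<Rightarrow> complex
    \<Rightarrow> (('k \<Rightarrow> complex) \<Rightarrow> complex) set" where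
  "I_dual K chi s = algebraic_dual (I_smooth K (\<lambda>x. cnj (chi x)) (- s))"

definition as_distribution ::
  "(('k::topological_space \<Rightarrow> complex) \<Rightarrow> complex) \<Rightarrow> ('k \<Rightarrow> complex) \<Rightarrow> complex" where
  "as_distribution T = (\<lambda>\<phi>. if \<phi> \<in> Cc_smooth then T \<phi> else 0)"

definition function_distribution ::
  "'k::topological_space field_data \<Rightarrow> ('k \<Rightarrow> complex) \<Rightarrow> ('k \<Rightarrow> complex) \<Rightarrow> complex" where
  "function_distribution K f = as_distribution (\<lambda>\<phi>. \<integral>x. f x * \<phi> x \<partial>haar K)"

definition fourier ::
  "'k::nonarch_local_field field_data \<Rightarrow> ('k \<Rightarrow> complex) \<Rightarrow> 'k \<Rightarrow> complex" where
  "fourier K f = (\<lambda>x. \<integral>y. addchar K (x * y) * f y \<partial>haar K)"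

definition fourier_distribution ::
  "'k::nonarch_local_field field_data \<Rightarrow> (('k \<Rightarrow> complex) \<Rightarrow> complex) \<Rightarrow> ('k \<Rightarrow> complex) \<Rightarrow> complex"
where
  "fourier_distribution K T = as_distribution (\<lambda>\<phi>. T (fourier K \<phi>))"

definition given_by ::
  "'k::topological_space field_data \<Rightarrow> (('k \<Rightarrow> complex) \<Rightarrow> complex) \<Rightarrow> ('k \<Rightarrow> complex) \<Rightarrow> bool" where
  "given_by K T g \<longleftrightarrow> g \<in> borel_measurable borel
     \<and> (\<forall>\<phi>\<in>Cc_smooth. integrable (haar K) (\<lambda>x. g x * \<phi> x))
     \<and> T = function_distribution K g"

definition hilb ::
  "'k::nonarch_local_field field_data \<Rightarrow> real \<Rightarrow> (('k \<Rightarrow> complex) \<Rightarrow> complex) set" where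
  "hilb K s = {T \<in> distributions. \<exists>g. given_by K (fourier_distribution K T) g
     \<and> integrable (haar K) (\<lambda>x. (norm (g x))\<^sup>2 * absval x powr (- 2 * s))}"

text \<open>The choice is immaterial: any two functions representing the Fourier transform agree almost
  everywhere.\<close>

definition fourier_function ::
  "'k::nonarch_local_field field_data \<Rightarrow> (('k \<Rightarrow> complex) \<Rightarrow> complex) \<Rightarrow> 'k \<Rightarrow> complex" where
  "fourier_function K T = (SOME g. given_by K (fourier_distribution K T) g)"

text \<open>For \<open>0 < s < 1/2\<close> this is a positive multiple of the form with kernel \<open>absval (x - x') powr (2 * s - 1)\<close>
  on smooth vectors. The inner product does not involve chi, but the group action does.\<close>

definition hilb_inner ::
  "'k::nonarch_local_field field_data \<Rightarrow> real \<Rightarrow> (('k \<Rightarrow> complex) \<Rightarrow> complex)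
    \<Rightarrow> (('k \<Rightarrow> complex) \<Rightarrow> complex) \<Rightarrow> complex" where
  "hilb_inner K s T1 T2 =
     (\<integral>x. fourier_function K T1 x * cnj (fourier_function K T2 x)
          * complex_of_real (absval x powr (- 2 * s)) \<partial>haar K)"

definition inner_norm :: "('v \<Rightarrow> 'v \<Rightarrow> complex) \<Rightarrow> 'v \<Rightarrow> real" where
  "inner_norm ip v = sqrt (Re (ip v v))"

definition subspace_of_functions :: "('a \<Rightarrow> complex) set \<Rightarrow> bool" where
  "subspace_of_functions V \<longleftrightarrow> (\<lambda>x. 0) \<in> V
     \<and> (\<forall>f\<in>V. \<forall>g\<in>V. (\<lambda>x. f x + g x) \<in> V) \<and> (\<forall>c. \<forall>f\<in>V. (\<lambda>x. c * f x) \<in> V)"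

definition linear_between ::
  "('a \<Rightarrow> complex) set \<Rightarrow> ('b \<Rightarrow> complex) set \<Rightarrow> (('a \<Rightarrow> complex) \<Rightarrow> 'b \<Rightarrow> complex) \<Rightarrow> bool" where
  "linear_between V W L \<longleftrightarrow> (\<forall>f\<in>V. L f \<in> W)
     \<and> (\<forall>f\<in>V. \<forall>g\<in>V. L (\<lambda>x. f x + g x) = (\<lambda>y. L f y + L g y))
     \<and> (\<forall>c. \<forall>f\<in>V. L (\<lambda>x. c * f x) = (\<lambda>y. c * L f y))"

definition hilbert_space ::
  "('a \<Rightarrow> complex) set \<Rightarrow> (('a \<Rightarrow> complex) \<Rightarrow> ('a \<Rightarrow> complex) \<Rightarrow> complex) \<Rightarrow> bool" where
  "hilbert_space V ip \<longleftrightarrow> subspace_of_functions V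
     \<and> (\<forall>f\<in>V. \<forall>g\<in>V. \<forall>h\<in>V. ip (\<lambda>x. f x + g x) h = ip f h + ip g h)
     \<and> (\<forall>c. \<forall>f\<in>V. \<forall>h\<in>V. ip (\<lambda>x. c * f x) h = c * ip f h)
     \<and> (\<forall>f\<in>V. \<forall>h\<in>V. ip h f = cnj (ip f h))
     \<and> (\<forall>f\<in>V. f \<noteq> (\<lambda>x. 0) \<longrightarrow> Re (ip f f) > 0)
     \<and> (\<forall>u. (\<forall>n::nat. u n \<in> V)
          \<and> (\<forall>e>0. \<exists>N. \<forall>m\<ge>N. \<forall>n\<ge>N. inner_norm ip (\<lambda>x. u m x - u n x) < e)
          \<longrightarrow> (\<exists>f\<in>V. (\<lambda>n. inner_norm ip (\<lambda>x. u n x - f x)) \<longlonglongrightarrow> 0))"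

definition closed_subspace ::
  "('a \<Rightarrow> complex) set \<Rightarrow> (('a \<Rightarrow> complex) \<Rightarrow> ('a \<Rightarrow> complex) \<Rightarrow> complex)
    \<Rightarrow> ('a \<Rightarrow> complex) set \<Rightarrow> bool" where
  "closed_subspace V ip W \<longleftrightarrow> W \<subseteq> V \<and> subspace_of_functions W
     \<and> (\<forall>u. \<forall>f\<in>V. (\<forall>n::nat. u n \<in> W) \<and> (\<lambda>n. inner_norm ip (\<lambda>x. u n x - f x)) \<longlonglongrightarrow> 0 \<longrightarrow> f \<in> W)"

definition unitary_rep ::
  "'g monoid \<Rightarrow> 'g topology \<Rightarrow> ('a \<Rightarrow> complex) set
    \<Rightarrow> (('a \<Rightarrow> complex) \<Rightarrow> ('a \<Rightarrow> complex) \<Rightarrow> complex)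
    \<Rightarrow> ('g \<Rightarrow> ('a \<Rightarrow> complex) \<Rightarrow> 'a \<Rightarrow> complex) \<Rightarrow> bool" where
  "unitary_rep G X V ip \<rho> \<longleftrightarrow> hilbert_space V ip
     \<and> (\<forall>g\<in>carrier G. linear_between V V (\<rho> g)
          \<and> (\<forall>f\<in>V. \<forall>h\<in>V. ip (\<rho> g f) (\<rho> g h) = ip f h))
     \<and> (\<forall>f\<in>V. \<rho> \<one>\<^bsub>G\<^esub> f = f)
     \<and> (\<forall>g\<in>carrier G. \<forall>h\<in>carrier G. \<forall>f\<in>V. \<rho> (g \<otimes>\<^bsub>G\<^esub> h) f = \<rho> g (\<rho> h f))
     \<and> (\<forall>f\<in>V. \<forall>g\<in>carrier G. \<forall>e>0. \<exists>U. openin X U \<and> g \<in> U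
          \<and> (\<forall>h\<in>U. inner_norm ip (\<lambda>x. \<rho> h f x - \<rho> g f x) < e))"

definition invariant_subspace ::
  "'g monoid \<Rightarrow> ('g \<Rightarrow> ('a \<Rightarrow> complex) \<Rightarrow> 'a \<Rightarrow> complex) \<Rightarrow> ('a \<Rightarrow> complex) set \<Rightarrow> bool" where
  "invariant_subspace G \<rho> W \<longleftrightarrow> (\<forall>g\<in>carrier G. \<forall>f\<in>W. \<rho> g f \<in> W)"

definition irreducible_unitary_rep ::
  "'g monoid \<Rightarrow> 'g topology \<Rightarrow> ('a \<Rightarrow> complex) set
    \<Rightarrow> (('a \<Rightarrow> complex) \<Rightarrow> ('a \<Rightarrow> complex) \<Rightarrow> complex)
    \<Rightarrow> ('g \<Rightarrow> ('a \<Rightarrow> complex) \<Rightarrow> 'a \<Rightarrow> complex) \<Rightarrow> bool" where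
  "irreducible_unitary_rep G X V ip \<rho> \<longleftrightarrow> unitary_rep G X V ip \<rho> \<and> V \<noteq> {\<lambda>x. 0}
     \<and> (\<forall>W. closed_subspace V ip W \<and> invariant_subspace G \<rho> W \<longrightarrow> W = {\<lambda>x. 0} \<or> W = V)"

definition contains_summand ::
  "'g monoid \<Rightarrow> 'g topology
    \<Rightarrow> ('a \<Rightarrow> complex) set \<Rightarrow> (('a \<Rightarrow> complex) \<Rightarrow> ('a \<Rightarrow> complex) \<Rightarrow> complex)
    \<Rightarrow> ('g \<Rightarrow> ('a \<Rightarrow> complex) \<Rightarrow> 'a \<Rightarrow> complex)
    \<Rightarrow> ('b \<Rightarrow> complex) set \<Rightarrow> (('b \<Rightarrow> complex) \<Rightarrow> ('b \<Rightarrow> complex) \<Rightarrow> complex)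
    \<Rightarrow> ('g \<Rightarrow> ('b \<Rightarrow> complex) \<Rightarrow> 'b \<Rightarrow> complex) \<Rightarrow> bool" where
  "contains_summand G X V ip \<rho> V' ip' \<rho>' \<longleftrightarrow>
     unitary_rep G X V ip \<rho> \<and> unitary_rep G X V' ip' \<rho>'
     \<and> (\<exists>W L. closed_subspace V ip W \<and> invariant_subspace G \<rho> W
          \<and> linear_between V' W L \<and> bij_betw L V' W
          \<and> (\<forall>f\<in>V'. \<forall>h\<in>V'. ip (L f) (L h) = ip' f h)
          \<and> (\<forall>g\<in>carrier G. \<forall>f\<in>V'. L (\<rho>' g f) = \<rho> g (L f)))"

text \<open>The continuous extension, to the completion \<open>hilb K s\<close>, of an action \<open>\<sigma>\<close> on the dense
  subspace of (distributions given by) the functions in \<open>V\<close>.\<close>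

definition completed_action ::
  "'k::nonarch_local_field field_data \<Rightarrow> real \<Rightarrow> ('k \<Rightarrow> complex) set
    \<Rightarrow> ('g \<Rightarrow> ('k \<Rightarrow> complex) \<Rightarrow> 'k \<Rightarrow> complex)
    \<Rightarrow> 'g \<Rightarrow> (('k \<Rightarrow> complex) \<Rightarrow> complex) \<Rightarrow> ('k \<Rightarrow> complex) \<Rightarrow> complex" where
  "completed_action K s V \<sigma> g T = (THE S. S \<in> hilb K s
     \<and> (\<forall>e>0. \<exists>d>0. \<forall>f\<in>V.
          inner_norm (hilb_inner K s) (\<lambda>\<phi>. T \<phi> - function_distribution K f \<phi>) < d
          \<longrightarrow> inner_norm (hilb_inner K s) (\<lambda>\<phi>. S \<phi> - function_distribution K (\<sigma> g f) \<phi>) < e))"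

definition complementary_action ::
  "'k::nonarch_local_field field_data \<Rightarrow> ('k \<Rightarrow> complex) \<Rightarrow> real
    \<Rightarrow> ('k^2^2) set \<Rightarrow> (('k \<Rightarrow> complex) \<Rightarrow> complex) \<Rightarrow> ('k \<Rightarrow> complex) \<Rightarrow> complex" where
  "complementary_action K chi s =
     completed_action K s (I_smooth K chi (of_real s)) (smooth_action K chi (of_real s))"

definition steinberg_action ::
  "'k::nonarch_local_field field_data \<Rightarrow> ('k \<Rightarrow> complex)
    \<Rightarrow> ('k^2^2) set \<Rightarrow> (('k \<Rightarrow> complex) \<Rightarrow> complex) \<Rightarrow> ('k \<Rightarrow> complex) \<Rightarrow> complex" where
  "steinberg_action K chi = completed_action K (1/2) (I_smooth0 K chi) (smooth_action K chi (1/2))"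

text \<open>The transpose of the restriction of functions in \<open>I_smooth E chi' s'\<close> along \<open>\<iota>\<close>; on test
  functions it sends \<open>\<phi>\<close> to the value of \<open>T\<close> at \<open>\<phi>(x1 + 0 * \<alpha>)\<close>, i.e. it is
  the tensor product of \<open>T\<close> with the Dirac distribution in the second coordinate.\<close>

definition restriction_transpose ::
  "('f \<Rightarrow> 'e::nonarch_local_field) \<Rightarrow> 'e field_data \<Rightarrow> ('e \<Rightarrow> complex) \<Rightarrow> complex
    \<Rightarrow> (('f \<Rightarrow> complex) \<Rightarrow> complex) \<Rightarrow> ('e \<Rightarrow> complex) \<Rightarrow> complex" where
  "restriction_transpose \<iota> E chi' s' T = (\<lambda>f. if f \<in> I_smooth E chi' s' then T (f \<circ> \<iota>) else 0)"

text \<open>An operator \<open>A\<close> from \<open>D\<close> to \<open>D'\<close> restricts to an isometric embedding, up to a scalar, of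
  the Hilbert spaces \<open>H\<close> into \<open>H'\<close>. Elements of the duals \<open>D\<close>, \<open>D'\<close> are compared with
  distributions by restriction to test functions. This map has a kernel (functionals supported
  at infinity), so the property is required for all functionals representing an element of \<open>H\<close>.\<close>

definition restricts_to_scaled_isometry ::
  "((('f::topological_space \<Rightarrow> complex) \<Rightarrow> complex) \<Rightarrow> ('e::topological_space \<Rightarrow> complex) \<Rightarrow> complex)
    \<Rightarrow> (('f \<Rightarrow> complex) \<Rightarrow> complex) set \<Rightarrow> (('e \<Rightarrow> complex) \<Rightarrow> complex) set
    \<Rightarrow> (('f \<Rightarrow> complex) \<Rightarrow> complex) set
    \<Rightarrow> ((('f \<Rightarrow> complex) \<Rightarrow> complex) \<Rightarrow> (('f \<Rightarrow> complex) \<Rightarrow> complex) \<Rightarrow> complex)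
    \<Rightarrow> (('e \<Rightarrow> complex) \<Rightarrow> complex) set
    \<Rightarrow> ((('e \<Rightarrow> complex) \<Rightarrow> complex) \<Rightarrow> (('e \<Rightarrow> complex) \<Rightarrow> complex) \<Rightarrow> complex) \<Rightarrow> bool" where
  "restricts_to_scaled_isometry A D D' H ip H' ip' \<longleftrightarrow>
     (\<forall>T\<in>D. A T \<in> D') \<and> H \<subseteq> as_distribution ` D
     \<and> (\<exists>c>0. \<forall>T\<in>D. as_distribution T \<in> H \<longrightarrow>
          as_distribution (A T) \<in> H'
          \<and> inner_norm ip' (as_distribution (A T)) = c * inner_norm ip (as_distribution T))"

end

theory Submission
 imports Defs
begin

text \<open>
 On the Fourier side \<open>hilb K s\<close> is the space of functions that are square integrable with weight
 \<open>|x|^(-2s)\<close>. On smooth vectors its inner product is a multiple of the form with kernel \<open>|x - y|^(2s - 1)\<close>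
 (for \<open>s = 1/2\<close>: with a logarithmic kernel, on functions of integral 0), because this kernel is a
 superposition of the positive definite functions \<open>1[|x - y| \<le> |a|]\<close>; the Moebius covariance of the kernel
 makes the action isometric. Irreducibility already holds for the affine group.

 The transpose of restriction sends the vector with Fourier transform \<open>g\<close> to the vector with Fourier
 transform \<open>x1 + x2 \<alpha> \<mapsto> g x1\<close>. Substituting \<open>x2 = x1 u\<close>, this multiplies the squared norm by the integral of
 \<open>|1 + u \<alpha>|^(-2s)\<close>, which is finite for \<open>s > 1/4\<close>. The embedding intertwines the completed actions because both
 sides agree on test functions vanishing near one point, and no nonzero vector is supported at a point.
\<close>

text \<open>Two obstacles shape the development. The group acts on a completion by limits over
  smooth vectors, so properties of the action are shown on smooth vectors and carried over by
  density. The embedding, however, produces distributions concentrated on the subfield, which are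
  not smooth, so equivariance cannot be read off from the smooth action of the larger group. It is
  tested by duality: the operators are transposes of explicit Moebius substitutions with parameter
  \<open>- s\<close>, provided that these keep supports compact, which is why one point has to be
  excluded.

  At \<open>s = 1/2\<close> the superposition of ball kernels diverges. Subtracting the indicator of
  |a| >= 1 leaves a kernel that turns products into sums, so Moebius maps change it by terms in one
  variable only, and these die on functions of integral 0.

  Each ball kernel contributes the integral of |FT f|^2 over the dual ball. These contributions are
  nonnegative, so one exchange of integrals yields both the membership of \<open>FT f\<close> in the
  weighted space and the norm formula; the Fourier transform of the kernel itself never
  appears.\<close>

abbreviation "bm \<equiv> borel_measurable borel"

abbreviation "Cc \<equiv> Cc_smooth"

section \<open>Balls in a local field\<close>

text \<open>The fractional ideals. Zero is adjoined by hand, since \<open>val 0\<close> is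
  unspecified.\<close>

definition vball :: "int => 'k::nonarch_local_field set" where
 "vball n = {x. x = 0 \<or> n <= val x}"

lemma val_one [simp]: "val (1::'k::nonarch_local_field) = 0" using val_mult[of "1::'k" 1] by simp

lemma val_minus [simp]: "val (- x) = val (x::'k::nonarch_local_field)"
proof (cases "x = 0")
 case False
 have "val ((-1) * (-1::'k)) = val (-1::'k) + val (-1::'k)" by (rule val_mult) auto
 hence "val (-1::'k) = 0" by simp
 thus ?thesis using val_mult[of "-1" x] False by simp
qed simp

lemma val_inverse: "x ~= 0 ==> val (inverse x) = - val (x::'k::nonarch_local_field)" using val_mult[of x "inverse x"] by simp

lemma val_divide: "x ~= 0 ==> y ~= 0 ==> val (x / y) = val x - val (y::'k::nonarch_local_field)"
 by (simp add: divide_inverse val_mult val_inverse)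

lemma val_power: "x ~= 0 ==> val (x ^ n) = int n * val (x::'k::nonarch_local_field)" by (induction n) (simp_all add: val_mult algebra_simps)

lemma val_powi: "x ~= 0 ==> val (x powi n) = n * val (x::'k::nonarch_local_field)" by (simp add: power_int_def val_power val_inverse)

lemma vball_0 [simp]: "0 \<in> vball n" by (simp add: vball_def)

lemma vball_add: "x \<in> vball n ==> y \<in> vball n ==> x + y \<in> vball n" unfolding vball_def using val_add[of x y] by fastforce

lemma vball_minus_iff [simp]: "- x \<in> vball n \<longleftrightarrow> x \<in> vball n" by (auto simp: vball_def)

lemma vball_mult: "x \<in> vball m ==> y \<in> vball n ==> x * y \<in> vball (m + n)" by (cases "x = 0 \<or> y = 0") (auto simp: vball_def val_mult)

lemma vball_mono: "m <= n ==> vball n \<subseteq> vball m" by (auto simp: vball_def)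

lemma vball_smult_iff: "a ~= 0 ==> a * x \<in> vball n \<longleftrightarrow> x \<in> vball (n - val a)" by (cases "x = 0") (auto simp: vball_def val_mult)

lemma vball_diff_commute: "x - y \<in> vball n \<longleftrightarrow> y - x \<in> vball n" by (metis minus_diff_eq vball_minus_iff)

lemma vball_diff_trans: "x - y \<in> vball n ==> y - z \<in> vball n ==> x - z \<in> vball n" using vball_add[of "x - y" n "y - z"] by simp

lemma ex_vball: "\<exists>n. x \<in> vball n" by (auto simp: vball_def)

text \<open>The isosceles triangle principle: \<open>val_add\<close> is applied to
  \<open>x = (x - a) + a\<close> and to \<open>a = x - (x - a)\<close>, where \<open>x - a\<close>
  is strictly smaller than \<open>a\<close>.\<close>

lemma val_eq_of_close:
 assumes "a ~= 0" "x - a \<in> vball (val a + 1)"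
 shows "x ~= 0 \<and> val x = val a"
proof (cases "x = a")
 case False
 hence d: "val (x - a) >= val a + 1" using assms by (simp add: vball_def)
 have x: "x ~= 0" using d by auto
 have "min (val (x - a)) (val a) <= val x" using val_add[of "x - a" a] False assms x by simp
 moreover have "min (val x) (val (x - a)) <= val a"
  using val_add[of x "-(x - a)"] False assms x val_minus[of "x - a"] by (simp del: val_minus minus_diff_eq)
 ultimately show ?thesis using d x by linarith
qed (use assms in simp)

lemma dist_le_iff_vball: "dist x y <= 2 powi (- n) \<longleftrightarrow> x - y \<in> vball n"
 proof -
 have "2 powi a <= (2 powi b :: real) \<longleftrightarrow> a <= b" for a b :: int
  using power_int_strict_increasing[of b a "2::real"] power_int_increasing[of a b "2::real"] by force
 thus ?thesis by (auto simp: dist_val vball_def)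
qed

lemma open_iff_vball:
 "open S \<longleftrightarrow> (\<forall>x\<in>S. \<exists>n. \<forall>y. y - x \<in> vball n --> y \<in> S)" for S :: "'k::nonarch_local_field set"
proof
 assume "open S"
 show "\<forall>x\<in>S. \<exists>n. \<forall>y. y - x \<in> vball n --> y \<in> S"
 proof
  fix x assume "x \<in> S"
  with \<open>open S\<close> obtain e where e: "e > 0" "!!y. dist y x < e ==> y \<in> S"
   unfolding open_dist by blast
  obtain n :: nat where "(1/2::real) ^ n < e" using real_arch_pow_inv[of e "1/2"] e(1) by auto
  hence n: "2 powi (- int n) < e" by (simp add: power_int_minus power_one_over inverse_eq_divide)
  show "\<exists>n. \<forall>y. y - x \<in> vball n --> y \<in> S" by (intro exI[of _ "int n"]) (use e(2) n in \<open>auto simp: dist_le_iff_vball[symmetric]\<close>)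
 qed
next
 assume *: "\<forall>x\<in>S. \<exists>n. \<forall>y. y - x \<in> vball n --> y \<in> S"
 show "open S" unfolding open_dist
 proof
  fix x assume "x \<in> S"
  with * obtain n where n: "!!y. y - x \<in> vball n ==> y \<in> S" by blast
  show "\<exists>e>0. \<forall>y. dist y x < e --> y \<in> S" by (intro exI[of _ "2 powi (- n)"]) (use n in \<open>auto simp: dist_le_iff_vball[symmetric]\<close>)
 qed
qed

definition vcoset :: "'k::nonarch_local_field => int => 'k set" where
 "vcoset x n = {y. y - x \<in> vball n}"

lemma vcoset_0 [simp]: "vcoset 0 n = vball n" by (simp add: vcoset_def)

lemma vcoset_self [simp]: "x \<in> vcoset x n" by (simp add: vcoset_def)

lemma vcoset_eq: "y \<in> vcoset x n ==> vcoset y n = vcoset x n" unfolding vcoset_def using vball_diff_trans vball_diff_commute by blast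

lemma vcoset_mono: "m <= n ==> vcoset x n \<subseteq> vcoset x m" using vball_mono by (auto simp: vcoset_def)

text \<open>A common point is a centre of both cosets, so the one with the larger index lies inside
  the other. This makes the cosets an intersection-stable generator of the Borel sets.\<close>

lemma vcoset_Int: "m <= n ==> vcoset x m \<inter> vcoset y n = {} \<or> vcoset x m \<inter> vcoset y n = vcoset y n"
proof (rule disjCI)
 assume mn: "m <= n" "vcoset x m \<inter> vcoset y n ~= vcoset y n"
 show "vcoset x m \<inter> vcoset y n = {}"
 proof (rule ccontr)
  assume "vcoset x m \<inter> vcoset y n ~= {}"
  then obtain z where z: "z \<in> vcoset x m" "z \<in> vcoset y n" by auto
  have "vcoset y n \<subseteq> vcoset x m" using vcoset_eq[OF z(1)] vcoset_eq[OF z(2)] vcoset_mono[OF mn(1), of z] by simp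
  with mn show False by auto
 qed
qed

lemma open_vcoset: "open (vcoset x n)" unfolding open_iff_vball vcoset_def using vball_diff_trans by blast

lemma open_vball: "open (vball n)" using open_vcoset[of 0 n] by simp

lemma closed_vcoset: "closed (vcoset x n)"
proof -
 have "z \<in> - vcoset x n" if "y \<in> - vcoset x n" "z - y \<in> vball n" for y z
  using that vball_diff_trans vball_diff_commute unfolding vcoset_def by blast
 hence "open (- vcoset x n)" unfolding open_iff_vball by blast
 thus ?thesis by (simp add: closed_def)
qed

lemma eventually_vball: "eventually (%x. x - a \<in> vball n) (nhds a)"
 unfolding eventually_nhds using open_vcoset[of a n] vcoset_self[of a n] unfolding vcoset_def by blast

lemma tendsto_vball_iff:
 "(f \<longlongrightarrow> l) F \<longleftrightarrow> (\<forall>n. eventually (%x. f x - l \<in> vball n) F)" for l :: "'k::nonarch_local_field"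
proof
 assume f: "(f \<longlongrightarrow> l) F"
 show "\<forall>n. eventually (%x. f x - l \<in> vball n) F"
 proof
  fix n
  show "eventually (%x. f x - l \<in> vball n) F" using topological_tendstoD[OF f open_vcoset vcoset_self, of n] by (simp add: vcoset_def)
 qed
next
 assume *: "\<forall>n. eventually (%x. f x - l \<in> vball n) F"
 show "(f \<longlongrightarrow> l) F"
 proof (rule topological_tendstoI)
  fix S :: "'k set" assume S: "open S" "l \<in> S"
  then obtain n where n: "!!y. y - l \<in> vball n ==> y \<in> S" unfolding open_iff_vball by blast
  show "eventually (%x. f x \<in> S) F" by (rule eventually_mono[OF spec[OF *, of n]]) (rule n)
 qed
qed

section \<open>Continuity of the field operations\<close>

instance nonarch_local_field \<subseteq> topological_ab_group_add
proof
 fix a b :: 'a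
 show "LIM x (nhds a \<times>\<^sub>F nhds b). fst x + snd x :> nhds (a + b)" unfolding tendsto_vball_iff
 proof
  fix n
  show "\<forall>\<^sub>F x in nhds a \<times>\<^sub>F nhds b. fst x + snd x - (a + b) \<in> vball n" unfolding eventually_prod_filter
  proof (intro exI conjI allI impI)
   show "eventually (%x. x - a \<in> vball n) (nhds a)" "eventually (%x. x - b \<in> vball n) (nhds b)" by (rule eventually_vball)+
   fix x y assume "x - a \<in> vball n" "y - b \<in> vball n"
   hence "(x - a) + (y - b) \<in> vball n" by (rule vball_add)
   thus "fst (x, y) + snd (x, y) - (a + b) \<in> vball n" by (simp add: algebra_simps)
  qed
 qed
 show "(uminus \<longlongrightarrow> - a) (nhds a)" unfolding tendsto_vball_iff
 proof
  fix n
  have "- x - - a \<in> vball n \<longleftrightarrow> x - a \<in> vball n" for x using vball_minus_iff[of "x - a" n] by (simp add: algebra_simps)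
  thus "\<forall>\<^sub>F x in nhds a. - x - - a \<in> vball n" using eventually_vball[of a n] by simp
 qed
qed

instance nonarch_local_field \<subseteq> topological_comm_monoid_mult
proof
 fix a b :: 'a
 show "LIM x (nhds a \<times>\<^sub>F nhds b). fst x * snd x :> nhds (a * b)" unfolding tendsto_vball_iff
 proof
  fix n
  obtain k l where k: "a \<in> vball k" and l: "b \<in> vball l" using ex_vball by metis
  \<comment> \<open>Large enough for each summand of x y - a b = (x - a)(y - b) + a (y - b) + (x -
    a) b; for the quadratic one, \<open>m >= 0\<close> and \<open>m >= n\<close> give
    \<open>n <= m + m\<close>.\<close>
  define m where "m = max (max 0 n) (max (n - k) (n - l))"
  have m: "0 <= m" "n <= m" "n <= k + m" "n <= m + l" by (auto simp: m_def)
  show "\<forall>\<^sub>F x in nhds a \<times>\<^sub>F nhds b. fst x * snd x - (a * b) \<in> vball n" unfolding eventually_prod_filter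
  proof (intro exI conjI allI impI)
   show "eventually (%x. x - a \<in> vball m) (nhds a)" "eventually (%x. x - b \<in> vball m) (nhds b)" by (rule eventually_vball)+
   fix x y assume x: "x - a \<in> vball m" and y: "y - b \<in> vball m"
   have "(x - a) * (y - b) \<in> vball n" using vball_mult[OF x y] m vball_mono[of n "m + m"] by auto
   moreover have "a * (y - b) \<in> vball n" using vball_mult[OF k y] m vball_mono by blast
   moreover have "(x - a) * b \<in> vball n" using vball_mult[OF x l] m vball_mono by blast
   ultimately have "(x - a) * (y - b) + a * (y - b) + (x - a) * b \<in> vball n" by (intro vball_add)
   thus "fst (x, y) * snd (x, y) - (a * b) \<in> vball n" by (simp add: algebra_simps)
  qed
 qed
qed

lemma tendsto_inverse_local_field [tendsto_intros]:
 fixes l :: "'k::nonarch_local_field"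
 assumes f: "(f \<longlongrightarrow> l) F" and l: "l ~= 0"
 shows "((%x. inverse (f x)) \<longlongrightarrow> inverse l) F" unfolding tendsto_vball_iff
proof
 fix n
 \<comment> \<open>The first entry forces \<open>f x\<close> to have the valuation of
   \<open>l\<close>; the second pays for the division by \<open>f x * l\<close>, whose valuation is
   \<open>2 * val l\<close>.\<close>
 define m where "m = max (val l + 1) (n + 2 * val l)"
 from f have "eventually (%x. f x - l \<in> vball m) F" by (simp add: tendsto_vball_iff)
 thus "eventually (%x. inverse (f x) - inverse l \<in> vball n) F"
 proof eventually_elim
  case (elim x)
  have "f x - l \<in> vball (val l + 1)" using elim vball_mono[of "val l + 1" m] by (auto simp: m_def)
  hence x: "f x ~= 0" "val (f x) = val l" using val_eq_of_close l by blast+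
  have "(f x * l) * (inverse (f x) - inverse l) = l - f x" using x l by (simp add: field_simps)
  moreover have "l - f x \<in> vball (n + 2 * val l)"
   using elim vball_mono[of "n + 2 * val l" m] unfolding vball_diff_commute[of l "f x"] by (auto simp: m_def)
  ultimately have "(f x * l) * (inverse (f x) - inverse l) \<in> vball (n + 2 * val l)" by simp
  thus ?case using x l by (simp add: vball_smult_iff val_mult)
 qed
qed

lemma continuous_on_inverse_local_field [continuous_intros]:
 fixes f :: "'b::topological_space => 'k::nonarch_local_field"
 shows "continuous_on S f ==> \<forall>x\<in>S. f x ~= 0 ==> continuous_on S (%x. inverse (f x))"
 by (auto simp: continuous_on_def intro: tendsto_inverse_local_field)

section \<open>Residue classes, compactness and second countability\<close>

lemma residue_representatives:
 "\<exists>R :: 'k::nonarch_local_field set. finite R \<and> R \<subseteq> vball 0 \<and>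
  (\<forall>x\<in>vball 0. \<exists>!r. r \<in> R \<and> x - r \<in> vball 1)"
proof -
 define r :: "('k \<times> 'k) set" where
  "r = {(x, y). (x = 0 \<or> 0 <= val x) \<and> (y = 0 \<or> 0 <= val y) \<and> (x = y \<or> 1 <= val (x - y))}"
 have r: "(x, y) \<in> r \<longleftrightarrow> x \<in> vball 0 \<and> y \<in> vball 0 \<and> x - y \<in> vball 1" for x y by (auto simp: r_def vball_def)
 have fin: "finite ((vball 0::'k set) // r)" using finite_residue_field by (simp add: r_def vball_def)
 define rep where "rep C = (SOME x. x \<in> C)" for C :: "'k set"
 have rep: "rep (r `` {x}) \<in> vball 0 \<and> x - rep (r `` {x}) \<in> vball 1" if "x \<in> vball 0" for x
 proof -
  have "x \<in> r `` {x}" using that by (simp add: r)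
  hence "rep (r `` {x}) \<in> r `` {x}" unfolding rep_def by (rule someI)
  thus ?thesis by (simp add: r)
 qed
 have cls: "r `` {x} = r `` {y}" if "x \<in> vball 0" "y \<in> vball 0" "x - y \<in> vball 1" for x y
 proof -
  have "(x, z) \<in> r \<longleftrightarrow> (y, z) \<in> r" for z using that vball_diff_trans vball_diff_commute unfolding r by blast
  thus ?thesis by auto
 qed
 define R where "R = rep ` (vball 0 // r)"
 show ?thesis
 proof (intro exI[of _ R] conjI ballI)
  show "finite R" unfolding R_def using fin by simp
  show sub: "R \<subseteq> vball 0" unfolding R_def quotient_def using rep by auto
  fix x :: 'k assume x: "x \<in> vball 0"
  show "\<exists>!s. s \<in> R \<and> x - s \<in> vball 1"
  proof (rule ex1I[of _ "rep (r `` {x})"])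
   show "rep (r `` {x}) \<in> R \<and> x - rep (r `` {x}) \<in> vball 1" using rep x by (auto simp: R_def quotient_def)
   fix s assume s: "s \<in> R \<and> x - s \<in> vball 1"
   then obtain y where y: "y \<in> vball 0" "s = rep (r `` {y})" by (auto simp: R_def quotient_def)
   have "x - y \<in> vball 1" using rep[OF y(1)] s y vball_diff_trans vball_diff_commute by blast
   thus "s = rep (r `` {x})" using cls[OF x y(1)] y by simp
  qed
 qed
qed

lemma ex_val: "\<exists>x::'k::nonarch_local_field. x ~= 0 \<and> val x = n"
proof -
 obtain w :: 'k where "w ~= 0" "val w = 1" using val_normalized by blast
 thus ?thesis by (intro exI[of _ "w powi n"]) (simp add: val_powi)
qed

text \<open>Multiplication by an element of valuation \<open>n\<close> transports the residue
  classes of the integers to \<open>vball n\<close>.\<close>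

lemma vball_finite_cover_Suc:
 fixes n :: int
 shows "\<exists>R :: 'k::nonarch_local_field set. finite R \<and> vball n \<subseteq> (\<Union>x\<in>R. vcoset x (n + 1))"
proof -
 obtain a :: 'k where a: "a ~= 0" "val a = n" using ex_val by blast
 obtain R :: "'k set" where R: "finite R" "\<forall>x\<in>vball 0. \<exists>!r. r \<in> R \<and> x - r \<in> vball 1" using residue_representatives by blast
 have "vball n \<subseteq> (\<Union>x\<in>(%r. a * r) ` R. vcoset x (n + 1))"
 proof
  fix x :: 'k assume x: "x \<in> vball n"
  have "x = a * (x / a)" using a by simp
  hence "x / a \<in> vball 0" using vball_smult_iff[OF a(1), of "x / a" n] x a by simp
  then obtain r where r: "r \<in> R" "x / a - r \<in> vball 1" using R by blast
  have "a * (x / a - r) \<in> vball (n + 1)" using vball_smult_iff[OF a(1)] r a by simp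
  hence "x - a * r \<in> vball (n + 1)" using a by (simp add: right_diff_distrib)
  thus "x \<in> (\<Union>x\<in>(%r. a * r) ` R. vcoset x (n + 1))" using r by (auto simp: vcoset_def)
 qed
 thus ?thesis using R(1) by blast
qed

lemma vball_finite_cover: "\<exists>R :: 'k::nonarch_local_field set. finite R \<and> vball m \<subseteq> (\<Union>x\<in>R. vcoset x n)"
proof -
 have *: "\<exists>R. finite R \<and> (vball m :: 'k set) \<subseteq> (\<Union>x\<in>R. vcoset x (m + int j))" for j
 proof (induction j)
  case 0
  thus ?case by (intro exI[of _ "{0}"]) simp
 next
  case (Suc j)
  then obtain R :: "'k set" where R: "finite R" "vball m \<subseteq> (\<Union>x\<in>R. vcoset x (m + int j))" by blast
  obtain Q :: "'k set" where Q: "finite Q" "vball (m + int j) \<subseteq> (\<Union>x\<in>Q. vcoset x (m + int j + 1))" using vball_finite_cover_Suc by blast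
  show ?case
  proof (intro exI[of _ "(%(x, y). x + y) ` (R \<times> Q)"] conjI subsetI)
   show "finite ((%(x, y). x + y) ` (R \<times> Q))" using R Q by simp
   fix x :: 'k assume "x \<in> vball m"
   then obtain y where y: "y \<in> R" "x - y \<in> vball (m + int j)" using R by (auto simp: vcoset_def)
   then obtain z where z: "z \<in> Q" "x - y - z \<in> vball (m + int j + 1)" using Q by (auto simp: vcoset_def)
   hence "x \<in> vcoset (y + z) (m + int (Suc j))" by (simp add: vcoset_def algebra_simps)
   thus "x \<in> (\<Union>x\<in>(%(x, y). x + y) ` (R \<times> Q). vcoset x (m + int (Suc j)))" using y z by force
  qed
 qed
 show ?thesis
 proof (cases "m <= n")
  case True
  thus ?thesis using *[of "nat (n - m)"] by simp
 next
  case False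
  hence "vball m \<subseteq> vcoset (0::'k) n" using vball_mono[of n m] by simp
  thus ?thesis by (intro exI[of _ "{0}"]) simp
 qed
qed

text \<open>Complete because closed in a complete space, and totally bounded because finitely many
  cosets of any smaller ball cover it. Here the finiteness of the residue field enters the
  topology.\<close>

lemma compact_vball: "compact (vball n :: 'k::nonarch_local_field set)" unfolding compact_eq_totally_bounded
proof (intro conjI allI impI)
 show "complete (vball n :: 'k set)" using closed_vcoset[of 0 n] by (simp add: complete_eq_closed)
 fix e :: real assume "e > 0"
 then obtain j :: nat where "(1/2::real) ^ j < e" using real_arch_pow_inv[of e "1/2"] by auto
 hence j: "2 powi (- int j) < e" by (simp add: power_int_minus power_one_over inverse_eq_divide)
 obtain R where R: "finite R" "(vball n :: 'k set) \<subseteq> (\<Union>x\<in>R. vcoset x (int j))" using vball_finite_cover by blast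
 have "vcoset x (int j) \<subseteq> ball x e" for x :: 'k
 proof
  fix y assume "y \<in> vcoset x (int j)"
  hence "dist y x <= 2 powi (- int j)" by (simp add: vcoset_def dist_le_iff_vball)
  thus "y \<in> ball x e" using j by (simp add: dist_commute)
 qed
 thus "\<exists>k. finite k \<and> (vball n :: 'k set) \<subseteq> (\<Union>x\<in>k. ball x e)" using R by (intro exI[of _ R]) blast
qed

lemma compact_vcoset: "compact (vcoset x n)"
proof -
 have "vcoset x n = (+) x ` vball n" by (force simp: vcoset_def image_iff)
 thus ?thesis using compact_continuous_image[OF _ compact_vball, of n "(+) x"] by (simp add: continuous_intros)
qed

lemma UN_vball: "(\<Union>j::nat. vball (- int j)) = (UNIV :: 'k::nonarch_local_field set)"
proof -
 have "x \<in> vball (- int (nat (- val x)))" for x :: 'k by (simp add: vball_def)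
 thus ?thesis by blast
qed

lemma compact_subset_vball:
 assumes "compact (S :: 'k::nonarch_local_field set)"
 shows "\<exists>n. S \<subseteq> vball n"
proof -
 have "S \<subseteq> (\<Union>j\<in>UNIV. vball (- int j))" using UN_vball by blast
 then obtain J :: "nat set" where J: "finite J" "S \<subseteq> (\<Union>j\<in>J. vball (- int j))"
  using compactE_image[OF assms, of UNIV "%j. vball (- int j)"] open_vball by metis
 have "S \<subseteq> vball (- int (Max (insert 0 J)))"
 proof
  fix x assume "x \<in> S"
  then obtain j where j: "j \<in> J" "x \<in> vball (- int j)" using J by auto
  have "j <= Max (insert 0 J)" using J j by (intro Max_ge) auto
  thus "x \<in> vball (- int (Max (insert 0 J)))" using j vball_mono[of "- int (Max (insert 0 J))" "- int j"] by auto
 qed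
 thus ?thesis by blast
qed

definition vcosets :: "'k::nonarch_local_field set set" where
 "vcosets = {vcoset x n | x n. True}"

lemma countable_vcosets: "countable (vcosets :: 'k::nonarch_local_field set set)"
proof -
 have "\<exists>R. finite R \<and> (vball (- int j) :: 'k set) \<subseteq> (\<Union>x\<in>R. vcoset x n)" for j :: nat and n :: int by (rule vball_finite_cover)
 then obtain R where R: "!!j n. finite (R j n)" "!!j n. (vball (- int j) :: 'k set) \<subseteq> (\<Union>x\<in>R j n. vcoset x n)" by metis
 have "vcosets \<subseteq> (\<Union>j::nat. \<Union>n. (%x. vcoset x n) ` R j n)"
 proof
  fix C :: "'k set" assume "C \<in> vcosets"
  then obtain x n where C: "C = vcoset x n" by (auto simp: vcosets_def)
  obtain j where "x \<in> vball (- int j)" using UN_vball by blast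
  then obtain y where y: "y \<in> R j n" "x \<in> vcoset y n" using R(2)[of j n] by blast
  hence "C = vcoset y n" using C vcoset_eq by metis
  thus "C \<in> (\<Union>j::nat. \<Union>n. (%x. vcoset x n) ` R j n)" using y by blast
 qed
 moreover have "countable (\<Union>j::nat. \<Union>n. (%x. vcoset x n) ` R j n)" using R(1) by (intro countable_UN) (auto intro: countable_finite)
 ultimately show ?thesis by (rule countable_subset)
qed

lemma topological_basis_vcosets: "topological_basis (vcosets :: 'k::nonarch_local_field set set)"
proof (rule topological_basisI)
 fix C :: "'k set" assume "C \<in> vcosets" thus "open C" by (auto simp: vcosets_def open_vcoset)
next
 fix U :: "'k set" and x assume U: "open U" "x \<in> U"
 then obtain n where "!!y. y - x \<in> vball n ==> y \<in> U" unfolding open_iff_vball by blast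
 thus "\<exists>B'\<in>vcosets. x \<in> B' \<and> B' \<subseteq> U" by (intro bexI[of _ "vcoset x n"]) (auto simp: vcosets_def vcoset_def)
qed

text \<open>Second countability makes continuous functions of two variables measurable for the
  product sigma-algebra, as the uses of Fubini require.\<close>

instance nonarch_local_field \<subseteq> second_countable_topology
proof
 show "\<exists>B :: 'a set set. countable B \<and> open = generate_topology B"
  using countable_vcosets topological_basis_imp_subbasis[OF topological_basis_vcosets] by blast
qed

section \<open>Haar measure and the absolute value\<close>

text \<open>The empty set is inserted because disjoint cosets must intersect inside the
  generator.\<close>

lemma sets_borel_vcosets:
 "sets (borel :: 'k::nonarch_local_field measure) = sigma_sets UNIV (insert {} vcosets)"
proof -
 have "sets (borel :: 'k measure) = sigma_sets UNIV vcosets"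
  unfolding borel_eq_countable_basis[OF countable_vcosets topological_basis_vcosets] by (rule sets_measure_of) simp
 moreover have "sigma_sets UNIV (insert {} vcosets) = sigma_sets UNIV (vcosets :: 'k set set)"
  by (rule sigma_sets_eqI) (auto intro: sigma_sets.intros)
 ultimately show ?thesis by simp
qed

lemma Int_stable_vcosets: "Int_stable (insert {} (vcosets :: 'k::nonarch_local_field set set))"
proof (rule Int_stableI)
 fix A B :: "'k set" assume AB: "A \<in> insert {} vcosets" "B \<in> insert {} vcosets"
 show "A \<inter> B \<in> insert {} vcosets"
 proof (cases "A = {} \<or> B = {}")
  case False
  then obtain x m y n where xy: "A = vcoset x m" "B = vcoset y n" using AB by (auto simp: vcosets_def)
  thus ?thesis using vcoset_Int[of m n x y] vcoset_Int[of n m y x] AB by (cases "m <= n") (auto simp: Int_commute)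
 qed auto
qed

lemma measure_eqI_vcosets:
 fixes M N :: "'k::nonarch_local_field measure"
 assumes "sets M = sets borel" "sets N = sets borel"
  and eq: "!!x n. emeasure M (vcoset x n) = emeasure N (vcoset x n)"
  and fin: "!!n. emeasure M (vball n) ~= \<infinity>"
 shows "M = N"
proof (rule measure_eqI_generator_eq[OF Int_stable_vcosets, of UNIV])
 show "range (%j::nat. vball (- int j)) \<subseteq> insert {} (vcosets :: 'k set set)" unfolding vcosets_def using vcoset_0 by blast
qed (use assms UN_vball in \<open>auto simp: sets_borel_vcosets vcosets_def\<close>)

text \<open>A ball around 0 is {0} together with countably many disjoint cosets avoiding 0, so
  comparing balls off 0 is enough. This serves maps such as inversion, under which balls around 0
  behave badly.\<close>

lemma measure_eqI_vcosets_nonzero: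
 fixes M N :: "'k::nonarch_local_field measure"
 assumes M: "sets M = sets borel" and N: "sets N = sets borel"
  and eq: "!!x n. x ~= 0 ==> val x < n ==> emeasure M (vcoset x n) = emeasure N (vcoset x n)"
  and zero: "emeasure M {0} = emeasure N {0}"
  and fin: "!!n. emeasure M (vball n) ~= \<infinity>"
 shows "M = N"
proof (rule measure_eqI_vcosets[OF M N _ fin])
 fix x :: 'k and n
 have ball: "emeasure M (vball n) = emeasure N (vball n)" for n
 proof -
  \<comment> \<open>The valuation is constant on each of these cosets, so two of them that meet
    coincide; together they fill the ball except for 0.\<close>
  define C where "C = {vcoset x (val x + 1) | x :: 'k. x ~= 0 \<and> x \<in> vball n}"
  have C: "C \<subseteq> vcosets" by (auto simp: C_def vcosets_def)
  have count: "countable C" using countable_subset[OF C countable_vcosets] .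
  have same: "vcoset x (val x + 1) = vcoset y (val y + 1)"
   if z: "x ~= 0" "y ~= 0" "z \<in> vcoset x (val x + 1)" "z \<in> vcoset y (val y + 1)" for x y z :: 'k
  proof -
   have "val z = val x" "val z = val y" using z val_eq_of_close by (auto simp: vcoset_def)
   thus ?thesis using vcoset_eq[OF z(3)] vcoset_eq[OF z(4)] by simp
  qed
  have disj: "disjoint_family_on (%A. A) C" unfolding disjoint_family_on_def C_def using same by blast
  have meas: "A \<in> sets borel" if "A \<in> C" for A using that C by (auto simp: vcosets_def intro!: borel_open open_vcoset)
  have "vball n = {0} \<union> \<Union>((%A. A) ` C)"
  proof (intro equalityI subsetI)
   fix z :: 'k assume "z \<in> vball n"
   thus "z \<in> {0} \<union> \<Union>((%A. A) ` C)" unfolding C_def by (cases "z = 0") auto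
  next
   fix z :: 'k assume "z \<in> {0} \<union> \<Union>((%A. A) ` C)"
   then consider "z = 0" | y where "y ~= 0" "y \<in> vball n" "z \<in> vcoset y (val y + 1)" by (auto simp: C_def)
   thus "z \<in> vball n"
   proof cases
    case 2
    hence "val z = val y" using val_eq_of_close by (auto simp: vcoset_def)
    thus ?thesis using 2 by (simp add: vball_def)
   qed simp
  qed
  moreover have "{0} \<inter> \<Union>((%A. A) ` C) = {}" using val_eq_of_close[of _ 0] by (auto simp: C_def vcoset_def)
  moreover have "\<Union>((%A. A) ` C) \<in> sets borel" using meas count by blast
  ultimately have split: "emeasure Q (vball n) = emeasure Q {0} + emeasure Q (\<Union>((%A. A) ` C))"
   if "sets Q = sets borel" for Q :: "'k measure" using that plus_emeasure[of "{0}" Q "\<Union>((%A. A) ` C)"] by simp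
  have "emeasure Q (\<Union>((%A. A) ` C)) = (\<integral>\<^sup>+A. emeasure Q A \<partial>count_space C)"
   if "sets Q = sets borel" for Q :: "'k measure" using that meas by (intro emeasure_UN_countable count disj) auto
  moreover have "(\<integral>\<^sup>+A. emeasure M A \<partial>count_space C) = (\<integral>\<^sup>+A. emeasure N A \<partial>count_space C)"
   by (intro nn_integral_cong) (auto simp: C_def intro!: eq)
  ultimately show ?thesis using split M N zero by simp
 qed
 show "emeasure M (vcoset x n) = emeasure N (vcoset x n)"
 proof (cases "x = 0 \<or> n <= val x")
  case True
  hence "0 \<in> vcoset x n" by (auto simp: vcoset_def vball_def)
  hence "vcoset x n = vball n" using vcoset_eq[of 0 x n] by simp
  thus ?thesis using ball by simp
 qed (use eq in auto)
qed

lemma haar_vcoset: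
 assumes "haar_measure (M :: 'k::nonarch_local_field measure)"
 shows "emeasure M (vcoset x n) = emeasure M (vball n)"
proof -
 have "vcoset x n = (+) x ` vball n" by (force simp: vcoset_def image_iff)
 moreover have "(vball n :: 'k set) \<in> sets borel" by (simp add: borel_open open_vball)
 ultimately show ?thesis using assms unfolding haar_measure_def by simp
qed

lemma haar_vball_finite: "haar_measure M ==> emeasure M (vball n) < \<infinity>" unfolding haar_measure_def by (simp add: compact_vball)

lemma haar_vball_pos: "haar_measure M ==> emeasure M (vball n) > 0"
 unfolding haar_measure_def using open_vball[of n] vball_0[of n] by (metis empty_iff)

text \<open>The factor is the number of residue classes: an element of valuation \<open>n\<close>
  carries the partition of \<open>vball 0\<close> by residues to a partition of
  \<open>vball n\<close> into cosets of equal measure. It is the same for all Haar measures, and at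
  least 2 because 0 and 1 are incongruent.\<close>

lemma haar_vball_Suc:
 "\<exists>q::nat. 2 <= q \<and> (\<forall>(M :: 'k::nonarch_local_field measure) n. haar_measure M -->
   emeasure M (vball n) = of_nat q * emeasure M (vball (n + 1)))"
proof -
 from residue_representatives[where 'k = 'k] obtain R :: "'k set"
  where R0: "finite R \<and> R \<subseteq> vball 0 \<and> (\<forall>x\<in>vball 0. \<exists>!r. r \<in> R \<and> x - r \<in> vball 1)" ..
 hence R: "finite R" "R \<subseteq> vball 0" "!!x. x \<in> vball 0 ==> \<exists>!r. r \<in> R \<and> x - r \<in> vball 1" by auto
 from ex1_implies_ex[OF R(3)[OF vball_0]] obtain r0 where r0: "r0 \<in> R" "0 - r0 \<in> vball 1" by blast
 have "1 \<in> (vball 0 :: 'k set)" by (simp add: vball_def)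
 from ex1_implies_ex[OF R(3)[OF this]] obtain r1 where r1: "r1 \<in> R" "1 - r1 \<in> vball 1" by blast
 have "r0 ~= r1"
 proof
  assume "r0 = r1"
  hence "(1 - r1) + - (0 - r0) \<in> vball 1" using r0(2) r1(2) by (intro vball_add) (simp_all del: minus_diff_eq)
  hence "(1::'k) \<in> vball 1" using \<open>r0 = r1\<close> by simp
  thus False by (simp add: vball_def)
 qed
 hence "card {r0, r1} <= card R" using r0 r1 R(1) by (intro card_mono) auto
 hence q: "2 <= card R" using \<open>r0 ~= r1\<close> by simp
 show ?thesis
 proof (intro exI[of _ "card R"] conjI q allI impI)
  fix M :: "'k measure" and n :: int assume M: "haar_measure M"
  obtain a :: 'k where a: "a ~= 0" "val a = n" using ex_val by blast
  have mem: "z \<in> vcoset (a * r) (n + 1) \<longleftrightarrow> z / a - r \<in> vball 1" for z r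
  proof -
   have "a * (z / a - r) = z - a * r" using a by (simp add: right_diff_distrib)
   thus ?thesis using vball_smult_iff[OF a(1), of "z / a - r" "n + 1"] a by (simp add: vcoset_def)
  qed
  have memn: "z \<in> vball n \<longleftrightarrow> z / a \<in> vball 0" for z using vball_smult_iff[OF a(1), of "z / a" n] a by simp
  have "vball n = (\<Union>r\<in>R. vcoset (a * r) (n + 1))"
  proof (intro equalityI subsetI)
   fix z :: 'k assume "z \<in> vball n"
   hence "z / a \<in> vball 0" using memn by simp
   from ex1_implies_ex[OF R(3)[OF this]] show "z \<in> (\<Union>r\<in>R. vcoset (a * r) (n + 1))" using mem by blast
  next
   fix z :: 'k assume "z \<in> (\<Union>r\<in>R. vcoset (a * r) (n + 1))"
   then obtain r where r: "r \<in> R" "z / a - r \<in> vball 1" using mem by blast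
   hence "z / a - r \<in> vball 0" "r \<in> vball 0" using vball_mono[of 0 1] R(2) by auto
   hence "(z / a - r) + r \<in> vball 0" by (rule vball_add)
   thus "z \<in> vball n" using memn by simp
  qed
  moreover have "disjoint_family_on (%r. vcoset (a * r) (n + 1)) R" unfolding disjoint_family_on_def
  proof (intro ballI impI equals0I)
   fix r s z assume rs: "r \<in> R" "s \<in> R" "r ~= s" and z: "z \<in> vcoset (a * r) (n + 1) \<inter> vcoset (a * s) (n + 1)"
   hence z': "z / a - r \<in> vball 1" "z / a - s \<in> vball 1" using mem by blast+
   hence "z / a - r \<in> vball 0" "r \<in> vball 0" using vball_mono[of 0 1] R(2) rs by auto
   hence "(z / a - r) + r \<in> vball 0" by (rule vball_add)
   thus False using R(3)[of "z / a"] rs z' by auto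
  qed
  moreover have "(%r. vcoset (a * r) (n + 1)) ` R \<subseteq> sets M" using M by (auto simp: haar_measure_def intro!: borel_open open_vcoset)
  ultimately have "emeasure M (vball n) = (\<Sum>r\<in>R. emeasure M (vcoset (a * r) (n + 1)))" using sum_emeasure R(1) by metis
  thus "emeasure M (vball n) = of_nat (card R) * emeasure M (vball (n + 1))" by (simp add: haar_vcoset[OF M])
 qed
qed

definition residue_card :: "'k::nonarch_local_field itself => nat" where
 "residue_card _ = (SOME q::nat. 2 <= q \<and> (\<forall>(M :: 'k measure) n. haar_measure M -->
   emeasure M (vball n) = of_nat q * emeasure M (vball (n + 1))))"

lemma residue_card:
 shows residue_card_ge_2: "2 <= residue_card TYPE('k::nonarch_local_field)"
  and "haar_measure (M :: 'k measure) ==>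
   emeasure M (vball n) = of_nat (residue_card TYPE('k)) * emeasure M (vball (n + 1))"
 using someI_ex[OF haar_vball_Suc[where 'k = 'k]] unfolding residue_card_def by blast+

lemma haar_vball:
 assumes M: "haar_measure (M :: 'k::nonarch_local_field measure)"
 shows "emeasure M (vball n) =
  ennreal (measure M (vball 0) * real (residue_card TYPE('k)) powi (- n))"
proof -
 let ?q = "real (residue_card TYPE('k))"
 have q: "?q ~= 0" using residue_card_ge_2[where 'k = 'k] by simp
 define m where "m n = measure M (vball n)" for n
 have m: "emeasure M (vball n) = ennreal (m n)" "m n >= 0" for n
  unfolding m_def using haar_vball_finite[OF M, of n] by (auto simp: emeasure_eq_ennreal_measure)
 have step: "m n = ?q * m (n + 1)" for n
 proof -
  have "ennreal (m n) = ennreal (?q * m (n + 1))"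
   using residue_card(2)[OF M, of n] m by (simp add: ennreal_mult ennreal_of_nat_eq_real_of_nat)
  thus ?thesis using m by (simp add: ennreal_inj)
 qed
 have "m n = m 0 * ?q powi (- n)"
 proof (induction n rule: int_induct[where k = 0])
  case (step1 i)
  thus ?case using step[of i] q by (simp add: power_int_diff power_int_minus power_int_add field_simps)
 next
  case (step2 i)
  thus ?case using step[of "i - 1"] q by (simp add: power_int_diff power_int_minus power_int_add field_simps)
 qed simp
 thus ?thesis using m by (simp add: m_def)
qed

lemma haar_vball_measure_pos: "haar_measure M ==> measure M (vball 0) > 0"
 using haar_vball_pos[of M 0] haar_vball_finite[of M 0] by (simp add: measure_def enn2real_positive_iff)

lemma haar_singleton:
 assumes M: "haar_measure (M :: 'k::nonarch_local_field measure)"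
 shows "emeasure M {0} = 0"
proof -
 let ?q = "real (residue_card TYPE('k))"
 have q: "?q >= 2" using residue_card_ge_2[where 'k = 'k] by simp
 have "emeasure M {0} <= ennreal (measure M (vball 0) * inverse ?q ^ j)" for j
 proof -
  have "vball (int j) \<in> sets M" using M by (auto simp: haar_measure_def intro!: borel_open open_vball)
  hence "emeasure M {0} <= emeasure M (vball (int j))" by (intro emeasure_mono) auto
  thus ?thesis using haar_vball[OF M, of "int j"] by (simp add: power_int_minus power_inverse)
 qed
 moreover have "(%j. ennreal (measure M (vball 0) * inverse ?q ^ j)) \<longlonglongrightarrow> ennreal (measure M (vball 0) * 0)"
  using q by (intro tendsto_ennrealI tendsto_mult tendsto_const LIMSEQ_power_zero) (auto simp: field_simps)
 ultimately have "emeasure M {0} <= ennreal (measure M (vball 0) * 0)"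
  by (intro Lim_bounded2[where f = "%j. ennreal (measure M (vball 0) * inverse ?q ^ j)"]) auto
 thus ?thesis by simp
qed

text \<open>The measure B \<mapsto> M (a B) agrees on cosets with a multiple of \<open>M\<close>,
  and a measure is determined by its values on cosets.\<close>

lemma haar_scale:
 assumes M: "haar_measure (M :: 'k::nonarch_local_field measure)" and a: "a ~= 0" and A: "A \<in> sets borel"
 shows "emeasure M ((*) a ` A) = ennreal (real (residue_card TYPE('k)) powi (- val a)) * emeasure M A"
proof -
 let ?q = "real (residue_card TYPE('k))"
 have q: "?q > 0" using residue_card_ge_2[where 'k = 'k] by simp
 have sM: "sets M = sets borel" using M by (simp add: haar_measure_def)
 have spM: "space M = UNIV" using sets_eq_imp_space_eq[OF sM] by simp
 have meas: "(%x. inverse a * x) \<in> M \<rightarrow>\<^sub>M borel"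
  unfolding measurable_cong_sets[OF sM refl] by (intro borel_measurable_continuous_onI continuous_intros)
 define N where "N = distr M borel (%x. inverse a * x)"
 have N: "emeasure N B = emeasure M ((*) a ` B)" if "B \<in> sets borel" for B
 proof -
  have "(%x. inverse a * x) -` B \<inter> space M = (*) a ` B"
  proof (intro equalityI subsetI)
   fix x assume "x \<in> (%x. inverse a * x) -` B \<inter> space M"
   thus "x \<in> (*) a ` B" using a by (intro image_eqI[of _ _ "inverse a * x"]) auto
  qed (use a spM in \<open>auto simp: mult.assoc[symmetric]\<close>)
  thus ?thesis using that meas by (simp add: N_def emeasure_distr)
 qed
 have img: "(*) a ` vcoset x n = vcoset (a * x) (n + val a)" for x n
 proof -
  have "z \<in> vcoset (a * x) (n + val a) \<longleftrightarrow> z / a \<in> vcoset x n" for z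
  proof -
   have "a * (z / a - x) = z - a * x" using a by (simp add: right_diff_distrib)
   thus ?thesis using vball_smult_iff[OF a, of "z / a - x" "n + val a"] by (simp add: vcoset_def)
  qed
  thus ?thesis using a by (force simp: image_iff)
 qed
 have "N = scale_measure (ennreal (?q powi (- val a))) M"
 proof (rule measure_eqI_vcosets)
  show "emeasure N (vcoset x n) = emeasure (scale_measure (ennreal (?q powi (- val a))) M) (vcoset x n)" for x n
  proof -
   have "emeasure N (vcoset x n) = emeasure M (vcoset (a * x) (n + val a))" by (simp only: N borel_open open_vcoset img)
   also have "... = ennreal (?q powi (- val a) * (measure M (vball 0) * ?q powi (- n)))"
    using q unfolding haar_vcoset[OF M] haar_vball[OF M] by (simp add: power_int_add power_int_diff power_int_minus field_simps)
   finally show ?thesis using q by (simp add: haar_vcoset[OF M] haar_vball[OF M] ennreal_mult')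
  qed
  have "emeasure N (vball n) = emeasure M (vball (n + val a))" for n
   using img[of 0 n] by (simp only: N borel_open open_vball vcoset_0 mult_zero_right)
  thus "emeasure N (vball n) ~= \<infinity>" for n using haar_vball_finite[OF M] by (simp add: less_top)
 qed (simp_all add: N_def sM)
 thus ?thesis using N[OF A] by simp
qed

lemma borel_measurable_uminus_local_field [measurable (raw)]:
 fixes f :: "'b => 'k::nonarch_local_field"
 shows "f \<in> borel_measurable M ==> (%x. - f x) \<in> borel_measurable M"
 by (erule measurable_compose) (intro borel_measurable_continuous_onI continuous_intros)

lemma borel_measurable_diff_local_field [measurable (raw)]:
 fixes f g :: "'b => 'k::nonarch_local_field"
 assumes "f \<in> borel_measurable M" "g \<in> borel_measurable M"
 shows "(%x. f x - g x) \<in> borel_measurable M" unfolding diff_conv_add_uminus using assms by measurable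

lemma borel_measurable_times_local_field [measurable (raw)]:
 fixes f g :: "'b => 'k::nonarch_local_field"
 assumes "f \<in> borel_measurable M" "g \<in> borel_measurable M"
 shows "(%x. f x * g x) \<in> borel_measurable M" using assms by (rule borel_measurable_continuous_Pair) (intro continuous_intros)

section \<open>The normalized absolute value\<close>

locale local_field_data =
 fixes K :: "'k::nonarch_local_field field_data"
 assumes field_data: "field_data K"
begin

abbreviation "\<mu> \<equiv> haar K"
abbreviation "fd \<equiv> function_distribution K"
abbreviation "\<mu>2 \<equiv> haar K \<Otimes>\<^sub>M haar K"
abbreviation "\<psi> \<equiv> addchar K"

abbreviation Lint :: "('k => 'b::{banach, second_countable_topology}) => 'b" (binder "LI " 10)
 where "Lint f \<equiv> integral\<^sup>L \<mu> f"

abbreviation Nint :: "('k => ennreal) => ennreal" (binder "NI " 10)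
 where "Nint f \<equiv> integral\<^sup>N \<mu> f"


definition "q = real (residue_card TYPE('k))"
definition "vol = measure \<mu> (vball 0)"

lemma haar: "haar_measure \<mu>" using field_data by (simp add: field_data_def)

lemma sets_haar [simp, measurable_cong]: "sets \<mu> = sets borel" using haar by (simp add: haar_measure_def)

lemma space_haar [simp]: "space \<mu> = UNIV" using sets_eq_imp_space_eq[OF sets_haar] by simp

lemma q_ge_2: "2 <= q" unfolding q_def using residue_card_ge_2[where 'k = 'k] by simp

lemma vol_pos: "0 < vol" unfolding vol_def by (rule haar_vball_measure_pos[OF haar])

text \<open>Existence of the constant is \<open>haar_scale\<close>. Uniqueness requires an actual
  Haar measure, here \<open>haar K\<close>: evaluating on \<open>vball 0\<close>, of finite nonzero
  measure, pins the constant down.\<close>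

lemma absval_eq: "absval (a::'k) = (if a = 0 then 0 else q powi (- val a))"
proof -
 let ?c = "if a = 0 then 0 else q powi (- val a)"
 have "emeasure M ((*) a ` A) = ennreal ?c * emeasure M A"
  if M: "haar_measure (M :: 'k measure)" and A: "A \<in> sets borel" for M A
 proof (cases "a = 0")
  case True
  hence "(*) a ` A = {} \<or> (*) a ` A = {0}" by auto
  thus ?thesis using True haar_singleton[OF M] by auto
 next
  case False
  thus ?thesis using haar_scale[OF M False A] by (simp add: q_def)
 qed
 moreover have "0 <= ?c" using q_ge_2 by simp
 moreover have "c = ?c" if c: "0 <= c"
  "!!M A. haar_measure (M :: 'k measure) ==> A \<in> sets borel ==> emeasure M ((*) a ` A) = ennreal c * emeasure M A" for c
 proof -
  have "vball 0 \<in> sets (borel :: 'k measure)" by (simp add: borel_open open_vball)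
  hence "ennreal c * emeasure \<mu> (vball 0) = ennreal ?c * emeasure \<mu> (vball 0)" using calculation(1) c(2) haar by metis
  hence "ennreal (c * vol) = ennreal (?c * vol)" using haar_vball[OF haar, of 0] vol_pos c(1) calculation(2)
   by (simp add: vol_def ennreal_mult del: ennreal_eq_0_iff split del: if_split)
  thus ?thesis using vol_pos c(1) calculation(2) ennreal_inj[of "c * vol" "?c * vol"] by (simp split del: if_split)
 qed
 ultimately show ?thesis unfolding absval_def by (intro the_equality) blast+
qed

lemma absval_0 [simp]: "absval (0::'k) = 0" by (simp add: absval_eq)
lemma absval_nonneg [simp]: "0 <= absval (a::'k)" using q_ge_2 by (simp add: absval_eq)
lemma absval_eq_0 [simp]: "absval (a::'k) = 0 \<longleftrightarrow> a = 0" using q_ge_2 by (simp add: absval_eq)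
lemma absval_pos [simp]: "0 < absval (a::'k) \<longleftrightarrow> a ~= 0" using absval_nonneg[of a] absval_eq_0[of a] by linarith
lemma absval_1 [simp]: "absval (1::'k) = 1" by (simp add: absval_eq)
lemma absval_minus [simp]: "absval (- a::'k) = absval a" by (simp add: absval_eq)
lemma absval_mult: "absval (a * b::'k) = absval a * absval b"
 using q_ge_2 by (auto simp: absval_eq val_mult power_int_add power_int_diff power_int_minus field_simps)
lemma absval_inverse: "absval (inverse a::'k) = inverse (absval a)" using q_ge_2 by (auto simp: absval_eq val_inverse power_int_minus)
lemma absval_divide: "absval (a / b::'k) = absval a / absval b" by (simp add: divide_inverse absval_mult absval_inverse)
lemma absval_power: "absval (a ^ n::'k) = absval a ^ n" by (induction n) (auto simp: absval_mult)
lemma absval_diff_commute: "absval (a - b::'k) = absval (b - a)" by (metis absval_minus minus_diff_eq)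

lemma absval_le_iff: "a ~= 0 ==> absval (x::'k) <= absval (a::'k) \<longleftrightarrow> x \<in> vball (val a)"
proof -
 have "q powi i <= q powi j \<longleftrightarrow> i <= j" for i j using q_ge_2 power_int_strict_increasing[of j i q] power_int_increasing[of i j q] by force
 thus "a ~= 0 ==> absval (x::'k) <= absval (a::'k) \<longleftrightarrow> x \<in> vball (val a)" using q_ge_2 by (auto simp: absval_eq vball_def)
qed

lemma absval_less_iff: "a ~= 0 ==> absval (x::'k) < absval (a::'k) \<longleftrightarrow> x \<in> vball (val a + 1)"
proof -
 have "q powi i < q powi j \<longleftrightarrow> i < j" for i j using q_ge_2 power_int_strict_increasing[of i j q] power_int_increasing[of j i q] by force
 thus "a ~= 0 ==> absval (x::'k) < absval (a::'k) \<longleftrightarrow> x \<in> vball (val a + 1)" using q_ge_2 by (auto simp: absval_eq vball_def)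
qed

lemma absval_add: "absval (x + y::'k) <= max (absval x) (absval y)"
proof -
 define z where "z = (if absval x <= absval y then y else x)"
 have z: "absval x <= absval z" "absval y <= absval z" "absval z = max (absval x) (absval y)" by (auto simp: z_def)
 show ?thesis
 proof (cases "z = 0")
  case True
  hence "x = 0" "y = 0" using z(1,2) absval_nonneg[of x] absval_nonneg[of y] absval_eq_0 by (metis absval_0 order_antisym)+
  thus ?thesis by simp
 next
  case False
  thus ?thesis using z absval_le_iff vball_add by metis
 qed
qed

lemma absval_diff: "absval (x - y::'k) <= max (absval x) (absval y)" using absval_add[of x "-y"] by simp

lemma absval_add_eq: "absval x < absval y ==> absval (x + y::'k) = absval y"
 using absval_add[of x y] absval_diff[of "x + y" x] by (simp add: max_def split: if_splits)

lemma ex_absval_less: "0 < e ==> \<exists>a::'k. a ~= 0 \<and> absval a < e"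
proof -
 assume "0 < e"
 then obtain n where n: "inverse q ^ n < e" using real_arch_pow_inv[of e "inverse q"] q_ge_2 by (auto simp: field_simps)
 obtain a :: 'k where "a ~= 0" "val a = int n" using ex_val by blast
 thus ?thesis using n by (intro exI[of _ a]) (simp add: absval_eq power_int_minus power_inverse)
qed

lemma ex_absval_gt: "\<exists>a::'k. a ~= 0 \<and> e < absval a"
proof -
 have "0 < inverse (\<bar>e\<bar> + 1)" by simp
 then obtain a :: 'k where a: "a ~= 0" "absval a < inverse (\<bar>e\<bar> + 1)" using ex_absval_less by blast
 have "inverse (inverse (\<bar>e\<bar> + 1)) < inverse (absval a)" using a by (intro less_imp_inverse_less) auto
 thus ?thesis using a by (intro exI[of _ "inverse a"]) (simp add: absval_inverse)
qed

lemma open_iff_absval: "open (S :: 'k set) \<longleftrightarrow> (\<forall>x\<in>S. \<exists>a::'k. a ~= 0 \<and> (\<forall>y. absval (y - x) <= absval a --> y \<in> S))"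
proof -
 have "(\<exists>n. \<forall>y. y - x \<in> vball n --> y \<in> S) \<longleftrightarrow> (\<exists>a::'k. a ~= 0 \<and> (\<forall>y. absval (y - x) <= absval a --> y \<in> S))" for x
 proof
  assume "\<exists>n. \<forall>y. y - x \<in> vball n --> y \<in> S"
  then obtain n where n: "!!y. y - x \<in> vball n ==> y \<in> S" by blast
  obtain a :: 'k where "a ~= 0" "val a = n" using ex_val by blast
  thus "\<exists>a::'k. a ~= 0 \<and> (\<forall>y. absval (y - x) <= absval a --> y \<in> S)" using n by (intro exI[of _ a]) (simp add: absval_le_iff)
 next
  assume "\<exists>a::'k. a ~= 0 \<and> (\<forall>y. absval (y - x) <= absval a --> y \<in> S)"
  then obtain a :: 'k where "a ~= 0" "!!y. absval (y - x) <= absval a ==> y \<in> S" by auto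
  thus "\<exists>n. \<forall>y. y - x \<in> vball n --> y \<in> S" by (intro exI[of _ "val a"]) (simp add: absval_le_iff)
 qed
 thus ?thesis unfolding open_iff_vball by simp
qed

text \<open>Balls indexed by a field element instead of an integer, so that radii can be multiplied
  and divided like elements.\<close>

definition cb :: "'k => 'k => 'k set" where "cb x a = {y. absval (y - x) <= absval a}"

lemma cb_eq_vcoset: "a ~= 0 ==> cb x a = vcoset x (val a)" by (simp add: cb_def vcoset_def absval_le_iff)

lemma open_cb [simp]: "a ~= 0 ==> open (cb x a)" by (simp add: cb_eq_vcoset open_vcoset)
lemma closed_cb [simp]: "a ~= 0 ==> closed (cb x a)" by (simp add: cb_eq_vcoset closed_vcoset)
lemma compact_cb: "a ~= 0 ==> compact (cb x a)" by (simp add: cb_eq_vcoset compact_vcoset)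
lemma cb_self [simp]: "x \<in> cb x a" by (simp add: cb_def)

lemma emeasure_cb: "a ~= 0 ==> emeasure \<mu> (cb x a) = ennreal (vol * absval a)"
 by (simp add: cb_eq_vcoset haar_vcoset[OF haar] haar_vball[OF haar] absval_eq vol_def q_def)

lemma measure_cb: "a ~= 0 ==> measure \<mu> (cb x a) = vol * absval a" using emeasure_cb[of a x] vol_pos by (simp add: measure_def)

lemma compact_subset_cb:
 assumes "compact (S :: 'k set)"
 shows "\<exists>a. a ~= 0 \<and> S \<subseteq> cb 0 a"
proof -
 obtain n where n: "S \<subseteq> vball n" using compact_subset_vball[OF assms] by blast
 obtain a :: 'k where "a ~= 0" "val a = n" using ex_val by blast
 thus ?thesis using n by (intro exI[of _ a]) (simp add: cb_eq_vcoset)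
qed

lemma eventually_absval: "(a::'k) ~= 0 ==> eventually (%y. absval (y - x :: 'k) <= absval a) (nhds x)"
 using eventually_vball[of x "val a"] by (simp add: absval_le_iff)

lemma eventually_absval_eq: "(x::'k) ~= 0 ==> eventually (%y. absval y = absval x) (nhds x)"
proof -
 assume x: "x ~= 0"
 obtain a :: 'k where a: "a ~= 0" "absval a < absval x" using ex_absval_less[of "absval x"] x by auto
 show ?thesis using eventually_absval[OF a(1), of x]
 proof eventually_elim
  case (elim y)
  thus ?case using a absval_add_eq[of "y - x" x] by simp
 qed
qed

lemma continuous_on_absval: "continuous_on UNIV (absval :: 'k => real)" unfolding continuous_on_def
proof
 fix x :: 'k
 have "(absval \<longlongrightarrow> absval x) (nhds x)"
 proof (cases "x = 0")
  case True
  show ?thesis unfolding tendsto_iff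
  proof (intro allI impI)
   fix e :: real assume "0 < e"
   then obtain a :: 'k where a: "a ~= 0" "absval a < e" using ex_absval_less by blast
   show "\<forall>\<^sub>F y in nhds x. dist (absval y) (absval x) < e" using eventually_absval[OF a(1), of x] by eventually_elim (use True a in auto)
  qed
 next
  case False
  thus ?thesis using eventually_absval_eq[OF False] by (intro tendsto_eventually)
 qed
 thus "(absval \<longlongrightarrow> absval x) (at x within UNIV)" by (simp add: tendsto_nhds_iff)
qed

lemma absval_measurable [measurable]: "(absval :: 'k => real) \<in> bm" by (rule borel_measurable_continuous_onI[OF continuous_on_absval])

lemma inverse_measurable [measurable]: "(inverse :: 'k => 'k) \<in> bm"
proof -
 have "continuous_on (-{0}) (inverse :: 'k => 'k)" by (intro continuous_intros) auto
 hence "(%x::'k. if x \<in> - {0} then inverse x else 0) \<in> bm" by (intro borel_measurable_continuous_on_if) auto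
 moreover have "(%x::'k. if x \<in> - {0} then inverse x else 0) = inverse" by auto
 ultimately show ?thesis by simp
qed

lemma divide_measurable [measurable (raw)]:
 "f \<in> borel_measurable M ==> g \<in> borel_measurable M ==> (%x. f x / g x :: 'k) \<in> borel_measurable M" unfolding divide_inverse
 by (intro borel_measurable_times_local_field measurable_compose[OF _ inverse_measurable])

lemma cb_measurable [measurable]: "cb x a \<in> sets borel" unfolding cb_def by measurable

sublocale haar: sigma_finite_measure \<mu>
proof
 show "\<exists>A. countable A \<and> A \<subseteq> sets \<mu> \<and> \<Union>A = space \<mu> \<and> (\<forall>a\<in>A. emeasure \<mu> a ~= \<infinity>)"
  using haar_vball_finite[OF haar] UN_vball[where 'k = 'k] open_vball
  by (intro exI[of _ "range (%j::nat. vball (- int j))"]) (auto simp: less_top intro!: borel_open)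
qed

sublocale haar2: pair_sigma_finite \<mu> \<mu> ..

lemma emeasure_singleton [simp]: "emeasure \<mu> {x} = 0"
proof -
 have "(+) x ` {0} = {x}" by simp
 thus ?thesis using haar haar_singleton[OF haar] unfolding haar_measure_def by (metis borel_singleton sets.empty_sets)
qed

lemma AE_neq: "AE x in \<mu>. x ~= c" by (rule AE_I'[of "{c}"]) auto

end

section \<open>Change of variables and locally constant functions\<close>

context local_field_data
begin

abbreviation av :: "'k => real" where "av \<equiv> absval"

text \<open>Change of variables as an identity of measures: \<open>T\<close> pushes \<open>J\<close>
  times \<open>\<mu>\<close> forward to \<open>\<mu>\<close>. This leaves \<open>T\<close> arbitrary
  where \<open>J\<close> vanishes, which takes care of the poles of Moebius maps.\<close>

definition cov :: "('k => 'k) => ('k => real) => bool" where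
 "cov T J \<longleftrightarrow> T \<in> bm \<and> J \<in> bm \<and> (\<forall>x. 0 <= J x)
   \<and> distr (density \<mu> (%x. ennreal (J x))) borel T = \<mu>"

lemma emeasure_distr_density:
 assumes [measurable]: "T \<in> bm" "J \<in> bm" "A \<in> sets borel"
 shows "emeasure (distr (density \<mu> (%x. ennreal (J x))) borel T) A = (NI y. ennreal (J y) * indicator A (T y))"
proof -
 have "emeasure (distr (density \<mu> (%x. ennreal (J x))) borel T) A
   = emeasure (density \<mu> (%x. ennreal (J x))) (T -` A)" by (subst emeasure_distr) simp_all
 also have "... = (NI y. ennreal (J y) * indicator (T -` A) y)"
  by (rule emeasure_density) (simp_all add: measurable_sets_borel[OF assms(1) assms(3)])
 finally show ?thesis by (simp add: indicator_def)
qed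

lemma cov_nn_integral:
 assumes c: "cov T J" and f[measurable]: "f \<in> bm"
 shows "(NI x. ennreal (J x) * f (T x)) = (NI x. f x)"
proof -
 have [measurable]: "T \<in> bm" "J \<in> bm" using c by (auto simp: cov_def)
 have "(NI x. f x) = (\<integral>\<^sup>+x. f x \<partial>distr (density \<mu> (%x. ennreal (J x))) borel T)" using c by (simp add: cov_def)
 also have "... = (\<integral>\<^sup>+x. f (T x) \<partial>density \<mu> (%x. ennreal (J x)))" by (rule nn_integral_distr) simp_all
 also have "... = (NI x. ennreal (J x) * f (T x))" by (rule nn_integral_density) simp_all
 finally show ?thesis by simp
qed

lemma covI_nn:
 assumes [measurable]: "T \<in> bm" "J \<in> bm" and "!!x. 0 <= J x"
  and "!!f. f \<in> bm ==> (NI x. ennreal (J x) * f (T x)) = (NI x. f x)"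
 shows "cov T J" unfolding cov_def
proof (intro conjI allI)
 show "distr (density \<mu> (%x. ennreal (J x))) borel T = \<mu>"
 proof (rule measure_eqI)
  fix A assume "A \<in> sets (distr (density \<mu> (%x. ennreal (J x))) borel T)"
  hence [measurable]: "A \<in> sets borel" by simp
  show "emeasure (distr (density \<mu> (%x. ennreal (J x))) borel T) A = emeasure \<mu> A"
   by (subst emeasure_distr_density) (simp_all add: assms(4)[of "indicator A"])
 qed simp
qed (use assms in auto)

text \<open>The condition \<open>av a < av x\<close> says that \<open>cb x a\<close> misses 0; such
  balls and the point 0 determine the measure by \<open>measure_eqI_vcosets_nonzero\<close>.\<close>

lemma covI_cb:
 assumes m[measurable]: "T \<in> bm" "J \<in> bm" and nn: "!!x. 0 <= J x"
  and eq: "!!x a. a ~= 0 ==> av a < av x ==>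
   (NI y. ennreal (J y) * indicator (cb x a) (T y)) = ennreal (vol * av a)"
  and zero: "!!x. (NI y. ennreal (J y) * indicator {0} (T y)) = 0"
 shows "cov T J"
proof -
 have "\<mu> = distr (density \<mu> (%x. ennreal (J x))) borel T"
 proof (rule measure_eqI_vcosets_nonzero)
  fix x :: 'k and n assume x: "x ~= 0" "val x < n"
  obtain a :: 'k where a: "a ~= 0" "val a = n" using ex_val by blast
  have "av a < av x" unfolding absval_less_iff[OF x(1)] using x a by (simp add: vball_def)
  thus "emeasure \<mu> (vcoset x n) = emeasure (distr (density \<mu> (%x. ennreal (J x))) borel T) (vcoset x n)"
   using eq[OF a(1), of x] emeasure_cb[OF a(1), of x] a by (subst emeasure_distr_density) (auto simp: cb_eq_vcoset open_vcoset)
 next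
  show "emeasure \<mu> {0} = emeasure (distr (density \<mu> (%x. ennreal (J x))) borel T) {0}" using zero by (subst emeasure_distr_density) auto
 next
  show "emeasure \<mu> (vball n) ~= \<infinity>" for n using haar_vball_finite[OF haar, of n] by (simp add: less_top)
 qed simp_all
 thus ?thesis unfolding cov_def using nn m by simp
qed

lemma cov_integral:
 fixes f :: "'k => complex"
 assumes c: "cov T J" and f[measurable]: "f \<in> bm"
 shows "(LI x. J x *\<^sub>R f (T x)) = (LI x. f x)"
  and "integrable \<mu> (%x. J x *\<^sub>R f (T x)) \<longleftrightarrow> integrable \<mu> f"
proof -
 have [measurable]: "T \<in> bm" "J \<in> bm" and J: "!!x. 0 <= J x"
  and eq: "distr (density \<mu> (%x. ennreal (J x))) borel T = \<mu>" using c by (auto simp: cov_def)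
 have "(LI x. J x *\<^sub>R f (T x)) = (\<integral>x. f (T x) \<partial>density \<mu> (%x. ennreal (J x)))" by (rule integral_density[symmetric]) (simp_all add: J)
 also have "... = (\<integral>x. f x \<partial>distr (density \<mu> (%x. ennreal (J x))) borel T)" by (rule integral_distr[symmetric]) simp_all
 finally show "(LI x. J x *\<^sub>R f (T x)) = (LI x. f x)" unfolding eq .
 have "integrable \<mu> (%x. J x *\<^sub>R f (T x)) \<longleftrightarrow> integrable (density \<mu> (%x. ennreal (J x))) (%x. f (T x))"
  by (rule integrable_density[symmetric]) (simp_all add: J)
 also have "... \<longleftrightarrow> integrable (distr (density \<mu> (%x. ennreal (J x))) borel T) f" by (rule integrable_distr_eq[symmetric]) simp_all
 finally show "integrable \<mu> (%x. J x *\<^sub>R f (T x)) \<longleftrightarrow> integrable \<mu> f" unfolding eq .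
qed

lemma cov_comp:
 assumes "cov S I" "cov T J"
 shows "cov (%x. T (S x)) (%x. J (S x) * I x)"
proof (rule covI_nn)
 have m[measurable]: "T \<in> bm" "J \<in> bm" "S \<in> bm" "I \<in> bm"
  and J: "!!x. 0 <= J x" "!!x. 0 <= I x" using assms by (auto simp: cov_def)
 show "(%x. T (S x)) \<in> bm" "(%x. J (S x) * I x) \<in> bm" by measurable
 show "0 <= J (S x) * I x" for x using J by simp
 fix f :: "'k => ennreal" assume [measurable]: "f \<in> bm"
 have "(NI x. ennreal (J (S x) * I x) * f (T (S x)))
   = (NI x. ennreal (I x) * (ennreal (J (S x)) * f (T (S x))))" using J by (simp add: ennreal_mult mult_ac)
 also have "... = (NI x. ennreal (J x) * f (T x))" using cov_nn_integral[OF assms(1), of "%x. ennreal (J x) * f (T x)"] by simp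
 also have "... = (NI x. f x)" by (rule cov_nn_integral[OF assms(2)]) simp
 finally show "(NI x. ennreal (J (S x) * I x) * f (T (S x))) = (NI x. f x)" .
qed

text \<open>At the pole of a Moebius map division by zero makes the Jacobian 0, and there totalized
  formulas for the same map may disagree.\<close>

lemma cov_cong:
 assumes "cov T J" and [measurable]: "T' \<in> bm"
  and eq: "!!x. J' x = J x" "!!x. J x ~= 0 ==> T' x = T x"
 shows "cov T' J'"
proof -
 have J': "J' = J" using eq(1) by auto
 show ?thesis unfolding J'
 proof (rule covI_nn)
  fix f :: "'k => ennreal" assume f: "f \<in> bm"
  have "(NI x. ennreal (J x) * f (T' x)) = (NI x. ennreal (J x) * f (T x))"
   by (intro nn_integral_cong) (metis eq(2) ennreal_0 mult_zero_left)
  thus "(NI x. ennreal (J x) * f (T' x)) = (NI x. f x)" using cov_nn_integral[OF assms(1) f] by simp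
 qed (use assms in \<open>auto simp: cov_def\<close>)
qed

lemma cov_translate: "cov (%x. c + x) (%_. 1)"
proof (rule covI_cb)
 fix x a :: 'k assume a: "a ~= 0"
 have "(NI y. ennreal 1 * indicator (cb x a) (c + y)) = (NI y. indicator (cb (x - c) a) y)"
  by (intro nn_integral_cong) (simp add: indicator_def cb_def algebra_simps)
 thus "(NI y. ennreal 1 * indicator (cb x a) (c + y)) = ennreal (vol * av a)" using emeasure_cb[OF a, of "x - c"] by simp
next
 have "(NI y. ennreal 1 * indicator {0} (c + y)) = (NI y. indicator {- c} y)"
  by (intro nn_integral_cong) (simp add: indicator_def eq_neg_iff_add_eq_0 add.commute)
 thus "(NI y. ennreal 1 * indicator {0} (c + y)) = 0" by simp
qed simp_all

lemma cov_scale: assumes d: "d ~= 0" shows "cov (%x. d * x) (%_. av d)"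
proof (rule covI_cb)
 fix x a :: 'k assume a: "a ~= 0"
 have *: "av (y - x / d) <= av (a / d) \<longleftrightarrow> av (d * y - x) <= av a" for y
 proof -
  have "d * y - x = d * (y - x / d)" using d by (simp add: right_diff_distrib)
  hence "av (d * y - x) = av d * av (y - x / d)" by (simp only: absval_mult)
  thus ?thesis using d by (simp add: absval_divide field_simps)
 qed
 have "(NI y. ennreal (av d) * indicator (cb x a) (d * y))
   = (NI y. ennreal (av d) * indicator (cb (x / d) (a / d)) y)" by (intro nn_integral_cong) (simp add: indicator_def cb_def *)
 also have "... = ennreal (av d) * emeasure \<mu> (cb (x / d) (a / d))" by (subst nn_integral_cmult) simp_all
 also have "... = ennreal (vol * av a)" using a d vol_pos by (subst emeasure_cb) (simp_all add: absval_divide ennreal_mult'[symmetric])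
 finally show "(NI y. ennreal (av d) * indicator (cb x a) (d * y)) = ennreal (vol * av a)" .
next
 have "(NI y. ennreal (av d) * indicator {0} (d * y)) = (NI y. ennreal (av d) * indicator {0} y)"
  using d by (intro nn_integral_cong) (simp add: indicator_def)
 also have "... = 0" by (subst nn_integral_cmult) simp_all
 finally show "(NI y. ennreal (av d) * indicator {0} (d * y)) = 0" .
qed simp_all

text \<open>Inversion maps balls off 0 to balls:
  \<open>y - inverse x = - ((inverse y - x) * (y / x))\<close>, and \<open>av y\<close> is the
  inverse of \<open>av x\<close> by the isosceles principle.\<close>

lemma inverse_cb_aux:
 assumes "y ~= 0" "x ~= 0" "av (inverse y - x) <= av a" "av a < av (x::'k)"
 shows "av y = inverse (av x) \<and> av (y - inverse x) <= av (a / x\<^sup>2)"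
proof -
 have "av (inverse y) = av x" using absval_add_eq[of "inverse y - x" x] assms by simp
 hence y: "av y = inverse (av x)" by (metis absval_inverse inverse_inverse_eq)
 have "y - inverse x = - ((inverse y - x) * (y / x))" using assms by (simp add: field_simps)
 hence "av (y - inverse x) = av (inverse y - x) * (av y / av x)" by (simp only: absval_minus absval_mult absval_divide)
 also have "... <= av a * (av y / av x)" using assms by (intro mult_right_mono) auto
 also have "... = av (a / x\<^sup>2)" using y by (simp add: absval_divide absval_mult power2_eq_square field_simps)
 finally show ?thesis using y by simp
qed

lemma cov_inverse: "cov inverse (%x. 1 / (av x)\<^sup>2)"
proof (rule covI_cb)
 fix x a :: 'k assume a: "a ~= 0" "av a < av x"
 hence x: "x ~= 0" by (metis absval_0 absval_nonneg not_less)
 have iff: "inverse y \<in> cb x a \<longleftrightarrow> y \<in> cb (inverse x) (a / x\<^sup>2)" if y: "y ~= 0" for y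
 proof
  assume "inverse y \<in> cb x a"
  thus "y \<in> cb (inverse x) (a / x\<^sup>2)" using inverse_cb_aux[OF y x] a by (simp add: cb_def)
 next
  assume "y \<in> cb (inverse x) (a / x\<^sup>2)"
  hence "av (inverse (inverse y) - inverse x) <= av (a / x\<^sup>2)" by (simp add: cb_def)
  moreover have "av (a / x\<^sup>2) < av (inverse x)"
   using a x by (simp add: absval_divide absval_mult absval_inverse power2_eq_square field_simps del: not_less)
  ultimately have "av (inverse y - inverse (inverse x)) <= av (a / x\<^sup>2 / (inverse x)\<^sup>2)"
   using inverse_cb_aux[of "inverse y" "inverse x" "a / x\<^sup>2"] x y by simp
  thus "inverse y \<in> cb x a" using x by (simp add: cb_def power2_eq_square field_simps)
 qed
 \<comment> \<open>On the preimage of a ball that misses 0 the Jacobian is the constant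
   \<open>(av x)\<^sup>2\<close>.\<close>
 have J: "ennreal (1 / (av y)\<^sup>2) * indicator (cb x a) (inverse y)
   = ennreal ((av x)\<^sup>2) * indicator (cb (inverse x) (a / x\<^sup>2)) y" for y
 proof (cases "y = 0")
  case True
  have "0 \<notin> cb (inverse x) (a / x\<^sup>2)" using a x by (auto simp: cb_def absval_inverse absval_divide absval_mult power2_eq_square field_simps)
  thus ?thesis using True by simp
 next
  case False
  show ?thesis
  proof (cases "inverse y \<in> cb x a")
   case True
   hence "av y = inverse (av x)" using inverse_cb_aux[OF False x] a by (simp add: cb_def)
   thus ?thesis using iff[OF False] True by (simp add: power_one_over inverse_eq_divide)
  qed (use iff[OF False] in simp)
 qed
 have "(NI y. ennreal (1 / (av y)\<^sup>2) * indicator (cb x a) (inverse y))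
   = ennreal ((av x)\<^sup>2) * emeasure \<mu> (cb (inverse x) (a / x\<^sup>2))" unfolding J by (subst nn_integral_cmult) simp_all
 also have "... = ennreal (vol * av a)"
  using a x vol_pos by (subst emeasure_cb) (simp_all add: absval_divide absval_power ennreal_mult'[symmetric])
 finally show "(NI y. ennreal (1 / (av y)\<^sup>2) * indicator (cb x a) (inverse y)) = ennreal (vol * av a)" .
next
 have "(%y. ennreal (1 / (av y)\<^sup>2) * indicator {0::'k} (inverse y)) = (%y. 0)" by (auto simp: indicator_def)
 thus "(NI y. ennreal (1 / (av y)\<^sup>2) * indicator {0} (inverse y)) = 0" by simp
qed simp_all

lemma cov_affine: assumes "d ~= 0" shows "cov (%x. c + d * x) (%_. av d)" using cov_comp[OF cov_scale[OF assms] cov_translate[of c]] by simp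

lemma cov_moebius:
 assumes det: "a * d - b * c ~= (0::'k)"
 shows "cov (%x. (c + d * x) / (a + b * x)) (%x. av (a * d - b * c) / (av (a + b * x))\<^sup>2)"
proof (cases "b = 0")
 case True
 hence a: "a ~= 0" "d ~= 0" using det by auto
 show ?thesis by (rule cov_cong[OF cov_affine[of "d / a" "c / a"]])
    (use a True in \<open>auto simp: absval_divide absval_mult power2_eq_square add_divide_distrib\<close>)
next
 case False
 \<comment> \<open>Partial fractions: the map is \<open>d / b + e / (a + b * x)\<close>, composed of
   two affine maps and one inversion.\<close>
 define e where "e = (b * c - a * d) / b"
 have e: "e ~= 0" using det False by (auto simp: e_def)
 show ?thesis
 proof (rule cov_cong[OF cov_comp[OF cov_comp[OF cov_affine[OF False, of a] cov_inverse] cov_affine[OF e, of "d / b"]]])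
  fix x
  have "av e = av (a * d - b * c) / av b" unfolding e_def absval_divide by (simp add: absval_diff_commute)
  thus "av (a * d - b * c) / (av (a + b * x))\<^sup>2 = av e * (1 / (av (a + b * x))\<^sup>2 * av b)" using False by simp
  assume "av e * (1 / (av (a + b * x))\<^sup>2 * av b) ~= 0"
  hence nz: "a + b * x ~= 0" by auto
  thus "(c + d * x) / (a + b * x) = d / b + e * inverse (a + b * x)"
  proof -
   have "c + d * x = d / b * (a + b * x) + e" using False by (simp add: e_def field_simps)
   hence "(c + d * x) / (a + b * x) = d / b * (a + b * x) / (a + b * x) + e / (a + b * x)" by (simp only: add_divide_distrib)
   thus ?thesis using nz by (simp add: divide_inverse)
  qed
 qed measurable
qed

section \<open>Integrability of powers of the absolute value\<close>

lemma nn_integral_scale: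
 assumes "d ~= 0" "f \<in> bm"
 shows "ennreal (av d) * (NI x. f (d * x)) = (NI x. f x)"
proof -
 have [measurable]: "f \<in> bm" by fact
 show ?thesis using cov_nn_integral[OF cov_scale[OF assms(1)] assms(2)] by (subst (asm) nn_integral_cmult) simp_all
qed

lemma nn_integral_translate:
 "f \<in> bm ==> (NI x. f (c + x)) = (NI x. f x)" using cov_nn_integral[OF cov_translate] by simp

text \<open>The power is dominated by a sum of multiples of indicators of shrinking balls, since at
  each nonzero \<open>x\<close> of the ball one term equals the power. The sum integrates to a
  geometric series of ratio \<open>q powr (- (r + 1))\<close>, which is less than 1 for r >
  -1.\<close>

lemma nn_integral_powr_near:
 assumes r: "- 1 < r" and a: "a ~= 0"
 shows "(NI x. ennreal (av x powr r) * indicator (cb 0 a) x) < \<infinity>"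
proof -
 define t where "t i x = ennreal (q powr (- r * (val a + int i))) * indicator (vball (val a + int i)) x" for i :: nat and x :: 'k
 have [measurable]: "vball n \<in> sets borel" for n :: int by (simp add: borel_open open_vball)
 have meas: "t i \<in> bm" for i unfolding t_def by measurable
 have le: "ennreal (av x powr r) * indicator (cb 0 a) x <= (\<Sum>i. t i x)" for x
 proof (cases "x ~= 0 \<and> x \<in> cb 0 a")
  case True
  hence "x \<in> vball (val a)" using cb_eq_vcoset[OF a, of 0] by simp
  hence v: "val a <= val x" using True by (simp add: vball_def)
  define i where "i = nat (val x - val a)"
  have i: "val a + int i = val x" using v by (simp add: i_def)
  have "t i x = ennreal (av x powr r)"
   using True q_ge_2 i by (simp add: t_def vball_def absval_eq powr_powr powr_real_of_int'[symmetric] mult.commute)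
  moreover have "t i x <= (\<Sum>i. t i x)" using sum_le_suminf[of "%i. t i x" "{i}"] by simp
  ultimately show ?thesis using True by simp
 qed (auto simp: indicator_def)
 have int_t: "(NI x. t i x) = ennreal (vol * q powr (- (r + 1) * val a) * (q powr (- (r + 1))) ^ i)" for i
 proof -
  have "(NI x. t i x) = ennreal (q powr (- r * (val a + int i))) * emeasure \<mu> (vball (val a + int i))"
   unfolding t_def by (subst nn_integral_cmult) simp_all
  also have "... = ennreal (q powr (- r * (val a + int i)) * (vol * q powi (- (val a + int i))))"
   using haar_vball[OF haar, of "val a + int i"] q_ge_2 by (simp add: vol_def q_def ennreal_mult')
  also have "q powi (- (val a + int i)) = q powr (- (val a + int i))" using q_ge_2 by (simp add: powr_real_of_int'[symmetric])
  also have "q powr (- r * (val a + int i)) * (vol * q powr (- (val a + int i))) =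
    vol * (q powr (- r * (val a + int i)) * q powr (- (val a + int i)))" by simp
  also have "q powr (- r * (val a + int i)) * q powr (- (val a + int i)) = q powr (- (r + 1) * val a) * (q powr (- (r + 1))) ^ i"
  proof -
   have "- r * (val a + int i) + - (val a + int i) = - (r + 1) * val a + - (r + 1) * real i" by (simp add: algebra_simps)
   hence "q powr (- r * (val a + int i)) * q powr (- (val a + int i)) = q powr (- (r + 1) * val a + - (r + 1) * real i)"
    by (simp only: powr_add[symmetric])
   also have "... = q powr (- (r + 1) * val a) * (q powr (- (r + 1))) ^ i"
    using q_ge_2 by (simp only: powr_add powr_powr[symmetric]) (simp add: powr_realpow)
   finally show ?thesis .
  qed
  finally show ?thesis by (simp add: mult.assoc)
 qed
 have "(NI x. ennreal (av x powr r) * indicator (cb 0 a) x) <= (NI x. (\<Sum>i. t i x))" by (intro nn_integral_mono le)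
 also have "... = (\<Sum>i. \<integral>\<^sup>+x. t i x \<partial>\<mu>)" using meas by (intro nn_integral_suminf) simp
 also have "... = (\<Sum>i. ennreal (vol * q powr (- (r + 1) * val a) * (q powr (- (r + 1))) ^ i))" by (simp only: int_t)
 also have "... = ennreal (\<Sum>i. vol * q powr (- (r + 1) * val a) * (q powr (- (r + 1))) ^ i)"
 proof (rule suminf_ennreal2)
  show "summable (%i. vol * q powr (- (r + 1) * val a) * (q powr (- (r + 1))) ^ i)"
   using q_ge_2 r by (intro summable_mult summable_geometric) (simp add: powr_less_one)
 qed (use vol_pos in simp)
 also have "... < \<infinity>" by simp
 finally show ?thesis .
qed

text \<open>Inversion turns the far region into a ball and the exponent \<open>r\<close> into
  \<open>- 2 - r\<close>.\<close>

lemma nn_integral_powr_far: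
 assumes r: "r < - 1" and a: "a ~= 0"
 shows "(NI x. ennreal (av x powr r) * indicator {x. av a <= av x} x) < \<infinity>"
proof -
 have [measurable]: "{x::'k. av a <= av x} \<in> sets borel" by measurable
 have "(NI x. ennreal (av x powr r) * indicator {x. av a <= av x} x)
   = (NI x. ennreal (1 / (av x)\<^sup>2) * (ennreal (av (inverse x) powr r) * indicator {x. av a <= av x} (inverse x)))"
  by (subst cov_nn_integral[OF cov_inverse]) simp_all
 also have "... <= (NI x. ennreal (av x powr (- 2 - r)) * indicator (cb 0 (inverse a)) x)"
 proof (intro nn_integral_mono)
  fix x
  show "ennreal (1 / (av x)\<^sup>2) * (ennreal (av (inverse x) powr r) * indicator {x. av a <= av x} (inverse x))
   <= ennreal (av x powr (- 2 - r)) * indicator (cb 0 (inverse a)) x"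
  proof (cases "x ~= 0 \<and> av a <= av (inverse x)")
   case True
   hence x: "x ~= 0" "0 < av x" by auto
   have "av x <= av (inverse a)" using True a le_imp_inverse_le[of "av a" "av (inverse x)"] by (simp add: absval_inverse)
   moreover have "1 / (av x)\<^sup>2 * (av (inverse x) powr r) = av x powr (- 2 - r)"
   proof -
    have "1 / (av x)\<^sup>2 = av x powr (- 2)" using x by (simp add: powr_minus divide_inverse)
    moreover have "av (inverse x) powr r = av x powr (- r)" using x by (simp add: absval_inverse powr_minus inverse_powr)
    ultimately show ?thesis by (simp add: powr_add[symmetric])
   qed
   ultimately show ?thesis using True by (simp add: cb_def ennreal_mult'[symmetric])
  qed auto
 qed
 also have "... < \<infinity>" using r a by (intro nn_integral_powr_near) auto
 finally show ?thesis .
qed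

lemma finite_absval_lower:
 assumes "finite I" "!!i. i \<in> I ==> b i ~= (0::'k)"
 shows "\<exists>c. c ~= 0 \<and> (\<forall>i\<in>I. av c <= av (b i))" using assms
proof (induction I rule: finite_induct)
 case empty
 thus ?case by (intro exI[of _ 1]) simp
next
 case (insert i I)
 then obtain c where c: "c ~= 0" "\<forall>i\<in>I. av c <= av (b i)" by auto
 thus ?case using insert(4)[of i] by (intro exI[of _ "if av c <= av (b i) then c else b i"]) auto
qed

section \<open>Locally constant functions and test functions\<close>

definition loc_const :: "('k => complex) => bool" where
 "loc_const f \<longleftrightarrow> (\<forall>x. \<exists>b. b ~= 0 \<and> (\<forall>y. av (y - x) <= av b --> f y = f x))"

lemma loc_const_iff_open: "loc_const f \<longleftrightarrow> (\<forall>x. \<exists>U. open U \<and> x \<in> U \<and> (\<forall>y\<in>U. f y = f x))"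
proof
 assume f: "loc_const f"
 show "\<forall>x. \<exists>U. open U \<and> x \<in> U \<and> (\<forall>y\<in>U. f y = f x)"
 proof
  fix x
  from f have "\<exists>b. b ~= 0 \<and> (\<forall>y. av (y - x) <= av b --> f y = f x)" unfolding loc_const_def ..
  then obtain b where "b ~= 0" "\<forall>y. av (y - x) <= av b --> f y = f x" by (elim exE conjE)
  thus "\<exists>U. open U \<and> x \<in> U \<and> (\<forall>y\<in>U. f y = f x)"
   by (intro exI[of _ "cb x b"] conjI ballI open_cb cb_self) (auto simp only: cb_def mem_Collect_eq)
 qed
next
 assume f: "\<forall>x. \<exists>U. open U \<and> x \<in> U \<and> (\<forall>y\<in>U. f y = f x)"
 show "loc_const f" unfolding loc_const_def
 proof
  fix x
  obtain U where U: "open U" "x \<in> U" "\<forall>y\<in>U. f y = f x" using f by auto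
  then obtain b :: 'k where "b ~= 0" "\<forall>y. av (y - x) <= av b --> y \<in> U" unfolding open_iff_absval by auto
  thus "\<exists>b. b ~= 0 \<and> (\<forall>y. av (y - x) <= av b --> f y = f x)" using U by blast
 qed
qed

lemma loc_const_continuous: "loc_const f ==> continuous_on UNIV f"
proof -
 assume f: "loc_const f"
 have "(f \<longlongrightarrow> f x) (nhds x)" for x
 proof -
  from f have "\<exists>b. b ~= 0 \<and> (\<forall>y. av (y - x) <= av b --> f y = f x)" unfolding loc_const_def ..
  then obtain b where b: "b ~= 0" "\<forall>y. av (y - x) <= av b --> f y = f x" by (elim exE conjE)
  have "eventually (%y. f y = f x) (nhds x)" using eventually_absval[OF b(1), of x] by (rule eventually_mono) (use b in blast)
  thus ?thesis by (rule tendsto_eventually)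
 qed
 thus ?thesis unfolding continuous_on_def by (auto simp: tendsto_nhds_iff)
qed

lemma loc_const_measurable: "loc_const f ==> f \<in> bm" by (intro borel_measurable_continuous_onI loc_const_continuous)

text \<open>Finitely many balls of local constancy cover \<open>S\<close>; by the ultrametric
  inequality a translation by at most the smallest radius stays in the same ball.\<close>

lemma uniformly_loc_const:
 assumes f: "loc_const f" and S: "compact S"
 shows "\<exists>b. b ~= 0 \<and> (\<forall>x\<in>S. \<forall>y. av y <= av b --> f (x + y) = f x)"
proof -
 have "\<forall>x. \<exists>b. b ~= 0 \<and> (\<forall>y. av (y - x) <= av b --> f y = f x)" using f by (simp add: loc_const_def)
 then obtain b where b: "!!x. b x ~= 0" "!!x y. av (y - x) <= av (b x) ==> f y = f x" by metis
 have "S \<subseteq> (\<Union>x\<in>S. cb x (b x))" using cb_self by blast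
 moreover have "open (cb x (b x))" for x using b(1) by (rule open_cb)
 ultimately obtain X where X: "X \<subseteq> S" "finite X" "S \<subseteq> (\<Union>x\<in>X. cb x (b x))" using compactE_image[OF S, of S "%x. cb x (b x)"] by metis
 have "\<exists>c. c ~= 0 \<and> (\<forall>x\<in>X. av c <= av (b x))" by (rule finite_absval_lower[OF X(2)]) (rule b(1))
 then obtain c where c: "c ~= 0" "\<forall>x\<in>X. av c <= av (b x)" by (elim exE conjE)
 have "f (x + y) = f x" if x: "x \<in> S" and y: "av y <= av c" for x y
 proof -
  obtain z where z: "z \<in> X" "av (x - z) <= av (b z)" using X(3) x by (auto simp: cb_def)
  have "av (x - z + y) <= av (b z)" using absval_add[of "x - z" y] z y c by fastforce
  hence "f (x + y) = f z" using b(2)[of "x + y" z] by (simp add: algebra_simps)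
  thus ?thesis using b(2)[OF z(2)] by simp
 qed
 thus ?thesis using c(1) by auto
qed

text \<open>The quantitative form of being a test function, with one radius for the support and one
  radius of invariance that is uniform by compactness.\<close>

lemma Cc_iff:
 "\<phi> \<in> Cc \<longleftrightarrow> (\<exists>a b. a ~= 0 \<and> b ~= 0 \<and> (\<forall>x. av x > av a --> \<phi> x = 0)
   \<and> (\<forall>x y. av y <= av b --> \<phi> (x + y) = \<phi> x))" (is "_ = ?R")
proof
 assume "\<phi> \<in> Cc"
 hence l: "loc_const \<phi>" and c: "compact (closure {x. \<phi> x ~= 0})" by (simp_all add: Cc_smooth_def loc_const_iff_open)
 obtain a where a: "a ~= 0" "closure {x. \<phi> x ~= 0} \<subseteq> cb 0 a" using compact_subset_cb[OF c] by auto
 have supp: "\<phi> x = 0" if "av x > av a" for x using a(2) closure_subset[of "{x. \<phi> x ~= 0}"] that by (auto simp: cb_def)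
 obtain b where b: "b ~= 0" "\<forall>x\<in>cb 0 a. \<forall>y. av y <= av b --> \<phi> (x + y) = \<phi> x"
  using uniformly_loc_const[OF l compact_cb[OF a(1), of 0]] by blast
 \<comment> \<open>The radius is capped by \<open>av a\<close>: translating a point outside
   \<open>cb 0 a\<close> then keeps its absolute value, and both values are 0.\<close>
 define c where "c = (if av b <= av a then b else a)"
 have c: "c ~= 0" "av c <= av b" "av c <= av a" using a b by (auto simp: c_def)
 have "\<phi> (x + y) = \<phi> x" if y: "av y <= av c" for x y
 proof (cases "x \<in> cb 0 a")
  case True
  thus ?thesis using b y c by auto
 next
  case False
  hence "av y < av x" using y c by (simp add: cb_def)
  hence "av (x + y) = av x" using absval_add_eq[of y x] by (simp add: add.commute)
  thus ?thesis using False supp by (simp add: cb_def)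
 qed
 thus ?R using a(1) c(1) supp by auto
next
 assume ?R
 then obtain a b where ab: "a ~= 0" "b ~= 0" "!!x. av x > av a ==> \<phi> x = 0"
  "!!x y. av y <= av b ==> \<phi> (x + y) = \<phi> x" by auto
 have "loc_const \<phi>" unfolding loc_const_def
 proof (intro allI exI[of _ b] conjI impI ab(2))
  fix x y assume "av (y - x) <= av b"
  thus "\<phi> y = \<phi> x" using ab(4)[of "y - x" x] by simp
 qed
 moreover have "{x. \<phi> x ~= 0} \<subseteq> cb 0 a" using ab(3) by (force simp: cb_def)
 hence "closure {x. \<phi> x ~= 0} \<subseteq> cb 0 a" using ab(1) by (intro closure_minimal) auto
 hence "compact (closure {x. \<phi> x ~= 0})" using compact_cb[OF ab(1), of 0] by (metis closed_closure compact_Int_closed inf.absorb_iff2)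
 ultimately show "\<phi> \<in> Cc" by (simp add: Cc_smooth_def loc_const_iff_open)
qed

lemma CcE:
 assumes "\<phi> \<in> Cc"
 obtains a b where "a ~= 0" "b ~= 0" "!!x. av x > av a ==> \<phi> x = 0"
  "!!x y. av y <= av b ==> \<phi> (x + y) = \<phi> x" using assms unfolding Cc_iff by auto

lemma Cc_loc_const: "\<phi> \<in> Cc ==> loc_const \<phi>" by (simp add: Cc_smooth_def loc_const_iff_open)

lemma CcI_loc_const:
 assumes "loc_const \<phi>" "!!x. av x > av a ==> \<phi> x = 0" "a ~= 0"
 shows "\<phi> \<in> Cc"
proof -
 have "{x. \<phi> x ~= 0} \<subseteq> cb 0 a" using assms(2) by (force simp: cb_def)
 hence "closure {x. \<phi> x ~= 0} \<subseteq> cb 0 a" using assms(3) by (intro closure_minimal) auto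
 hence "compact (closure {x. \<phi> x ~= 0})" using compact_cb[OF assms(3), of 0] by (metis closed_closure compact_Int_closed inf.absorb_iff2)
 thus "\<phi> \<in> Cc" using assms(1) by (simp add: Cc_smooth_def loc_const_iff_open)
qed

lemma Cc_measurable: "(\<phi> :: 'k => complex) \<in> Cc ==> \<phi> \<in> bm" by (intro loc_const_measurable Cc_loc_const)

lemma Cc_bounded:
 assumes "\<phi> \<in> Cc"
 obtains a B where "a ~= 0" "0 <= B" "!!x. norm (\<phi> x) <= B * indicator (cb 0 a) x"
proof -
 from assms obtain a b where ab: "a ~= 0" "b ~= 0" "!!x. av x > av a ==> \<phi> x = 0"
  "!!x y. av y <= av b ==> \<phi> (x + y) = \<phi> x" by (rule CcE) (rule that; assumption)
 have "compact (\<phi> ` cb 0 a)" using loc_const_continuous[OF Cc_loc_const[OF assms]] compact_cb[OF ab(1)]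
  by (intro compact_continuous_image) (auto intro: continuous_on_subset)
 then obtain B where B: "!!z. z \<in> \<phi> ` cb 0 a ==> norm z <= B" using compact_imp_bounded bounded_iff by metis
 have "norm (\<phi> 0) <= B" by (intro B imageI cb_self)
 hence "0 <= B" using norm_ge_zero order_trans by blast
 thus ?thesis using that[OF ab(1), of B] B ab(3) by (force simp: cb_def indicator_def)
qed

lemma integrable_indicator_cb: "a ~= 0 ==> integrable \<mu> (indicator (cb x a) :: 'k => real)"
 by (intro integrable_real_indicator) (simp_all add: emeasure_cb)

lemma Cc_integrable: "\<phi> \<in> Cc ==> integrable \<mu> \<phi>"
proof -
 assume \<phi>: "\<phi> \<in> Cc"
 then obtain a B where "a ~= 0" "0 <= B" "!!x. norm (\<phi> x) <= B * indicator (cb 0 a) x" by (rule Cc_bounded) (rule that; assumption)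
 note aB = this
 show ?thesis
 proof (rule Bochner_Integration.integrable_bound)
  show "integrable \<mu> (%x. B * indicator (cb 0 a) x)" using integrable_indicator_cb[OF aB(1)] by simp
  show "AE x in \<mu>. norm (\<phi> x) <= norm (B * indicator (cb 0 a) x)"
  proof (rule AE_I2)
   fix x show "norm (\<phi> x) <= norm (B * indicator (cb 0 a) x)" using aB(3)[of x] aB(2) by simp
  qed
 qed (use Cc_measurable[OF \<phi>] in simp)
qed

lemma Cc_add: assumes "(\<phi> :: 'k => complex) \<in> Cc" "\<theta> \<in> Cc" shows "(%x. \<phi> x + \<theta> x) \<in> Cc"
proof -
 from assms(1) obtain a b where 1: "a ~= 0" "b ~= 0" "!!x. av x > av a ==> \<phi> x = 0"
  "!!x y. av y <= av b ==> \<phi> (x + y) = \<phi> x" by (rule CcE) (rule that; assumption)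
 from assms(2) obtain a' b' where 2: "a' ~= 0" "b' ~= 0" "!!x. av x > av a' ==> \<theta> x = 0"
  "!!x y. av y <= av b' ==> \<theta> (x + y) = \<theta> x" by (rule CcE) (rule that; assumption)
 show ?thesis unfolding Cc_iff by (intro exI[of _ "if av a <= av a' then a' else a"] exI[of _ "if av b <= av b' then b else b'"])
    (use 1(1-3) 2(1-3) in \<open>auto intro!: arg_cong2[of _ _ _ _ "(+)"] 1(4) 2(4)\<close>)
qed

lemma Cc_mult: assumes "\<phi> \<in> Cc" "loc_const g" shows "(%x. g x * \<phi> x) \<in> Cc"
proof -
 from assms(1) obtain a b where 1: "a ~= 0" "b ~= 0" "!!x. av x > av a ==> \<phi> x = 0"
  "!!x y. av y <= av b ==> \<phi> (x + y) = \<phi> x" by (rule CcE) (rule that; assumption)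
 show ?thesis
 proof (rule CcI_loc_const[of _ a])
  show "loc_const (%x. g x * \<phi> x)" unfolding loc_const_def
  proof
   fix x
   from assms(2) have "\<exists>b. b ~= 0 \<and> (\<forall>y. av (y - x) <= av b --> g y = g x)" unfolding loc_const_def ..
   then obtain c where c: "c ~= 0" "\<forall>y. av (y - x) <= av c --> g y = g x" by (elim exE conjE)
   have "\<phi> y = \<phi> x" if "av (y - x) <= av b" for y using 1(4)[OF that, of x] by simp
   thus "\<exists>c. c ~= 0 \<and> (\<forall>y. av (y - x) <= av c --> g y * \<phi> y = g x * \<phi> x)"
   proof (intro exI[of _ "if av b <= av c then b else c"] conjI allI impI)
    fix y assume "av (y - x) <= av (if av b <= av c then b else c)"
    hence "av (y - x) <= av b" "av (y - x) <= av c" by (auto split: if_splits)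
    thus "g y * \<phi> y = g x * \<phi> x" using c(2) \<open>av (y - x) <= av b ==> \<phi> y = \<phi> x\<close> by metis
   qed (use c(1) 1(2) in auto)
  qed
 qed (use 1 in auto)
qed

lemma Cc_cmult: "(\<phi> :: 'k => complex) \<in> Cc ==> (%x. c * \<phi> x) \<in> Cc" by (rule Cc_mult) (auto simp: loc_const_def intro: exI[of _ 1])

lemma Cc_indicator: "a ~= 0 ==> (%x. indicator (cb c a) x :: complex) \<in> Cc"
proof -
 assume a: "a ~= 0"
 have lc: "loc_const (%x. indicator (cb c a) x :: complex)" unfolding loc_const_def
 proof (intro allI exI[of _ a] conjI impI a)
  fix x y assume "av (y - x) <= av a"
  hence "av (y - c) <= av a \<longleftrightarrow> av (x - c) <= av a"
   using absval_add[of "y - x" "x - c"] absval_add[of "x - y" "y - c"] absval_diff_commute[of y x] by auto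
  thus "(indicator (cb c a) y :: complex) = indicator (cb c a) x" by (simp add: indicator_def cb_def)
 qed
 obtain e where e: "e ~= 0" "max (av a) (av c) < av e" using ex_absval_gt[of "max (av a) (av c)"] by blast
 show ?thesis
 proof (rule CcI_loc_const[OF lc _ e(1)])
  fix x assume "av e < av x"
  hence "x \<notin> cb c a" using absval_add[of "x - c" c] e by (auto simp: cb_def)
  thus "(indicator (cb c a) x :: complex) = 0" by simp
 qed
qed

lemma Cc_affine: assumes "(\<phi> :: 'k => complex) \<in> Cc" "d ~= 0" shows "(%x. \<phi> (c + d * x)) \<in> Cc"
proof -
 from assms(1) obtain a b where 1: "a ~= 0" "b ~= 0" "!!x. av x > av a ==> \<phi> x = 0"
  "!!x y. av y <= av b ==> \<phi> (x + y) = \<phi> x" by (rule CcE) (rule that; assumption)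
 obtain e where e: "e ~= 0" "max (av a) (av c) / av d < av e" using ex_absval_gt[of "max (av a) (av c) / av d"] by blast
 show ?thesis unfolding Cc_iff
 proof (rule exI[of _ e], rule exI[of _ "b / d"], intro conjI allI impI)
  show "e ~= 0" "b / d ~= 0" using e 1 assms by auto
  fix x assume x: "av e < av x"
  have "max (av a) (av c) < av e * av d" using e(2) assms(2) by (simp add: pos_divide_less_eq del: max_less_iff_conj)
  also have "... < av x * av d" using x assms(2) by (intro mult_strict_right_mono) auto
  finally have "max (av a) (av c) < av (d * x)" by (simp only: absval_mult mult.commute)
  hence "av (c + d * x) > av a" using absval_add_eq[of c "d * x"] by simp
  thus "\<phi> (c + d * x) = 0" by (rule 1)
 next
  fix x y assume "av y <= av (b / d)"
  hence "av (d * y) <= av b" using assms(2) by (simp add: absval_mult absval_divide field_simps)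
  thus "\<phi> (c + d * (x + y)) = \<phi> (c + d * x)" using 1(4)[of "d * y" "c + d * x"] by (simp add: algebra_simps)
 qed
qed

end

section \<open>The Fourier transform\<close>

context local_field_data
begin

lemma psi_add: "\<psi> (x + y) = \<psi> x * \<psi> y"
 and psi_norm [simp]: "norm (\<psi> x) = 1"
 and psi_continuous: "continuous_on UNIV \<psi>" using field_data by (simp_all add: field_data_def additive_character_def)

lemma psi_0 [simp]: "\<psi> 0 = 1"
proof -
 have "\<psi> 0 * \<psi> 0 = \<psi> 0 * 1" using psi_add[of 0 0] by simp
 moreover have "\<psi> 0 ~= 0" using psi_norm[of 0] by (metis norm_zero zero_neq_one)
 ultimately show ?thesis by (metis mult_cancel_left)
qed

lemma psi_minus: "\<psi> (- x) = cnj (\<psi> x)"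
proof -
 have 1: "\<psi> x * \<psi> (- x) = 1" using psi_add[of x "- x"] by simp
 have "\<psi> x * cnj (\<psi> x) = 1" using complex_norm_square[of "\<psi> x"] by simp
 hence "cnj (\<psi> x) * (\<psi> x * \<psi> (- x)) = \<psi> (- x)" by (simp add: mult.assoc[symmetric] mult.commute)
 thus ?thesis using 1 by simp
qed

lemma psi_measurable [measurable]: "\<psi> \<in> bm" by (intro borel_measurable_continuous_onI psi_continuous)

text \<open>The field has arbitrarily small additive subgroups, the circle has none. Doubling inside
  \<open>vball n\<close> squares the value of \<open>\<psi>\<close>, and squaring a value within 1/2
  of 1 enlarges its distance from 1 by a factor of at least 3/2.\<close>

lemma psi_trivial_near: "\<exists>n. \<forall>x\<in>vball n. \<psi> x = 1"
proof -
 have "open (\<psi> -` {z. norm (z - 1) < 1/2})"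
 proof (rule open_vimage)
  have "{z::complex. norm (z - 1) < 1/2} = ball 1 (1/2)" by (auto simp: dist_norm norm_minus_commute)
  thus "open {z::complex. norm (z - 1) < 1/2}" by simp
 qed (rule psi_continuous)
 moreover have "0 \<in> \<psi> -` {z. norm (z - 1) < 1/2}" by simp
 ultimately have "\<exists>n. \<forall>y. y - 0 \<in> vball n --> y \<in> \<psi> -` {z. norm (z - 1) < 1/2}" unfolding open_iff_vball by (rule bspec)
 then obtain n where n: "!!y. y \<in> vball n ==> norm (\<psi> y - 1) < 1/2" by auto
 have "\<psi> x = 1" if x: "x \<in> vball n" for x
 proof (rule ccontr)
  assume ne: "\<psi> x ~= 1"
  have pow: "\<exists>y. y \<in> vball n \<and> \<psi> y = \<psi> x ^ (2 ^ k)" for k :: nat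
  proof (induction k)
   case 0
   thus ?case using x by auto
  next
   case (Suc k)
   then obtain y where y: "y \<in> vball n" "\<psi> y = \<psi> x ^ (2 ^ k)" by auto
   have "\<psi> (y + y) = \<psi> x ^ (2 ^ k + 2 ^ k)" unfolding psi_add power_add y(2) ..
   also have "2 ^ k + 2 ^ k = (2 ^ Suc k :: nat)" by simp
   finally show ?case using vball_add[OF y(1) y(1)] by (intro exI conjI)
  qed
  have small: "norm (\<psi> x ^ (2 ^ k) - 1) < 1/2" for k :: nat
  proof -
   from pow[of k] obtain y where "y \<in> vball n" "\<psi> y = \<psi> x ^ (2 ^ k)" by (elim exE conjE)
   thus ?thesis using n[of y] by simp
  qed
  have grow: "(3/2) ^ k * norm (\<psi> x - 1) <= norm (\<psi> x ^ (2 ^ k) - 1)" for k :: nat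
  proof (induction k)
   case (Suc k)
   define w where "w = \<psi> x ^ (2 ^ k)"
   have "2 - norm (w - 1) <= norm (w + 1)" using norm_triangle_ineq4[of "w + 1" "w - 1"] by simp
   hence w: "3/2 <= norm (w + 1)" using small[of k] by (simp add: w_def)
   have "(3/2) ^ Suc k * norm (\<psi> x - 1) <= norm (w + 1) * norm (w - 1)"
    using Suc w mult_mono[of "3/2" "norm (w + 1)" "(3/2) ^ k * norm (\<psi> x - 1)" "norm (w - 1)"] by (simp add: w_def mult.assoc)
   also have "... = norm (\<psi> x ^ (2 ^ Suc k) - 1)"
   proof -
    have "(w + 1) * (w - 1) = \<psi> x ^ (2 ^ Suc k) - 1" by (simp add: w_def algebra_simps power_add[symmetric] mult_2[symmetric])
    thus ?thesis by (metis norm_mult)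
   qed
   finally show ?case .
  qed simp
  have "norm (\<psi> x - 1) > 0" using ne by simp
  then obtain k :: nat where "1 / (2 * norm (\<psi> x - 1)) < (3/2) ^ k" using real_arch_pow[of "3/2" "1 / (2 * norm (\<psi> x - 1))"] by auto
  hence "1/2 < (3/2) ^ k * norm (\<psi> x - 1)" using ne by (simp add: field_simps)
  thus False using grow[of k] small[of k] by simp
 qed
 thus ?thesis by auto
qed

text \<open>The balls on which \<open>\<psi>\<close> is trivial form an upward closed set of
  indices, which is bounded below because \<open>\<psi>\<close> is nontrivial at \<open>x0\<close>.
  The minimum is found by counting upwards from \<open>val x0 + 1\<close>, so that
  \<open>LEAST\<close> on natural numbers applies.\<close>

lemma ex_conductor: "\<exists>p. p ~= 0 \<and> (\<forall>a. (\<forall>x. av x <= av a --> \<psi> x = 1) \<longleftrightarrow> av a <= av p)"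
proof -
 define P where "P n \<longleftrightarrow> (\<forall>x\<in>vball n. \<psi> x = 1)" for n
 obtain n1 where n1: "P n1" using psi_trivial_near by (auto simp: P_def)
 obtain x0 where x0: "\<psi> x0 ~= 1" using field_data by (auto simp: field_data_def)
 hence "x0 ~= 0" by auto
 define m where "m = val x0"
 have up: "P n'" if "P n" "n <= n'" for n n' using that vball_mono[of n n'] by (auto simp: P_def)
 have "\<not> P m" using x0 by (auto simp: P_def m_def vball_def)
 hence gt: "m < n" if "P n" for n using up[OF that, of m] by fastforce
 define k where "k = (LEAST k::nat. P (m + 1 + int k))"
 have "P (m + 1 + int (nat (n1 - m - 1)))" using n1 gt[OF n1] by simp
 hence Pk: "P (m + 1 + int k)" unfolding k_def by (rule LeastI)
 have least: "m + 1 + int k <= n" if "P n" for n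
 proof -
  have "P (m + 1 + int (nat (n - m - 1)))" using that gt[OF that] by simp
  hence "k <= nat (n - m - 1)" unfolding k_def by (rule Least_le)
  thus ?thesis using gt[OF that] by simp
 qed
 obtain p :: 'k where p: "p ~= 0" "val p = m + 1 + int k" using ex_val by blast
 have "(\<forall>x. av x <= av a --> \<psi> x = 1) \<longleftrightarrow> av a <= av p" for a
 proof (cases "a = 0")
  case True
  have "av x <= 0 \<longleftrightarrow> x = 0" for x using absval_nonneg[of x] absval_eq_0[of x] by linarith
  thus ?thesis using True by simp
 next
  case False
  have "(\<forall>x. av x <= av a --> \<psi> x = 1) \<longleftrightarrow> P (val a)" by (simp add: P_def absval_le_iff[OF False] Ball_def)
  also have "... \<longleftrightarrow> val p <= val a"
  proof
   assume "P (val a)" thus "val p <= val a" using least p(2) by simp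
  next
   assume "val p <= val a" thus "P (val a)" using up[OF Pk] p(2) by simp
  qed
  finally show ?thesis using False by (simp add: absval_le_iff[OF p(1)] vball_def)
 qed
 thus ?thesis using p(1) by auto
qed

definition "p0 = (SOME p. p ~= 0 \<and> (\<forall>a. (\<forall>x. av x <= av a --> \<psi> x = 1) \<longleftrightarrow> av a <= av p))"

lemma p0: "p0 ~= 0" "(\<forall>x. av x <= av a --> \<psi> x = 1) \<longleftrightarrow> av a <= av p0"
proof -
 have *: "p0 ~= 0 \<and> (\<forall>a. (\<forall>x. av x <= av a --> \<psi> x = 1) \<longleftrightarrow> av a <= av p0)" unfolding p0_def by (rule someI_ex[OF ex_conductor])
 show "p0 ~= 0" using * by (rule conjunct1)
 show "(\<forall>x. av x <= av a --> \<psi> x = 1) \<longleftrightarrow> av a <= av p0" using conjunct2[OF *] by (rule spec)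
qed

lemma psi_eq_1: "av x <= av p0 ==> \<psi> x = 1" using p0(2)[of p0] by simp

lemma ex_psi_neq_1: "av p0 < av a ==> \<exists>x. av x <= av a \<and> \<psi> x ~= 1" using p0(2)[of a] by auto

section \<open>Fourier transform and inversion on test functions\<close>

abbreviation "FT \<equiv> fourier K"

lemma fourier_eq: "FT f x = (LI y. \<psi> (x * y) * f y)" by (simp add: fourier_def)

lemma integrable_psi_mult:
 assumes "integrable \<mu> f" and [measurable]: "g \<in> bm"
 shows "integrable \<mu> (%y. \<psi> (g y) * f y)"
proof (rule Bochner_Integration.integrable_bound[OF assms(1)])
 have [measurable]: "f \<in> bm" using borel_measurable_integrable[OF assms(1)] by simp
 show "(%y. \<psi> (g y) * f y) \<in> borel_measurable \<mu>" by simp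
qed (simp add: norm_mult)

lemma integrable_psi_mult': "integrable \<mu> f ==> integrable \<mu> (%y. \<psi> (x * y) * f y)" by (rule integrable_psi_mult) simp_all

lemma fourier_add: "integrable \<mu> f ==> integrable \<mu> g ==> FT (%x. f x + g x) = (%x. FT f x + FT g x)"
 by (simp add: fourier_eq fun_eq_iff distrib_left integrable_psi_mult')

lemma fourier_cmult: "FT (%x. c * f x) = (%x. c * FT f x)" unfolding fourier_eq fun_eq_iff by (simp add: mult.left_commute[of _ c])

lemma fourier_norm_le: "norm (FT f x) <= (LI y. norm (f y))"
 unfolding fourier_eq using integral_norm_bound[of \<mu> "%y. \<psi> (x * y) * f y"] by (simp add: norm_mult)

text \<open>Translating the integrand by \<open>y0 / \<xi>\<close> leaves \<open>f\<close> unchanged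
  but multiplies the transform at \<open>\<xi>\<close> by \<open>\<psi> y0\<close>, which is not
  1.\<close>

lemma fourier_support:
 assumes f: "integrable \<mu> f" and b: "b ~= 0" and inv: "!!x y. av y <= av b ==> f (x + y) = f x"
  and \<xi>: "av p0 < av (b * \<xi>)"
 shows "FT f \<xi> = 0"
proof -
 obtain y0 where y0: "av y0 <= av (b * \<xi>)" "\<psi> y0 ~= 1" using ex_psi_neq_1[OF \<xi>] by auto
 have nz: "\<xi> ~= 0"
 proof
  assume "\<xi> = 0"
  hence "av p0 < 0" using \<xi> by simp
  thus False using absval_nonneg[of p0] by linarith
 qed
 have [measurable]: "f \<in> bm" using borel_measurable_integrable[OF f] by simp
 define h where "h = y0 / \<xi>"
 have h: "av h <= av b" using y0(1) nz by (simp add: h_def absval_divide absval_mult field_simps)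
 have "(LI y. \<psi> (\<xi> * (h + y)) * f (h + y)) = FT f \<xi>"
  using cov_integral(1)[OF cov_translate[of h], of "%y. \<psi> (\<xi> * y) * f y"] by (simp add: fourier_eq)
 moreover have "\<psi> (\<xi> * (h + y)) * f (h + y) = \<psi> y0 * (\<psi> (\<xi> * y) * f y)" for y
  using inv[OF h, of y] nz by (simp add: distrib_left psi_add h_def add.commute)
 ultimately have "\<psi> y0 * FT f \<xi> = FT f \<xi>" by (simp add: fourier_eq)
 thus ?thesis using y0(2) by simp
qed

lemma fourier_invariant:
 assumes a: "a ~= 0" and supp: "!!x. av a < av x ==> f x = 0" and y: "av (a * y) <= av p0"
 shows "FT f (x + y) = FT f x" unfolding fourier_eq
proof (rule Bochner_Integration.integral_cong[OF refl])
 fix z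
 show "\<psi> ((x + y) * z) * f z = \<psi> (x * z) * f z"
 proof (cases "av z <= av a")
  case True
  have "av (y * z) = av z * av y" by (simp add: absval_mult mult.commute)
  also have "... <= av a * av y" using True by (intro mult_right_mono) auto
  also have "... <= av p0" using y by (simp add: absval_mult)
  finally show ?thesis by (simp add: distrib_right psi_add psi_eq_1)
 qed (simp add: supp)
qed

lemma fourier_Cc: assumes "\<phi> \<in> Cc" shows "FT \<phi> \<in> Cc"
proof -
 from assms obtain a b where ab: "a ~= 0" "b ~= 0" "!!x. av x > av a ==> \<phi> x = 0"
  "!!x y. av y <= av b ==> \<phi> (x + y) = \<phi> x" by (rule CcE) (rule that; assumption)
 show ?thesis unfolding Cc_iff
 proof (rule exI[of _ "p0 / b"], rule exI[of _ "p0 / a"], intro conjI allI impI)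
  fix x assume "av (p0 / b) < av x"
  hence "av p0 < av (b * x)" using ab(2) by (simp add: absval_divide absval_mult field_simps)
  thus "FT \<phi> x = 0" by (simp add: fourier_support[OF Cc_integrable[OF assms] ab(2) ab(4)])
 next
  fix x y assume "av y <= av (p0 / a)"
  hence "av (a * y) <= av p0" using ab(1) by (simp add: absval_divide absval_mult field_simps)
  thus "FT \<phi> (x + y) = FT \<phi> x" by (simp add: fourier_invariant[OF ab(1) ab(3)])
 qed (use ab p0 in auto)
qed

text \<open>Either the character is trivial on the ball, or \<open>fourier_support\<close> applies,
  the indicator of a ball around 0 being invariant under that ball.\<close>

lemma integral_psi_cb:
 assumes b: "b ~= 0"
 shows "(LI x. \<psi> (\<xi> * x) * indicator (cb 0 b) x) = (if av (b * \<xi>) <= av p0 then of_real (vol * av b) else 0)"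
proof (cases "av (b * \<xi>) <= av p0")
 case True
 have "(LI x. \<psi> (\<xi> * x) * indicator (cb 0 b) x) = (LI x. of_real (indicator (cb 0 b) x))"
 proof (rule Bochner_Integration.integral_cong[OF refl])
  fix x
  show "\<psi> (\<xi> * x) * indicator (cb 0 b) x = of_real (indicator (cb 0 b) x)"
  proof (cases "x \<in> cb 0 b")
   case x: True
   have "av (\<xi> * x) = av x * av \<xi>" by (simp add: absval_mult mult.commute)
   also have "... <= av b * av \<xi>" using x by (intro mult_right_mono) (auto simp: cb_def)
   also have "... <= av p0" using True by (simp add: absval_mult)
   finally show ?thesis using x by (simp add: psi_eq_1)
  qed simp
 qed
 also have "... = of_real (measure \<mu> (cb 0 b))" by (subst integral_complex_of_real) simp
 finally show ?thesis using True measure_cb[OF b] by simp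
next
 case False
 have inv: "(indicator (cb 0 b) (x + y) :: complex) = indicator (cb 0 b) x" if "av y <= av b" for x y
 proof -
  have "av (x + y) <= av b \<longleftrightarrow> av x <= av b" using absval_add[of x y] absval_diff[of "x + y" y] that by auto
  thus ?thesis by (simp add: indicator_def cb_def)
 qed
 have "FT (indicator (cb 0 b)) \<xi> = 0"
  using False Cc_integrable[OF Cc_indicator[OF b, of 0]] by (intro fourier_support[OF _ b]) (auto simp: inv)
 thus ?thesis using False by (simp add: fourier_eq)
qed

lemma integrable_prod_bound:
 fixes f :: "'k \<times> 'k => complex" and u v :: "'k => real"
 assumes f: "f \<in> borel_measurable \<mu>2" and u: "integrable \<mu> u" and v: "integrable \<mu> v"
  and le: "!!x y. norm (f (x, y)) <= u x * v y"
 shows "integrable \<mu>2 f"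
proof -
 have [measurable]: "u \<in> borel_measurable \<mu>" "v \<in> borel_measurable \<mu>" using u v by (auto dest: borel_measurable_integrable)
 have "integrable \<mu>2 (%(x, y). u x * v y)" using u v by (intro haar2.Fubini_integrable) (auto simp: abs_mult)
 thus ?thesis by (rule Bochner_Integration.integrable_bound[OF _ f]) (use le abs_ge_self order_trans in \<open>fastforce intro!: AE_I2\<close>)
qed

lemma integral_swap:
 fixes f :: "'k => 'k => complex"
 assumes "integrable \<mu>2 (%(x, y). f x y)"
 shows "(LI x. LI y. f x y) = (LI y. LI x. f x y)" using haar2.Fubini_integral[of f] assms by simp

lemma fourier_swap:
 assumes f: "integrable \<mu> f" and g: "integrable \<mu> g"
 shows "(LI x. f x * FT g x) = (LI x. FT f x * g x)"
proof -
 have [measurable]: "f \<in> bm" "g \<in> bm" using f g by (auto dest: borel_measurable_integrable)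
 have "(LI x. f x * FT g x) = (LI x. LI y. f x * (\<psi> (x * y) * g y))" by (simp add: fourier_eq)
 also have "... = (LI y. LI x. f x * (\<psi> (x * y) * g y))"
 proof (rule integral_swap, rule integrable_prod_bound)
  show "integrable \<mu> (%x. norm (f x))" "integrable \<mu> (%x. norm (g x))" using f g by auto
 qed (simp_all add: norm_mult case_prod_beta)
 also have "... = (LI y. FT f y * g y)"
 proof (rule Bochner_Integration.integral_cong[OF refl])
  fix y
  have "(LI x. f x * (\<psi> (x * y) * g y)) = (LI x. (\<psi> (y * x) * f x) * g y)" by (simp add: mult_ac)
  thus "(LI x. f x * (\<psi> (x * y) * g y)) = FT f y * g y" by (simp add: fourier_eq)
 qed
 finally show ?thesis .
qed

text \<open>The constant by which \<open>\<mu>\<close> deviates from being self-dual for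
  \<open>\<psi>\<close>: the product of the measures of a ball and of its dual ball.\<close>

definition "\<kappa> = vol\<^sup>2 * av p0"

lemma kappa_pos: "0 < \<kappa>" using vol_pos p0(1) by (simp add: \<kappa>_def)

text \<open>Inserting the indicator of a ball that contains the support of \<open>FT \<phi>\<close>
  makes the double integral absolutely convergent. After the exchange the inner integral is a
  multiple of the indicator of a ball around \<open>- x\<close> on which \<open>\<phi>\<close> is
  constant.\<close>

lemma fourier_fourier:
 assumes "\<phi> \<in> Cc"
 shows "FT (FT \<phi>) x = of_real \<kappa> * \<phi> (- x)"
proof -
 from assms obtain a b where ab: "a ~= 0" "b ~= 0" "!!x. av x > av a ==> \<phi> x = 0"
  "!!x y. av y <= av b ==> \<phi> (x + y) = \<phi> x" by (rule CcE) (rule that; assumption)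
 have [measurable]: "\<phi> \<in> bm" by (rule Cc_measurable[OF assms])
 let ?i = "%\<xi>. indicator (cb 0 (p0 / b)) \<xi> :: complex"
 have pb: "p0 / b ~= 0" using ab p0 by simp
 have supp: "FT \<phi> \<xi> = ?i \<xi> * FT \<phi> \<xi>" for \<xi>
 proof (cases "\<xi> \<in> cb 0 (p0 / b)")
  case False
  hence "av p0 < av (b * \<xi>)" using ab(2) by (simp add: cb_def absval_divide absval_mult field_simps)
  thus ?thesis using fourier_support[OF Cc_integrable[OF assms] ab(2) ab(4)] by simp
 qed simp
 have "FT (FT \<phi>) x = (LI \<xi>. \<psi> (x * \<xi>) * (?i \<xi> * FT \<phi> \<xi>))" unfolding fourier_eq[of "FT \<phi>"] by (subst supp) (rule refl)
 also have "... = (LI \<xi>. LI y. \<psi> (x * \<xi>) * (?i \<xi> * (\<psi> (\<xi> * y) * \<phi> y)))" by (simp add: fourier_eq)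
 also have "... = (LI y. LI \<xi>. \<psi> (x * \<xi>) * (?i \<xi> * (\<psi> (\<xi> * y) * \<phi> y)))"
 proof (rule integral_swap, rule integrable_prod_bound)
  show "integrable \<mu> (indicator (cb 0 (p0 / b)) :: 'k => real)" by (rule integrable_indicator_cb[OF pb])
  show "integrable \<mu> (%y. norm (\<phi> y))" using Cc_integrable[OF assms] by simp
 qed (simp_all add: norm_mult case_prod_beta indicator_def)
 also have "... = (LI y. of_real (vol * av (p0 / b)) * \<phi> (- x) * indicator (cb (- x) b) y)"
 proof (rule Bochner_Integration.integral_cong[OF refl])
  fix y
  have "(LI \<xi>. \<psi> (x * \<xi>) * (?i \<xi> * (\<psi> (\<xi> * y) * \<phi> y))) = (LI \<xi>. (\<psi> ((x + y) * \<xi>) * ?i \<xi>) * \<phi> y)"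
  proof (rule Bochner_Integration.integral_cong[OF refl])
   fix \<xi>
   have "\<psi> ((x + y) * \<xi>) = \<psi> (x * \<xi>) * \<psi> (\<xi> * y)" by (simp only: distrib_right psi_add mult.commute[of y])
   thus "\<psi> (x * \<xi>) * (?i \<xi> * (\<psi> (\<xi> * y) * \<phi> y)) = \<psi> ((x + y) * \<xi>) * ?i \<xi> * \<phi> y" by simp
  qed
  also have "... = (LI \<xi>. \<psi> ((x + y) * \<xi>) * ?i \<xi>) * \<phi> y" by simp
  also have "... = (if av (p0 / b * (x + y)) <= av p0 then of_real (vol * av (p0 / b)) else 0) * \<phi> y" by (simp only: integral_psi_cb[OF pb])
  also have "... = of_real (vol * av (p0 / b)) * \<phi> (- x) * indicator (cb (- x) b) y"
  proof -
   have iff: "av (p0 / b * (x + y)) <= av p0 \<longleftrightarrow> y \<in> cb (- x) b"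
   proof -
    have "av (p0 / b * (x + y)) = av p0 / av b * av (y + x)" by (simp only: absval_mult absval_divide add.commute)
    thus ?thesis using ab(2) p0(1) by (simp add: cb_def pos_divide_le_eq)
   qed
   have "\<phi> y = \<phi> (- x)" if "y \<in> cb (- x) b" using ab(4)[of "y + x" "- x"] that by (simp add: cb_def)
   thus ?thesis using iff by (auto simp: indicator_def)
  qed
  finally show "(LI \<xi>. \<psi> (x * \<xi>) * (?i \<xi> * (\<psi> (\<xi> * y) * \<phi> y)))
   = of_real (vol * av (p0 / b)) * \<phi> (- x) * indicator (cb (- x) b) y" .
 qed
 also have "... = of_real (vol * av (p0 / b)) * \<phi> (- x) * of_real (measure \<mu> (cb (- x) b))"
 proof -
  have "(LI y. (indicator (cb (- x) b) y :: complex)) = (LI y. of_real (indicator (cb (- x) b) y))" by (simp add: of_real_indicator)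
  also have "... = of_real (measure \<mu> (cb (- x) b))" by (subst integral_complex_of_real) simp
  finally show ?thesis by simp
 qed
 also have "... = of_real \<kappa> * \<phi> (- x)" using measure_cb[OF ab(2)] ab(2) by (simp add: \<kappa>_def absval_divide power2_eq_square)
 finally show ?thesis .
qed

lemma integral_reflect:
 fixes f :: "'k => complex"
 assumes [measurable]: "f \<in> bm"
 shows "(LI x. f (- x)) = (LI x. f x)" using cov_integral(1)[OF cov_scale[of "-1"] assms] by simp

definition Finv :: "('k => complex) => 'k => complex" where
 "Finv \<phi> = (%x. of_real (inverse \<kappa>) * FT \<phi> (- x))"

lemma Finv_Cc: "\<phi> \<in> Cc ==> Finv \<phi> \<in> Cc"
 unfolding Finv_def using Cc_cmult[OF Cc_affine[OF fourier_Cc, of \<phi> "-1" 0], of "of_real (inverse \<kappa>)"] by simp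

lemma Finv_fourier: "\<phi> \<in> Cc ==> Finv (FT \<phi>) = \<phi>" using kappa_pos by (simp add: Finv_def fourier_fourier fun_eq_iff)

lemma fourier_Finv: assumes "\<phi> \<in> Cc" shows "FT (Finv \<phi>) = \<phi>"
proof
 fix y
 have [measurable]: "FT \<phi> \<in> bm" by (intro Cc_measurable fourier_Cc assms)
 have "FT (Finv \<phi>) y = of_real (inverse \<kappa>) * (LI x. \<psi> (y * x) * FT \<phi> (- x))" unfolding Finv_def fourier_cmult by (simp add: fourier_eq)
 also have "(LI x. \<psi> (y * x) * FT \<phi> (- x)) = FT (FT \<phi>) (- y)"
  using integral_reflect[of "%x. \<psi> (- y * x) * FT \<phi> x"] by (simp add: fourier_eq[of "FT \<phi>"])
 finally show "FT (Finv \<phi>) y = \<phi> y" using kappa_pos fourier_fourier[OF assms, of "- y"] by simp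
qed

text \<open>Vanishing integrals over cosets extend to all Borel sets by a Dynkin argument, and then
  the density is 0 almost everywhere.\<close>

lemma AE_eq_0_on_ball:
 fixes g :: "'k => complex"
 assumes int: "integrable \<mu> (%x. indicator (vcoset c n) x * g x)"
  and zero: "!!x m. n <= m ==> x \<in> vcoset c n ==> (LI y. indicator (vcoset x m) y * g y) = 0"
 shows "AE x in \<mu>. x \<in> vcoset c n --> g x = 0"
proof -
 let ?h = "%x. indicator (vcoset c n) x * g x"
 have vm[measurable]: "vcoset x m \<in> sets borel" for x :: 'k and m by (simp add: borel_open open_vcoset)
 have "AE x in \<mu>. ?h x = 0"
 proof (rule haar.density_zero[OF int])
  fix A assume "A \<in> sets \<mu>"
  hence A: "A \<in> sigma_sets UNIV (insert {} vcosets)" by (simp add: sets_borel_vcosets)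
  have sets: "B \<in> sets \<mu>" if "B \<in> sigma_sets UNIV (insert {} vcosets)" for B :: "'k set" using that by (simp add: sets_borel_vcosets)
  have si: "set_integrable \<mu> B ?h" if "B \<in> sets \<mu>" for B unfolding set_integrable_def using integrable_mult_indicator[OF that int] .
  have Pow: "insert {} vcosets \<subseteq> Pow (UNIV :: 'k set)" by auto
  show "set_lebesgue_integral \<mu> A ?h = 0" using Int_stable_vcosets Pow A
  proof (induction rule: sigma_sets_induct_disjoint)
   case (basic A)
   show ?case
   proof (cases "A \<inter> vcoset c n = {}")
    case True
    hence z: "(%x. indicator A x *\<^sub>R ?h x) = (%x. 0)" by (intro ext) (auto simp: indicator_def)
    show ?thesis unfolding set_lebesgue_integral_def z by simp
   next
    case False
    then obtain z where z: "z \<in> A" "z \<in> vcoset c n" by auto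
    then obtain x m where A: "A = vcoset x m" using basic by (auto simp: vcosets_def)
    have Az: "A = vcoset z m" using vcoset_eq z(1) A by metis
    have cz: "vcoset c n = vcoset z n" using vcoset_eq z(2) by metis
    have "vcoset z m \<inter> vcoset z n = vcoset z (max m n)"
     using vcoset_mono[of m n z] vcoset_mono[of n m z] by (cases "m <= n") (auto simp: max_def)
    hence "indicator A x *\<^sub>R ?h x = indicator (vcoset z (max m n)) x * g x" for x unfolding Az cz by (auto simp: indicator_def)
    thus ?thesis using zero[of "max m n" z] z(2) by (simp add: set_lebesgue_integral_def)
   qed
  next
   case empty
   thus ?case by (simp add: set_lebesgue_integral_def)
  next
   case (compl A)
   have "(LI x. ?h x) = 0" using zero[of n c] by simp
   moreover have "set_lebesgue_integral \<mu> (UNIV - A) ?h = (LI x. ?h x) - set_lebesgue_integral \<mu> A ?h"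
   proof -
    have "(LI x. ?h x) - set_lebesgue_integral \<mu> A ?h = (LI x. ?h x - indicator A x *\<^sub>R ?h x)" unfolding set_lebesgue_integral_def
     by (rule Bochner_Integration.integral_diff[symmetric, OF int integrable_mult_indicator[OF sets[OF compl(1)] int]])
    also have "... = set_lebesgue_integral \<mu> (UNIV - A) ?h" unfolding set_lebesgue_integral_def
     by (rule Bochner_Integration.integral_cong[OF refl]) (simp add: indicator_def)
    finally show ?thesis by simp
   qed
   ultimately show ?case using compl by simp
  next
   case (union A)
   have "set_lebesgue_integral \<mu> (\<Union>i. A i) ?h = (\<Sum>i. set_lebesgue_integral \<mu> (A i) ?h)"
   proof (rule lebesgue_integral_countable_add)
    show "A i \<in> sets \<mu>" for i using union(2) sets by auto
    thus "set_integrable \<mu> (\<Union>i. A i) ?h" by (intro si) auto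
    show "A i \<inter> A j = {}" if "i ~= j" for i j using union(1) that by (auto simp: disjoint_family_on_def)
   qed
   thus ?case using union(3) by simp
  qed
 qed
 thus ?thesis by (rule AE_mp) (auto intro!: AE_I2)
qed

text \<open>Only balls missing 0 are tested, because weighted integrands may fail to be integrable
  near 0. Countably many such balls cover the complement of 0.\<close>

lemma AE_eq_0_punctured:
 fixes g :: "'k => complex"
 assumes int: "!!x a. a ~= 0 ==> av a < av x ==> integrable \<mu> (%y. indicator (cb x a) y * g y)"
  and zero: "!!x a. a ~= 0 ==> av a < av x ==> (LI y. indicator (cb x a) y * g y) = 0"
 shows "AE x in \<mu>. g x = 0"
proof -
 let ?C = "{C \<in> vcosets. (0::'k) \<notin> C}"
 have "countable ?C" by (rule countable_subset[OF _ countable_vcosets]) auto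
 moreover have "AE x in \<mu>. x \<in> C --> g x = 0" if "C \<in> ?C" for C
 proof -
  from that have "C \<in> vcosets" "0 \<notin> C" by auto
  then obtain c n where C: "C = vcoset c n" "0 \<notin> vcoset c n" unfolding vcosets_def by blast
  have cb: "\<exists>a. a ~= 0 \<and> av a < av x \<and> vcoset x m = cb x a" if "n <= m" "x \<in> vcoset c n" for x m
  proof -
   obtain a :: 'k where a: "a ~= 0" "val a = m" using ex_val by blast
   have "0 \<notin> vcoset x n" using C(2) vcoset_eq[OF that(2)] by simp
   hence "0 \<notin> vcoset x m" using vcoset_mono[OF that(1), of x] by auto
   hence "0 \<notin> cb x a" using a by (simp add: cb_eq_vcoset)
   hence "av a < av x" by (simp add: cb_def)
   thus ?thesis using a by (intro exI[of _ a]) (simp add: cb_eq_vcoset)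
  qed
  show ?thesis unfolding C(1)
  proof (rule AE_eq_0_on_ball)
   show "integrable \<mu> (%x. indicator (vcoset c n) x * g x)" using cb[of n c] int by auto
   show "(LI y. indicator (vcoset x m) y * g y) = 0" if "n <= m" "x \<in> vcoset c n" for x m using cb[OF that] zero by auto
  qed
 qed
 ultimately have "AE x in \<mu>. \<forall>C\<in>?C. x \<in> C --> g x = 0" by (subst AE_ball_countable) auto
 thus ?thesis using AE_neq[of 0]
 proof eventually_elim
  case (elim x)
  have "0 \<notin> vcoset x (val x + 1)" using elim(2) by (simp add: vcoset_def vball_def)
  hence "vcoset x (val x + 1) \<in> ?C" by (auto simp: vcosets_def)
  thus ?case using elim(1) by auto
 qed
qed

lemma AE_eq_0_Cc:
 fixes g :: "'k => complex"
 assumes int: "!!\<phi>. \<phi> \<in> Cc ==> integrable \<mu> (%x. g x * \<phi> x)"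
  and zero: "!!\<phi>. \<phi> \<in> Cc ==> (LI x. g x * \<phi> x) = 0"
 shows "AE x in \<mu>. g x = 0" by (rule AE_eq_0_punctured) (use int[OF Cc_indicator] zero[OF Cc_indicator] in \<open>simp_all add: mult.commute\<close>)

end

section \<open>Hilbert spaces of functions\<close>

text \<open>Vectors are functions with pointwise operations, so that distributions, being
  functionals on test functions, can serve as vectors directly.\<close>

locale hspace =
 fixes V :: "('a => complex) set" and ip :: "('a => complex) => ('a => complex) => complex"
 assumes hs: "hilbert_space V ip"
begin

abbreviation "nrm \<equiv> inner_norm ip"

abbreviation "dst f g \<equiv> nrm (%x. f x - g x)"

lemma sub: "subspace_of_functions V" using hs by (simp add: hilbert_space_def)

lemma zero_mem [simp]: "(%x. 0) \<in> V"
 and add_mem [simp]: "f \<in> V ==> g \<in> V ==> (%x. f x + g x) \<in> V"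
 and cmult_mem [simp]: "f \<in> V ==> (%x. c * f x) \<in> V" using sub by (simp_all add: subspace_of_functions_def)

lemma diff_mem [simp]: assumes "f \<in> V" "g \<in> V" shows "(%x. f x - g x) \<in> V"
 using add_mem[OF assms(1) cmult_mem[OF assms(2), of "-1"]] by simp

lemma ip_add_left: "f \<in> V ==> g \<in> V ==> h \<in> V ==> ip (%x. f x + g x) h = ip f h + ip g h"
 and ip_cmult_left: "f \<in> V ==> h \<in> V ==> ip (%x. c * f x) h = c * ip f h"
 and ip_sym: "f \<in> V ==> h \<in> V ==> ip h f = cnj (ip f h)"
 and ip_pos: "f \<in> V ==> f ~= (%x. 0) ==> Re (ip f f) > 0"
proof -
 note h = hs[unfolded hilbert_space_def, THEN conjunct2]
 show "f \<in> V ==> g \<in> V ==> h \<in> V ==> ip (%x. f x + g x) h = ip f h + ip g h" using h[THEN conjunct1] by simp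
 show "f \<in> V ==> h \<in> V ==> ip (%x. c * f x) h = c * ip f h" using h[THEN conjunct2, THEN conjunct1] by simp
 show "f \<in> V ==> h \<in> V ==> ip h f = cnj (ip f h)" using h[THEN conjunct2, THEN conjunct2, THEN conjunct1] by blast
 show "f \<in> V ==> f ~= (%x. 0) ==> Re (ip f f) > 0" using h[THEN conjunct2, THEN conjunct2, THEN conjunct2, THEN conjunct1] by blast
qed

lemma complete_nrm:
 assumes "!!n::nat. u n \<in> V" "!!e. e > 0 ==> \<exists>N. \<forall>m\<ge>N. \<forall>n\<ge>N. dst (u m) (u n) < e"
 shows "\<exists>f\<in>V. (%n. dst (u n) f) \<longlonglongrightarrow> 0"
proof -
 have "\<forall>u. (\<forall>n::nat. u n \<in> V) \<and> (\<forall>e>0. \<exists>N. \<forall>m\<ge>N. \<forall>n\<ge>N. dst (u m) (u n) < e)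
     --> (\<exists>f\<in>V. (%n. dst (u n) f) \<longlonglongrightarrow> 0)" using hs unfolding hilbert_space_def by (elim conjE)
 from spec[OF this, of u] show ?thesis using assms by simp
qed

lemma ip_add_right: "f \<in> V ==> g \<in> V ==> h \<in> V ==> ip h (%x. f x + g x) = ip h f + ip h g"
 using ip_sym[of "%x. f x + g x" h] ip_sym[of f h] ip_sym[of g h] ip_add_left[of f g h] by simp

lemma ip_cmult_right: "f \<in> V ==> h \<in> V ==> ip h (%x. c * f x) = cnj c * ip h f"
 using ip_sym[of "%x. c * f x" h] ip_sym[of f h] ip_cmult_left[of f h c] by simp

lemma ip_diff_left: "f \<in> V ==> g \<in> V ==> h \<in> V ==> ip (%x. f x - g x) h = ip f h - ip g h"
 using ip_add_left[of f "%x. (-1) * g x" h] ip_cmult_left[of g h "-1"] cmult_mem[of g "-1"] by simp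

lemma ip_diff_right: "f \<in> V ==> g \<in> V ==> h \<in> V ==> ip h (%x. f x - g x) = ip h f - ip h g"
 using ip_add_right[of f "%x. (-1) * g x" h] ip_cmult_right[of g h "-1"] cmult_mem[of g "-1"] by simp

lemma ip_zero_left [simp]: "h \<in> V ==> ip (%x. 0) h = 0" using ip_cmult_left[of "%x. 0" h 0] by simp

lemma ip_self: assumes "f \<in> V" shows "ip f f = of_real ((nrm f)\<^sup>2)" and "Re (ip f f) >= 0"
proof -
 have "Im (ip f f) = 0" using ip_sym[OF assms assms] by (metis add_cancel_right_right cnj.simps(2) equal_neg_zero)
 moreover show "Re (ip f f) >= 0" using ip_pos[OF assms] ip_zero_left[OF zero_mem] by (cases "f = (%x. 0)") auto
 ultimately show "ip f f = of_real ((nrm f)\<^sup>2)" by (simp add: inner_norm_def complex_eq_iff)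
qed

lemma nrm_sq: "f \<in> V ==> (nrm f)\<^sup>2 = Re (ip f f)" using ip_self[of f] by simp

lemma nrm_nonneg [simp]: "f \<in> V ==> 0 <= nrm f" using ip_self(2)[of f] by (simp add: inner_norm_def)

lemma nrm_eq_0: "f \<in> V ==> nrm f = 0 ==> f = (%x. 0)" using ip_pos[of f] nrm_sq[of f] by force

lemma nrm_zero [simp]: "nrm (%x. 0) = 0" by (simp add: inner_norm_def)

lemma nrm_add_sq: "f \<in> V ==> g \<in> V ==> (nrm (%x. f x + g x))\<^sup>2 = (nrm f)\<^sup>2 + 2 * Re (ip f g) + (nrm g)\<^sup>2"
 using ip_sym[of f g] by (simp add: nrm_sq ip_add_left ip_add_right)

lemma nrm_diff_sq: "f \<in> V ==> g \<in> V ==> (dst f g)\<^sup>2 = (nrm f)\<^sup>2 - 2 * Re (ip f g) + (nrm g)\<^sup>2"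
 using ip_sym[of f g] by (simp add: nrm_sq ip_diff_left ip_diff_right)

lemma nrm_cmult: assumes "f \<in> V" shows "nrm (%x. c * f x) = norm c * nrm f"
proof -
 have "ip (%x. c * f x) (%x. c * f x) = (c * cnj c) * ip f f" using assms by (simp add: ip_cmult_left ip_cmult_right)
 also have "... = of_real ((norm c * nrm f)\<^sup>2)" using ip_self[OF assms] by (simp add: complex_norm_square[symmetric] power_mult_distrib)
 finally have "Re (ip (%x. c * f x) (%x. c * f x)) = (norm c * nrm f)\<^sup>2" by (simp only: Re_complex_of_real)
 thus ?thesis using assms by (simp add: inner_norm_def[of ip "%x. c * f x"])
qed

lemma nrm_diff_commute: assumes "f \<in> V" "g \<in> V" shows "dst f g = dst g f" using nrm_cmult[OF diff_mem[OF assms(2,1)], of "-1"] by simp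

lemma cauchy_schwarz: assumes f: "f \<in> V" and g: "g \<in> V" shows "norm (ip f g) <= nrm f * nrm g"
proof (cases "nrm g = 0")
 case True
 hence "g = (%x. 0)" using nrm_eq_0 g by simp
 hence "ip f g = 0" using ip_sym[OF zero_mem f] f by simp
 thus ?thesis using f g by simp
next
 case False
 define c where "c = ip f g / of_real ((nrm g)\<^sup>2)"
 have "0 <= (nrm (%x. f x - c * g x))\<^sup>2" by simp
 also have "... = (nrm f)\<^sup>2 - 2 * Re (cnj c * ip f g) + (norm c)\<^sup>2 * (nrm g)\<^sup>2"
  using nrm_diff_sq[OF f cmult_mem[OF g], of c] g f by (simp add: ip_cmult_right nrm_cmult power_mult_distrib)
 also have "cnj c * ip f g = of_real ((norm (ip f g))\<^sup>2 / (nrm g)\<^sup>2)"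
  using complex_norm_square[of "ip f g"] by (simp add: c_def mult.commute)
 also have "(norm c)\<^sup>2 * (nrm g)\<^sup>2 = (norm (ip f g))\<^sup>2 / (nrm g)\<^sup>2"
 proof -
  have "norm c = norm (ip f g) / (nrm g)\<^sup>2" by (simp add: c_def norm_divide norm_power)
  thus ?thesis using False by (simp add: power2_eq_square)
 qed
 finally have "(norm (ip f g))\<^sup>2 / (nrm g)\<^sup>2 <= (nrm f)\<^sup>2" by simp
 hence "(norm (ip f g))\<^sup>2 <= (nrm f * nrm g)\<^sup>2" using False by (simp add: pos_divide_le_eq power_mult_distrib)
 thus ?thesis by (rule power2_le_imp_le) (use f g in simp)
qed

lemma nrm_triangle: assumes f: "f \<in> V" and g: "g \<in> V" shows "nrm (%x. f x + g x) <= nrm f + nrm g"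
proof -
 have "Re (ip f g) <= nrm f * nrm g" using cauchy_schwarz[OF f g] complex_Re_le_cmod[of "ip f g"] by linarith
 hence "(nrm (%x. f x + g x))\<^sup>2 <= (nrm f + nrm g)\<^sup>2" unfolding nrm_add_sq[OF f g] by (simp add: power2_sum)
 thus ?thesis by (rule power2_le_imp_le) (use f g in simp)
qed

lemma nrm_diff_triangle:
 assumes "f \<in> V" "g \<in> V" "h \<in> V" shows "dst f h <= dst f g + dst g h"
 using nrm_triangle[OF diff_mem[OF assms(1,2)] diff_mem[OF assms(2,3)]] by simp

lemma nrm_le_diff: assumes "f \<in> V" "g \<in> V" shows "\<bar>nrm f - nrm g\<bar> <= dst f g"
 using nrm_triangle[OF diff_mem[OF assms] assms(2)] nrm_triangle[OF diff_mem[OF assms(2,1)] assms(1)]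
  nrm_diff_commute[OF assms] by simp

lemma eq_if_small:
 assumes "f \<in> V" "g \<in> V" "!!e. e > 0 ==> dst f g <= e" shows "f = g"
proof -
 have "dst f g <= 0" by (rule field_le_epsilon) (simp add: assms(3))
 hence "(%x. f x - g x) = (%x. 0)" using assms(1,2) by (intro nrm_eq_0) (auto intro: antisym)
 thus ?thesis by (metis (no_types) eq_iff_diff_eq_0 ext)
qed

text \<open>Orthogonal projection onto the closure of \<open>X\<close>: a minimizing sequence
  converges by completeness, and the difference \<open>h\<close> between \<open>v\<close> and its
  limit is orthogonal to \<open>X\<close> because no translate of \<open>h\<close> by
  \<open>X\<close> is shorter.\<close>

lemma ex_orthogonal:
 assumes X: "subspace_of_functions X" "X \<subseteq> V" and v: "v \<in> V" and e: "0 < e"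
  and far: "!!x. x \<in> X ==> e <= dst v x"
 shows "\<exists>h\<in>V. h ~= (%x. 0) \<and> (\<forall>x\<in>X. ip h x = 0)"
proof -
 have X0: "(%y. 0) \<in> X" and Xadd: "!!x z. x \<in> X ==> z \<in> X ==> (%y. x y + z y) \<in> X"
  and Xc: "!!x c. x \<in> X ==> (%y. c * x y) \<in> X" using X(1) by (auto simp: subspace_of_functions_def)
 have XV: "x \<in> V" if "x \<in> X" for x using that X(2) by auto
 define S where "S = (%x. dst v x) ` X"
 define d where "d = Inf S"
 have bdd: "bdd_below S" using far by (auto simp: S_def bdd_below_def)
 have ne: "S ~= {}" using X0 by (auto simp: S_def)
 have de: "e <= d" unfolding d_def using far by (intro cInf_greatest ne) (auto simp: S_def)
 have dle: "d <= dst v x" if "x \<in> X" for x unfolding d_def using bdd that by (intro cInf_lower) (auto simp: S_def)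
 have "\<exists>x. x \<in> X \<and> (dst v x)\<^sup>2 < d\<^sup>2 + 1 / real (Suc n)" for n
 proof -
  have "d < sqrt (d\<^sup>2 + 1 / real (Suc n))" using de e by (intro real_less_rsqrt) auto
  then obtain z where "z \<in> S" "z < sqrt (d\<^sup>2 + 1 / real (Suc n))" using cInf_lessD[OF ne] by (auto simp: d_def)
  then obtain x where x: "x \<in> X" "dst v x < sqrt (d\<^sup>2 + 1 / real (Suc n))" by (auto simp: S_def)
  hence "(dst v x)\<^sup>2 < (sqrt (d\<^sup>2 + 1 / real (Suc n)))\<^sup>2" using v XV by (intro power_strict_mono) auto
  thus ?thesis using x(1) by auto
 qed
 then obtain u where u: "!!n. u n \<in> X" "!!n. (dst v (u n))\<^sup>2 < d\<^sup>2 + 1 / real (Suc n)" by metis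
 have uV: "u n \<in> V" for n using u(1) XV by auto
 \<comment> \<open>The parallelogram law: the midpoint of \<open>u m\<close> and \<open>u n\<close>
   lies in \<open>X\<close>, so its distance from \<open>v\<close> is at least
   \<open>d\<close>.\<close>
 have par: "(dst (u m) (u n))\<^sup>2 <= 2 / real (Suc m) + 2 / real (Suc n)" for m n
 proof -
  let ?a = "%y. v y - u n y" and ?b = "%y. v y - u m y"
  have V: "?a \<in> V" "?b \<in> V" using v uV by auto
  have mid: "(%y. (1/2) * (u n y + u m y)) \<in> X" by (intro Xc Xadd u(1))
  have "(%y. ?a y + ?b y) = (%y. 2 * (v y - (1/2) * (u n y + u m y)))" by (simp add: fun_eq_iff algebra_simps)
  hence "nrm (%y. ?a y + ?b y) = 2 * nrm (%y. v y - (1/2) * (u n y + u m y))"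
   using nrm_cmult[of "%y. v y - (1/2) * (u n y + u m y)" 2] v mid XV by simp
  moreover have "d\<^sup>2 <= (nrm (%y. v y - (1/2) * (u n y + u m y)))\<^sup>2" using dle[OF mid] de e by (intro power_mono) auto
  ultimately have 1: "4 * d\<^sup>2 <= (nrm (%y. ?a y + ?b y))\<^sup>2" by (simp add: power_mult_distrib)
  have "(%y. ?a y - ?b y) = (%y. u m y - u n y)" by (simp add: fun_eq_iff)
  hence "(dst (u m) (u n))\<^sup>2 + (nrm (%y. ?a y + ?b y))\<^sup>2 = 2 * (nrm ?a)\<^sup>2 + 2 * (nrm ?b)\<^sup>2" using nrm_add_sq[OF V] nrm_diff_sq[OF V] by simp
  thus ?thesis using 1 u(2)[of n] u(2)[of m] by simp
 qed
 have "\<exists>N. \<forall>m\<ge>N. \<forall>n\<ge>N. dst (u m) (u n) < r" if r: "r > 0" for r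
 proof -
  obtain N where N: "4 / r\<^sup>2 < real N" using reals_Archimedean2 by blast
  have "dst (u m) (u n) < r" if "N <= m" "N <= n" for m n
  proof -
   have N0: "0 < real N" using N r by (meson divide_pos_pos order.strict_trans zero_less_numeral zero_less_power)
   have "2 / real (Suc m) <= 2 / real N" "2 / real (Suc n) <= 2 / real N" using that N0 by (auto intro!: divide_left_mono mult_pos_pos)
   hence "(dst (u m) (u n))\<^sup>2 <= 4 / real N" using par[of m n] by simp
   also have "... < r\<^sup>2" using N N0 r by (simp add: field_simps)
   finally show ?thesis using r by (simp add: power_less_imp_less_base)
  qed
  thus ?thesis by auto
 qed
 from complete_nrm[of u, OF uV this] obtain p where p: "p \<in> V" "(%n. dst (u n) p) \<longlonglongrightarrow> 0" by blast
 define h where "h = (%y. v y - p y)"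
 have hV: "h \<in> V" using v p by (simp add: h_def)
 \<comment> \<open>The limit \<open>p\<close> may lie outside \<open>X\<close>; therefore
   \<open>p + x\<close> is approximated by \<open>u n + x\<close>, which lies in
   \<open>X\<close>.\<close>
 have lower: "d <= dst h x" if x: "x \<in> X" for x
 proof (rule field_le_epsilon)
  fix r :: real assume "r > 0"
  with p(2) obtain n where n: "dst (u n) p < r" by (metis (no_types, lifting) LIMSEQ_iff abs_less_iff diff_zero order_refl real_norm_def)
  have xu: "(%y. u n y + x y) \<in> X" by (intro Xadd u x)
  have "d <= nrm (%y. v y - (u n y + x y))" by (rule dle[OF xu])
  also have "... <= nrm (%y. v y - (p y + x y)) + nrm (%y. (p y + x y) - (u n y + x y))"
   by (rule nrm_diff_triangle) (use v p(1) XV[OF x] XV[OF xu] in auto)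
  also have "nrm (%y. (p y + x y) - (u n y + x y)) = dst (u n) p" using nrm_diff_commute[OF p(1) uV, of n] by simp
  also have "(%y. v y - (p y + x y)) = (%y. h y - x y)" by (simp add: h_def fun_eq_iff)
  finally show "d <= dst h x + r" using n by simp
 qed
 have upper: "(nrm h)\<^sup>2 <= d\<^sup>2"
 proof (rule LIMSEQ_le_const2)
  have "(%n. dst v (u n)) \<longlonglongrightarrow> nrm h"
  proof (rule LIMSEQ_I)
   fix r :: real assume "r > 0"
   with p(2) obtain N where N: "!!n. n >= N ==> norm (dst (u n) p - 0) < r" using LIMSEQ_D by blast
   have "norm (dst v (u n) - nrm h) < r" if "n >= N" for n
   proof -
    have "\<bar>dst v (u n) - nrm h\<bar> <= nrm (%y. (v y - u n y) - h y)" by (rule nrm_le_diff) (use v uV hV in auto)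
    also have "(%y. (v y - u n y) - h y) = (%y. p y - u n y)" by (simp add: h_def fun_eq_iff)
    also have "nrm ... = dst (u n) p" by (rule nrm_diff_commute[OF p(1) uV])
    finally show ?thesis using N[OF that] by simp
   qed
   thus "\<exists>N. \<forall>n\<ge>N. norm (dst v (u n) - nrm h) < r" by auto
  qed
  hence "(%n. (dst v (u n))\<^sup>2 - 1 / real (Suc n)) \<longlonglongrightarrow> (nrm h)\<^sup>2 - 0"
   using LIMSEQ_inverse_real_of_nat by (intro tendsto_diff tendsto_power) (simp_all add: inverse_eq_divide)
  thus "(%n. (dst v (u n))\<^sup>2 - 1 / real (Suc n)) \<longlonglongrightarrow> (nrm h)\<^sup>2" by simp
  show "\<exists>N. \<forall>n\<ge>N. (dst v (u n))\<^sup>2 - 1 / real (Suc n) <= d\<^sup>2"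
   using u(2) less_eq_real_def by (auto simp: algebra_simps intro!: exI[of _ 0] less_imp_le)
 qed
 have "nrm h > 0" using lower[OF X0] de e by simp
 hence "h ~= (%x. 0)" by auto
 moreover have "ip h x = 0" if x: "x \<in> X" for x
 proof (rule ccontr)
  assume nz: "ip h x ~= 0"
  \<comment> \<open>Moving \<open>h\<close> by \<open>t\<close> times its component along
    \<open>x\<close> would shorten it: \<open>t\<close> times the squared norm of \<open>x\<close>
    is below 1, which keeps the quadratic term under the linear gain. The \<open>+ 1\<close> covers
    \<open>nrm x = 0\<close>.\<close>
  define t where "t = 1 / ((nrm x)\<^sup>2 + 1)"
  have t: "0 < t" "t * (nrm x)\<^sup>2 < 1" by (auto simp: t_def field_simps add_pos_nonneg)
  define c where "c = of_real t * ip h x"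
  have "d\<^sup>2 <= (nrm (%y. h y - c * x y))\<^sup>2" using lower[OF Xc[OF x]] de e by (intro power_mono) auto
  also have "... = (nrm h)\<^sup>2 - 2 * Re (cnj c * ip h x) + (norm c)\<^sup>2 * (nrm x)\<^sup>2"
   using nrm_diff_sq[OF hV cmult_mem[OF XV[OF x]], of c] XV[OF x] hV by (simp add: ip_cmult_right nrm_cmult power_mult_distrib)
  also have "cnj c * ip h x = of_real (t * (norm (ip h x))\<^sup>2)" using complex_norm_square[of "ip h x"] by (simp add: c_def mult_ac)
  also have "(norm c)\<^sup>2 * (nrm x)\<^sup>2 = t * (norm (ip h x))\<^sup>2 * (t * (nrm x)\<^sup>2)" by (simp add: c_def norm_mult power2_eq_square)
  finally have "2 * (t * (norm (ip h x))\<^sup>2) <= t * (norm (ip h x))\<^sup>2 * (t * (nrm x)\<^sup>2)" using upper by simp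
  moreover have pos: "0 < t * (norm (ip h x))\<^sup>2" using t nz by simp
  moreover have "t * (norm (ip h x))\<^sup>2 * (t * (nrm x)\<^sup>2) < t * (norm (ip h x))\<^sup>2 * 1" using t pos by (intro mult_strict_left_mono)
  ultimately show False by simp
 qed
 ultimately show ?thesis using hV by blast
qed

lemma dense_if_orthogonal_trivial:
 assumes X: "subspace_of_functions X" "X \<subseteq> V"
  and triv: "!!h. h \<in> V ==> (!!x. x \<in> X ==> ip h x = 0) ==> h = (%x. 0)"
  and v: "v \<in> V" and e: "0 < e"
 shows "\<exists>x\<in>X. dst v x < e"
proof (rule ccontr)
 assume "\<not> ?thesis"
 hence "!!x. x \<in> X ==> e <= dst v x" by (auto simp: not_less)
 from ex_orthogonal[OF X v e this] triv show False by blast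
qed

text \<open>Closedness puts a vector outside \<open>W\<close> at positive distance from
  \<open>W\<close>, which is what \<open>ex_orthogonal\<close> asks for.\<close>

lemma closed_subspace_orthogonal:
 assumes W: "closed_subspace V ip W" "W ~= V"
 shows "\<exists>h\<in>V. h ~= (%x. 0) \<and> (\<forall>x\<in>W. ip h x = 0)"
proof -
 have sub: "subspace_of_functions W" "W \<subseteq> V"
  and cl: "!!u f. f \<in> V ==> (!!n::nat. u n \<in> W) ==> (%n. dst (u n) f) \<longlonglongrightarrow> 0 ==> f \<in> W" using W(1) unfolding closed_subspace_def by auto
 obtain v where v: "v \<in> V" "v \<notin> W" using W(2) sub by auto
 have "\<exists>e>0. \<forall>x\<in>W. e <= dst v x"
 proof (rule ccontr)
  assume "\<not> ?thesis"
  hence "\<exists>x\<in>W. dst v x < e" if "e > 0" for e using that by (meson not_le)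
  hence "\<exists>x\<in>W. dst v x < 1 / real (Suc n)" for n by simp
  then obtain u where u: "!!n. u n \<in> W" "!!n. dst v (u n) < 1 / real (Suc n)" by metis
  have "(%n. dst (u n) v) \<longlonglongrightarrow> 0"
  proof (rule tendsto_sandwich[OF _ _ tendsto_const])
   show "(%n. 1 / real (Suc n)) \<longlonglongrightarrow> 0" using LIMSEQ_inverse_real_of_nat by (simp add: inverse_eq_divide)
   have "u n \<in> V" for n using u(1) sub(2) by blast
   thus "\<forall>\<^sub>F n in sequentially. 0 <= dst (u n) v" using v(1) by (intro always_eventually allI nrm_nonneg diff_mem)
   show "\<forall>\<^sub>F n in sequentially. dst (u n) v <= 1 / real (Suc n)"
   proof (intro always_eventually allI)
    fix n show "dst (u n) v <= 1 / real (Suc n)" using u(2)[of n] nrm_diff_commute[of "u n" v] u(1)[of n] sub(2) v(1) by auto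
   qed
  qed
  thus False using cl[OF v(1) u(1)] v(2) by simp
 qed
 then obtain e where "e > 0" "!!x. x \<in> W ==> e <= dst v x" by blast
 thus ?thesis using ex_orthogonal[OF sub v(1)] by blast
qed

end

section \<open>Extending an isometric action from a dense subspace\<close>

lemma isometry_preserves_inner:
 assumes 1: "hspace V ip" and 2: "hspace V' ip'" and L: "linear_between V V' L"
  and iso: "!!f. f \<in> V ==> inner_norm ip' (L f) = inner_norm ip f"
  and f: "f \<in> V" and g: "g \<in> V"
 shows "ip' (L f) (L g) = ip f g"
proof -
 interpret A: hspace V ip by fact
 interpret B: hspace V' ip' by fact
 have LV: "L f \<in> V'" if "f \<in> V" for f using L that by (simp add: linear_between_def)
 have Re: "Re (ip' (L f) (L g)) = Re (ip f g)" if "f \<in> V" "g \<in> V" for f g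
 proof -
  have "L (%x. f x + g x) = (%y. L f y + L g y)" using L that by (simp add: linear_between_def)
  thus ?thesis using A.nrm_add_sq[OF that] B.nrm_add_sq[OF LV[OF that(1)] LV[OF that(2)]] iso[OF A.add_mem[OF that]] iso that by simp
 qed
 \<comment> \<open>Polarization: real parts agree by the norm of a sum, and the imaginary part is,
   up to sign, the real part after replacing \<open>f\<close> by \<open>\<i> * f\<close>.\<close>
 have "L (%x. \<i> * f x) = (%y. \<i> * L f y)" using L f by (simp add: linear_between_def)
 hence "Im (ip' (L f) (L g)) = Im (ip f g)"
  using Re[OF A.cmult_mem[OF f, of \<i>] g] A.ip_cmult_left[OF f g] B.ip_cmult_left[OF LV[OF f] LV[OF g]] by simp
 thus ?thesis using Re[OF f g] by (simp add: complex_eq_iff)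
qed

text \<open>Smooth vectors are functions on the field while the Hilbert space consists of
  distributions; \<open>j\<close> passes from one to the other.\<close>

locale dense_rep = hspace V ip
 for V :: "('a => complex) set" and ip +
 fixes G :: "'g monoid" and X :: "('b => complex) set" and j :: "('b => complex) => 'a => complex"
  and \<sigma> :: "'g => ('b => complex) => 'b => complex"
 assumes G: "monoid G"
  and subX: "subspace_of_functions X"
  and jV: "f \<in> X ==> j f \<in> V"
  and j_add: "f \<in> X ==> f' \<in> X ==> j (%x. f x + f' x) = (%y. j f y + j f' y)"
  and j_cmult: "f \<in> X ==> j (%x. c * f x) = (%y. c * j f y)"
  and dense: "T \<in> V ==> 0 < e ==> \<exists>f\<in>X. dst T (j f) < e"
  and \<sigma>X: "g \<in> carrier G ==> f \<in> X ==> \<sigma> g f \<in> X"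
  and \<sigma>_add: "g \<in> carrier G ==> f \<in> X ==> f' \<in> X ==> \<sigma> g (%x. f x + f' x) = (%y. \<sigma> g f y + \<sigma> g f' y)"
  and \<sigma>_cmult: "g \<in> carrier G ==> f \<in> X ==> \<sigma> g (%x. c * f x) = (%y. c * \<sigma> g f y)"
  and \<sigma>_one: "f \<in> X ==> \<sigma> \<one>\<^bsub>G\<^esub> f = f"
  and \<sigma>_mult: "g \<in> carrier G ==> h \<in> carrier G ==> f \<in> X ==> \<sigma> (g \<otimes>\<^bsub>G\<^esub> h) f = \<sigma> g (\<sigma> h f)"
  and \<sigma>_iso: "g \<in> carrier G ==> f \<in> X ==> nrm (j (\<sigma> g f)) = nrm (j f)"
begin

text \<open>Spelled exactly as \<open>completed_action\<close>, with \<open>j\<close> in place of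
  \<open>function_distribution K\<close>, so that both can be identified by unfolding.\<close>

definition U :: "'g => ('a => complex) => 'a => complex" where
 "U g T = (THE S. S \<in> V \<and> (\<forall>e>0. \<exists>d>0. \<forall>f\<in>X. dst T (j f) < d --> dst S (j (\<sigma> g f)) < e))"

lemma X_mem: "f \<in> X ==> f' \<in> X ==> (%x. f x + f' x) \<in> X" "f \<in> X ==> (%x. c * f x) \<in> X"
 using subX by (simp_all add: subspace_of_functions_def)

lemma diff_iso:
 assumes g: "g \<in> carrier G" and f: "f \<in> X" "f' \<in> X"
 shows "dst (j (\<sigma> g f)) (j (\<sigma> g f')) = dst (j f) (j f')"
proof -
 have m: "(%x. (-1) * f' x) \<in> X" by (rule X_mem(2)[OF f(2)])
 have s: "(%x. f x + (-1) * f' x) \<in> X" by (rule X_mem(1)[OF f(1) m])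
 have 1: "j (%x. f x + (-1) * f' x) = (%y. j f y + (-1) * j f' y)" unfolding j_add[OF f(1) m] j_cmult[OF f(2)] ..
 have "\<sigma> g (%x. f x + (-1) * f' x) = (%y. \<sigma> g f y + (-1) * \<sigma> g f' y)" unfolding \<sigma>_add[OF g f(1) m] \<sigma>_cmult[OF g f(2)] ..
 hence 2: "j (\<sigma> g (%x. f x + (-1) * f' x)) = (%y. j (\<sigma> g f) y + (-1) * j (\<sigma> g f') y)"
  using j_add[OF \<sigma>X[OF g f(1)] X_mem(2)[OF \<sigma>X[OF g f(2)]], of "-1"] j_cmult[OF \<sigma>X[OF g f(2)], of "-1"] by simp
 show ?thesis using \<sigma>_iso[OF g s] unfolding 1 2 by simp
qed

text \<open>Images of vectors approaching \<open>T\<close> form a Cauchy sequence. Its limit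
  satisfies a sharp bound for every \<open>f\<close> at once, which is easier to handle than the
  epsilon-delta condition in \<open>U\<close>.\<close>

lemma U_ex1:
 assumes g: "g \<in> carrier G" and T: "T \<in> V"
 shows "\<exists>S\<in>V. \<forall>f\<in>X. dst S (j (\<sigma> g f)) <= dst T (j f)"
proof -
 have "\<exists>f. f \<in> X \<and> dst T (j f) < 1 / real (Suc n)" for n using dense[OF T, of "1 / real (Suc n)"] by auto
 then obtain f where f: "!!n. f n \<in> X" "!!n. dst T (j (f n)) < 1 / real (Suc n)" by metis
 have V: "j (\<sigma> g (f n)) \<in> V" "j (f n) \<in> V" for n using f jV \<sigma>X g by auto
 have "\<exists>N. \<forall>m\<ge>N. \<forall>n\<ge>N. dst (j (\<sigma> g (f m))) (j (\<sigma> g (f n))) < r" if r: "r > 0" for r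
 proof -
  obtain N where N: "2 / r < real N" using reals_Archimedean2 by blast
  have "dst (j (\<sigma> g (f m))) (j (\<sigma> g (f n))) < r" if mn: "N <= m" "N <= n" for m n
  proof -
   have N0: "0 < real N" using N r by (meson divide_pos_pos order.strict_trans zero_less_numeral)
   have "dst (j (f m)) (j (f n)) <= dst (j (f m)) T + dst T (j (f n))" by (rule nrm_diff_triangle) (use V T in auto)
   also have "dst (j (f m)) T = dst T (j (f m))" by (rule nrm_diff_commute[OF V(2) T])
   also have "dst T (j (f m)) + dst T (j (f n)) < 1 / real (Suc m) + 1 / real (Suc n)" by (intro add_strict_mono f)
   also have "... <= 1 / real N + 1 / real N" using mn N0 by (intro add_mono divide_left_mono mult_pos_pos) auto
   also have "... < r" using N N0 r by (simp add: field_simps)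
   finally show ?thesis using diff_iso[OF g f(1) f(1)] by simp
  qed
  thus ?thesis by auto
 qed
 from complete_nrm[of "%n. j (\<sigma> g (f n))", OF V(1) this] obtain S where S: "S \<in> V"
  "(%n. dst (j (\<sigma> g (f n))) S) \<longlonglongrightarrow> 0" by blast
 have "dst S (j (\<sigma> g h)) <= dst T (j h)" if h: "h \<in> X" for h
 proof -
  have hV: "j h \<in> V" "j (\<sigma> g h) \<in> V" using h jV \<sigma>X g by auto
  have "(%n. dst (j (\<sigma> g (f n))) S + (1 / real (Suc n) + dst T (j h)))
   \<longlonglongrightarrow> 0 + (0 + dst T (j h))" using LIMSEQ_inverse_real_of_nat by (intro tendsto_add S(2) tendsto_const) (simp add: inverse_eq_divide)
  moreover have "dst S (j (\<sigma> g h)) \<le>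
   dst (j (\<sigma> g (f n))) S + (1 / real (Suc n) + dst T (j h))" for n
  proof -
   have "dst S (j (\<sigma> g h)) <= dst S (j (\<sigma> g (f n))) + dst (j (\<sigma> g (f n))) (j (\<sigma> g h))" by (rule nrm_diff_triangle) (use S V hV in auto)
   moreover have "dst S (j (\<sigma> g (f n))) = dst (j (\<sigma> g (f n))) S" by (rule nrm_diff_commute[OF S(1) V(1)])
   moreover have "dst (j (\<sigma> g (f n))) (j (\<sigma> g h)) = dst (j (f n)) (j h)" by (rule diff_iso[OF g f(1) h])
   moreover have "dst (j (f n)) (j h) <= dst (j (f n)) T + dst T (j h)" by (rule nrm_diff_triangle) (use T V hV in auto)
   moreover have "dst (j (f n)) T = dst T (j (f n))" by (rule nrm_diff_commute[OF V(2) T])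
   ultimately show ?thesis using f(2)[of n] by linarith
  qed
  ultimately show ?thesis by (intro LIMSEQ_le_const[where X = "%n. dst (j (\<sigma> g (f n))) S + (1 / real (Suc n) + dst T (j h))"]) auto
 qed
 thus ?thesis using S(1) by blast
qed

lemma U:
 assumes g: "g \<in> carrier G" and T: "T \<in> V"
 shows U_mem: "U g T \<in> V" and U_bound: "f \<in> X ==> dst (U g T) (j (\<sigma> g f)) <= dst T (j f)"
proof -
 obtain S where S: "S \<in> V" "!!f. f \<in> X ==> dst S (j (\<sigma> g f)) <= dst T (j f)" using U_ex1[OF g T] by blast
 have "U g T = S" unfolding U_def
 proof (rule the_equality)
  show "S \<in> V \<and> (\<forall>e>0. \<exists>d>0. \<forall>f\<in>X. dst T (j f) < d --> dst S (j (\<sigma> g f)) < e)" using S by (meson le_less_trans)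
 next
  fix S' assume "S' \<in> V \<and> (\<forall>e>0. \<exists>d>0. \<forall>f\<in>X. dst T (j f) < d --> dst S' (j (\<sigma> g f)) < e)"
  hence S': "S' \<in> V" "!!e. e > 0 ==> \<exists>d>0. \<forall>f\<in>X. dst T (j f) < d --> dst S' (j (\<sigma> g f)) < e" by auto
  show "S' = S"
  proof (rule eq_if_small[OF S'(1) S(1)])
   fix e :: real assume e: "e > 0"
   then obtain d where d: "d > 0" "\<forall>f\<in>X. dst T (j f) < d --> dst S' (j (\<sigma> g f)) < e / 2" using S'(2)[of "e / 2"] by auto
   obtain f where f: "f \<in> X" "dst T (j f) < min d (e / 2)" using dense[OF T, of "min d (e / 2)"] d e by auto
   have jf: "j (\<sigma> g f) \<in> V" using f jV \<sigma>X g by auto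
   have "dst S' S <= dst S' (j (\<sigma> g f)) + dst (j (\<sigma> g f)) S" by (rule nrm_diff_triangle[OF S'(1) jf S(1)])
   moreover have "dst (j (\<sigma> g f)) S = dst S (j (\<sigma> g f))" by (rule nrm_diff_commute[OF jf S(1)])
   moreover have "dst S' (j (\<sigma> g f)) < e / 2" using d f by auto
   moreover have "dst S (j (\<sigma> g f)) < e / 2" using S(2)[OF f(1)] f(2) by auto
   ultimately show "dst S' S <= e" by linarith
  qed
 qed
 thus "U g T \<in> V" "f \<in> X ==> dst (U g T) (j (\<sigma> g f)) <= dst T (j f)" using S by auto
qed

text \<open>By density the sharp bound determines the vector; the group laws then follow by checking
  the bound for the expected value.\<close>

lemma U_eqI:
 assumes g: "g \<in> carrier G" and T: "T \<in> V" and S: "S \<in> V"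
  and le: "!!f. f \<in> X ==> dst S (j (\<sigma> g f)) <= dst T (j f)"
 shows "U g T = S"
proof (rule eq_if_small[OF U_mem[OF g T] S])
 fix e :: real assume e: "e > 0"
 obtain f where f: "f \<in> X" "dst T (j f) < e / 2" using dense[OF T, of "e / 2"] e by auto
 have jf: "j (\<sigma> g f) \<in> V" using f jV \<sigma>X g by auto
 have "dst (U g T) S <= dst (U g T) (j (\<sigma> g f)) + dst (j (\<sigma> g f)) S" by (rule nrm_diff_triangle[OF U_mem[OF g T] jf S])
 moreover have "dst (j (\<sigma> g f)) S = dst S (j (\<sigma> g f))" by (rule nrm_diff_commute[OF jf S])
 ultimately show "dst (U g T) S <= e" using U_bound[OF g T f(1)] le[OF f(1)] f(2) by linarith
qed

lemma U_j: "g \<in> carrier G ==> f \<in> X ==> U g (j f) = j (\<sigma> g f)" by (rule U_eqI) (auto simp: jV \<sigma>X diff_iso)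

lemma U_iso: assumes g: "g \<in> carrier G" and T: "T \<in> V" shows "nrm (U g T) = nrm T"
proof -
 have "\<bar>nrm (U g T) - nrm T\<bar> <= 0 + e" if e: "e > 0" for e
 proof -
  obtain f where f: "f \<in> X" "dst T (j f) < e / 2" using dense[OF T, of "e / 2"] e by auto
  have V: "j f \<in> V" "j (\<sigma> g f) \<in> V" using f jV \<sigma>X g by auto
  show ?thesis using nrm_le_diff[OF T V(1)] nrm_le_diff[OF U_mem[OF g T] V(2)] U_bound[OF g T f(1)] \<sigma>_iso[OF g f(1)] f(2) by linarith
 qed
 hence "\<bar>nrm (U g T) - nrm T\<bar> <= 0" by (rule field_le_epsilon)
 thus ?thesis by simp
qed

lemma U_linear: assumes g: "g \<in> carrier G" shows "linear_between V V (U g)" unfolding linear_between_def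
proof (intro conjI ballI allI)
 show "U g T \<in> V" if "T \<in> V" for T by (rule U_mem[OF g that])
next
 fix T T' assume T: "T \<in> V" "T' \<in> V"
 show "U g (%x. T x + T' x) = (%y. U g T y + U g T' y)"
 proof (rule eq_if_small)
  show "U g (%x. T x + T' x) \<in> V" "(%y. U g T y + U g T' y) \<in> V" using T U_mem[OF g] by auto
  fix e :: real assume e: "e > 0"
  obtain f where f: "f \<in> X" "dst T (j f) < e / 4" using dense[OF T(1), of "e / 4"] e by auto
  obtain f' where f': "f' \<in> X" "dst T' (j f') < e / 4" using dense[OF T(2), of "e / 4"] e by auto
  define h where "h = (%x. f x + f' x)"
  have h: "h \<in> X" unfolding h_def by (rule X_mem(1)[OF f(1) f'(1)])
  have V: "j f \<in> V" "j f' \<in> V" "j h \<in> V" "j (\<sigma> g f) \<in> V" "j (\<sigma> g f') \<in> V" "j (\<sigma> g h) \<in> V" using f f' h jV \<sigma>X g by auto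
  have jh: "j h = (%y. j f y + j f' y)" unfolding h_def by (rule j_add[OF f(1) f'(1)])
  have sh: "j (\<sigma> g h) = (%y. j (\<sigma> g f) y + j (\<sigma> g f') y)"
   unfolding h_def \<sigma>_add[OF g f(1) f'(1)] by (rule j_add[OF \<sigma>X[OF g f(1)] \<sigma>X[OF g f'(1)]])
  have "nrm (%x. U g (%x. T x + T' x) x - (U g T x + U g T' x))
   <= nrm (%x. U g (%x. T x + T' x) x - j (\<sigma> g h) x) + nrm (%x. j (\<sigma> g h) x - (U g T x + U g T' x))"
   by (rule nrm_diff_triangle) (use T V U_mem[OF g] in auto)
  also have "nrm (%x. U g (%x. T x + T' x) x - j (\<sigma> g h) x) <= nrm (%x. (T x + T' x) - j h x)" by (rule U_bound[OF g _ h]) (use T in auto)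
  also have "(%x. (T x + T' x) - j h x) = (%x. (T x - j f x) + (T' x - j f' x))" by (simp add: jh fun_eq_iff)
  also have "nrm ... <= dst T (j f) + dst T' (j f')" by (rule nrm_triangle) (use T V in auto)
  also have "nrm (%x. j (\<sigma> g h) x - (U g T x + U g T' x)) = nrm (%x. (U g T x + U g T' x) - j (\<sigma> g h) x)"
   by (rule nrm_diff_commute) (use T V U_mem[OF g] in auto)
  also have "(%x. (U g T x + U g T' x) - j (\<sigma> g h) x) = (%x. (U g T x - j (\<sigma> g f) x) + (U g T' x - j (\<sigma> g f') x))"
   by (simp add: sh fun_eq_iff)
  also have "nrm ... <= dst (U g T) (j (\<sigma> g f)) + dst (U g T') (j (\<sigma> g f'))" by (rule nrm_triangle) (use T V U_mem[OF g] in auto)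
  finally show "nrm (%x. U g (%x. T x + T' x) x - (U g T x + U g T' x)) <= e"
   using f(2) f'(2) U_bound[OF g T(1) f(1)] U_bound[OF g T(2) f'(1)] by simp
 qed
next
 fix c T assume T: "T \<in> V"
 show "U g (%x. c * T x) = (%y. c * U g T y)"
 proof (rule eq_if_small)
  show "U g (%x. c * T x) \<in> V" "(%y. c * U g T y) \<in> V" using T U_mem[OF g] by auto
  fix e :: real assume e: "e > 0"
  \<comment> \<open>The summand 1 keeps the quotient meaningful for \<open>c = 0\<close>.\<close>
  define r where "r = e / (2 * (norm c + 1))"
  have r: "r > 0" "norm c * r <= e / 2" using e by (auto simp: r_def field_simps add_pos_nonneg)
  obtain f where f: "f \<in> X" "dst T (j f) < r" using dense[OF T, of r] r by auto
  define h where "h = (%x. c * f x)"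
  have h: "h \<in> X" unfolding h_def by (rule X_mem(2)[OF f(1)])
  have V: "j f \<in> V" "j h \<in> V" "j (\<sigma> g f) \<in> V" "j (\<sigma> g h) \<in> V" using f h jV \<sigma>X g by auto
  have jh: "j h = (%y. c * j f y)" unfolding h_def by (rule j_cmult[OF f(1)])
  have sh: "j (\<sigma> g h) = (%y. c * j (\<sigma> g f) y)" unfolding h_def \<sigma>_cmult[OF g f(1)] by (rule j_cmult[OF \<sigma>X[OF g f(1)]])
  have "nrm (%x. U g (%x. c * T x) x - c * U g T x)
   <= nrm (%x. U g (%x. c * T x) x - j (\<sigma> g h) x) + nrm (%x. j (\<sigma> g h) x - c * U g T x)"
   by (rule nrm_diff_triangle) (use T V U_mem[OF g] in auto)
  also have "nrm (%x. U g (%x. c * T x) x - j (\<sigma> g h) x) <= nrm (%x. c * T x - j h x)" by (rule U_bound[OF g _ h]) (use T in auto)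
  also have "(%x. c * T x - j h x) = (%x. c * (T x - j f x))" by (simp add: jh fun_eq_iff right_diff_distrib)
  also have "nrm ... = norm c * dst T (j f)" by (rule nrm_cmult) (use T V in auto)
  also have "nrm (%x. j (\<sigma> g h) x - c * U g T x) = nrm (%x. c * U g T x - j (\<sigma> g h) x)"
   by (rule nrm_diff_commute) (use T V U_mem[OF g] in auto)
  also have "(%x. c * U g T x - j (\<sigma> g h) x) = (%x. c * (U g T x - j (\<sigma> g f) x))" by (simp add: sh fun_eq_iff right_diff_distrib)
  also have "nrm ... = norm c * dst (U g T) (j (\<sigma> g f))" by (rule nrm_cmult) (use T V U_mem[OF g] in auto)
  finally have "nrm (%x. U g (%x. c * T x) x - c * U g T x)
    <= norm c * dst T (j f) + norm c * dst (U g T) (j (\<sigma> g f))" by simp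
  also have "... <= norm c * r + norm c * r" using f(2) U_bound[OF g T f(1)] by (intro add_mono mult_left_mono) auto
  finally show "nrm (%x. U g (%x. c * T x) x - c * U g T x) <= e" using r(2) by linarith
 qed
qed

lemma U_one: assumes T: "T \<in> V" shows "U \<one>\<^bsub>G\<^esub> T = T" by (rule U_eqI[OF monoid.one_closed[OF G] T T]) (simp add: \<sigma>_one)

lemma U_mult:
 assumes g: "g \<in> carrier G" "h \<in> carrier G" and T: "T \<in> V"
 shows "U (g \<otimes>\<^bsub>G\<^esub> h) T = U g (U h T)"
proof (rule U_eqI[OF monoid.m_closed[OF G g] T U_mem[OF g(1) U_mem[OF g(2) T]]])
 fix f assume f: "f \<in> X"
 show "dst (U g (U h T)) (j (\<sigma> (g \<otimes>\<^bsub>G\<^esub> h) f)) <= dst T (j f)"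
  using U_bound[OF g(1) U_mem[OF g(2) T] \<sigma>X[OF g(2) f]] U_bound[OF g(2) T f] \<sigma>_mult[OF g f] by simp
qed

lemma U_inner: "g \<in> carrier G ==> T \<in> V ==> T' \<in> V ==> ip (U g T) (U g T') = ip T T'"
 by (rule isometry_preserves_inner[OF hspace_axioms hspace_axioms U_linear U_iso])

end

section \<open>Weighted square integrable functions on the Fourier side\<close>

abbreviation "L2d M f g \<equiv> \<integral>\<^sup>+x. ennreal ((norm (f x - g x :: complex))\<^sup>2) \<partial>M"

text \<open>Riesz-Fischer: a rapidly Cauchy subsequence converges almost everywhere, and Fatou
  compares the whole sequence with its limit.\<close>

lemma L2_complete:
 fixes g :: "nat => 'a => complex"
 assumes meas[measurable]: "!!n. g n \<in> borel_measurable M"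
  and cauchy: "!!e. e > 0 ==> \<exists>N. \<forall>m\<ge>N. \<forall>n\<ge>N. (L2d M (g m) (g n)) < ennreal e"
 shows "\<exists>h. h \<in> borel_measurable M \<and>
  (\<forall>e>0. \<exists>N. \<forall>n\<ge>N. (L2d M (g n) h) <= ennreal e)"
proof -
 have "\<exists>N. \<forall>m\<ge>N. \<forall>n\<ge>N. (L2d M (g m) (g n)) < ennreal ((1/8) ^ k)" for k by (rule cauchy) simp
 then obtain N where N: "!!k m n. N k <= m ==> N k <= n ==>
   (L2d M (g m) (g n)) < ennreal ((1/8) ^ k)" by metis
 \<comment> \<open>A crude choice of indices: \<open>R k\<close> dominates \<open>k\<close> and
   every \<open>N i\<close> with \<open>i <= k\<close>.\<close>
 define R where "R k = k + (\<Sum>i\<le>k. N i)" for k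
 have RN: "N i <= R k" if "i <= k" for i k using that member_le_sum[of i "{..k}" N] by (simp add: R_def)
 \<comment> \<open>The squares of these steps have integral at most 8^(-k). Weighting them by 4^k
   leaves a convergent series, whose finiteness at \<open>x\<close> gives the pointwise bound sqrt C
   / 2^k.\<close>
 define D where "D k x = g (R (Suc k)) x - g (R k) x" for k x
 have [measurable]: "D k \<in> borel_measurable M" for k unfolding D_def by measurable
 have D: "(\<integral>\<^sup>+x. ennreal ((norm (D k x))\<^sup>2) \<partial>M) <= ennreal ((1/8) ^ k)" for k
  unfolding D_def using N[of k "R (Suc k)" "R k"] RN[of k k] RN[of k "Suc k"] by (simp add: less_imp_le)
 have "(\<integral>\<^sup>+x. (\<Sum>k. ennreal (4 ^ k * (norm (D k x))\<^sup>2)) \<partial>M) = (\<Sum>k. \<integral>\<^sup>+x. ennreal (4 ^ k * (norm (D k x))\<^sup>2) \<partial>M)"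
  by (intro nn_integral_suminf) simp
 also have "... <= (\<Sum>k. ennreal ((1/2) ^ k))"
 proof (intro suminf_le)
  fix k
  have "(\<integral>\<^sup>+x. ennreal (4 ^ k * (norm (D k x))\<^sup>2) \<partial>M) = ennreal (4 ^ k) * (\<integral>\<^sup>+x. ennreal ((norm (D k x))\<^sup>2) \<partial>M)"
   by (subst nn_integral_cmult[symmetric]) (simp_all add: ennreal_mult)
  also have "... <= ennreal (4 ^ k) * ennreal ((1/8) ^ k)" by (intro mult_left_mono D) simp
  also have "... = ennreal ((1/2) ^ k)" by (simp add: ennreal_mult'[symmetric] power_mult_distrib[symmetric])
  finally show "(\<integral>\<^sup>+x. ennreal (4 ^ k * (norm (D k x))\<^sup>2) \<partial>M) <= ennreal ((1/2) ^ k)" .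
 qed auto
 also have "... = ennreal (\<Sum>k. (1/2) ^ k)" by (intro suminf_ennreal2) (auto intro: summable_geometric)
 also have "... < \<infinity>" by simp
 finally have "AE x in M. (\<Sum>k. ennreal (4 ^ k * (norm (D k x))\<^sup>2)) ~= \<infinity>" by (intro nn_integral_noteq_infinite) auto
 hence conv: "AE x in M. convergent (%k. g (R k) x)"
 proof eventually_elim
  case (elim x)
  define C where "C = enn2real (\<Sum>k. ennreal (4 ^ k * (norm (D k x))\<^sup>2))"
  have C: "C >= 0" "(\<Sum>k. ennreal (4 ^ k * (norm (D k x))\<^sup>2)) = ennreal C"
   unfolding C_def using elim by (auto simp only: ennreal_enn2real_if enn2real_nonneg infinity_ennreal_def if_False)
  have bound: "norm (D k x) <= sqrt C * (1/2) ^ k" for k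
  proof -
   have "ennreal (4 ^ k * (norm (D k x))\<^sup>2) <= ennreal C"
    using sum_le_suminf[of "%k. ennreal (4 ^ k * (norm (D k x))\<^sup>2)" "{k}"] C(2) by simp
   hence "4 ^ k * (norm (D k x))\<^sup>2 <= C" using C(1) by simp
   moreover have "(2 ^ k * norm (D k x))\<^sup>2 = 4 ^ k * (norm (D k x))\<^sup>2"
   proof -
    have "((2::real) ^ k)\<^sup>2 = (2\<^sup>2) ^ k" by (simp only: power_mult[symmetric] mult.commute)
    thus ?thesis by (simp add: power_mult_distrib)
   qed
   ultimately have "(2 ^ k * norm (D k x))\<^sup>2 <= (sqrt C)\<^sup>2" using C(1) by simp
   hence "2 ^ k * norm (D k x) <= sqrt C" by (rule power2_le_imp_le) (simp add: C(1))
   hence "norm (D k x) <= sqrt C / 2 ^ k" by (simp add: pos_le_divide_eq mult.commute)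
   thus ?thesis by (simp add: power_divide)
  qed
  have "summable (%k. sqrt C * (1/2) ^ k)" by (intro summable_mult summable_geometric) simp
  hence "summable (%k. D k x)" by (rule summable_comparison_test'[of _ 0]) (rule bound)
  hence "convergent (%n. \<Sum>k<n. D k x)" by (simp add: summable_iff_convergent)
  moreover have "(\<Sum>k<n. D k x) = g (R n) x - g (R 0) x" for n unfolding D_def by (rule sum_lessThan_telescope)
  ultimately have "convergent (%n. g (R n) x - g (R 0) x)" by simp
  hence "convergent (%n. (g (R n) x - g (R 0) x) + g (R 0) x)" by (intro convergent_add convergent_const)
  thus ?case by simp
 qed
 define h where "h x = lim (%k. g (R k) x)" for x
 have [measurable]: "h \<in> borel_measurable M" unfolding h_def by (rule borel_measurable_lim_metric) simp
 have "\<exists>N. \<forall>n\<ge>N. (L2d M (g n) h) <= ennreal e" if e: "e > 0" for e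
 proof -
  obtain N0 where N0: "\<forall>m\<ge>N0. \<forall>n\<ge>N0. (L2d M (g m) (g n)) < ennreal e" using cauchy[OF e] by auto
  have "(L2d M (g n) h) <= ennreal e" if n: "n >= N0" for n
  proof -
   have "(L2d M (g n) h) = (\<integral>\<^sup>+x. liminf (%k. ennreal ((norm (g n x - g (R k) x))\<^sup>2)) \<partial>M)"
   proof (rule nn_integral_cong_AE)
    show "AE x in M. ennreal ((norm (g n x - h x))\<^sup>2) = liminf (%k. ennreal ((norm (g n x - g (R k) x))\<^sup>2))" using conv
    proof eventually_elim
     case (elim x)
     hence "(%k. g (R k) x) \<longlonglongrightarrow> h x" unfolding h_def by (simp add: convergent_LIMSEQ_iff)
     hence "(%k. ennreal ((norm (g n x - g (R k) x))\<^sup>2)) \<longlonglongrightarrow> ennreal ((norm (g n x - h x))\<^sup>2)"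
      by (intro tendsto_ennrealI tendsto_power tendsto_norm tendsto_diff tendsto_const)
     thus ?case by (intro lim_imp_Liminf[symmetric]) auto
    qed
   qed
   also have "... <= liminf (%k. \<integral>\<^sup>+x. ennreal ((norm (g n x - g (R k) x))\<^sup>2) \<partial>M)" by (rule nn_integral_liminf) simp
   also have "... <= liminf (%k. ennreal e)"
   proof (rule Liminf_mono)
    show "\<forall>\<^sub>F k in sequentially. (L2d M (g n) (g (R k))) <= ennreal e" using eventually_ge_at_top[of N0]
    proof eventually_elim
     case (elim k)
     hence "N0 <= R k" by (simp add: R_def)
     thus ?case using N0 n by (simp add: less_imp_le)
    qed
   qed
   also have "... = ennreal e" by (simp add: Liminf_const)
   finally show ?thesis .
  qed
  thus ?thesis by auto
 qed
 thus ?thesis by (intro exI[of _ h]) auto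
qed

lemma norm_add_sq_le: "(norm (a + b :: complex))\<^sup>2 <= 2 * (norm a)\<^sup>2 + 2 * (norm b)\<^sup>2"
proof -
 have "(norm (a + b))\<^sup>2 <= (norm a + norm b)\<^sup>2" by (intro power_mono norm_triangle_ineq) auto
 also have "... <= 2 * (norm a)\<^sup>2 + 2 * (norm b)\<^sup>2" using zero_le_power2[of "norm a - norm b"] by (simp add: power2_eq_square algebra_simps)
 finally show ?thesis .
qed

lemma mult_le_sum_squares: "a * b <= a\<^sup>2 + (b::real)\<^sup>2"
proof -
 have "2 * (a * b) <= a\<^sup>2 + b\<^sup>2" using zero_le_power2[of "a - b"] by (simp add: power2_diff)
 thus ?thesis using zero_le_power2[of a] zero_le_power2[of b] by linarith
qed

lemma borel_measurable_cnj [measurable (raw)]: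
 "f \<in> borel_measurable M ==> (%x. cnj (f x)) \<in> borel_measurable M"
 by (erule measurable_compose) (intro borel_measurable_continuous_onI continuous_intros)

section \<open>The weighted space and its distributions\<close>

locale half_line = local_field_data K for K :: "'k::nonarch_local_field field_data" +
 fixes s :: real
 assumes s: "0 < s" "s <= 1/2"
begin

abbreviation "hnrm \<equiv> inner_norm (hilb_inner K s)"
abbreviation w :: "'k => real" where "w x \<equiv> absval x powr (- 2 * s)"

definition Lw :: "('k => complex) set" where
 "Lw = {g \<in> bm. integrable \<mu> (%x. (norm (g x))\<^sup>2 * w x)}"

lemma Lw_meas: "g \<in> Lw ==> g \<in> bm"
 and Lw_int: "g \<in> Lw ==> integrable \<mu> (%x. (norm (g x))\<^sup>2 * w x)" by (auto simp: Lw_def)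

lemma Lw_add: assumes "f \<in> Lw" "g \<in> Lw" shows "(%x. f x + g x) \<in> Lw"
proof -
 have [measurable]: "f \<in> bm" "g \<in> bm" using assms Lw_meas by auto
 have "integrable \<mu> (%x. (norm (f x + g x))\<^sup>2 * w x)"
 proof (rule Bochner_Integration.integrable_bound)
  show "integrable \<mu> (%x. 2 * ((norm (f x))\<^sup>2 * w x) + 2 * ((norm (g x))\<^sup>2 * w x))"
   using Lw_int assms by (intro Bochner_Integration.integrable_add integrable_mult_right) auto
  show "AE x in \<mu>. norm ((norm (f x + g x))\<^sup>2 * w x) <= norm (2 * ((norm (f x))\<^sup>2 * w x) + 2 * ((norm (g x))\<^sup>2 * w x))"
  proof (rule AE_I2)
   fix x
   have "(norm (f x + g x))\<^sup>2 * w x <= (2 * (norm (f x))\<^sup>2 + 2 * (norm (g x))\<^sup>2) * w x" by (intro mult_right_mono norm_add_sq_le) simp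
   thus "norm ((norm (f x + g x))\<^sup>2 * w x) <= norm (2 * ((norm (f x))\<^sup>2 * w x) + 2 * ((norm (g x))\<^sup>2 * w x))" by (simp add: algebra_simps)
  qed
 qed simp
 thus ?thesis by (simp add: Lw_def)
qed

lemma Lw_cmult: assumes "f \<in> Lw" shows "(%x. c * f x) \<in> Lw"
proof -
 have [measurable]: "f \<in> bm" using assms Lw_meas by auto
 have "integrable \<mu> (%x. (norm c)\<^sup>2 * ((norm (f x))\<^sup>2 * w x))" using Lw_int[OF assms] by (rule integrable_mult_right)
 thus ?thesis by (simp add: Lw_def norm_mult power_mult_distrib mult.assoc)
qed

lemma Lw_diff: "f \<in> Lw ==> g \<in> Lw ==> (%x. f x - g x) \<in> Lw" using Lw_add[of f "%x. (-1) * g x"] Lw_cmult[of g "-1"] by simp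

lemma Lw_prod_integrable:
 assumes "f \<in> Lw" "g \<in> Lw"
 shows "integrable \<mu> (%x. f x * cnj (g x) * of_real (w x))"
proof -
 have [measurable]: "f \<in> bm" "g \<in> bm" using assms Lw_meas by auto
 show ?thesis
 proof (rule Bochner_Integration.integrable_bound)
  show "integrable \<mu> (%x. (norm (f x))\<^sup>2 * w x + (norm (g x))\<^sup>2 * w x)"
   using Lw_int assms by (intro Bochner_Integration.integrable_add) auto
  show "AE x in \<mu>. norm (f x * cnj (g x) * of_real (w x)) <= norm ((norm (f x))\<^sup>2 * w x + (norm (g x))\<^sup>2 * w x)"
  proof (rule AE_I2)
   fix x
   have "norm (f x) * norm (g x) * w x <= ((norm (f x))\<^sup>2 + (norm (g x))\<^sup>2) * w x" by (intro mult_right_mono mult_le_sum_squares) simp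
   thus "norm (f x * cnj (g x) * of_real (w x)) <= norm ((norm (f x))\<^sup>2 * w x + (norm (g x))\<^sup>2 * w x)"
    by (simp add: norm_mult algebra_simps)
  qed
 qed simp
qed

text \<open>The product is split as |x|^(-s) on \<open>g\<close> and |x|^s on \<open>\<phi>\<close>.
  The bound shows that weighted square integrable functions define distributions.\<close>

lemma Lw_Cc_bound:
 assumes x: "(x::'k) ~= 0"
 shows "norm (g x * \<phi> x) <= (norm (g x))\<^sup>2 * w x + (norm (\<phi> x :: complex))\<^sup>2 * absval x powr (2 * s)"
proof -
 let ?r = "absval x powr (- s)" and ?t = "absval x powr s"
 have "?r * ?t = 1" using x by (simp add: powr_add[symmetric])
 hence "norm (g x * \<phi> x) = (norm (g x) * ?r) * (norm (\<phi> x) * ?t)" by (simp add: norm_mult mult_ac)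
 also have "... <= (norm (g x) * ?r)\<^sup>2 + (norm (\<phi> x) * ?t)\<^sup>2" by (rule mult_le_sum_squares)
 also have "?r\<^sup>2 = w x" using x by (simp add: powr_powr mult.commute flip: powr_numeral)
 hence "(norm (g x) * ?r)\<^sup>2 + (norm (\<phi> x) * ?t)\<^sup>2 = (norm (g x))\<^sup>2 * w x + (norm (\<phi> x))\<^sup>2 * ?t\<^sup>2" by (simp add: power_mult_distrib)
 also have "?t\<^sup>2 = absval x powr (2 * s)" using x by (simp add: powr_powr mult.commute flip: powr_numeral)
 finally show ?thesis .
qed

lemma Cc_dual_weight_integrable:
 assumes \<phi>: "\<phi> \<in> Cc"
 shows "integrable \<mu> (%x. (norm (\<phi> x))\<^sup>2 * absval x powr (2 * s))"
proof -
 have [measurable]: "\<phi> \<in> bm" by (rule Cc_measurable[OF \<phi>])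
 obtain a B where aB: "a ~= 0" "0 <= B" "!!x. norm (\<phi> x) <= B * indicator (cb 0 a) x" using \<phi> by (rule Cc_bounded) (rule that; assumption)
 show ?thesis
 proof (rule Bochner_Integration.integrable_bound)
  show "integrable \<mu> (%x. (B\<^sup>2 * absval a powr (2 * s)) * indicator (cb 0 a) x)"
   using integrable_indicator_cb[OF aB(1)] by (rule integrable_mult_right)
  show "AE x in \<mu>. norm ((norm (\<phi> x))\<^sup>2 * absval x powr (2 * s)) <= norm ((B\<^sup>2 * absval a powr (2 * s)) * indicator (cb 0 a) x)"
  proof (rule AE_I2)
   fix x
   show "norm ((norm (\<phi> x))\<^sup>2 * absval x powr (2 * s)) <= norm ((B\<^sup>2 * absval a powr (2 * s)) * indicator (cb 0 a) x)"
   proof (cases "x \<in> cb 0 a")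
    case True
    have "norm (\<phi> x) <= B" using aB(3)[of x] True by simp
    hence "(norm (\<phi> x))\<^sup>2 <= B\<^sup>2" by (intro power_mono) auto
    moreover have "absval x powr (2 * s) <= absval a powr (2 * s)" using True s by (intro powr_mono2) (auto simp: cb_def)
    ultimately have "(norm (\<phi> x))\<^sup>2 * absval x powr (2 * s) <= B\<^sup>2 * absval a powr (2 * s)" by (intro mult_mono) auto
    thus ?thesis using True by simp
   next
    case False
    hence "\<phi> x = 0" using aB(3)[of x] by simp
    thus ?thesis by simp
   qed
  qed
 qed simp
qed

lemma Lw_Cc_integrable:
 assumes g: "g \<in> Lw" and \<phi>: "\<phi> \<in> Cc"
 shows "integrable \<mu> (%x. g x * \<phi> x)"
proof -
 have [measurable]: "g \<in> bm" "\<phi> \<in> bm" using Lw_meas[OF g] Cc_measurable[OF \<phi>] by auto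
 show ?thesis
 proof (rule Bochner_Integration.integrable_bound)
  show "integrable \<mu> (%x. (norm (g x))\<^sup>2 * w x + (norm (\<phi> x))\<^sup>2 * absval x powr (2 * s))"
   using Lw_int[OF g] Cc_dual_weight_integrable[OF \<phi>] by (rule Bochner_Integration.integrable_add)
  show "AE x in \<mu>. norm (g x * \<phi> x) <= norm ((norm (g x))\<^sup>2 * w x + (norm (\<phi> x))\<^sup>2 * absval x powr (2 * s))" using AE_neq[of 0]
  proof eventually_elim
   case (elim x)
   thus ?case using Lw_Cc_bound[of x g \<phi>] by simp
  qed
 qed simp
qed

lemma given_by_unique:
 assumes "given_by K T g" "given_by K T h" shows "AE x in \<mu>. g x = h x"
proof -
 have [measurable]: "g \<in> bm" "h \<in> bm"
  and i: "!!\<phi>. \<phi> \<in> Cc ==> integrable \<mu> (%x. g x * \<phi> x)" "!!\<phi>. \<phi> \<in> Cc ==> integrable \<mu> (%x. h x * \<phi> x)"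
  and e: "fd g = fd h" using assms by (auto simp: given_by_def)
 have "AE x in \<mu>. g x - h x = 0"
 proof (rule AE_eq_0_Cc)
  fix \<phi> :: "'k => complex" assume \<phi>: "\<phi> \<in> Cc"
  show "integrable \<mu> (%x. (g x - h x) * \<phi> x)" using i[OF \<phi>] by (simp add: left_diff_distrib)
  have "(LI x. g x * \<phi> x) = (LI x. h x * \<phi> x)" using fun_cong[OF e, of \<phi>] \<phi> by (simp add: function_distribution_def as_distribution_def)
  thus "(LI x. (g x - h x) * \<phi> x) = 0" using i[OF \<phi>] by (simp add: left_diff_distrib)
 qed
 thus ?thesis by simp
qed

text \<open>The distribution with Fourier transform \<open>g\<close>, obtained by explicit
  inversion; this avoids the choice in \<open>fourier_function\<close>.\<close>

definition Dst :: "('k => complex) => ('k => complex) => complex" where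
 "Dst g = (%\<phi>. if \<phi> \<in> Cc then \<integral>x. g x * Finv \<phi> x \<partial>\<mu> else 0)"

lemma Dst_fourier: "\<phi> \<in> Cc ==> Dst g (FT \<phi>) = (LI x. g x * \<phi> x)" by (simp add: Dst_def fourier_Cc Finv_fourier)

lemma Finv_add: "\<phi> \<in> Cc ==> \<theta> \<in> Cc ==> Finv (%x. \<phi> x + \<theta> x) = (%x. Finv \<phi> x + Finv \<theta> x)"
 by (simp add: Finv_def fourier_add Cc_integrable distrib_left)

lemma Finv_cmult: "Finv (%x. c * \<phi> x) = (%x. c * Finv \<phi> x)" by (simp add: Finv_def fourier_cmult mult.left_commute)

lemma Dst_distribution: assumes g: "g \<in> Lw" shows "Dst g \<in> distributions" unfolding distributions_def algebraic_dual_def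
proof (intro CollectI conjI allI ballI impI)
 show "Dst g \<phi> = 0" if "\<phi> \<notin> Cc" for \<phi> using that by (simp add: Dst_def)
 show "Dst g (%x. \<phi> x + \<theta> x) = Dst g \<phi> + Dst g \<theta>" if "\<phi> \<in> Cc" "\<theta> \<in> Cc" for \<phi> \<theta>
  using that Lw_Cc_integrable[OF g] by (simp add: Dst_def Cc_add Finv_add distrib_left Finv_Cc)
 show "Dst g (%x. c * \<phi> x) = c * Dst g \<phi>" if "\<phi> \<in> Cc" for c \<phi> using that by (simp add: Dst_def Cc_cmult Finv_cmult mult.left_commute)
qed

lemma given_by_Dst: assumes g: "g \<in> Lw" shows "given_by K (fourier_distribution K (Dst g)) g" unfolding given_by_def
proof (intro conjI ballI)
 show "g \<in> bm" by (rule Lw_meas[OF g])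
 show "integrable \<mu> (%x. g x * \<phi> x)" if "\<phi> \<in> Cc" for \<phi> by (rule Lw_Cc_integrable[OF g that])
 show "fourier_distribution K (Dst g) = fd g"
  by (rule ext) (simp add: fourier_distribution_def function_distribution_def as_distribution_def Dst_fourier)
qed

lemma distribution_zero: "T \<in> distributions ==> \<phi> \<notin> Cc ==> T \<phi> = 0" by (simp add: distributions_def algebraic_dual_def)

text \<open>Every test function is a Fourier transform of one, so a distribution is determined by
  its values on transforms.\<close>

lemma distribution_eq_Dst:
 assumes T: "T \<in> distributions" and eq: "!!\<phi>. \<phi> \<in> Cc ==> T (FT \<phi>) = (LI x. g x * \<phi> x)"
 shows "T = Dst g"
proof
 fix \<phi> :: "'k => complex"
 show "T \<phi> = Dst g \<phi>"
 proof (cases "\<phi> \<in> Cc")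
  case True
  thus ?thesis using eq[OF Finv_Cc[OF True]] by (simp add: fourier_Finv Dst_def)
 next
  case False
  thus ?thesis using distribution_zero[OF T] by (simp add: Dst_def)
 qed
qed

lemma hilb_eq: "hilb K s = Dst ` Lw"
proof (intro equalityI subsetI)
 fix T assume "T \<in> hilb K s"
 then obtain g where T: "T \<in> distributions" and g: "given_by K (fourier_distribution K T) g"
  "integrable \<mu> (%x. (norm (g x))\<^sup>2 * w x)" by (auto simp: hilb_def)
 have "g \<in> Lw" using g by (simp add: Lw_def given_by_def)
 moreover have "T = Dst g"
 proof (rule distribution_eq_Dst[OF T])
  fix \<phi> :: "'k => complex" assume \<phi>: "\<phi> \<in> Cc"
  have "fourier_distribution K T \<phi> = fd g \<phi>" using g(1) by (simp add: given_by_def)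
  thus "T (FT \<phi>) = (LI x. g x * \<phi> x)" using \<phi> by (simp add: fourier_distribution_def function_distribution_def as_distribution_def)
 qed
 ultimately show "T \<in> Dst ` Lw" by blast
next
 fix T assume "T \<in> Dst ` Lw"
 then obtain g where "g \<in> Lw" "T = Dst g" by auto
 thus "T \<in> hilb K s" unfolding hilb_def using Dst_distribution given_by_Dst Lw_int by blast
qed

lemma fourier_function_Dst: assumes g: "g \<in> Lw" shows "AE x in \<mu>. fourier_function K (Dst g) x = g x"
 and fourier_function_Dst_meas: "fourier_function K (Dst g) \<in> bm"
proof -
 have *: "given_by K (fourier_distribution K (Dst g)) (fourier_function K (Dst g))" unfolding fourier_function_def
  by (rule someI[of "given_by K (fourier_distribution K (Dst g))", OF given_by_Dst[OF g]])
 show "AE x in \<mu>. fourier_function K (Dst g) x = g x" by (rule given_by_unique[OF * given_by_Dst[OF g]])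
 show "fourier_function K (Dst g) \<in> bm" using * by (simp add: given_by_def)
qed

lemma hilb_inner_Dst:
 assumes g: "g \<in> Lw" and h: "h \<in> Lw"
 shows "hilb_inner K s (Dst g) (Dst h) = (LI x. g x * cnj (h x) * of_real (w x))" unfolding hilb_inner_def
proof (rule integral_cong_AE)
 have [measurable]: "fourier_function K (Dst g) \<in> bm" "fourier_function K (Dst h) \<in> bm"
  "g \<in> bm" "h \<in> bm" using fourier_function_Dst_meas g h Lw_meas by auto
 show "(%x. fourier_function K (Dst g) x * cnj (fourier_function K (Dst h) x) * of_real (w x)) \<in> borel_measurable \<mu>"
  "(%x. g x * cnj (h x) * of_real (w x)) \<in> borel_measurable \<mu>" by simp_all
 show "AE x in \<mu>. fourier_function K (Dst g) x * cnj (fourier_function K (Dst h) x) * of_real (w x) = g x * cnj (h x) * of_real (w x)"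
  using fourier_function_Dst(1)[OF g] fourier_function_Dst(1)[OF h] by eventually_elim simp
qed

lemma Dst_add: assumes "g \<in> Lw" "h \<in> Lw" shows "Dst (%x. g x + h x) = (%\<phi>. Dst g \<phi> + Dst h \<phi>)"
 using Lw_Cc_integrable[OF assms(1)] Lw_Cc_integrable[OF assms(2)] by (intro ext) (simp add: Dst_def distrib_right Finv_Cc)

lemma Dst_cmult: "Dst (%x. c * g x) = (%\<phi>. c * Dst g \<phi>)" by (intro ext) (simp add: Dst_def mult.assoc)

lemma Dst_diff: assumes "g \<in> Lw" "h \<in> Lw" shows "Dst (%x. g x - h x) = (%\<phi>. Dst g \<phi> - Dst h \<phi>)"
 using Lw_Cc_integrable[OF assms(1)] Lw_Cc_integrable[OF assms(2)] by (intro ext) (simp add: Dst_def left_diff_distrib Finv_Cc)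

lemma Dst_zero: "Dst (%x. 0) = (%\<phi>. 0)" by (auto simp: Dst_def fun_eq_iff)

lemma zero_Lw: "(%x. 0) \<in> Lw" by (simp add: Lw_def)

lemma Dst_cong_AE:
 assumes "AE x in \<mu>. g x = h x" "g \<in> bm" "h \<in> bm"
 shows "Dst g = Dst h"
proof
 fix \<phi> :: "'k => complex"
 have [measurable]: "g \<in> bm" "h \<in> bm" using assms by auto
 have "(LI x. g x * Finv \<phi> x) = (LI x. h x * Finv \<phi> x)" if "\<phi> \<in> Cc"
 proof (rule integral_cong_AE)
  have [measurable]: "Finv \<phi> \<in> bm" by (intro Cc_measurable Finv_Cc that)
  show "(%x. g x * Finv \<phi> x) \<in> borel_measurable \<mu>" "(%x. h x * Finv \<phi> x) \<in> borel_measurable \<mu>" by simp_all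
  show "AE x in \<mu>. g x * Finv \<phi> x = h x * Finv \<phi> x" using assms(1) by eventually_elim simp
 qed
 thus "Dst g \<phi> = Dst h \<phi>" by (simp add: Dst_def)
qed

lemma Dst_eq_iff: assumes "g \<in> Lw" "h \<in> Lw" shows "Dst g = Dst h \<longleftrightarrow> (AE x in \<mu>. g x = h x)"
proof
 assume "Dst g = Dst h"
 thus "AE x in \<mu>. g x = h x" using given_by_unique given_by_Dst[OF assms(1)] given_by_Dst[OF assms(2)] by metis
qed (use assms Lw_meas in \<open>auto intro: Dst_cong_AE\<close>)

lemma hilb_norm_Dst:
 assumes g: "g \<in> Lw"
 shows "(hnrm (Dst g))\<^sup>2 = (LI x. (norm (g x))\<^sup>2 * w x)"
  and "hnrm (Dst g) >= 0"
  and "Re (hilb_inner K s (Dst g) (Dst g)) = (LI x. (norm (g x))\<^sup>2 * w x)"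
proof -
 have "hilb_inner K s (Dst g) (Dst g) = (LI x. of_real ((norm (g x))\<^sup>2 * w x))" unfolding hilb_inner_Dst[OF g g]
  by (rule Bochner_Integration.integral_cong[OF refl]) (simp add: complex_norm_square[symmetric])
 hence e: "hilb_inner K s (Dst g) (Dst g) = of_real (LI x. (norm (g x))\<^sup>2 * w x)" by (simp only: integral_complex_of_real)
 thus "Re (hilb_inner K s (Dst g) (Dst g)) = (LI x. (norm (g x))\<^sup>2 * w x)" by simp
 have "0 <= (LI x. (norm (g x))\<^sup>2 * w x)" by (intro Bochner_Integration.integral_nonneg) simp
 thus "(hnrm (Dst g))\<^sup>2 = (LI x. (norm (g x))\<^sup>2 * w x)"
  "hnrm (Dst g) >= 0" by (simp_all add: inner_norm_def e)
qed

lemma nn_norm_Dst: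
 assumes g: "g \<in> Lw"
 shows "(NI x. ennreal ((norm (g x))\<^sup>2 * w x)) = ennreal ((hnrm (Dst g))\<^sup>2)"
 unfolding hilb_norm_Dst(1)[OF g] by (intro nn_integral_eq_integral Lw_int[OF g]) simp

lemma AE_0_if_weighted:
 assumes g: "g \<in> Lw" and z: "(LI x. (norm (g x))\<^sup>2 * w x) = 0"
 shows "AE x in \<mu>. g x = 0"
proof -
 have "AE x in \<mu>. (norm (g x))\<^sup>2 * w x = 0" using z integral_nonneg_eq_0_iff_AE[OF Lw_int[OF g]] by simp
 thus ?thesis using AE_neq[of 0] by eventually_elim simp
qed

lemma hilbert_space_hilb: "hilbert_space (hilb K s) (hilb_inner K s)" unfolding hilbert_space_def
proof (intro conjI ballI allI impI)
 show "subspace_of_functions (hilb K s)" unfolding subspace_of_functions_def hilb_eq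
 proof (intro conjI ballI allI)
  show "(%x. 0) \<in> Dst ` Lw" using Dst_zero zero_Lw by (metis imageI)
  show "(%x. f x + g x) \<in> Dst ` Lw" if "f \<in> Dst ` Lw" "g \<in> Dst ` Lw" for f g
  proof -
   from that obtain f' g' where "f' \<in> Lw" "f = Dst f'" "g' \<in> Lw" "g = Dst g'" by auto
   hence "(%x. f x + g x) = Dst (%x. f' x + g' x)" "(%x. f' x + g' x) \<in> Lw" by (simp_all add: Dst_add Lw_add)
   thus ?thesis by simp
  qed
  show "(%x. c * f x) \<in> Dst ` Lw" if "f \<in> Dst ` Lw" for c f
  proof -
   from that obtain f' where "f' \<in> Lw" "f = Dst f'" by auto
   hence "(%x. c * f x) = Dst (%x. c * f' x)" "(%x. c * f' x) \<in> Lw" by (simp_all add: Dst_cmult Lw_cmult)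
   thus ?thesis by simp
  qed
 qed
next
 fix S T R assume "S \<in> hilb K s" "T \<in> hilb K s" "R \<in> hilb K s"
 then obtain f g h where eq: "S = Dst f" "T = Dst g" "R = Dst h" and L: "f \<in> Lw" "g \<in> Lw" "h \<in> Lw" unfolding hilb_eq by blast
 show "hilb_inner K s (%x. S x + T x) R = hilb_inner K s S R + hilb_inner K s T R"
  unfolding eq Dst_add[OF L(1,2), symmetric] hilb_inner_Dst[OF Lw_add[OF L(1,2)] L(3)]
   hilb_inner_Dst[OF L(1,3)] hilb_inner_Dst[OF L(2,3)]
   Bochner_Integration.integral_add[OF Lw_prod_integrable[OF L(1,3)] Lw_prod_integrable[OF L(2,3)], symmetric] by (simp only: distrib_right)
next
 fix c S R assume "S \<in> hilb K s" "R \<in> hilb K s"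
 then obtain f h where eq: "S = Dst f" "R = Dst h" and L: "f \<in> Lw" "h \<in> Lw" unfolding hilb_eq by blast
 show "hilb_inner K s (%x. c * S x) R = c * hilb_inner K s S R"
  unfolding eq Dst_cmult[symmetric] using L by (simp add: hilb_inner_Dst Lw_cmult mult.assoc)
next
 fix S R assume "S \<in> hilb K s" "R \<in> hilb K s"
 then obtain f h where eq: "S = Dst f" "R = Dst h" and L: "f \<in> Lw" "h \<in> Lw" unfolding hilb_eq by blast
 show "hilb_inner K s R S = cnj (hilb_inner K s S R)"
  unfolding eq using L by (simp add: hilb_inner_Dst mult_ac flip: Bochner_Integration.integral_cnj)
next
 fix S assume "S \<in> hilb K s" and nz: "S ~= (%x. 0)"
 then obtain f where eq: "S = Dst f" and L: "f \<in> Lw" unfolding hilb_eq by blast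
 have "(LI x. (norm (f x))\<^sup>2 * w x) ~= 0"
 proof
  assume "(LI x. (norm (f x))\<^sup>2 * w x) = 0"
  hence "Dst f = Dst (%x. 0)" using AE_0_if_weighted[OF L] Dst_eq_iff[OF L zero_Lw] by simp
  thus False using nz eq Dst_zero by simp
 qed
 moreover have "0 <= (LI x. (norm (f x))\<^sup>2 * w x)" by (intro Bochner_Integration.integral_nonneg) simp
 ultimately show "0 < Re (hilb_inner K s S S)" unfolding eq hilb_norm_Dst(3)[OF L] by linarith
next
 fix u :: "nat => ('k => complex) => complex"
 assume "(\<forall>n. u n \<in> hilb K s) \<and> (\<forall>e>0. \<exists>N. \<forall>m\<ge>N. \<forall>n\<ge>N. hnrm (%x. u m x - u n x) < e)"
 hence u: "!!n. u n \<in> hilb K s"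
  and c: "!!e. e > 0 ==> \<exists>N. \<forall>m\<ge>N. \<forall>n\<ge>N. hnrm (%x. u m x - u n x) < e" by auto
 have "\<exists>g. g \<in> Lw \<and> u n = Dst g" for n using u[of n] unfolding hilb_eq by blast
 then obtain g where g: "!!n. g n \<in> Lw" "!!n. u n = Dst (g n)" by metis
 have [measurable]: "g n \<in> bm" for n by (rule Lw_meas[OF g(1)])
 \<comment> \<open>The weight is absorbed into the measure, so that completeness becomes that of an
   ordinary L2 space.\<close>
 define M where "M = density \<mu> (%x. ennreal (w x))"
 have sM: "sets M = sets borel" by (simp add: M_def)
 have nnM: "(\<integral>\<^sup>+x. ennreal ((norm (f x))\<^sup>2) \<partial>M) = (NI x. ennreal ((norm (f x))\<^sup>2 * w x))"
  if [measurable]: "f \<in> bm" for f :: "'k => complex"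
  unfolding M_def by (subst nn_integral_density) (simp_all add: ennreal_mult mult.commute)
 have nrm: "(L2d M (g m) (g n)) = ennreal ((hnrm (%x. u m x - u n x))\<^sup>2)" for m n
  using nnM[of "%x. g m x - g n x"] nn_norm_Dst[OF Lw_diff[OF g(1) g(1)], of m n] by (simp add: g(2) Dst_diff[OF g(1) g(1)])
 have "\<exists>h. h \<in> borel_measurable M \<and>
  (\<forall>e>0. \<exists>N. \<forall>n\<ge>N. (L2d M (g n) h) <= ennreal e)"
 proof (rule L2_complete)
  show "g n \<in> borel_measurable M" for n by (simp add: measurable_cong_sets[OF sM refl])
  fix e :: real assume e: "e > 0"
  then obtain N where N: "\<forall>m\<ge>N. \<forall>n\<ge>N. hnrm (%x. u m x - u n x) < sqrt e" using c[of "sqrt e"] by auto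
  have "(L2d M (g m) (g n)) < ennreal e" if "N <= m" "N <= n" for m n
  proof -
   have "0 <= hnrm (%x. u m x - u n x)" using hilb_norm_Dst(2)[OF Lw_diff[OF g(1) g(1)], of m n] by (simp add: g(2) Dst_diff[OF g(1) g(1)])
   hence "(hnrm (%x. u m x - u n x))\<^sup>2 < (sqrt e)\<^sup>2" using N that by (intro power_strict_mono) auto
   thus ?thesis unfolding nrm using e by (simp add: ennreal_lessI)
  qed
  thus "\<exists>N. \<forall>m\<ge>N. \<forall>n\<ge>N. (L2d M (g m) (g n)) < ennreal e" by auto
 qed
 then obtain h where "h \<in> borel_measurable M"
  and h: "!!e. e > 0 ==> \<exists>N. \<forall>n\<ge>N. (L2d M (g n) h) <= ennreal e" by auto
 hence hm[measurable]: "h \<in> bm" by (simp add: measurable_cong_sets[OF sM refl])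
 have diffL: "(%x. g n x - h x) \<in> Lw" if "(L2d M (g n) h) <= ennreal e" for n e unfolding Lw_def using that nnM[of "%x. g n x - h x"]
  by (auto intro!: integrableI_bounded simp: le_less_trans[OF _ ennreal_less_top])
 obtain N1 where N1: "(L2d M (g N1) h) <= ennreal 1" using h[of 1] by auto
 have hL: "h \<in> Lw" using Lw_diff[OF g(1)[of N1] diffL[OF N1]] by simp
 show "\<exists>f\<in>hilb K s. (%n. hnrm (%x. u n x - f x)) \<longlonglongrightarrow> 0"
 proof (intro bexI[of _ "Dst h"] LIMSEQ_I)
  show "Dst h \<in> hilb K s" using hL by (simp add: hilb_eq)
  fix r :: real assume r: "r > 0"
  then obtain N where N: "\<forall>n\<ge>N. (L2d M (g n) h) <= ennreal ((r / 2)\<^sup>2)" using h[of "(r / 2)\<^sup>2"] by auto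
  have "norm (hnrm (%x. u n x - Dst h x) - 0) < r" if "n >= N" for n
  proof -
   have d: "(%x. g n x - h x) \<in> Lw" by (rule Lw_diff[OF g(1) hL])
   have eq: "(%x. u n x - Dst h x) = Dst (%x. g n x - h x)" by (simp add: g(2) Dst_diff[OF g(1) hL])
   have "ennreal ((hnrm (Dst (%x. g n x - h x)))\<^sup>2) = (L2d M (g n) h)" using nnM[of "%x. g n x - h x"] nn_norm_Dst[OF d] by simp
   also have "... <= ennreal ((r / 2)\<^sup>2)" using N that by blast
   finally have "(hnrm (Dst (%x. g n x - h x)))\<^sup>2 <= (r / 2)\<^sup>2" by (subst (asm) ennreal_le_iff) simp_all
   hence "hnrm (Dst (%x. g n x - h x)) <= r / 2" by (rule power2_le_imp_le) (use r in simp)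
   thus ?thesis unfolding eq using hilb_norm_Dst(2)[OF d] r by simp
  qed
  thus "\<exists>N. \<forall>n\<ge>N. norm (hnrm (%x. u n x - Dst h x) - 0) < r" by auto
 qed
qed

sublocale hspace "hilb K s" "hilb_inner K s" by unfold_locales (rule hilbert_space_hilb)

text \<open>For \<open>s < 1/2\<close> the weight is integrable near 0. For \<open>s = 1/2\<close>
  it is |x|^(-1), which is not, but a locally constant function that vanishes at 0 vanishes near
  0.\<close>

lemma Cc_Lw: assumes \<phi>: "\<phi> \<in> Cc" and z: "s < 1/2 \<or> \<phi> 0 = 0" shows "\<phi> \<in> Lw"
proof -
 have [measurable]: "\<phi> \<in> bm" by (rule Cc_measurable[OF \<phi>])
 obtain a B where aB: "a ~= 0" "0 <= B" "!!x. norm (\<phi> x) <= B * indicator (cb 0 a) x" using \<phi> by (rule Cc_bounded) (rule that; assumption)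
 have \<phi>0: "\<phi> x = 0" if "x \<notin> cb 0 a" for x using aB(3)[of x] that by simp
 have sq: "(norm (\<phi> x))\<^sup>2 <= B\<^sup>2 * indicator (cb 0 a) x" for x using power_mono[OF aB(3)[of x], of 2] by (auto simp: indicator_def)
 have "(NI x. ennreal ((norm (\<phi> x))\<^sup>2 * w x)) < \<infinity>"
 proof (cases "s < 1/2")
  case True
  have "(NI x. ennreal ((norm (\<phi> x))\<^sup>2 * w x)) <= (NI x. ennreal (B\<^sup>2) * (ennreal (w x) * indicator (cb 0 a) x))"
  proof (intro nn_integral_mono)
   fix x
   have "(norm (\<phi> x))\<^sup>2 * w x <= B\<^sup>2 * indicator (cb 0 a) x * w x" by (intro mult_right_mono sq) simp
   thus "ennreal ((norm (\<phi> x))\<^sup>2 * w x) <= ennreal (B\<^sup>2) * (ennreal (w x) * indicator (cb 0 a) x)"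
    using \<phi>0[of x] by (cases "x \<in> cb 0 a") (simp_all add: ennreal_mult'[symmetric] ennreal_leI)
  qed
  also have "... = ennreal (B\<^sup>2) * (NI x. ennreal (w x) * indicator (cb 0 a) x)" by (intro nn_integral_cmult) simp
  also have "... < \<infinity>" using nn_integral_powr_near[of "- 2 * s" a] True aB(1) by (simp add: ennreal_mult_less_top)
  finally show ?thesis .
 next
  case False
  hence "\<phi> 0 = 0" using z by simp
  obtain a' b where b: "b ~= 0" "!!x y. av y <= av b ==> \<phi> (x + y) = \<phi> x" using \<phi> by (rule CcE) (rule that; assumption)
  have z: "\<phi> x = 0" if "av x <= av b" for x using b(2)[OF that, of 0] \<open>\<phi> 0 = 0\<close> by simp
  have "(NI x. ennreal ((norm (\<phi> x))\<^sup>2 * w x)) <= (NI x. ennreal (B\<^sup>2 * av b powr (- 2 * s)) * indicator (cb 0 a) x)"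
  proof (intro nn_integral_mono)
   fix x
   show "ennreal ((norm (\<phi> x))\<^sup>2 * w x) <= ennreal (B\<^sup>2 * av b powr (- 2 * s)) * indicator (cb 0 a) x"
   proof (cases "av x <= av b \<or> x \<notin> cb 0 a")
    case True
    hence "\<phi> x = 0" using z aB(3)[of x] by auto
    thus ?thesis by simp
   next
    case False
    hence "w x <= av b powr (- 2 * s)" using b(1) s by (intro powr_mono2') auto
    hence "(norm (\<phi> x))\<^sup>2 * w x <= B\<^sup>2 * av b powr (- 2 * s)" using sq[of x] False by (intro mult_mono) auto
    thus ?thesis using False by (simp add: ennreal_leI)
   qed
  qed
  also have "... < \<infinity>" using emeasure_cb[OF aB(1)] by (subst nn_integral_cmult) (auto simp: ennreal_mult_less_top)
  finally show ?thesis .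
 qed
 hence "integrable \<mu> (%x. (norm (\<phi> x))\<^sup>2 * w x)" by (intro integrableI_bounded) simp_all
 thus ?thesis by (simp add: Lw_def)
qed

text \<open>A vector orthogonal to the indicators of balls missing 0 vanishes. The condition
  \<open>\<theta> 0 = 0\<close> accommodates \<open>s = 1/2\<close>; for the inverse transform of
  \<open>\<theta>\<close> it means integral 0.\<close>

lemma Dst_dense:
 assumes X: "subspace_of_functions X" "X \<subseteq> hilb K s"
  and Cc: "!!\<theta>. \<theta> \<in> Cc ==> \<theta> 0 = 0 ==> Dst \<theta> \<in> X"
  and T: "T \<in> hilb K s" and e: "0 < e"
 shows "\<exists>x\<in>X. dst T x < e"
proof (rule dense_if_orthogonal_trivial[OF X _ T e])
 fix R assume R: "R \<in> hilb K s" and orth: "!!x. x \<in> X ==> hilb_inner K s R x = 0"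
 then obtain h where h: "h \<in> Lw" "R = Dst h" unfolding hilb_eq by blast
 have int: "integrable \<mu> (%y. indicator (cb x a) y * (h y * of_real (w y)))"
  and zero: "(LI y. indicator (cb x a) y * (h y * of_real (w y))) = 0"
  if a: "a ~= 0" "av a < av x" for x a
 proof -
  let ?i = "%y. indicator (cb x a) y :: complex"
  have i: "?i \<in> Cc" "?i 0 = 0" using Cc_indicator[OF a(1)] a(2) by (auto simp: cb_def)
  have iL: "?i \<in> Lw" using Cc_Lw[OF i(1)] i(2) by simp
  have eq: "(%y. h y * cnj (?i y) * of_real (w y)) = (%y. ?i y * (h y * of_real (w y)))" by (auto simp: indicator_def)
  show "integrable \<mu> (%y. ?i y * (h y * of_real (w y)))" using Lw_prod_integrable[OF h(1) iL] unfolding eq .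
  show "(LI y. ?i y * (h y * of_real (w y))) = 0" using orth[OF Cc[OF i]] unfolding h(2) hilb_inner_Dst[OF h(1) iL] eq .
 qed
 have "AE x in \<mu>. h x * of_real (w x) = 0" by (rule AE_eq_0_punctured[OF int zero])
 hence "AE x in \<mu>. h x = 0" using AE_neq[of 0] by eventually_elim simp
 thus "R = (%x. 0)" using Dst_eq_iff[OF h(1) zero_Lw] h(2) Dst_zero by simp
qed

text \<open>Evaluation at \<open>\<phi>\<close> is the inner product with an explicit vector, so
  Cauchy-Schwarz applies. Continuity of evaluations lets identities pass from smooth vectors to the
  completion.\<close>

lemma Dst_Cc_bounded:
 assumes \<phi>: "\<phi> \<in> Cc"
 shows "\<exists>C\<ge>0. \<forall>T\<in>hilb K s. norm (T \<phi>) <= C * nrm T"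
proof -
 define \<theta> where "\<theta> x = cnj (Finv \<phi> x) * of_real (absval x powr (2 * s))" for x
 have F: "Finv \<phi> \<in> Cc" by (rule Finv_Cc[OF \<phi>])
 have [measurable]: "Finv \<phi> \<in> bm" by (rule Cc_measurable[OF F])
 have "(norm (\<theta> x))\<^sup>2 * w x = (norm (Finv \<phi> x))\<^sup>2 * absval x powr (2 * s)" for x
 proof (cases "x = 0")
  case False
  have "(absval x powr (2 * s))\<^sup>2 * w x = absval x powr (2 * s)" using False by (simp add: powr_powr powr_add[symmetric] flip: powr_numeral)
  thus ?thesis by (simp add: \<theta>_def norm_mult power_mult_distrib mult.assoc)
 qed simp
 hence \<theta>: "\<theta> \<in> Lw" using Cc_dual_weight_integrable[OF F] by (simp add: Lw_def) (simp add: \<theta>_def[abs_def])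
 have "norm (T \<phi>) <= nrm (Dst \<theta>) * nrm T" if T: "T \<in> hilb K s" for T
 proof -
  obtain g where g: "g \<in> Lw" "T = Dst g" using T unfolding hilb_eq by blast
  have [measurable]: "g \<in> bm" by (rule Lw_meas[OF g(1)])
  have "T \<phi> = (LI x. g x * Finv \<phi> x)" by (simp add: g(2) Dst_def \<phi>)
  also have "... = (LI x. g x * cnj (\<theta> x) * of_real (w x))"
  proof (rule integral_cong_AE)
   show "(%x. g x * Finv \<phi> x) \<in> borel_measurable \<mu>" by simp
   show "(%x. g x * cnj (\<theta> x) * of_real (w x)) \<in> borel_measurable \<mu>" unfolding \<theta>_def by simp
   show "AE x in \<mu>. g x * Finv \<phi> x = g x * cnj (\<theta> x) * of_real (w x)" using AE_neq[of 0]
   proof eventually_elim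
    case (elim x)
    have "absval x powr (2 * s) * w x = 1" using elim by (simp add: powr_add[symmetric])
    hence "of_real (absval x powr (2 * s)) * of_real (w x) = (1::complex)" by (metis of_real_1 of_real_mult)
    thus ?case by (simp add: \<theta>_def mult.assoc)
   qed
  qed
  also have "... = hilb_inner K s T (Dst \<theta>)" by (simp only: g(2) hilb_inner_Dst[OF g(1) \<theta>])
  finally show ?thesis using cauchy_schwarz[OF T, of "Dst \<theta>"] \<theta> by (simp add: hilb_eq mult.commute)
 qed
 moreover have "0 <= nrm (Dst \<theta>)" by (rule hilb_norm_Dst(2)[OF \<theta>])
 ultimately show ?thesis by blast
qed

end

section \<open>The group PGL(2) and induced functions\<close>

definition mt :: "'k::zero => 'k => 'k => 'k => 'k^2^2" where
 "mt a b c d = vector [vector [a, b], vector [c, d]]"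

lemma mt_nth [simp]: "mt a b c d $ 1 $ 1 = a" "mt a b c d $ 1 $ 2 = b" "mt a b c d $ 2 $ 1 = c" "mt a b c d $ 2 $ 2 = d"
 by (simp_all add: mt_def)

lemma mt_eta: "mt (A $ 1 $ 1) (A $ 1 $ 2) (A $ 2 $ 1) (A $ 2 $ 2) = A" by (simp add: vec_eq_iff forall_2)

lemma mt_cases: obtains a b c d where "A = mt a b c d" using mt_eta[of A] by metis

lemma mt_eq_iff: "mt a b c d = mt a' b' c' d' \<longleftrightarrow> a = a' \<and> b = b' \<and> c = c' \<and> d = d'" by (auto simp: vec_eq_iff forall_2)

lemma det_mt [simp]: "det (mt a b c d :: 'k::comm_ring_1^2^2) = a * d - b * c" by (simp add: det_2)

lemma mult_mt [simp]: "mt a b c d ** mt a' b' c' d' =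
  (mt (a * a' + b * c') (a * b' + b * d') (c * a' + d * c') (c * b' + d * d') :: 'k::semiring_1^2^2)"
 by (simp add: vec_eq_iff forall_2 matrix_matrix_mult_def sum_2)

lemma mat_mt: "(mat k :: 'k::semiring_1^2^2) = mt k 0 0 k" by (simp add: vec_eq_iff forall_2 mat_def)

text \<open>The adjugate, which represents the inverse in PGL(2) without any division.\<close>

definition adj :: "'k::ab_group_add^2^2 => 'k^2^2" where
 "adj A = mt (A $ 2 $ 2) (- (A $ 1 $ 2)) (- (A $ 2 $ 1)) (A $ 1 $ 1)"

lemma adj_mt [simp]: "adj (mt a b c d) = mt d (- b) (- c) a" by (simp add: adj_def)
lemma adj_adj [simp]: "adj (adj A) = A" by (cases A rule: mt_cases) simp
lemma det_adj [simp]: "det (adj A) = det (A :: 'k::comm_ring_1^2^2)" by (cases A rule: mt_cases) (simp add: mult.commute)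
lemma adj_mult: "adj A ** A = mat (det (A :: 'k::comm_ring_1^2^2))" by (cases A rule: mt_cases) (simp add: mat_mt mt_eq_iff algebra_simps)
lemma mult_adj: "A ** adj A = mat (det (A :: 'k::comm_ring_1^2^2))" by (cases A rule: mt_cases) (simp add: mat_mt mt_eq_iff algebra_simps)

lemma GL2_simps [simp]: "carrier GL2 = {A. det A ~= 0}" "monoid.mult GL2 = (**)" "one GL2 = mat 1" by (simp_all add: GL2_def)

lemma group_GL2: "group (GL2 :: ('k::field^2^2) monoid)"
proof (rule groupI)
 fix A assume A: "A \<in> carrier (GL2 :: ('k^2^2) monoid)"
 have "mat (1 / det A) ** adj A ** A = mat 1" using A by (simp add: matrix_mul_assoc[symmetric] adj_mult) (simp add: mat_mt)
 moreover have "det (mat (1 / det A) ** adj A) ~= 0" using A by (simp add: det_mul) (simp add: mat_mt)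
 ultimately show "\<exists>B\<in>carrier GL2. B \<otimes>\<^bsub>GL2\<^esub> A = \<one>\<^bsub>GL2\<^esub>" by auto
qed (simp_all add: det_mul matrix_mul_assoc)

lemma mat_commute: "mat k ** A = (A :: 'k::comm_ring_1^2^2) ** mat k" by (cases A rule: mt_cases) (simp add: mat_mt mt_eq_iff mult.commute)

lemma mat_mult_mat: "mat k ** mat l = (mat (k * l) :: 'k::comm_ring_1^2^2)" by (simp add: mat_mt)

lemma det_mat2 [simp]: "det (mat k :: 'k::comm_ring_1^2^2) = k\<^sup>2" by (simp add: mat_mt power2_eq_square)

lemma normal_scalars: "scalar_matrices \<lhd> (GL2 :: ('k::field^2^2) monoid)"
proof -
 interpret G: group "GL2 :: ('k^2^2) monoid" by (rule group_GL2)
 have inv: "inv\<^bsub>GL2\<^esub> (mat c :: 'k^2^2) = mat (inverse c)" if "c ~= 0" for c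
  using that by (intro G.inv_equality) (simp_all add: mat_mult_mat)
 show ?thesis
 proof (rule G.normalI)
  show "subgroup scalar_matrices (GL2 :: ('k^2^2) monoid)"
  proof (rule G.subgroupI)
   show "scalar_matrices \<subseteq> carrier (GL2 :: ('k^2^2) monoid)" by (auto simp: scalar_matrices_def)
   have "mat 1 \<in> (scalar_matrices :: ('k^2^2) set)" unfolding scalar_matrices_def by (auto intro: exI[of _ 1])
   thus "(scalar_matrices :: ('k^2^2) set) ~= {}" by auto
   fix A :: "'k^2^2" assume "A \<in> scalar_matrices"
   then obtain c where c: "c ~= 0" "A = mat c" by (auto simp: scalar_matrices_def)
   thus "inv\<^bsub>GL2\<^esub> A \<in> scalar_matrices" by (auto simp: scalar_matrices_def inv)
   fix B :: "'k^2^2" assume "B \<in> scalar_matrices"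
   then obtain d where d: "d ~= 0" "B = mat d" by (auto simp: scalar_matrices_def)
   thus "A \<otimes>\<^bsub>GL2\<^esub> B \<in> scalar_matrices" using c by (auto simp: scalar_matrices_def mat_mult_mat)
  qed
  show "\<forall>x\<in>carrier GL2. scalar_matrices #>\<^bsub>GL2\<^esub> x = x <#\<^bsub>GL2\<^esub> (scalar_matrices :: ('k^2^2) set)"
   by (auto simp: r_coset_def l_coset_def scalar_matrices_def mat_commute)
 qed
qed

interpretation PGL2: group "PGL2 :: ('k::field^2^2) set monoid" unfolding PGL2_def by (rule normal.factorgroup_is_group[OF normal_scalars])

lemma mem_pgl_class: "B \<in> pgl_class A \<longleftrightarrow> (\<exists>c. c ~= 0 \<and> B = mat c ** A)" by (auto simp: pgl_class_def r_coset_def scalar_matrices_def)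

lemma pgl_class_self: "A \<in> pgl_class A" unfolding mem_pgl_class by (intro exI[of _ 1]) simp

lemma pgl_class_scale: assumes c: "c ~= 0" shows "pgl_class (mat c ** A) = pgl_class (A :: 'k::field^2^2)"
proof (rule Set.set_eqI, rule iffI)
 fix B
 { assume "B \<in> pgl_class (mat c ** A)"
  then obtain k where "k ~= 0" "B = mat k ** (mat c ** A)" by (auto simp: mem_pgl_class)
  thus "B \<in> pgl_class A" using c unfolding mem_pgl_class by (intro exI[of _ "k * c"]) (simp add: matrix_mul_assoc mat_mult_mat) }
 { assume "B \<in> pgl_class A"
  then obtain k where "k ~= 0" "B = mat k ** A" by (auto simp: mem_pgl_class)
  thus "B \<in> pgl_class (mat c ** A)" using c unfolding mem_pgl_class by (intro exI[of _ "k / c"]) (simp add: matrix_mul_assoc mat_mult_mat) }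
qed

lemma pgl_class_eqD: "pgl_class A = pgl_class B ==> \<exists>c. c ~= 0 \<and> B = mat c ** A" using pgl_class_self[of B] mem_pgl_class[of B A] by simp

lemma carrier_PGL2: "carrier PGL2 = pgl_class ` {A :: 'k::field^2^2. det A ~= 0}"
 by (simp add: PGL2_def carrier_FactGroup pgl_class_def[abs_def])

lemma pgl_class_in [simp]: "det A ~= 0 ==> pgl_class (A :: 'k::field^2^2) \<in> carrier PGL2" by (simp add: carrier_PGL2)

lemma PGL2_cases:
 assumes "g \<in> carrier PGL2" obtains A :: "'k::field^2^2" where "det A ~= 0" "g = pgl_class A" using assms by (auto simp: carrier_PGL2)

lemma pgl_class_mult:
 "det A ~= 0 ==> det B ~= 0 ==> pgl_class A \<otimes>\<^bsub>PGL2\<^esub> pgl_class B = pgl_class (A ** B :: 'k::field^2^2)"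
 using normal.rcos_sum[OF normal_scalars, of A B] by (simp add: PGL2_def pgl_class_def)

lemma pgl_one: "\<one>\<^bsub>PGL2\<^esub> = pgl_class (mat 1 :: 'k::field^2^2)"
proof -
 have "(scalar_matrices :: ('k^2^2) set) = pgl_class (mat 1)" by (auto simp: scalar_matrices_def mem_pgl_class)
 thus ?thesis by (simp add: PGL2_def)
qed

lemma pgl_inv: assumes "det A ~= 0" shows "inv\<^bsub>PGL2\<^esub> (pgl_class A) = pgl_class (adj A :: 'k::field^2^2)"
proof (rule PGL2.inv_equality)
 have "pgl_class (adj A ** A) = pgl_class (mat (det A) ** mat 1)" by (simp add: adj_mult)
 also have "... = pgl_class (mat 1)" using assms by (rule pgl_class_scale)
 finally show "pgl_class (adj A) \<otimes>\<^bsub>PGL2\<^esub> pgl_class A = \<one>\<^bsub>PGL2\<^esub>" using assms by (simp add: pgl_class_mult pgl_one)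
qed (use assms in auto)

text \<open>Left translation by the inverse of a class multiplies the argument by the matrix itself,
  so elements are best written as inverses.\<close>

lemma PGL2_cases_inv:
 assumes "g \<in> carrier PGL2"
 obtains A :: "'k::field^2^2" where "det A ~= 0" "g = inv\<^bsub>PGL2\<^esub> (pgl_class A)"
proof -
 obtain B :: "'k^2^2" where "det B ~= 0" "g = pgl_class B" using assms by (rule PGL2_cases)
 thus ?thesis using that[of "adj B"] by (simp add: pgl_inv)
qed

lemma openin_PGL2:
 "openin PGL2_topology U \<longleftrightarrow> U \<subseteq> carrier PGL2 \<and> open {A :: 'k::{field, topological_space}^2^2. det A ~= 0 \<and> pgl_class A \<in> U}"
proof -
 have "istopology (%U. U \<subseteq> carrier PGL2 \<and> open {A :: 'k^2^2. det A ~= 0 \<and> pgl_class A \<in> U})" unfolding istopology_def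
 proof (intro conjI allI impI)
  fix S T :: "('k^2^2) set set"
  assume S: "S \<subseteq> carrier PGL2 \<and> open {A. det A ~= 0 \<and> pgl_class A \<in> S}"
   and T: "T \<subseteq> carrier PGL2 \<and> open {A. det A ~= 0 \<and> pgl_class A \<in> T}"
  have "{A. det A ~= 0 \<and> pgl_class A \<in> S \<inter> T} = {A. det A ~= 0 \<and> pgl_class A \<in> S} \<inter> {A. det A ~= 0 \<and> pgl_class A \<in> T}" by auto
  thus "open {A. det A ~= 0 \<and> pgl_class A \<in> S \<inter> T}" using S T by (simp add: open_Int)
  show "S \<inter> T \<subseteq> carrier PGL2" using S by auto
 next
  fix K :: "('k^2^2) set set set"
  assume K: "\<forall>S\<in>K. S \<subseteq> carrier PGL2 \<and> open {A. det A ~= 0 \<and> pgl_class A \<in> S}"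
  have "{A. det A ~= 0 \<and> pgl_class A \<in> \<Union>K} = (\<Union>S\<in>K. {A. det A ~= 0 \<and> pgl_class A \<in> S})" by auto
  thus "open {A. det A ~= 0 \<and> pgl_class A \<in> \<Union>K}" using K by (simp add: open_UN)
  show "\<Union>K \<subseteq> carrier PGL2" using K by auto
 qed
 thus ?thesis unfolding PGL2_topology_def by simp
qed

lemma continuous_on_det2: "continuous_on UNIV (det :: 'k::nonarch_local_field^2^2 => 'k)"
 unfolding det_2[abs_def] by (intro continuous_intros)

lemma open_det_nz: "open {A :: 'k::nonarch_local_field^2^2. det A ~= 0}"
proof -
 have "open (det -` (- {0}) :: ('k^2^2) set)" by (rule open_vimage[OF _ continuous_on_det2]) auto
 moreover have "det -` (- {0}) = {A :: 'k^2^2. det A ~= 0}" by auto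
 ultimately show ?thesis by simp
qed

lemma continuous_on_mult2: "continuous_on UNIV (%A :: 'k::nonarch_local_field^2^2. B ** A)"
 unfolding matrix_matrix_mult_def sum_2 by (intro continuous_intros)

section \<open>Locally constant functions on PGL(2) and the induced space\<close>

definition pgl_lc :: "(('k::{field, topological_space}^2^2) set => complex) => bool" where
 "pgl_lc F \<longleftrightarrow> (\<forall>g\<in>carrier PGL2. \<exists>U. openin PGL2_topology U \<and> g \<in> U \<and> (\<forall>h\<in>U. F h = F g))"

lemma pgl_lcD:
 assumes F: "pgl_lc F" and A: "det (A :: 'k::nonarch_local_field^2^2) ~= 0"
 shows "\<exists>N. open N \<and> A \<in> N \<and> (\<forall>B\<in>N. det B ~= 0 \<and> F (pgl_class B) = F (pgl_class A))"
proof -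
 from F A obtain U where U: "openin PGL2_topology U" "pgl_class A \<in> U" "\<forall>h\<in>U. F h = F (pgl_class A)"
  unfolding pgl_lc_def using pgl_class_in by metis
 have o: "open {B :: 'k^2^2. det B ~= 0 \<and> pgl_class B \<in> U}" using U(1) by (simp only: openin_PGL2)
 show ?thesis
 proof (intro exI[of _ "{B. det B ~= 0 \<and> pgl_class B \<in> U}"] conjI ballI o)
  show "A \<in> {B. det B ~= 0 \<and> pgl_class B \<in> U}" using A U(2) by simp
  fix B assume "B \<in> {B. det B ~= 0 \<and> pgl_class B \<in> U}"
  thus "det B ~= 0" "F (pgl_class B) = F (pgl_class A)" using U(3) by simp_all
 qed
qed

lemma pgl_lcI:
 fixes F :: "('k::nonarch_local_field^2^2) set => complex"
 assumes "!!A. det A ~= 0 ==> \<exists>N. open N \<and> A \<in> N \<and> (\<forall>B\<in>N. det B ~= 0 --> F (pgl_class B) = F (pgl_class A))"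
 shows "pgl_lc F" unfolding pgl_lc_def
proof
 fix g :: "('k^2^2) set" assume g: "g \<in> carrier PGL2"
 define U where "U = {X \<in> carrier PGL2. F X = F g}"
 let ?S = "{B :: 'k^2^2. det B ~= 0 \<and> pgl_class B \<in> U}"
 have "\<exists>T. open T \<and> A \<in> T \<and> T \<subseteq> ?S" if "A \<in> ?S" for A
 proof -
  have A: "det A ~= 0" "F (pgl_class A) = F g" using that by (auto simp: U_def)
  from assms[OF A(1)] obtain N where N: "open N" "A \<in> N"
   "\<forall>B\<in>N. det B ~= 0 --> F (pgl_class B) = F (pgl_class A)" by (elim exE conjE)
  have "N \<inter> {B. det B ~= 0} \<subseteq> ?S" using N(3) A by (auto simp: U_def)
  thus ?thesis using N(1,2) A(1) open_det_nz by (intro exI[of _ "N \<inter> {B. det B ~= 0}"]) auto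
 qed
 hence "open ?S" by (subst open_subopen) blast
 thus "\<exists>U. openin PGL2_topology U \<and> g \<in> U \<and> (\<forall>h\<in>U. F h = F g)" by (intro exI[of _ U]) (use g in \<open>auto simp: openin_PGL2 U_def\<close>)
qed

lemma Ind_iff: "F \<in> Ind K chi \<sigma> \<longleftrightarrow> F \<in> extensional (carrier PGL2) \<and> pgl_lc F \<and>
  (\<forall>A a b. det A ~= 0 --> a ~= 0 --> F (pgl_class (A ** mt a b 0 1)) = inverse (mult_char K chi (\<sigma> + 1/2) a) * F (pgl_class A))"
proof -
 have "F (pgl_class A \<otimes>\<^bsub>PGL2\<^esub> borel_elt a b) = F (pgl_class (A ** mt a b 0 1))" if "det A ~= 0" "a ~= 0" for A a b
  using pgl_class_mult[of A "mt a b 0 1"] that by (simp add: borel_elt_def mt_def[symmetric])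
 thus ?thesis unfolding Ind_def pgl_lc_def carrier_PGL2 by auto
qed

lemma nbar_mt: "nbar x = pgl_class (mt 1 0 x 1)" by (simp add: nbar_def mt_def)

text \<open>On the big cell, where the upper left entry is nonzero, a matrix is a scalar times a
  lower unipotent times an upper triangular matrix with lower right entry 1, and equivariance
  applies.\<close>

lemma Ind_class:
 assumes F: "F \<in> Ind K chi \<sigma>" and nz: "a * d - b * c ~= 0" "a ~= 0"
 shows "F (pgl_class (mt a b c d)) = inverse (mult_char K chi (\<sigma> + 1/2) (a\<^sup>2 / (a * d - b * c))) * nbar_restrict F (c / a)"
proof -
 let ?D = "a * d - b * c"
 have 1: "mt a b c d = mat (?D / a) ** (mt 1 0 (c / a) 1 ** mt (a\<^sup>2 / ?D) (a * b / ?D) 0 1)"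
 proof -
  have e: "?D / a * (a\<^sup>2 / ?D) = a" "?D / a * (a * b / ?D) = b" using nz by (simp_all add: power2_eq_square)
  have "?D / a * (c / a * (a\<^sup>2 / ?D)) = c / a * (?D / a * (a\<^sup>2 / ?D))" by (rule mult.left_commute)
  also have "... = c" unfolding e(1) using nz(2) by simp
  finally have e3: "?D / a * (c / a * (a\<^sup>2 / ?D)) = c" .
  have "?D / a * (c / a * (a * b / ?D) + 1) = c / a * (?D / a * (a * b / ?D)) + ?D / a"
   by (simp only: distrib_left mult.left_commute mult_1_right)
  also have "... = d" unfolding e(2) using nz(2) by (simp add: field_simps)
  finally have e4: "?D / a * (c / a * (a * b / ?D) + 1) = d" .
  show ?thesis unfolding mat_mt mult_mt mult_zero_left mult_zero_right add_0_left add_0_right mult_1_left mult_1_right e e3 e4 ..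
 qed
 have "F (pgl_class (mt a b c d)) = F (pgl_class (mt 1 0 (c / a) 1 ** mt (a\<^sup>2 / ?D) (a * b / ?D) 0 1))"
  unfolding 1 using nz by (subst pgl_class_scale) simp_all
 also have "... = inverse (mult_char K chi (\<sigma> + 1/2) (a\<^sup>2 / ?D)) * F (pgl_class (mt 1 0 (c / a) 1))"
 proof -
  have "det (mt 1 0 (c / a) 1) ~= 0" "a\<^sup>2 / ?D ~= 0" using nz by simp_all
  thus ?thesis using F unfolding Ind_iff by blast
 qed
 finally show ?thesis by (simp add: nbar_restrict_def nbar_mt)
qed

text \<open>For large \<open>x\<close> the class \<open>nbar x\<close> is moved by the Borel
  subgroup to a matrix near \<open>mt 0 1 1 0\<close>, the point at infinity, where \<open>F\<close>
  is locally constant.\<close>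

lemma Ind_infinity:
 assumes F: "F \<in> Ind K chi \<sigma>" and x: "x ~= 0"
 shows "nbar_restrict F x = inverse (mult_char K chi (\<sigma> + 1/2) (- x\<^sup>2)) * F (pgl_class (mt (inverse x) 1 1 0))"
proof -
 have "mt (inverse x) 1 1 0 ** mt (- x\<^sup>2) (- x) 0 1 = mat (- x) ** mt 1 0 x 1"
  unfolding mat_mt mult_mt mt_eq_iff using x by (simp add: power2_eq_square)
 hence "pgl_class (mt (inverse x) 1 1 0 ** mt (- x\<^sup>2) (- x) 0 1) = nbar x"
  using pgl_class_scale[of "- x" "mt 1 0 x 1"] x by (simp only: nbar_mt) simp
 moreover have "det (mt (inverse x) 1 1 0) ~= 0" "- x\<^sup>2 ~= 0" using x by simp_all
 ultimately show ?thesis using F unfolding Ind_iff nbar_restrict_def by metis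
qed

text \<open>On the big cell the values are given by \<open>Ind_class\<close>. A matrix with upper
  left entry 0 is a limit of matrices of the big cell, and local constancy carries the equality
  over.\<close>

lemma Ind_inj:
 fixes K :: "'k::nonarch_local_field field_data"
 shows "inj_on nbar_restrict (Ind K chi \<sigma>)"
proof (rule inj_onI)
 fix F F' assume F: "F \<in> Ind K chi \<sigma>" and F': "F' \<in> Ind K chi \<sigma>" and eq: "nbar_restrict F = nbar_restrict F'"
 have big: "F (pgl_class (mt a b c d)) = F' (pgl_class (mt a b c d))" if "a * d - b * c ~= 0" "a ~= 0" for a b c d
  using Ind_class[OF F that] Ind_class[OF F' that] eq by simp
 have "F (pgl_class A) = F' (pgl_class A)" if A: "det A ~= 0" for A
 proof -
  obtain a b c d where A_eq: "A = mt a b c d" by (rule mt_cases)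
  show ?thesis
  proof (cases "a = 0")
   case True
   have "pgl_lc F" "pgl_lc F'" using F F' by (auto simp: Ind_iff)
  note lc = this
  from pgl_lcD[OF lc(1) A] obtain N where
   N: "open N" "A \<in> N" "\<forall>B\<in>N. det B ~= 0 \<and> F (pgl_class B) = F (pgl_class A)" by (elim exE conjE)
  from pgl_lcD[OF lc(2) A] obtain N' where
   N': "open N'" "A \<in> N'" "\<forall>B\<in>N'. det B ~= 0 \<and> F' (pgl_class B) = F' (pgl_class A)" by (elim exE conjE)
   have cont: "continuous_on UNIV (%e. \<chi> i j. if i = 1 \<and> j = 1 then e else A $ i $ j)"
   proof (intro continuous_on_vec_lambda)
    show "continuous_on UNIV (%e. if i = 1 \<and> j = 1 then e else A $ i $ j)" for i j by (cases "i = 1 \<and> j = 1") auto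
   qed
   have eq: "(\<chi> i j. if i = 1 \<and> j = 1 then e else A $ i $ j) = mt e b c d" for e by (simp add: vec_eq_iff forall_2 A_eq)
   have "open ((%e. mt e b c d) -` (N \<inter> N'))" using open_vimage[OF open_Int[OF N(1) N'(1)] cont] by (simp add: eq)
   moreover have "0 \<in> (%e. mt e b c d) -` (N \<inter> N')" using N(2) N'(2) A_eq True by simp
   ultimately have "\<exists>n. \<forall>y. y - 0 \<in> vball n --> y \<in> (%e. mt e b c d) -` (N \<inter> N')" unfolding open_iff_vball by (rule bspec)
   then obtain n where n: "!!y. y \<in> vball n ==> mt y b c d \<in> N \<inter> N'" by auto
   obtain e :: 'k where e: "e ~= 0" "val e = n" using ex_val by blast
   hence m: "mt e b c d \<in> N" "mt e b c d \<in> N'" using n[of e] by (auto simp: vball_def)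
   hence "e * d - b * c ~= 0" using bspec[OF N(3) m(1)] by simp
   thus ?thesis using big[OF _ e(1)] bspec[OF N(3) m(1)] bspec[OF N'(3) m(2)] by metis
  qed (use big A A_eq in auto)
 qed
 hence "F g = F' g" if "g \<in> carrier PGL2" for g using that by (auto elim!: PGL2_cases)
 thus "F = F'" using F F' by (intro extensionalityI[of F "carrier PGL2" F']) (auto simp: Ind_iff)
qed

definition lift where "lift K chi \<sigma> = the_inv_into (Ind K chi \<sigma>) nbar_restrict"

lemma lift:
 assumes "f \<in> I_smooth K chi \<sigma>"
 shows lift_Ind: "lift K chi \<sigma> f \<in> Ind K chi \<sigma>" and nbar_restrict_lift: "nbar_restrict (lift K chi \<sigma> f) = f"
 using assms the_inv_into_into[OF Ind_inj, of f K chi \<sigma>] f_the_inv_into_f[OF Ind_inj, of f K chi \<sigma>] unfolding lift_def I_smooth_def by auto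

lemma lift_nbar_restrict: "F \<in> Ind K chi \<sigma> ==> lift K chi \<sigma> (nbar_restrict F) = F" unfolding lift_def by (rule the_inv_into_f_f[OF Ind_inj])

lemma smooth_action_lift: "smooth_action K chi \<sigma> g f = nbar_restrict (left_translate g (lift K chi \<sigma> f))"
 by (simp add: smooth_action_def lift_def)

lemma nbar_in [simp]: "nbar (x :: 'k::field) \<in> carrier PGL2" unfolding nbar_mt by (rule pgl_class_in) simp

lemma left_translate_Ind:
 fixes K :: "'k::nonarch_local_field field_data"
 assumes g: "g \<in> carrier PGL2" and F: "F \<in> Ind K chi \<sigma>"
 shows "left_translate g F \<in> Ind K chi \<sigma>"
proof -
 obtain A where A: "det A ~= 0" "g = inv\<^bsub>PGL2\<^esub> (pgl_class A)" using g by (rule PGL2_cases_inv)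
 have lt: "left_translate g F (pgl_class B) = F (pgl_class (A ** B))" if "det B ~= 0" for B
  using that A by (simp add: left_translate_def pgl_class_mult)
 show ?thesis unfolding Ind_iff
 proof (intro conjI allI impI)
  show "left_translate g F \<in> extensional (carrier PGL2)" by (simp add: left_translate_def)
  show "pgl_lc (left_translate g F)"
  proof (rule pgl_lcI)
   fix B :: "'k^2^2" assume B: "det B ~= 0"
   have "pgl_lc F" using F by (simp add: Ind_iff)
   moreover have "det (A ** B) ~= 0" using A B by (simp add: det_mul)
   ultimately obtain N where N: "open N" "A ** B \<in> N" "!!C. C \<in> N ==> F (pgl_class C) = F (pgl_class (A ** B))" using pgl_lcD by metis
   show "\<exists>N. open N \<and> B \<in> N \<and> (\<forall>C\<in>N. det C ~= 0 --> left_translate g F (pgl_class C) = left_translate g F (pgl_class B))"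
   proof (intro exI[of _ "(%B. A ** B) -` N"] conjI open_vimage[OF N(1) continuous_on_mult2] ballI impI)
    show "B \<in> (%B. A ** B) -` N" using N(2) by simp
    fix C assume C: "C \<in> (%B. A ** B) -` N" "det C ~= 0"
    have "F (pgl_class (A ** C)) = F (pgl_class (A ** B))" by (rule N(3)) (use C(1) in simp)
    thus "left_translate g F (pgl_class C) = left_translate g F (pgl_class B)" by (simp only: lt[OF C(2)] lt[OF B])
   qed
  qed
  fix B :: "'k^2^2" and a b :: 'k assume B: "det B ~= 0" "a ~= 0"
  have "det (A ** B) ~= 0" using A B by (simp add: det_mul)
  hence "F (pgl_class ((A ** B) ** mt a b 0 1)) = inverse (mult_char K chi (\<sigma> + 1 / 2) a) * F (pgl_class (A ** B))"
   using F B unfolding Ind_iff by blast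
  thus "left_translate g F (pgl_class (B ** mt a b 0 1)) = inverse (mult_char K chi (\<sigma> + 1 / 2) a) * left_translate g F (pgl_class B)"
   using B by (simp add: lt det_mul matrix_mul_assoc)
 qed
qed

lemma smooth_action_in: "g \<in> carrier PGL2 ==> f \<in> I_smooth K chi \<sigma> ==> smooth_action K chi \<sigma> g f \<in> I_smooth K chi \<sigma>"
 unfolding smooth_action_lift by (simp add: I_smooth_def left_translate_Ind lift_Ind)

lemma lift_smooth_action:
 "g \<in> carrier PGL2 ==> f \<in> I_smooth K chi \<sigma> ==> lift K chi \<sigma> (smooth_action K chi \<sigma> g f) = left_translate g (lift K chi \<sigma> f)"
 unfolding smooth_action_lift by (rule lift_nbar_restrict) (rule left_translate_Ind[OF _ lift_Ind])

lemma smooth_action_one: assumes f: "f \<in> I_smooth K chi \<sigma>" shows "smooth_action K chi \<sigma> \<one>\<^bsub>PGL2\<^esub> f = f"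
proof -
 have "nbar_restrict (left_translate \<one>\<^bsub>PGL2\<^esub> (lift K chi \<sigma> f)) = nbar_restrict (lift K chi \<sigma> f)"
  unfolding nbar_restrict_def left_translate_def by simp
 thus ?thesis using nbar_restrict_lift[OF f] by (simp add: smooth_action_lift)
qed

lemma smooth_action_mult:
 assumes g: "g \<in> carrier PGL2" "h \<in> carrier PGL2" and f: "f \<in> I_smooth K chi \<sigma>"
 shows "smooth_action K chi \<sigma> (g \<otimes>\<^bsub>PGL2\<^esub> h) f = smooth_action K chi \<sigma> g (smooth_action K chi \<sigma> h f)"
proof -
 have "left_translate (g \<otimes>\<^bsub>PGL2\<^esub> h) F = left_translate g (left_translate h F)" for F :: "('a^2^2) set => complex"
  unfolding left_translate_def using g by (auto simp: fun_eq_iff PGL2.inv_mult_group PGL2.m_assoc)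
 thus ?thesis using lift_smooth_action[OF g(2) f] by (simp add: smooth_action_lift[of K chi \<sigma> g] smooth_action_lift[of K chi \<sigma> "g \<otimes>\<^bsub>PGL2\<^esub> h"])
qed

lemma Ind_add:
 fixes K :: "'k::nonarch_local_field field_data"
 assumes F: "F \<in> Ind K chi \<sigma>" and F': "F' \<in> Ind K chi \<sigma>"
 shows "restrict (%h. F h + F' h) (carrier PGL2) \<in> Ind K chi \<sigma>" unfolding Ind_iff
proof (intro conjI allI impI)
 show "pgl_lc (restrict (%h. F h + F' h) (carrier PGL2))"
 proof (rule pgl_lcI)
  fix A :: "'k^2^2" assume A: "det A ~= 0"
  have "pgl_lc F" "pgl_lc F'" using F F' by (auto simp: Ind_iff)
  note lc = this
  from pgl_lcD[OF lc(1) A] obtain N where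
   N: "open N" "A \<in> N" "\<forall>B\<in>N. det B ~= 0 \<and> F (pgl_class B) = F (pgl_class A)" by (elim exE conjE)
  from pgl_lcD[OF lc(2) A] obtain N' where
   N': "open N'" "A \<in> N'" "\<forall>B\<in>N'. det B ~= 0 \<and> F' (pgl_class B) = F' (pgl_class A)" by (elim exE conjE)
  show "\<exists>N. open N \<and> A \<in> N \<and> (\<forall>B\<in>N. det B ~= 0 --> restrict (%h. F h + F' h) (carrier PGL2) (pgl_class B)
    = restrict (%h. F h + F' h) (carrier PGL2) (pgl_class A))"
  proof (intro exI[of _ "N \<inter> N'"] conjI open_Int N(1) N'(1) ballI impI)
   fix B assume "B \<in> N \<inter> N'" "det B ~= 0"
   hence "F (pgl_class B) = F (pgl_class A)" "F' (pgl_class B) = F' (pgl_class A)" using N(3) N'(3) by blast+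
   thus "restrict (%h. F h + F' h) (carrier PGL2) (pgl_class B) = restrict (%h. F h + F' h) (carrier PGL2) (pgl_class A)"
    using \<open>det B ~= 0\<close> A by simp
  qed (use N N' in simp)
 qed
qed (use F F' in \<open>auto simp: Ind_iff det_mul distrib_left\<close>)

lemma Ind_cmult:
 fixes K :: "'k::nonarch_local_field field_data"
 assumes F: "F \<in> Ind K chi \<sigma>"
 shows "restrict (%h. c * F h) (carrier PGL2) \<in> Ind K chi \<sigma>" unfolding Ind_iff
proof (intro conjI allI impI)
 show "pgl_lc (restrict (%h. c * F h) (carrier PGL2))"
 proof (rule pgl_lcI)
  fix A :: "'k^2^2" assume A: "det A ~= 0"
  have "pgl_lc F" using F by (auto simp: Ind_iff)
  from pgl_lcD[OF this A] obtain N where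
   N: "open N" "A \<in> N" "\<forall>B\<in>N. det B ~= 0 \<and> F (pgl_class B) = F (pgl_class A)" by (elim exE conjE)
  show "\<exists>N. open N \<and> A \<in> N \<and> (\<forall>B\<in>N. det B ~= 0 --> restrict (%h. c * F h) (carrier PGL2) (pgl_class B)
    = restrict (%h. c * F h) (carrier PGL2) (pgl_class A))"
  proof (intro exI[of _ N] conjI N(1,2) ballI impI)
   fix B assume "B \<in> N" "det B ~= 0"
   hence "F (pgl_class B) = F (pgl_class A)" using N(3) by blast
   thus "restrict (%h. c * F h) (carrier PGL2) (pgl_class B) = restrict (%h. c * F h) (carrier PGL2) (pgl_class A)"
    using \<open>det B ~= 0\<close> A by simp
  qed
 qed
qed (use F in \<open>auto simp: Ind_iff det_mul\<close>)

lemma nbar_restrict_restrict [simp]: "nbar_restrict (restrict F (carrier PGL2)) = nbar_restrict F" by (simp add: nbar_restrict_def)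

lemma I_smooth_add: assumes "f \<in> I_smooth K chi \<sigma>" "g \<in> I_smooth K chi \<sigma>" shows "(%x. f x + g x) \<in> I_smooth K chi \<sigma>"
 and smooth_action_add: "h \<in> carrier PGL2 ==> smooth_action K chi \<sigma> h (%x. f x + g x)
  = (%x. smooth_action K chi \<sigma> h f x + smooth_action K chi \<sigma> h g x)"
proof -
 let ?F = "lift K chi \<sigma> f" and ?G = "lift K chi \<sigma> g"
 let ?S = "restrict (%h. ?F h + ?G h) (carrier PGL2)"
 have S: "?S \<in> Ind K chi \<sigma>" by (rule Ind_add[OF lift_Ind[OF assms(1)] lift_Ind[OF assms(2)]])
 have "nbar_restrict ?S = (%x. nbar_restrict ?F x + nbar_restrict ?G x)" by (simp add: nbar_restrict_def)
 hence eq: "nbar_restrict ?S = (%x. f x + g x)" using assms by (simp add: nbar_restrict_lift)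
 show "(%x. f x + g x) \<in> I_smooth K chi \<sigma>" unfolding I_smooth_def eq[symmetric] by (rule imageI[OF S])
 show "smooth_action K chi \<sigma> h (%x. f x + g x) = (%x. smooth_action K chi \<sigma> h f x + smooth_action K chi \<sigma> h g x)"
  if h: "h \<in> carrier PGL2" unfolding smooth_action_lift eq[symmetric] lift_nbar_restrict[OF S]
  using h by (simp add: nbar_restrict_def left_translate_def fun_eq_iff)
qed

lemma I_smooth_cmult: assumes "f \<in> I_smooth K chi \<sigma>" shows "(%x. c * f x) \<in> I_smooth K chi \<sigma>"
 and smooth_action_cmult: "h \<in> carrier PGL2 ==> smooth_action K chi \<sigma> h (%x. c * f x)
  = (%x. c * smooth_action K chi \<sigma> h f x)"
proof -
 let ?F = "lift K chi \<sigma> f"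
 let ?S = "restrict (%h. c * ?F h) (carrier PGL2)"
 have S: "?S \<in> Ind K chi \<sigma>" by (rule Ind_cmult[OF lift_Ind[OF assms]])
 have "nbar_restrict ?S = (%x. c * nbar_restrict ?F x)" by (simp add: nbar_restrict_def)
 hence eq: "nbar_restrict ?S = (%x. c * f x)" using assms by (simp add: nbar_restrict_lift)
 show "(%x. c * f x) \<in> I_smooth K chi \<sigma>" unfolding I_smooth_def eq[symmetric] by (rule imageI[OF S])
 show "smooth_action K chi \<sigma> h (%x. c * f x) = (%x. c * smooth_action K chi \<sigma> h f x)"
  if h: "h \<in> carrier PGL2" unfolding smooth_action_lift eq[symmetric] lift_nbar_restrict[OF S]
  using h by (simp add: nbar_restrict_def left_translate_def fun_eq_iff)
qed

text \<open>Multiplying \<open>mt 1 0 x 1\<close> from the left by the matrix gives the first column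
  (a + b x, c + d x) and keeps the determinant, so \<open>Ind_class\<close> reads off the value.
  Acting by the inverse class keeps the formula free of adjugates.\<close>

lemma smooth_action_inv_class:
 assumes f: "f \<in> I_smooth K chi \<sigma>" and det: "a * d - b * c ~= 0" and nz: "a + b * x ~= 0"
 shows "smooth_action K chi \<sigma> (inv\<^bsub>PGL2\<^esub> (pgl_class (mt a b c d))) f x
  = inverse (mult_char K chi (\<sigma> + 1/2) ((a + b * x)\<^sup>2 / (a * d - b * c))) * f ((c + d * x) / (a + b * x))"
proof -
 let ?F = "lift K chi \<sigma> f"
 have D: "(a + b * x) * d - b * (c + d * x) = a * d - b * c" by (simp add: algebra_simps)
 have "smooth_action K chi \<sigma> (inv\<^bsub>PGL2\<^esub> (pgl_class (mt a b c d))) f x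
   = ?F (pgl_class (mt a b c d) \<otimes>\<^bsub>PGL2\<^esub> pgl_class (mt 1 0 x 1))"
  using det by (simp add: smooth_action_lift nbar_restrict_def left_translate_def nbar_mt)
 also have "... = ?F (pgl_class (mt (a + b * x) b (c + d * x) d))" using det by (subst pgl_class_mult) simp_all
 also have "... = inverse (mult_char K chi (\<sigma> + 1/2) ((a + b * x)\<^sup>2 / (a * d - b * c))) * nbar_restrict ?F ((c + d * x) / (a + b * x))"
  using Ind_class[OF lift_Ind[OF f], of "a + b * x" d b "c + d * x"] nz det unfolding D by blast
 finally show ?thesis using nbar_restrict_lift[OF f] by simp
qed

section \<open>Quadratic unit characters\<close>

locale quad_char = local_field_data K for K :: "'k::nonarch_local_field field_data" +
 fixes chi :: "'k => complex"
 assumes chi: "unit_character chi" and quad: "\<forall>u\<in>unit_group. (chi u)\<^sup>2 = 1"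
begin

abbreviation "mc \<equiv> mult_char K chi"

lemma unif: "unif K ~= 0" "val (unif K) = 1" using field_data by (auto simp: field_data_def uniformizer_def)

text \<open>The unit part of an element relative to the chosen uniformizer.\<close>

definition un :: "'k => 'k" where "un a = unif K powi (- val a) * a"

lemma un_unit: "a ~= 0 ==> un a \<in> unit_group" using unif by (simp add: un_def unit_group_def val_mult val_powi)

lemma un_mult: "a ~= 0 ==> b ~= 0 ==> un (a * b) = un a * un b"
 using unif by (simp add: un_def val_mult power_int_add power_int_diff power_int_minus field_simps)

lemma un_val_0: "val a = 0 ==> un a = a" by (simp add: un_def)

lemma chi_mult: "u \<in> unit_group ==> v \<in> unit_group ==> chi (u * v) = chi u * chi v"
 and chi_norm: "u \<in> unit_group ==> norm (chi u) = 1"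
 and chi_cont: "continuous_on unit_group chi" using chi by (simp_all add: unit_character_def)

lemma chi_cases: assumes "u \<in> unit_group" shows "chi u = 1 \<or> chi u = - 1" using quad assms power2_eq_1_iff[of "chi u"] by blast

lemma chi_1: "chi 1 = 1"
proof -
 have u: "(1::'k) \<in> unit_group" by (simp add: unit_group_def)
 have "chi 1 * chi 1 = chi 1 * 1" using chi_mult[OF u u] by simp
 moreover have "chi 1 ~= 0" using chi_norm[OF u] by auto
 ultimately show ?thesis by (metis mult_cancel_left)
qed

lemma mc_eq: "mc \<sigma> a = chi (un a) * of_real (av a) powr \<sigma>" by (simp add: mult_char_def un_def)

lemma mc_nz: assumes "a ~= 0" shows "mc \<sigma> a ~= 0" using chi_norm[OF un_unit[OF assms]] assms by (auto simp: mc_eq)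

lemma mc_mult: assumes "a ~= 0" "b ~= 0" shows "mc \<sigma> (a * b) = mc \<sigma> a * mc \<sigma> b"
proof -
 have "of_real (av (a * b)) powr \<sigma> = of_real (av a) powr \<sigma> * (of_real (av b) powr \<sigma> :: complex)"
  unfolding absval_mult of_real_mult by (rule powr_times_real) simp_all
 thus ?thesis using assms by (simp add: mc_eq un_mult chi_mult un_unit)
qed

lemma mc_1 [simp]: "mc \<sigma> 1 = 1" using chi_1 by (simp add: mc_eq un_val_0)

lemma mc_inverse: assumes "a ~= 0" shows "mc \<sigma> (inverse a) = inverse (mc \<sigma> a)"
 using mc_mult[of a "inverse a" \<sigma>] assms mc_nz[OF assms] by (simp add: field_simps)

lemma mc_divide: "a ~= 0 ==> b ~= 0 ==> mc \<sigma> (a / b) = mc \<sigma> a / mc \<sigma> b" by (simp add: divide_inverse mc_mult mc_inverse)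

lemma mc0_cases: assumes "a ~= 0" shows "mc 0 a = 1 \<or> mc 0 a = - 1" using chi_cases[OF un_unit[OF assms]] assms by (simp add: mc_eq)

lemma mc0_square: "a ~= 0 ==> mc 0 (a\<^sup>2) = 1" using mc_mult[of a a 0] mc0_cases[of a] by (auto simp: power2_eq_square)

lemma mc_real: "a ~= 0 ==> mc (of_real r) a = mc 0 a * of_real (av a powr r)" by (simp add: mc_eq powr_of_real)

text \<open>\<open>chi\<close> is continuous on units with values 1 and -1, hence 1 near 1. One
  radius serves all exponents, because the absolute value is 1 there.\<close>

lemma mc_near_1: "\<exists>h. h ~= 0 \<and> av h < 1 \<and> (\<forall>u. av (u - 1) <= av h --> u ~= 0 \<and> av u = 1 \<and> (\<forall>\<sigma>. mc \<sigma> u = 1))"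
proof -
 have u1: "(1::'k) \<in> unit_group" by (simp add: unit_group_def)
 have "\<forall>x\<in>unit_group. \<forall>e>0. \<exists>d>0. \<forall>y\<in>unit_group. dist y x < d --> dist (chi y) (chi x) < e" using chi_cont unfolding continuous_on_iff .
 from bspec[OF this u1, THEN spec, of 1] obtain d where d: "d > 0"
  "!!y. y \<in> unit_group ==> dist y 1 < d ==> dist (chi y) (chi 1) < 1" by auto
 have "open (ball (1::'k) d)" "(1::'k) \<in> ball 1 d" using d(1) by auto
 hence "\<exists>a::'k. a ~= 0 \<and> (\<forall>y. av (y - 1) <= av a --> y \<in> ball 1 d)" unfolding open_iff_absval by (rule bspec)
 then obtain a :: 'k where a: "a ~= 0" "!!y. av (y - 1) <= av a ==> dist 1 y < d" by auto
 obtain h :: 'k where h: "h ~= 0" "av h < min 1 (av a)" using ex_absval_less[of "min 1 (av a)"] a(1) by auto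
 have "u ~= 0 \<and> av u = 1 \<and> (\<forall>\<sigma>. mc \<sigma> u = 1)" if u: "av (u - 1) <= av h" for u
 proof -
  have "av (u - 1) < av 1" using u h(2) by simp
  hence "u - 1 \<in> vball (val (1::'k) + 1)" using absval_less_iff[of 1 "u - 1"] by simp
  hence u0: "u ~= 0" "val u = 0" using val_eq_of_close[of 1 u] by simp_all
  hence uu: "u \<in> unit_group" by (simp add: unit_group_def)
  have "dist u 1 < d" using a(2)[of u] u h(2) by (simp add: dist_commute)
  hence "dist (chi u) 1 < 1" using d(2)[OF uu] chi_1 by simp
  hence "chi u = 1" using chi_cases[OF uu] by (auto simp: dist_norm)
  moreover have "av u = 1" using u0 by (simp add: absval_eq)
  ultimately show ?thesis using u0 by (simp add: mc_eq un_val_0)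
 qed
 hence "\<forall>u. av (u - 1) <= av h --> u ~= 0 \<and> av u = 1 \<and> (\<forall>\<sigma>. mc \<sigma> u = 1)" by (intro allI impI)
 moreover have "av h < 1" using h(2) by simp
 ultimately show ?thesis using h(1) by (intro exI conjI)
qed

lemma I_smooth_loc_const: assumes f: "f \<in> I_smooth K chi \<sigma>" shows "loc_const f" unfolding loc_const_iff_open
proof
 fix x :: 'k
 let ?F = "lift K chi \<sigma> f"
 have F: "pgl_lc ?F" using lift_Ind[OF f] by (simp add: Ind_iff)
 have "det (mt 1 0 x 1) ~= 0" by simp
 from pgl_lcD[OF F this] obtain N where N: "open N" "mt 1 0 x 1 \<in> N"
  "\<forall>B\<in>N. det B ~= 0 \<and> ?F (pgl_class B) = ?F (pgl_class (mt 1 0 x 1))" by (elim exE conjE)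
 have cont: "continuous_on UNIV (%e::'k. \<chi> i j. if i = 2 \<and> j = 1 then e else mt 1 0 x 1 $ i $ j)"
 proof (intro continuous_on_vec_lambda)
  show "continuous_on UNIV (%e::'k. if i = 2 \<and> j = 1 then e else mt 1 0 x 1 $ i $ j)" for i j :: 2 by (cases "i = 2 \<and> j = 1") auto
 qed
 have eq: "(\<chi> i j. if i = 2 \<and> j = 1 then e else mt 1 0 x 1 $ i $ j) = mt 1 0 e 1" for e :: 'k by (simp add: vec_eq_iff forall_2)
 have o: "open ((%e. mt 1 0 e 1) -` N)" using open_vimage[OF N(1) cont] by (simp add: eq)
 have c: "f y = f x" if "mt 1 0 y 1 \<in> N" for y
 proof -
  have "?F (nbar y) = ?F (nbar x)" using N(3) that by (simp add: nbar_mt)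
  thus ?thesis using nbar_restrict_lift[OF f] by (metis nbar_restrict_def)
 qed
 show "\<exists>U. open U \<and> x \<in> U \<and> (\<forall>y\<in>U. f y = f x)"
 proof (intro exI conjI ballI)
  show "open ((%e. mt 1 0 e 1) -` N)" by (rule o)
  show "x \<in> (%e. mt 1 0 e 1) -` N" using N(2) by simp
  show "f y = f x" if "y \<in> (%e. mt 1 0 e 1) -` N" for y using that by (intro c) simp
 qed
qed

text \<open>Local constancy at the matrix \<open>mt 0 1 1 0\<close>, transported by
  \<open>Ind_infinity\<close>.\<close>

lemma I_smooth_infinity:
 assumes f: "f \<in> I_smooth K chi \<sigma>"
 shows "\<exists>C R. R ~= 0 \<and> (\<forall>x. av R <= av x --> f x = C * inverse (mc (\<sigma> + 1/2) (- x\<^sup>2)))"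
proof -
 let ?F = "lift K chi \<sigma> f"
 have F: "pgl_lc ?F" using lift_Ind[OF f] by (simp add: Ind_iff)
 have "det (mt 0 1 1 (0::'k)) ~= 0" by simp
 from pgl_lcD[OF F this] obtain N where N: "open N" "mt 0 1 1 (0::'k) \<in> N"
  "\<forall>B\<in>N. det B ~= 0 \<and> ?F (pgl_class B) = ?F (pgl_class (mt 0 1 1 0))" by (elim exE conjE)
 have cont: "continuous_on UNIV (%e::'k. \<chi> i j. if i = 1 \<and> j = 1 then e else mt 0 1 1 0 $ i $ j)"
 proof (intro continuous_on_vec_lambda)
  show "continuous_on UNIV (%e::'k. if i = 1 \<and> j = 1 then e else mt 0 1 1 0 $ i $ j)" for i j :: 2 by (cases "i = 1 \<and> j = 1") auto
 qed
 have eq: "(\<chi> i j. if i = 1 \<and> j = 1 then e else mt 0 1 1 0 $ i $ j) = mt e 1 1 0" for e :: 'k by (simp add: vec_eq_iff forall_2)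
 have "open ((%e. mt e 1 1 0) -` N)" using open_vimage[OF N(1) cont] by (simp add: eq)
 moreover have "0 \<in> (%e. mt e 1 1 0) -` N" using N(2) by simp
 ultimately have "\<exists>a::'k. a ~= 0 \<and> (\<forall>y. av (y - 0) <= av a --> y \<in> (%e. mt e 1 1 0) -` N)" unfolding open_iff_absval by (rule bspec)
 then obtain a :: 'k where a: "a ~= 0" "!!y. av y <= av a ==> mt y 1 1 0 \<in> N" by auto
 define C where "C = ?F (pgl_class (mt 0 1 1 0))"
 have "f x = C * inverse (mc (\<sigma> + 1/2) (- x\<^sup>2))" if x: "av (inverse a) <= av x" for x
 proof -
  have "0 < av (inverse a)" using a(1) by simp
  hence pos: "0 < av x" using x by linarith
  hence x0: "x ~= 0" by auto
  have "inverse (av x) <= inverse (av (inverse a))" using x \<open>0 < av (inverse a)\<close> by (rule le_imp_inverse_le)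
  hence "av (inverse x) <= av a" by (simp add: absval_inverse)
  hence "?F (pgl_class (mt (inverse x) 1 1 0)) = C" using N(3) a(2) unfolding C_def by blast
  thus ?thesis using Ind_infinity[OF lift_Ind[OF f] x0] nbar_restrict_lift[OF f] by (simp add: mult.commute)
 qed
 thus ?thesis using a(1) by (intro exI[of _ C] exI[of _ "inverse a"]) auto
qed

text \<open>A quadratic character is trivial on squares, so only its value at -1 remains, and this
  is merged into the constant.\<close>

lemma I_smooth_asymptotic:
 assumes f: "f \<in> I_smooth K chi (of_real s)"
 shows "\<exists>C R. R ~= 0 \<and> (\<forall>x. av R <= av x --> f x = C * of_real (av x powr (- 2 * s - 1)))"
proof -
 obtain C R where CR: "R ~= 0" "!!x. av R <= av x ==> f x = C * inverse (mc (of_real s + 1/2) (- x\<^sup>2))"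
  using I_smooth_infinity[OF f] by auto
 have "f x = C * mc 0 (- 1) * of_real (av x powr (- 2 * s - 1))" if x: "av R <= av x" for x
 proof -
  have "0 < av R" using CR(1) by simp
  hence pos: "0 < av x" using x by linarith
  hence x0: "x ~= 0" by auto
  have e: "of_real s + 1/2 = (of_real (s + 1/2) :: complex)" by simp
  have "mc 0 (- x\<^sup>2) = mc 0 (- 1)" using mc_mult[of "- 1" "x\<^sup>2" 0] mc0_square[OF x0] x0 by simp
  hence "mc (of_real s + 1/2) (- x\<^sup>2) = mc 0 (- 1) * of_real (av (- x\<^sup>2) powr (s + 1/2))"
   unfolding e using mc_real[of "- x\<^sup>2" "s + 1/2"] x0 by simp
  moreover have "inverse (mc 0 (- 1)) = mc 0 (- 1)" using mc0_cases[of "- 1"] by auto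
  moreover have "inverse (av (- x\<^sup>2) powr (s + 1/2)) = av x powr (- 2 * s - 1)"
  proof -
   have "av (- x\<^sup>2) = av x powr 2" using pos by (simp add: absval_power)
   hence "inverse (av (- x\<^sup>2) powr (s + 1/2)) = av x powr (- (2 * (s + 1/2)))" by (simp only: powr_powr powr_minus)
   also have "- (2 * (s + 1/2)) = - 2 * s - 1" by simp
   finally show ?thesis .
  qed
  ultimately show ?thesis using CR(2)[OF x] by (simp add: of_real_inverse[symmetric])
 qed
 thus ?thesis using CR(1) by blast
qed

text \<open>Extension by 0 from the big cell; compact support provides local constancy at the
  matrices outside the cell.\<close>

lemma Cc_I_smooth: assumes \<phi>: "\<phi> \<in> Cc" shows "\<phi> \<in> I_smooth K chi \<sigma>"
proof -
 let ?m = "mc (\<sigma> + 1/2)"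
 \<comment> \<open>The value is prescribed on matrices and shown to be invariant under scalars
   before it passes to classes through a chosen representative.\<close>
 define h where "h A = (if A $ 1 $ 1 = 0 then 0 else inverse (?m ((A $ 1 $ 1)\<^sup>2 / det A)) * \<phi> (A $ 2 $ 1 / A $ 1 $ 1))" for A :: "'k^2^2"
 have h_mt: "h (mt a b c d) = (if a = 0 then 0 else inverse (?m (a\<^sup>2 / (a * d - b * c))) * \<phi> (c / a))" for a b c d by (simp add: h_def)
 have h_scale: "h (mat k ** A) = h A" if k: "k ~= 0" and A: "det A ~= 0" for k A
 proof -
  obtain a b c d where A': "A = mt a b c d" by (rule mt_cases)
  have "(k * a)\<^sup>2 / (k * a * (k * d) - k * b * (k * c)) = a\<^sup>2 / (a * d - b * c)"
  proof -
   have "k * a * (k * d) - k * b * (k * c) = k\<^sup>2 * (a * d - b * c)" by (simp add: power2_eq_square algebra_simps)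
   thus ?thesis using k by (simp add: power_mult_distrib)
  qed
  thus ?thesis using k by (simp add: A' mat_mt h_mt)
 qed
 define F where "F = restrict (%X. h (SOME A. det A ~= 0 \<and> pgl_class A = X)) (carrier PGL2)"
 have F: "F (pgl_class A) = h A" if A: "det A ~= 0" for A
 proof -
  define B where "B = (SOME B. det B ~= 0 \<and> pgl_class B = pgl_class A)"
  have "det B ~= 0 \<and> pgl_class B = pgl_class A" unfolding B_def by (rule someI[of _ A]) (simp add: A)
  then obtain k where "k ~= 0" "A = mat k ** B" "det B ~= 0" using pgl_class_eqD by metis
  hence "h A = h B" using h_scale by simp
  thus ?thesis using A by (simp add: F_def B_def)
 qed
 from \<phi> obtain R e where R: "R ~= 0" "e ~= 0" "!!x. av x > av R ==> \<phi> x = 0"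
  "!!x y. av y <= av e ==> \<phi> (x + y) = \<phi> x" by (rule CcE) (rule that; assumption)
 from mc_near_1 obtain t where t: "t ~= 0" "av t < 1"
  "\<forall>u. av (u - 1) <= av t --> u ~= 0 \<and> av u = 1 \<and> (\<forall>\<sigma>. mc \<sigma> u = 1)" by (elim exE conjE)
 have comp: "continuous_on S (%A :: 'k^2^2. A $ i $ j)" for S i j by (intro continuous_on_component continuous_on_id)
 have "F \<in> Ind K chi \<sigma>" unfolding Ind_iff
 proof (intro conjI allI impI)
  show "F \<in> extensional (carrier PGL2)" by (simp add: F_def)
  show "pgl_lc F"
  proof (rule pgl_lcI)
   fix A :: "'k^2^2" assume A: "det A ~= 0"
   have "\<exists>N. open N \<and> A \<in> N \<and> (\<forall>B\<in>N. det B ~= 0 --> h B = h A)"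
   proof (cases "A $ 1 $ 1 = 0")
    case True
    \<comment> \<open>Close to a matrix with upper left entry 0 the quotient of the first column
      leaves the support of \<open>\<phi>\<close>.\<close>
    define N where "N = {B :: 'k^2^2. av R * av (B $ 1 $ 1) < av (B $ 2 $ 1)}"
    have oN: "open N" unfolding N_def
     by (intro open_Collect_less continuous_intros continuous_on_compose2[OF continuous_on_absval] comp) auto
    have AN: "A \<in> N" using A True by (auto simp: N_def det_2)
    have hN: "h B = h A" if "B \<in> N" for B
    proof (cases "B $ 1 $ 1 = 0")
     case False
     hence "av R < av (B $ 2 $ 1 / B $ 1 $ 1)" using that by (simp add: N_def absval_divide field_simps)
     thus ?thesis using True False R(3) by (simp add: h_def)
    qed (use True in \<open>simp add: h_def\<close>)
    show ?thesis by (intro exI[of _ N] conjI ballI impI oN AN hN)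
   next
    case False
    let ?S = "{B :: 'k^2^2. B $ 1 $ 1 ~= 0} \<inter> {B. det B ~= 0}"
    have "open ((%B. B $ 1 $ 1) -` (- {0}) :: ('k^2^2) set)" by (rule open_vimage[OF _ comp]) auto
    moreover have "(%B. B $ 1 $ 1) -` (- {0}) = {B :: 'k^2^2. B $ 1 $ 1 ~= 0}" by auto
    ultimately have S: "open ?S" using open_det_nz by (auto intro!: open_Int)
    have c1: "continuous_on ?S (%B. B $ 2 $ 1 * inverse (B $ 1 $ 1) - A $ 2 $ 1 / A $ 1 $ 1)" by (intro continuous_intros comp) auto
    have cd: "continuous_on ?S (det :: 'k^2^2 => 'k)" by (rule continuous_on_subset[OF continuous_on_det2]) simp
    have c2: "continuous_on ?S (%B. B $ 1 $ 1 * B $ 1 $ 1 * inverse (det B) * (det A / (A $ 1 $ 1)\<^sup>2) - 1)"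
     by (intro continuous_intros comp cd) auto
    \<comment> \<open>Nearness is measured in the two quantities on which \<open>h\<close> depends:
      the quotient of the first column and the ratio of the arguments of the character.\<close>
    define N where "N = ?S \<inter> (%B. B $ 2 $ 1 * inverse (B $ 1 $ 1) - A $ 2 $ 1 / A $ 1 $ 1) -` cb 0 e
     \<inter> (?S \<inter> (%B. B $ 1 $ 1 * B $ 1 $ 1 * inverse (det B) * (det A / (A $ 1 $ 1)\<^sup>2) - 1) -` cb 0 t)"
    have oN: "open N" unfolding N_def
     by (intro open_Int continuous_open_preimage[OF c1 S] continuous_open_preimage[OF c2 S] open_cb R(2) t(1))
    have AN: "A \<in> N" using A False by (simp add: N_def cb_def divide_inverse[symmetric] power2_eq_square)
    have hN: "h B = h A" if B: "B \<in> N" for B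
    proof -
     have B0: "B $ 1 $ 1 ~= 0" "det B ~= 0"
      and 1: "av (B $ 2 $ 1 / B $ 1 $ 1 - A $ 2 $ 1 / A $ 1 $ 1) <= av e"
      and 2: "av ((B $ 1 $ 1)\<^sup>2 / det B * (det A / (A $ 1 $ 1)\<^sup>2) - 1) <= av t"
      using B by (simp_all add: N_def cb_def divide_inverse power2_eq_square)
     have "\<phi> (B $ 2 $ 1 / B $ 1 $ 1) = \<phi> (A $ 2 $ 1 / A $ 1 $ 1)" using R(4)[OF 1, of "A $ 2 $ 1 / A $ 1 $ 1"] by simp
     moreover have "?m ((B $ 1 $ 1)\<^sup>2 / det B) = ?m ((A $ 1 $ 1)\<^sup>2 / det A)"
     proof -
      let ?u = "(B $ 1 $ 1)\<^sup>2 / det B * (det A / (A $ 1 $ 1)\<^sup>2)"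
      have e: "(B $ 1 $ 1)\<^sup>2 / det B = ?u * ((A $ 1 $ 1)\<^sup>2 / det A)" using A False by simp
      have u: "?u ~= 0" "?m ?u = 1" using mp[OF spec[OF t(3)] 2] by auto
      have n: "(A $ 1 $ 1)\<^sup>2 / det A ~= 0" using A False by simp
      have "?m ((B $ 1 $ 1)\<^sup>2 / det B) = ?m (?u * ((A $ 1 $ 1)\<^sup>2 / det A))" by (rule arg_cong[OF e])
      also have "... = ?m ((A $ 1 $ 1)\<^sup>2 / det A)" unfolding mc_mult[OF u(1) n] u(2) by simp
      finally show ?thesis .
     qed
     ultimately show ?thesis using B0 False by (simp add: h_def)
    qed
    show ?thesis by (intro exI[of _ N] conjI ballI impI oN AN hN)
   qed
   then obtain N where N: "open N" "A \<in> N" "\<forall>B\<in>N. det B ~= 0 --> h B = h A" by (elim exE conjE)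
   show "\<exists>N. open N \<and> A \<in> N \<and> (\<forall>B\<in>N. det B ~= 0 --> F (pgl_class B) = F (pgl_class A))"
   proof (intro exI conjI ballI impI)
    show "open N" "A \<in> N" by fact+
    fix B assume B: "B \<in> N" "det B ~= 0"
    have "h B = h A" using bspec[OF N(3) B(1)] B(2) by (rule mp)
    thus "F (pgl_class B) = F (pgl_class A)" by (simp only: F[OF B(2)] F[OF A])
   qed
  qed
  fix A :: "'k^2^2" and a b :: 'k assume A: "det A ~= 0" "a ~= 0"
  obtain a' b' c' d' where A': "A = mt a' b' c' d'" by (rule mt_cases)
  have dt: "det (A ** mt a b 0 1) = a * det A" by (simp add: A' algebra_simps)
  have "h (A ** mt a b 0 1) = inverse (?m a) * h A"
  proof (cases "a' = 0")
   case False
   have "(a' * a)\<^sup>2 / (a * det A) = a * (a'\<^sup>2 / det A)" using A by (simp add: power2_eq_square field_simps)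
   moreover have "?m (a * (a'\<^sup>2 / det A)) = ?m a * ?m (a'\<^sup>2 / det A)" using A False by (intro mc_mult) auto
   moreover have "c' * a / (a' * a) = c' / a'" using A by simp
   ultimately show ?thesis using A False unfolding h_def dt by (simp add: A')
  qed (use A in \<open>simp add: A' h_mt\<close>)
  thus "F (pgl_class (A ** mt a b 0 1)) = inverse (mult_char K chi (\<sigma> + 1 / 2) a) * F (pgl_class A)" using A dt by (simp add: F)
 qed
 moreover have "nbar_restrict F = \<phi>"
 proof
  fix x
  have "F (pgl_class (mt 1 0 x 1)) = h (mt 1 0 x 1)" by (rule F) simp
  thus "nbar_restrict F x = \<phi> x" by (simp add: nbar_restrict_def nbar_mt h_mt)
 qed
 ultimately show ?thesis unfolding I_smooth_def by blast
qed

text \<open>Functionals on test functions extend since \<open>Cc\<close> has codimension at most one in the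
 space of smooth vectors.\<close>

lemma extend_distribution:
 assumes T: "T \<in> distributions"
 shows "\<exists>S\<in>algebraic_dual (I_smooth K chi \<sigma>). as_distribution S = T"
proof -
 let ?I = "I_smooth K chi \<sigma>"
 have T0: "!!\<phi>. \<phi> \<notin> Cc ==> T \<phi> = 0"
  and Tadd: "!!\<phi> \<theta>. \<phi> \<in> Cc ==> \<theta> \<in> Cc ==> T (%x. \<phi> x + \<theta> x) = T \<phi> + T \<theta>"
  and Tc: "!!c \<phi>. \<phi> \<in> Cc ==> T (%x. c * \<phi> x) = c * T \<phi>" using T by (auto simp: distributions_def algebraic_dual_def)
 \<comment> \<open>The clause on \<open>f0 = 0\<close> keeps the coefficient unique even if every
   smooth vector is a test function.\<close>
 have "\<exists>f0. \<forall>f\<in>?I. \<exists>!c. (%x. f x - c * f0 x) \<in> Cc \<and> (f0 = (%x. 0) --> c = 0)"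
 proof (cases "?I \<subseteq> Cc")
  case True
  thus ?thesis by (intro exI[of _ "%x. 0"]) auto
 next
  case False
  then obtain f0 where f0: "f0 \<in> ?I" "f0 \<notin> Cc" by auto
  have f0nz: "f0 ~= (%x. 0)" using f0(2) Cc_cmult[OF Cc_indicator[of 1 0], of 0] by auto
  obtain C0 R0 where 0: "R0 ~= 0" "!!x. av R0 <= av x ==> f0 x = C0 * inverse (mc (\<sigma> + 1/2) (- x\<^sup>2))"
   using I_smooth_infinity[OF f0(1)] by auto
  have C0: "C0 ~= 0"
  proof
   assume "C0 = 0"
   hence "f0 \<in> Cc" using 0 by (intro CcI_loc_const[OF I_smooth_loc_const[OF f0(1)] _ 0(1)]) auto
   thus False using f0(2) by simp
  qed
  have "\<exists>!c. (%x. f x - c * f0 x) \<in> Cc" if f: "f \<in> ?I" for f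
  proof -
   obtain C R where CR: "R ~= 0" "!!x. av R <= av x ==> f x = C * inverse (mc (\<sigma> + 1/2) (- x\<^sup>2))" using I_smooth_infinity[OF f] by auto
   define R' where "R' = (if av R <= av R0 then R0 else R)"
   have R': "R' ~= 0" "av R <= av R'" "av R0 <= av R'" using CR(1) 0(1) by (auto simp: R'_def)
   have "(%x. f x + (- (C / C0)) * f0 x) \<in> ?I" by (rule I_smooth_add(1)[OF f I_smooth_cmult(1)[OF f0(1)]])
   hence "loc_const (%x. f x - C / C0 * f0 x)" using I_smooth_loc_const by simp
   hence ex: "(%x. f x - C / C0 * f0 x) \<in> Cc" using R' CR(2) 0(2) C0 by (intro CcI_loc_const[of _ R']) auto
   show ?thesis
   proof (rule ex1I, rule ex)
    fix c assume c: "(%x. f x - c * f0 x) \<in> Cc"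
    show "c = C / C0"
    proof (rule ccontr)
     assume ne: "c ~= C / C0"
     have "(%x. (f x - c * f0 x) + (-1) * (f x - C / C0 * f0 x)) \<in> Cc" by (rule Cc_add[OF c Cc_cmult[OF ex]])
     hence "(%x. (1 / (C / C0 - c)) * ((f x - c * f0 x) + (-1) * (f x - C / C0 * f0 x))) \<in> Cc" by (rule Cc_cmult)
     moreover have "(%x. (1 / (C / C0 - c)) * ((f x - c * f0 x) + (-1) * (f x - C / C0 * f0 x))) = f0"
     proof
      fix x
      have "(f x - c * f0 x) + (-1) * (f x - C / C0 * f0 x) = (C / C0 - c) * f0 x" by (simp add: algebra_simps)
      thus "(1 / (C / C0 - c)) * ((f x - c * f0 x) + (-1) * (f x - C / C0 * f0 x)) = f0 x" using ne by simp
     qed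
     ultimately show False using f0(2) by simp
    qed
   qed
  qed
  thus ?thesis using f0nz by (intro exI[of _ f0]) auto
 qed
 then obtain f0 where "\<forall>f\<in>?I. \<exists>!c. (%x. f x - c * f0 x) \<in> Cc \<and> (f0 = (%x. 0) --> c = 0)" by (rule exE)
 note f0 = bspec[OF this]
 define c where "c f = (THE c. (%x. f x - c * f0 x) \<in> Cc \<and> (f0 = (%x. 0) --> c = 0))" for f
 have c: "(%x. f x - c f * f0 x) \<in> Cc" "f0 = (%x. 0) ==> c f = 0" if "f \<in> ?I" for f using theI'[OF f0[OF that]] unfolding c_def by blast+
 have cI: "c f = k" if "f \<in> ?I" "(%x. f x - k * f0 x) \<in> Cc" "f0 = (%x. 0) ==> k = 0" for f k
  unfolding c_def by (rule the1_equality[OF f0[OF that(1)]]) (use that(2,3) in blast)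
 define S where "S f = (if f \<in> ?I then T (%x. f x - c f * f0 x) else 0)" for f
 have "S \<in> algebraic_dual ?I" unfolding algebraic_dual_def
 proof (intro CollectI conjI allI ballI impI)
  show "S f = 0" if "f \<notin> ?I" for f using that by (simp add: S_def)
  show "S (%x. f x + g x) = S f + S g" if f: "f \<in> ?I" "g \<in> ?I" for f g
  proof -
   have s: "(%x. (f x - c f * f0 x) + (g x - c g * f0 x)) \<in> Cc" by (rule Cc_add[OF c(1)[OF f(1)] c(1)[OF f(2)]])
   have e: "(%x. (f x - c f * f0 x) + (g x - c g * f0 x)) = (%x. (f x + g x) - (c f + c g) * f0 x)" by (simp add: fun_eq_iff algebra_simps)
   have "c (%x. f x + g x) = c f + c g" by (rule cI[OF I_smooth_add(1)[OF f]]) (use s c(2) f in \<open>simp_all add: e\<close>)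
   thus ?thesis using Tadd[OF c(1)[OF f(1)] c(1)[OF f(2)]] f I_smooth_add(1)[OF f] by (simp add: S_def e)
  qed
  show "S (%x. k * f x) = k * S f" if f: "f \<in> ?I" for f k
  proof -
   have s: "(%x. k * (f x - c f * f0 x)) \<in> Cc" by (rule Cc_cmult[OF c(1)[OF f]])
   have e: "(%x. k * (f x - c f * f0 x)) = (%x. k * f x - (k * c f) * f0 x)" by (simp add: fun_eq_iff algebra_simps)
   have "c (%x. k * f x) = k * c f" by (rule cI[OF I_smooth_cmult(1)[OF f]]) (use s c(2) f in \<open>simp_all add: e\<close>)
   thus ?thesis using Tc[OF c(1)[OF f], of k] f I_smooth_cmult(1)[OF f] by (simp add: S_def e)
  qed
 qed
 moreover have "as_distribution S = T"
 proof
  fix \<phi> :: "'k => complex"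
  show "as_distribution S \<phi> = T \<phi>"
  proof (cases "\<phi> \<in> Cc")
   case True
   have "c \<phi> = 0" by (rule cI[OF Cc_I_smooth[OF True]]) (use True in simp_all)
   thus ?thesis using True Cc_I_smooth[OF True] by (simp add: as_distribution_def S_def)
  qed (simp add: as_distribution_def T0)
 qed
 ultimately show ?thesis by blast
qed

text \<open>For a quadratic character the square of the denominator drops out of the argument, and
  what remains is a sign times a power of the Jacobian of the Moebius map.\<close>

lemma smooth_action_moebius:
 assumes f: "f \<in> I_smooth K chi (of_real s)" and det: "a * d - b * c ~= 0" and nz: "a + b * x ~= 0"
 shows "smooth_action K chi (of_real s) (inv\<^bsub>PGL2\<^esub> (pgl_class (mt a b c d))) f x
  = mc 0 (a * d - b * c) * of_real ((av (a * d - b * c) / (av (a + b * x))\<^sup>2) powr (s + 1/2)) * f ((c + d * x) / (a + b * x))"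
proof -
 let ?D = "a * d - b * c" and ?y = "a + b * x"
 have e: "of_real s + 1/2 = (of_real (s + 1/2) :: complex)" by simp
 have n: "?y\<^sup>2 / ?D ~= 0" using det nz by simp
 have "mc 0 (?y\<^sup>2 / ?D) = 1 / mc 0 ?D" using mc_divide[of "?y\<^sup>2" ?D 0] mc0_square[OF nz] det nz by simp
 also have "... = mc 0 ?D" using mc0_cases[OF det] by auto
 finally have m0: "mc 0 (?y\<^sup>2 / ?D) = mc 0 ?D" .
 have inv: "inverse (mc 0 ?D) = mc 0 ?D" using mc0_cases[OF det] by auto
 have p: "inverse (av (?y\<^sup>2 / ?D) powr (s + 1/2)) = (av ?D / (av ?y)\<^sup>2) powr (s + 1/2)"
 proof -
  have "av ?D / (av ?y)\<^sup>2 = inverse (av (?y\<^sup>2 / ?D))" by (simp add: absval_divide absval_power)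
  thus ?thesis by (simp add: inverse_powr)
 qed
 have "inverse (mc (of_real s + 1/2) (?y\<^sup>2 / ?D)) = mc 0 ?D * of_real ((av ?D / (av ?y)\<^sup>2) powr (s + 1/2))"
  unfolding e mc_real[OF n] m0 inverse_mult_distrib inv p[symmetric] of_real_inverse ..
 thus ?thesis unfolding smooth_action_inv_class[OF f det nz] by simp
qed

end

section \<open>Invariance of the inner product\<close>

context local_field_data
begin

lemma nn_integral_far_scale:
 assumes z: "z ~= 0"
 shows "(NI a. ennreal (av a powr r) * indicator {a. av z <= av a} a)
  = ennreal (av z powr (r + 1)) * (NI a. ennreal (av a powr r) * indicator {a. 1 <= av a} a)"
proof -
 have "(NI a. ennreal (av a powr r) * indicator {a. av z <= av a} a)
   = ennreal (av z) * (NI a. ennreal (av (z * a) powr r) * indicator {a. av z <= av a} (z * a))"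
  by (rule nn_integral_scale[OF z, symmetric]) measurable
 also have "(NI a. ennreal (av (z * a) powr r) * indicator {a. av z <= av a} (z * a))
   = (NI a. ennreal (av z powr r) * (ennreal (av a powr r) * indicator {a. 1 <= av a} a))"
  using z by (intro nn_integral_cong) (auto simp: absval_mult powr_mult ennreal_mult indicator_def)
 also have "... = ennreal (av z powr r) * (NI a. ennreal (av a powr r) * indicator {a. 1 <= av a} a)" by (rule nn_integral_cmult) measurable
 also have "ennreal (av z) * (ennreal (av z powr r) * (NI a. ennreal (av a powr r) * indicator {a. 1 <= av a} a))
  = ennreal (av z powr (r + 1)) * (NI a. ennreal (av a powr r) * indicator {a. 1 <= av a} a)"
  using z by (simp add: mult.assoc[symmetric] ennreal_mult'[symmetric] powr_add mult.commute)
 finally show ?thesis .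
qed

lemma nn_integral_near_scale:
 assumes z: "z ~= 0"
 shows "(NI a. ennreal (av a powr r) * indicator (cb 0 z) a)
  = ennreal (av z powr (r + 1)) * (NI a. ennreal (av a powr r) * indicator (cb 0 1) a)"
proof -
 have "(NI a. ennreal (av a powr r) * indicator (cb 0 z) a)
   = ennreal (av z) * (NI a. ennreal (av (z * a) powr r) * indicator (cb 0 z) (z * a))"
  by (rule nn_integral_scale[OF z, symmetric]) measurable
 also have "(NI a. ennreal (av (z * a) powr r) * indicator (cb 0 z) (z * a))
   = (NI a. ennreal (av z powr r) * (ennreal (av a powr r) * indicator (cb 0 1) a))"
  using z by (intro nn_integral_cong) (auto simp: absval_mult powr_mult ennreal_mult indicator_def cb_def)
 also have "... = ennreal (av z powr r) * (NI a. ennreal (av a powr r) * indicator (cb 0 1) a)" by (rule nn_integral_cmult) measurable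
 also have "ennreal (av z) * (ennreal (av z powr r) * (NI a. ennreal (av a powr r) * indicator (cb 0 1) a))
  = ennreal (av z powr (r + 1)) * (NI a. ennreal (av a powr r) * indicator (cb 0 1) a)"
  using z by (simp add: mult.assoc[symmetric] ennreal_mult'[symmetric] powr_add mult.commute)
 finally show ?thesis .
qed

sublocale haar3: pair_sigma_finite "\<mu> \<Otimes>\<^sub>M \<mu>" \<mu>
proof -
 interpret P: sigma_finite_measure "\<mu> \<Otimes>\<^sub>M \<mu>" by (rule haar2.sigma_finite_measure_axioms)
 show "pair_sigma_finite \<mu>2 \<mu>" ..
qed

lemma AE_den_nz:
 assumes det: "a * d - b * c ~= 0" shows "AE x in \<mu>. a + b * x ~= 0"
proof (cases "b = 0")
 case False
 show ?thesis using AE_neq[of "- a / b"]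
 proof eventually_elim
  case (elim x)
  show ?case
  proof
   assume "a + b * x = 0"
   hence "x = - a / b" using False by (simp add: field_simps eq_neg_iff_add_eq_0)
   thus False using elim by simp
  qed
 qed
qed (use det in simp)

lemma fourier_measurable:
 assumes [measurable]: "f \<in> bm" shows "FT f \<in> bm"
proof -
 have "(%x. \<integral>y. \<psi> (x * y) * f y \<partial>\<mu>) \<in> bm" by (rule haar.borel_measurable_lebesgue_integral) measurable
 thus ?thesis by (simp add: fourier_eq[abs_def])
qed

lemma integral_prod_const:
 fixes f g :: "'k => complex"
 assumes f: "integrable \<mu> f" and g: "integrable \<mu> g"
 shows "(\<integral>p. f (fst p) * g (snd p) \<partial>\<mu>2) = (LI x. f x) * (LI x. g x)"
  and "integrable \<mu>2 (%p. f (fst p) * g (snd p))"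
proof -
 have [measurable]: "f \<in> bm" "g \<in> bm" using f g by (auto dest: borel_measurable_integrable)
 show i: "integrable \<mu>2 (%p. f (fst p) * g (snd p))"
 proof (rule integrable_prod_bound)
  show "integrable \<mu> (%x. norm (f x))" "integrable \<mu> (%x. norm (g x))" using f g by auto
 qed (simp_all add: norm_mult)
 have "(\<integral>p. f (fst p) * g (snd p) \<partial>\<mu>2) = (LI x. LI y. f x * g y)" using haar2.integral_fst'[OF i] by simp
 thus "(\<integral>p. f (fst p) * g (snd p) \<partial>\<mu>2) = (LI x. f x) * (LI x. g x)" by simp
qed

text \<open>The positive definite function \<open>z \<mapsto> 1[|z| \<le> |a|]\<close> is the Fourier transform of a multiple of
 the indicator function of the ball dual to \<open>cb 0 a\<close>.\<close>

lemma ball_form: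
 assumes f: "integrable \<mu> f" and a: "a ~= 0"
 shows "(\<integral>p. (if av (fst p - snd p) <= av a then 1 else 0) * (f (fst p) * cnj (f (snd p))) \<partial>\<mu>2)
  = of_real (av a / (vol * av p0) * (LI \<xi>. indicator (cb 0 (p0 / a)) \<xi> * (norm (FT f \<xi>))\<^sup>2))"
proof -
 have fm[measurable]: "f \<in> bm" using f by (auto dest: borel_measurable_integrable)
 have pa: "p0 / a ~= 0" using a p0 by simp
 let ?c = "av a / (vol * av p0)"
 let ?i = "%\<xi>. indicator (cb 0 (p0 / a)) \<xi> :: complex"
 let ?g = "%p. f (fst p) * cnj (f (snd p))"
 have cf: "integrable \<mu> (%x. cnj (f x))" using f by simp
 have one: "(if av z <= av a then 1 else 0) = of_real ?c * (LI \<xi>. \<psi> (z * \<xi>) * ?i \<xi>)" for z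
 proof -
  have "av (p0 / a * z) <= av p0 \<longleftrightarrow> av z <= av a"
  proof -
   have eq: "av (p0 / a * z) = av p0 / av a * av z" by (simp only: absval_mult absval_divide)
   show ?thesis unfolding eq using a p0(1) by (simp add: field_simps)
  qed
  thus ?thesis unfolding integral_psi_cb[OF pa] using a p0(1) vol_pos by (simp add: absval_divide flip: of_real_mult)
 qed
 have int3: "integrable (\<mu>2 \<Otimes>\<^sub>M \<mu>) (%(p, \<xi>). \<psi> ((fst p - snd p) * \<xi>) * ?i \<xi> * ?g p)"
 proof (rule Bochner_Integration.integrable_bound)
  have "integrable \<mu>2 (%p. norm (?g p))" by (rule integrable_norm[OF integral_prod_const(2)[OF f cf]])
  thus "integrable (\<mu>2 \<Otimes>\<^sub>M \<mu>) (%(p, \<xi>). norm (?g p) * indicator (cb 0 (p0 / a)) \<xi>)" using integrable_indicator_cb[OF pa, of 0]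
   by (intro haar3.Fubini_integrable) (auto simp: abs_mult)
  show "(%(p, \<xi>). \<psi> ((fst p - snd p) * \<xi>) * ?i \<xi> * ?g p) \<in> borel_measurable (\<mu>2 \<Otimes>\<^sub>M \<mu>)" by simp
 qed (auto simp: norm_mult indicator_def)
 have "(\<integral>p. (if av (fst p - snd p) <= av a then 1 else 0) * ?g p \<partial>\<mu>2)
   = (\<integral>p. of_real ?c * (LI \<xi>. \<psi> ((fst p - snd p) * \<xi>) * ?i \<xi> * ?g p) \<partial>\<mu>2)" unfolding one integral_mult_left_zero by (simp only: mult.assoc)
 also have "... = of_real ?c * (\<integral>p. \<integral>\<xi>. \<psi> ((fst p - snd p) * \<xi>) * ?i \<xi> * ?g p \<partial>\<mu> \<partial>\<mu>2)" by (rule integral_mult_right_zero)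
 also have "(\<integral>p. \<integral>\<xi>. \<psi> ((fst p - snd p) * \<xi>) * ?i \<xi> * ?g p \<partial>\<mu> \<partial>\<mu>2)
   = (LI \<xi>. \<integral>p. \<psi> ((fst p - snd p) * \<xi>) * ?i \<xi> * ?g p \<partial>\<mu>2)" by (rule haar3.Fubini_integral[OF int3, symmetric])
 also have "... = (LI \<xi>. of_real (indicator (cb 0 (p0 / a)) \<xi> * (norm (FT f \<xi>))\<^sup>2))"
 proof (rule Bochner_Integration.integral_cong[OF refl])
  fix \<xi>
  have "(\<integral>p. \<psi> ((fst p - snd p) * \<xi>) * ?i \<xi> * ?g p \<partial>\<mu>2)
    = (\<integral>p. ?i \<xi> * ((\<psi> (\<xi> * fst p) * f (fst p)) * cnj (\<psi> (\<xi> * snd p) * f (snd p))) \<partial>\<mu>2)"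
  proof (rule Bochner_Integration.integral_cong[OF refl])
   fix p :: "'k \<times> 'k"
   have "\<psi> ((fst p - snd p) * \<xi>) = \<psi> (\<xi> * fst p) * cnj (\<psi> (\<xi> * snd p))"
    unfolding psi_minus[symmetric] psi_add[symmetric] by (simp add: algebra_simps)
   thus "\<psi> ((fst p - snd p) * \<xi>) * ?i \<xi> * ?g p
    = ?i \<xi> * ((\<psi> (\<xi> * fst p) * f (fst p)) * cnj (\<psi> (\<xi> * snd p) * f (snd p)))" by simp
  qed
  also have "... = ?i \<xi> * (FT f \<xi> * cnj (FT f \<xi>))"
  proof -
   note i = integrable_psi_mult'[OF f, of \<xi>]
   have c: "integrable \<mu> (%x. cnj (\<psi> (\<xi> * x) * f x))" using i by (rule integrable_cnj)
   have "(LI x. cnj (\<psi> (\<xi> * x) * f x)) = cnj (FT f \<xi>)" unfolding fourier_eq by (rule Bochner_Integration.integral_cnj)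
   moreover have "(LI x. \<psi> (\<xi> * x) * f x) = FT f \<xi>" unfolding fourier_eq ..
   ultimately show ?thesis unfolding integral_mult_right_zero integral_prod_const(1)[OF i c] by (simp only:)
  qed
  also have "... = of_real (indicator (cb 0 (p0 / a)) \<xi> * (norm (FT f \<xi>))\<^sup>2)"
   by (simp only: complex_norm_square of_real_mult of_real_indicator)
  finally show "(\<integral>p. \<psi> ((fst p - snd p) * \<xi>) * ?i \<xi> * ?g p \<partial>\<mu>2)
    = of_real (indicator (cb 0 (p0 / a)) \<xi> * (norm (FT f \<xi>))\<^sup>2)" .
 qed
 finally show ?thesis unfolding integral_complex_of_real of_real_mult[of "av a / (vol * av p0)"] .
qed

end

section \<open>The kernel as a superposition of ball indicators\<close>

locale srep = half_line K s + quad_char K chi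
 for K :: "'k::nonarch_local_field field_data" and s chi
begin

abbreviation "I \<equiv> I_smooth K chi (of_real s)"

text \<open>The smooth vectors of the unitary representation: all of \<open>I\<close> for
  \<open>s < 1/2\<close>, its Steinberg subspace for \<open>s = 1/2\<close>. One definition lets
  both cases share their proofs.\<close>

definition X where "X = {f \<in> I. s < 1/2 \<or> (LI x. f x) = 0}"

lemma XI: "f \<in> X ==> f \<in> I" by (simp add: X_def)

lemma I_measurable: "f \<in> I ==> f \<in> bm" by (intro loc_const_measurable I_smooth_loc_const)

lemma I_decay:
 assumes f: "f \<in> I"
 obtains B C R where "R ~= 0" "0 <= B" "0 <= C" "!!x. norm (f x) <= B"
  "!!x. av R <= av x ==> norm (f x) <= C * av x powr (- 2 * s - 1)"
proof -
 obtain C R where R: "R ~= 0" "!!x. av R <= av x ==> f x = C * of_real (av x powr (- 2 * s - 1))" using I_smooth_asymptotic[OF f] by auto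
 have "compact (f ` cb 0 R)" using loc_const_continuous[OF I_smooth_loc_const[OF f]] compact_cb[OF R(1)]
  by (intro compact_continuous_image) (auto intro: continuous_on_subset)
 then obtain B where B: "!!z. z \<in> f ` cb 0 R ==> norm z <= B" using compact_imp_bounded bounded_iff by metis
 have "norm (f 0) <= B" by (intro B imageI cb_self)
 hence B0: "0 <= B" using norm_ge_zero order_trans by blast
 have far: "norm (f x) <= norm C * av x powr (- 2 * s - 1)" if "av R <= av x" for x using R(2)[OF that] by (simp add: norm_mult)
 have "norm (f x) <= B + norm C * av R powr (- 2 * s - 1)" for x
 proof (cases "x \<in> cb 0 R")
  case True
  thus ?thesis using B[of "f x"] by (simp add: add_increasing2)
 next
  case False
  hence x: "av R <= av x" by (simp add: cb_def)
  have "av x powr (- 2 * s - 1) <= av R powr (- 2 * s - 1)" using x R(1) s by (intro powr_mono2') auto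
  hence "norm C * av x powr (- 2 * s - 1) <= norm C * av R powr (- 2 * s - 1)" by (intro mult_left_mono) auto
  thus ?thesis using far[OF x] B0 by linarith
 qed
 moreover have "0 <= B + norm C * av R powr (- 2 * s - 1)" using B0 by simp
 ultimately show ?thesis using that[OF R(1) _ norm_ge_zero[of C] _ far] by blast
qed

text \<open>Decay like |x|^(- 2 s - 1) leaves room for any exponent below 2 s. The exponent 1/2 is
  what absorbs the growth of the kernel at \<open>s = 1/2\<close>.\<close>

lemma I_weighted:
 assumes f: "f \<in> I" and r: "0 <= r" "r < 2 * s"
 shows "(NI x. ennreal (norm (f x) * av x powr r)) < \<infinity>"
proof -
 have [measurable]: "f \<in> bm" by (rule I_measurable[OF f])
 obtain B C R where R: "R ~= 0" "0 <= B" "0 <= C" "!!x. norm (f x) <= B"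
  "!!x. av R <= av x ==> norm (f x) <= C * av x powr (- 2 * s - 1)" using f by (rule I_decay) (rule that; assumption)
 have "(NI x. ennreal (norm (f x) * av x powr r))
  <= (NI x. ennreal B * (ennreal (av x powr r) * indicator (cb 0 R) x)
   + ennreal C * (ennreal (av x powr (- 2 * s - 1 + r)) * indicator {x. av R <= av x} x))"
 proof (intro nn_integral_mono)
  fix x
  show "ennreal (norm (f x) * av x powr r) <= ennreal B * (ennreal (av x powr r) * indicator (cb 0 R) x)
   + ennreal C * (ennreal (av x powr (- 2 * s - 1 + r)) * indicator {x. av R <= av x} x)"
  proof (cases "x \<in> cb 0 R")
   case True
   have "norm (f x) * av x powr r <= B * av x powr r" by (intro mult_right_mono R(4)) simp
   hence "ennreal (norm (f x) * av x powr r) <= ennreal B * (ennreal (av x powr r) * indicator (cb 0 R) x)"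
    using True R(2) by (simp add: ennreal_mult'[symmetric] ennreal_leI)
   thus ?thesis by (rule order_trans) simp
  next
   case False
   hence x: "av R <= av x" by (simp add: cb_def)
   have "norm (f x) * av x powr r <= (C * av x powr (- 2 * s - 1)) * av x powr r" by (intro mult_right_mono R(5)[OF x]) simp
   also have "... = C * av x powr (- 2 * s - 1 + r)" by (simp add: powr_add)
   finally have "ennreal (norm (f x) * av x powr r) <= ennreal C * (ennreal (av x powr (- 2 * s - 1 + r)) * indicator {x. av R <= av x} x)"
    using x R(3) by (simp add: ennreal_mult'[symmetric] ennreal_leI)
   thus ?thesis by (rule order_trans) simp
  qed
 qed
 also have "... = ennreal B * (NI x. ennreal (av x powr r) * indicator (cb 0 R) x)
   + ennreal C * (NI x. ennreal (av x powr (- 2 * s - 1 + r)) * indicator {x. av R <= av x} x)"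
  by (subst nn_integral_add, measurable) (subst nn_integral_cmult, measurable, subst nn_integral_cmult, measurable)
 also have "... < \<infinity>" using nn_integral_powr_near[of r R] nn_integral_powr_far[of "- 2 * s - 1 + r" R] R(1) r
  by (simp add: ennreal_mult_less_top)
 finally show ?thesis .
qed

lemma I_integrable: assumes f: "f \<in> I" shows "integrable \<mu> f"
proof (rule integrableI_bounded)
 show [measurable]: "f \<in> borel_measurable \<mu>" using I_measurable[OF f] by simp
 have "(NI x. ennreal (norm (f x))) = (NI x. ennreal (norm (f x) * av x powr 0))"
 proof (rule nn_integral_cong_AE)
  show "AE x in \<mu>. ennreal (norm (f x)) = ennreal (norm (f x) * av x powr 0)" using AE_neq[of 0] by eventually_elim simp
 qed
 thus "(NI x. ennreal (norm (f x))) < \<infinity>" using I_weighted[OF f, of 0] s by simp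
qed

text \<open>A cutoff for \<open>s = 1/2\<close>, where the integral over large \<open>a\<close>
  diverges. It does not depend on \<open>z\<close>, so it is harmless on functions of integral
  0.\<close>

definition \<theta> :: "'k => real" where "\<theta> a = (if s = 1/2 \<and> 1 <= av a then 1 else 0)"

text \<open>The integrand of the superposition. Its integral over \<open>a\<close> is a multiple of
  |z|^(2 s - 1) for \<open>s < 1/2\<close> and behaves like -log |z| for
  \<open>s = 1/2\<close>.\<close>

definition Kern :: "'k => 'k => real" where
 "Kern a z = ((if av z <= av a then 1 else 0) - \<theta> a) * av a powr (2 * s - 2)"

text \<open>With the cutoff the integrand takes both signs, so absolute convergence has to be
  tracked separately from the kernel.\<close>

definition kbar :: "'k => ennreal" where "kbar z = (NI a. ennreal \<bar>Kern a z\<bar>)"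

definition ker :: "'k => complex" where "ker z = (LI a. of_real (Kern a z))"

lemma theta_measurable [measurable]: "\<theta> \<in> bm" unfolding \<theta>_def by measurable

lemma Kern_measurable [measurable (raw)]:
 assumes [measurable]: "f \<in> borel_measurable M" "g \<in> borel_measurable M"
 shows "(%x. Kern (f x) (g x)) \<in> borel_measurable M" unfolding Kern_def by measurable

lemma kbar_measurable [measurable]: "kbar \<in> bm"
proof -
 have "(%z. \<integral>\<^sup>+a. ennreal \<bar>Kern a z\<bar> \<partial>\<mu>) \<in> bm" by (rule haar.borel_measurable_nn_integral) measurable
 thus ?thesis by (simp add: kbar_def[abs_def])
qed

lemma ker_measurable [measurable]: "ker \<in> bm"
proof -
 have "(%z. \<integral>a. (of_real (Kern a z) :: complex) \<partial>\<mu>) \<in> bm" by (rule haar.borel_measurable_lebesgue_integral) measurable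
 thus ?thesis by (simp add: ker_def[abs_def])
qed

lemma ker_le_kbar: "ennreal (norm (ker z)) <= kbar z"
proof (cases "integrable \<mu> (%a. of_real (Kern a z) :: complex)")
 case True
 thus ?thesis using integral_norm_bound_ennreal[OF True] by (simp add: ker_def kbar_def)
next
 case False
 have "ker z = 0" unfolding ker_def by (rule not_integrable_integral_eq[OF False])
 thus ?thesis by simp
qed

text \<open>For \<open>s < 1/2\<close> this is scaling, with exponent 2 s - 1. For
  \<open>s = 1/2\<close> the logarithm is bounded by multiples of |z|^(-1/2) and |z|^(1/2).\<close>

lemma kbar_bound:
 "\<exists>C1 C2 \<beta>. 0 <= C1 \<and> 0 <= C2 \<and> 0 < \<beta> \<and> \<beta> < 1 \<and> (s < 1/2 --> C2 = 0) \<and>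
   (\<forall>z. z ~= 0 --> kbar z <= ennreal (C1 * av z powr (- \<beta>) + C2 * av z powr (1/2)))"
proof (cases "s < 1/2")
 case True
 define k1 where "k1 = (NI a. ennreal (av a powr (2 * s - 2)) * indicator {a. 1 <= av a} a)"
 have "k1 < \<infinity>" using nn_integral_powr_far[of "2 * s - 2" 1] True by (simp add: k1_def)
 hence k1: "k1 = ennreal (enn2real k1)" by simp
 have "kbar z = ennreal (enn2real k1 * av z powr (- (1 - 2 * s)))" if z: "z ~= 0" for z
 proof -
  have "kbar z = (NI a. ennreal (av a powr (2 * s - 2)) * indicator {a. av z <= av a} a)"
   unfolding kbar_def using True by (intro nn_integral_cong) (simp add: Kern_def \<theta>_def indicator_def)
  also have "... = ennreal (av z powr (2 * s - 2 + 1)) * k1" unfolding k1_def by (rule nn_integral_far_scale[OF z])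
  also have "... = ennreal (enn2real k1 * av z powr (- (1 - 2 * s)))" by (subst k1) (simp add: ennreal_mult'[symmetric] mult.commute)
  finally show ?thesis .
 qed
 thus ?thesis using True s by (intro exI[of _ "enn2real k1"] exI[of _ 0] exI[of _ "1 - 2 * s"]) auto
next
 case False
 hence s12: "s = 1/2" using s by simp
 have K12: "Kern a z = ((if av z <= av a then 1 else 0) - (if 1 <= av a then 1 else 0)) * av a powr (- 1)" for a z
  unfolding Kern_def \<theta>_def by (simp add: s12)
 \<comment> \<open>Between |z| and 1 the factor |a|^(-1) is replaced by |a|^(-3/2) where |a| < 1 and
   by |a|^(-1/2) where |a| >= 1; both replacements extend to integrable powers on regions that scale
   with \<open>z\<close>.\<close>
 define k1 where "k1 = (NI a. ennreal (av a powr (- 3/2)) * indicator {a. 1 <= av a} a)"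
 define k2 where "k2 = (NI a. ennreal (av a powr (- 1/2)) * indicator (cb 0 1) a)"
 have "k1 < \<infinity>" using nn_integral_powr_far[of "- 3/2" 1] by (simp add: k1_def)
 hence k1: "k1 = ennreal (enn2real k1)" by simp
 have "k2 < \<infinity>" using nn_integral_powr_near[of "- 1/2" 1] by (simp add: k2_def)
 hence k2: "k2 = ennreal (enn2real k2)" by simp
 have "kbar z <= ennreal (enn2real k1 * av z powr (- (1/2)) + enn2real k2 * av z powr (1/2))" if z: "z ~= 0" for z
 proof -
  have "kbar z <= (NI a. ennreal (av a powr (- 3/2)) * indicator {a. av z <= av a} a
    + ennreal (av a powr (- 1/2)) * indicator (cb 0 z) a)" unfolding kbar_def
  proof (rule nn_integral_mono_AE)
   show "AE a in \<mu>. ennreal \<bar>Kern a z\<bar> <= ennreal (av a powr (- 3/2)) * indicator {a. av z <= av a} a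
    + ennreal (av a powr (- 1/2)) * indicator (cb 0 z) a" using AE_neq[of 0]
   proof eventually_elim
    case (elim a)
    hence a: "0 < av a" by simp
    consider "av z <= av a" "av a < 1" | "av a < av z" "1 <= av a" | "av z <= av a \<longleftrightarrow> 1 <= av a" by linarith
    thus ?case
    proof cases
     case 1
     have "av a powr (- 1) <= av a powr (- 3/2)" using 1 a by (intro powr_mono') auto
     thus ?thesis using 1 by (intro order_trans[OF _ add_increasing2[OF _ order_refl]]) (simp_all add: K12 ennreal_leI)
    next
     case 2
     have "av a powr (- 1) <= av a powr (- 1/2)" using 2 by (intro powr_mono) auto
     thus ?thesis using 2 by (intro order_trans[OF _ add_increasing[OF _ order_refl]]) (simp_all add: K12 cb_def ennreal_leI)
    next
     case 3
     thus ?thesis by (simp add: K12)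
    qed
   qed
  qed
  also have "... = (NI a. ennreal (av a powr (- 3/2)) * indicator {a. av z <= av a} a)
    + (NI a. ennreal (av a powr (- 1/2)) * indicator (cb 0 z) a)" by (rule nn_integral_add) measurable
  also have "... = ennreal (av z powr (- 3/2 + 1)) * k1 + ennreal (av z powr (- 1/2 + 1)) * k2"
   unfolding k1_def k2_def nn_integral_far_scale[OF z] nn_integral_near_scale[OF z] ..
  also have "... = ennreal (enn2real k1 * av z powr (- (1/2)) + enn2real k2 * av z powr (1/2))"
   by (subst k1, subst k2) (simp add: ennreal_mult'[symmetric] mult.commute)
  finally show ?thesis .
 qed
 thus ?thesis using False by (intro exI[of _ "enn2real k1"] exI[of _ "enn2real k2"] exI[of _ "1/2"]) auto
qed

lemma kbar_finite: "z ~= 0 ==> kbar z < \<infinity>" using kbar_bound by (metis ennreal_less_top infinity_ennreal_def le_less_trans)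

lemma Kern_integrable: assumes z: "z ~= 0" shows "integrable \<mu> (%a. of_real (Kern a z) :: complex)"
 using kbar_finite[OF z] by (intro integrableI_bounded) (simp_all add: kbar_def)

text \<open>The singular power is integrated against the sup bound of \<open>f\<close> on the unit
  ball around \<open>x\<close> and is at most 1 outside it. The growing power is split by |x -
  y|^(1/2) <= |x|^(1/2) + |y|^(1/2).\<close>

lemma kbar_conv:
 assumes f: "f \<in> I"
 shows "\<exists>c1 c2. 0 <= c1 \<and> 0 <= c2 \<and> (s < 1/2 --> c2 = 0) \<and>
  (\<forall>x. (NI y. kbar (x - y) * ennreal (norm (f y))) <= ennreal (c1 + c2 * av x powr (1/2)))"
proof -
 have [measurable]: "f \<in> bm" by (rule I_measurable[OF f])
 from kbar_bound obtain C1 C2 \<beta> where C: "0 <= C1" "0 <= C2" "0 < \<beta>" "\<beta> < 1" "s < 1/2 --> C2 = 0"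
  "\<forall>z. z ~= 0 --> kbar z <= ennreal (C1 * av z powr (- \<beta>) + C2 * av z powr (1/2))" by (elim exE conjE)
 obtain B C R where B: "R ~= 0" "0 <= B" "0 <= C" "!!x. norm (f x) <= B"
  "!!x. av R <= av x ==> norm (f x) <= C * av x powr (- 2 * s - 1)" using f by (rule I_decay) (rule that; assumption)
 define N where "N = (NI u. ennreal (av u powr (- \<beta>)) * indicator (cb 0 1) u)"
 have "N < \<infinity>" unfolding N_def using nn_integral_powr_near[of "- \<beta>" 1] C by simp
 hence N: "N = ennreal (enn2real N)" by simp
 define n1 where "n1 = (NI y. ennreal (norm (f y)))"
 have "n1 < \<infinity>" using I_integrable[OF f] by (simp add: n1_def integrable_iff_bounded)
 hence n1: "n1 = ennreal (enn2real n1)" by simp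
 define n2 where "n2 = (NI y. ennreal (norm (f y) * av y powr (1/2)))"
 have n2: "ennreal C2 * n2 = ennreal (C2 * enn2real n2)"
 proof (cases "s < 1/2")
  case False
  hence "n2 < \<infinity>" using I_weighted[OF f, of "1/2"] s by (simp add: n2_def)
  hence "n2 = ennreal (enn2real n2)" by simp
  thus ?thesis using C(2) by (metis ennreal_mult')
 qed (use C(5) in simp)
 have "(NI y. kbar (x - y) * ennreal (norm (f y)))
  <= ennreal ((C1 * (B * enn2real N + enn2real n1) + C2 * enn2real n2) + (C2 * enn2real n1) * av x powr (1/2))" for x
 proof -
  have "(NI y. kbar (x - y) * ennreal (norm (f y)))
   <= (NI y. (ennreal (C1 * B) * (ennreal (av (x - y) powr (- \<beta>)) * indicator (cb 0 1) (x - y)) + ennreal C1 * ennreal (norm (f y)))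
    + (ennreal (C2 * av x powr (1/2)) * ennreal (norm (f y)) + ennreal C2 * ennreal (norm (f y) * av y powr (1/2))))"
  proof (rule nn_integral_mono_AE)
   show "AE y in \<mu>. kbar (x - y) * ennreal (norm (f y))
    <= (ennreal (C1 * B) * (ennreal (av (x - y) powr (- \<beta>)) * indicator (cb 0 1) (x - y)) + ennreal C1 * ennreal (norm (f y)))
    + (ennreal (C2 * av x powr (1/2)) * ennreal (norm (f y)) + ennreal C2 * ennreal (norm (f y) * av y powr (1/2)))" using AE_neq[of x]
   proof eventually_elim
    case (elim y)
    let ?z = "x - y"
    have z: "?z ~= 0" using elim by simp
    have 1: "av ?z powr (- \<beta>) * norm (f y) <= B * (av ?z powr (- \<beta>) * indicator (cb 0 1) ?z) + norm (f y)"
    proof (cases "?z \<in> cb 0 1")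
     case True
     have "av ?z powr (- \<beta>) * norm (f y) <= av ?z powr (- \<beta>) * B" by (intro mult_left_mono B) simp
     thus ?thesis using True by (simp add: mult.commute add_increasing2)
    next
     case False
     hence "av ?z powr (- \<beta>) <= 1 powr (- \<beta>)" using C(3) by (intro powr_mono2') (auto simp: cb_def)
     hence "av ?z powr (- \<beta>) * norm (f y) <= 1 * norm (f y)" by (intro mult_right_mono) auto
     thus ?thesis using False by simp
    qed
    have 2: "av ?z powr (1/2) * norm (f y) <= av x powr (1/2) * norm (f y) + norm (f y) * av y powr (1/2)"
    proof -
     have "av ?z powr (1/2) <= av x powr (1/2) + av y powr (1/2)"
     proof (cases "av x <= av y")
      case True
      hence "av ?z powr (1/2) <= av y powr (1/2)" using absval_diff[of x y] by (intro powr_mono2) auto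
      thus ?thesis by (simp add: add_increasing)
     next
      case False
      hence "av ?z powr (1/2) <= av x powr (1/2)" using absval_diff[of x y] by (intro powr_mono2) auto
      thus ?thesis by (simp add: add_increasing2)
     qed
     from mult_right_mono[OF this norm_ge_zero[of "f y"]] show ?thesis by (simp add: distrib_left distrib_right mult.commute)
    qed
    have "kbar ?z * ennreal (norm (f y)) <= ennreal (C1 * av ?z powr (- \<beta>) + C2 * av ?z powr (1/2)) * ennreal (norm (f y))"
     using C(6) z by (intro mult_right_mono) auto
    also have "... = ennreal (C1 * (av ?z powr (- \<beta>) * norm (f y)) + C2 * (av ?z powr (1/2) * norm (f y)))"
     using C(1,2) by (simp add: ennreal_mult'[symmetric] distrib_right mult.assoc)
    also have "... <= ennreal (C1 * (B * (av ?z powr (- \<beta>) * indicator (cb 0 1) ?z) + norm (f y))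
      + C2 * (av x powr (1/2) * norm (f y) + norm (f y) * av y powr (1/2)))" by (intro ennreal_leI add_mono mult_left_mono 1 2 C)
    also have "... = ennreal ((C1 * B * (av ?z powr (- \<beta>) * indicator (cb 0 1) ?z) + C1 * norm (f y))
      + (C2 * av x powr (1/2) * norm (f y) + C2 * (norm (f y) * av y powr (1/2))))" by (simp add: algebra_simps)
    also have "... = (ennreal (C1 * B) * (ennreal (av ?z powr (- \<beta>)) * indicator (cb 0 1) ?z) + ennreal C1 * ennreal (norm (f y)))
     + (ennreal (C2 * av x powr (1/2)) * ennreal (norm (f y)) + ennreal C2 * ennreal (norm (f y) * av y powr (1/2)))"
     using C(1,2) B(2) by (simp add: ennreal_mult' ennreal_indicator)
    finally show ?case .
   qed
  qed
  also have "... = (ennreal (C1 * B) * (NI y. ennreal (av (x - y) powr (- \<beta>)) * indicator (cb 0 1) (x - y)) + ennreal C1 * n1)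
    + (ennreal (C2 * av x powr (1/2)) * n1 + ennreal C2 * n2)" unfolding n1_def n2_def by (simp add: nn_integral_add nn_integral_cmult)
  also have "(NI y. ennreal (av (x - y) powr (- \<beta>)) * indicator (cb 0 1) (x - y)) = N"
  proof -
   have "(NI y. ennreal (av (x - y) powr (- \<beta>)) * indicator (cb 0 1) (x - y))
    = (NI u. ennreal (av (x - (x + u)) powr (- \<beta>)) * indicator (cb 0 1) (x - (x + u)))"
    by (rule nn_integral_translate[symmetric]) measurable
   also have "... = N" unfolding N_def by (intro nn_integral_cong) (simp add: indicator_def cb_def)
   finally show ?thesis .
  qed
  also have "(ennreal (C1 * B) * N + ennreal C1 * n1) + (ennreal (C2 * av x powr (1/2)) * n1 + ennreal C2 * n2)
   = ennreal ((C1 * (B * enn2real N + enn2real n1) + C2 * enn2real n2) + (C2 * enn2real n1) * av x powr (1/2))"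
   unfolding n2 by (subst N, subst n1, subst n1)
    (use C(1,2) B(2) in \<open>simp add: ennreal_mult'[symmetric] algebra_simps flip: ennreal_plus\<close>)
  finally show ?thesis .
 qed
 thus ?thesis using C B(2) by (intro exI[of _ "C1 * (B * enn2real N + enn2real n1) + C2 * enn2real n2"] exI[of _ "C2 * enn2real n1"]) auto
qed

lemma ker_conv_integrable:
 assumes f: "f \<in> I" shows "integrable \<mu> (%y. ker (x - y) * f y)"
proof (rule integrableI_bounded)
 have [measurable]: "f \<in> bm" by (rule I_measurable[OF f])
 show "(%y. ker (x - y) * f y) \<in> borel_measurable \<mu>" by measurable
 have "(NI y. ennreal (norm (ker (x - y) * f y))) <= (NI y. kbar (x - y) * ennreal (norm (f y)))"
  by (intro nn_integral_mono) (simp add: norm_mult ennreal_mult mult_right_mono ker_le_kbar)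
 also have "... < \<infinity>" using kbar_conv[OF f] by (metis ennreal_less_top infinity_ennreal_def le_less_trans)
 finally show "(NI y. ennreal (norm (ker (x - y) * f y))) < \<infinity>" .
qed

lemma kbar_form_finite:
 assumes f: "f \<in> I"
 shows "(NI x. \<integral>\<^sup>+y. kbar (x - y) * ennreal (norm (f y)) \<partial>\<mu> * ennreal (norm (f x))) < \<infinity>"
proof -
 have [measurable]: "f \<in> bm" by (rule I_measurable[OF f])
 from kbar_conv[OF f] obtain c1 c2 where c: "0 <= c1" "0 <= c2" "s < 1/2 --> c2 = 0"
  "\<forall>x. (NI y. kbar (x - y) * ennreal (norm (f y))) <= ennreal (c1 + c2 * av x powr (1/2))" by (elim exE conjE)
 have "(NI x. (NI y. kbar (x - y) * ennreal (norm (f y))) * ennreal (norm (f x)))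
  <= (NI x. ennreal c1 * ennreal (norm (f x)) + ennreal c2 * ennreal (norm (f x) * av x powr (1/2)))"
 proof (intro nn_integral_mono)
  fix x
  have "(NI y. kbar (x - y) * ennreal (norm (f y))) * ennreal (norm (f x)) <= ennreal (c1 + c2 * av x powr (1/2)) * ennreal (norm (f x))"
   using c(4) by (intro mult_right_mono) auto
  also have "... = ennreal (c1 * norm (f x) + c2 * (norm (f x) * av x powr (1/2)))"
   using c by (simp add: ennreal_mult'[symmetric] algebra_simps)
  also have "... = ennreal c1 * ennreal (norm (f x)) + ennreal c2 * ennreal (norm (f x) * av x powr (1/2))"
   using c by (simp add: ennreal_mult')
  finally show "(NI y. kbar (x - y) * ennreal (norm (f y))) * ennreal (norm (f x))
   <= ennreal c1 * ennreal (norm (f x)) + ennreal c2 * ennreal (norm (f x) * av x powr (1/2))" .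
 qed
 also have "... = ennreal c1 * (NI x. ennreal (norm (f x))) + ennreal c2 * (NI x. ennreal (norm (f x) * av x powr (1/2)))"
  by (simp add: nn_integral_add nn_integral_cmult)
 also have "... < \<infinity>"
 proof -
  have "(NI x. ennreal (norm (f x))) < \<infinity>" using I_integrable[OF f] by (simp add: integrable_iff_bounded)
  moreover have "ennreal c2 * (NI x. ennreal (norm (f x) * av x powr (1/2))) < \<infinity>"
  proof (cases "s < 1/2")
   case False
   thus ?thesis using I_weighted[OF f, of "1/2"] s by (simp add: ennreal_mult_less_top)
  qed (use c in simp)
  ultimately show ?thesis by (simp add: ennreal_mult_less_top)
 qed
 finally show ?thesis .
qed

text \<open>Tonelli reduces the triple integral to \<open>kbar_form_finite\<close>. It justifies
  exchanging the integral over the ball radius with the two integrals of the form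
  \<open>Q\<close>.\<close>

lemma triple_integrable:
 assumes f: "f \<in> I"
 shows "integrable (\<mu>2 \<Otimes>\<^sub>M \<mu>) (%(p, a). of_real (Kern a (fst p - snd p)) * (f (fst p) * cnj (f (snd p))))"
  (is "integrable _ ?T")
proof (rule integrableI_bounded)
 have [measurable]: "f \<in> bm" by (rule I_measurable[OF f])
 show m[measurable]: "?T \<in> borel_measurable (\<mu>2 \<Otimes>\<^sub>M \<mu>)" by measurable
 have "(\<integral>\<^sup>+t. ennreal (norm (?T t)) \<partial>(\<mu>2 \<Otimes>\<^sub>M \<mu>)) = (\<integral>\<^sup>+p. \<integral>\<^sup>+a. ennreal (norm (?T (p, a))) \<partial>\<mu> \<partial>\<mu>2)"
  by (rule haar.nn_integral_fst[symmetric]) measurable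
 also have "... = (\<integral>\<^sup>+p. kbar (fst p - snd p) * ennreal (norm (f (fst p) * cnj (f (snd p)))) \<partial>\<mu>2)"
 proof (rule nn_integral_cong)
  fix p :: "'k \<times> 'k"
  have "(NI a. ennreal (norm (?T (p, a)))) = (NI a. ennreal \<bar>Kern a (fst p - snd p)\<bar> * ennreal (norm (f (fst p) * cnj (f (snd p)))))"
   by (simp add: norm_mult ennreal_mult)
  thus "(NI a. ennreal (norm (?T (p, a)))) = kbar (fst p - snd p) * ennreal (norm (f (fst p) * cnj (f (snd p))))"
   by (simp add: nn_integral_multc kbar_def)
 qed
 also have "... = (NI x. NI y. kbar (x - y) * ennreal (norm (f x * cnj (f y))))" by (subst haar.nn_integral_fst[symmetric]) simp_all
 also have "... = (NI x. (NI y. kbar (x - y) * ennreal (norm (f y))) * ennreal (norm (f x)))"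
 proof (rule nn_integral_cong)
  fix x
  have "(NI y. kbar (x - y) * ennreal (norm (f x * cnj (f y)))) = (NI y. (kbar (x - y) * ennreal (norm (f y))) * ennreal (norm (f x)))"
   by (simp add: norm_mult ennreal_mult mult_ac)
  thus "(NI y. kbar (x - y) * ennreal (norm (f x * cnj (f y)))) = (NI y. kbar (x - y) * ennreal (norm (f y))) * ennreal (norm (f x))"
   by (simp add: nn_integral_multc)
 qed
 also have "... < \<infinity>" by (rule kbar_form_finite[OF f])
 finally show "(\<integral>\<^sup>+t. ennreal (norm (?T t)) \<partial>(\<mu>2 \<Otimes>\<^sub>M \<mu>)) < \<infinity>" .
qed

definition Q :: "('k => complex) => complex" where
 "Q f = (LI x. LI y. ker (x - y) * (f x * cnj (f y)))"

lemma Q_eq: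
 assumes f: "f \<in> I"
 shows "Q f = (LI a. \<integral>p. of_real (Kern a (fst p - snd p)) * (f (fst p) * cnj (f (snd p))) \<partial>\<mu>2)"
  and "integrable \<mu> (%a. \<integral>p. of_real (Kern a (fst p - snd p)) * (f (fst p) * cnj (f (snd p))) \<partial>\<mu>2)"
  and "integrable \<mu>2 (%p. ker (fst p - snd p) * (f (fst p) * cnj (f (snd p))))"
proof -
 note T = triple_integrable[OF f]
 have k: "(LI a. of_real (Kern a (fst p - snd p)) * (f (fst p) * cnj (f (snd p))))
  = ker (fst p - snd p) * (f (fst p) * cnj (f (snd p)))" for p :: "'k \<times> 'k" by (simp add: ker_def)
 show i: "integrable \<mu>2 (%p. ker (fst p - snd p) * (f (fst p) * cnj (f (snd p))))"
  using haar3.integrable_fst'[OF T] by (simp only: k case_prod_conv)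
 show "integrable \<mu> (%a. \<integral>p. of_real (Kern a (fst p - snd p)) * (f (fst p) * cnj (f (snd p))) \<partial>\<mu>2)" using haar3.integrable_snd[OF T] .
 have "Q f = (\<integral>p. ker (fst p - snd p) * (f (fst p) * cnj (f (snd p))) \<partial>\<mu>2)" unfolding Q_def using haar2.integral_fst'[OF i] by simp
 also have "... = (\<integral>p. \<integral>a. of_real (Kern a (fst p - snd p)) * (f (fst p) * cnj (f (snd p))) \<partial>\<mu> \<partial>\<mu>2)" by (simp only: k)
 also have "... = (LI a. \<integral>p. of_real (Kern a (fst p - snd p)) * (f (fst p) * cnj (f (snd p))) \<partial>\<mu>2)"
  by (rule haar3.Fubini_integral[OF T, symmetric])
 finally show "Q f = (LI a. \<integral>p. of_real (Kern a (fst p - snd p)) * (f (fst p) * cnj (f (snd p))) \<partial>\<mu>2)" .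
qed

end

section \<open>The form on the Fourier side and its Moebius invariance\<close>

context srep
begin

text \<open>The cutoff contributes \<open>\<theta> a\<close> times the squared modulus of the
  integral of \<open>f\<close>; one of the two factors is 0 in either case. The rest is
  \<open>ball_form\<close>.\<close>

lemma slice_form:
 assumes f: "f \<in> X" and a: "a ~= 0"
 shows "(\<integral>p. of_real (Kern a (fst p - snd p)) * (f (fst p) * cnj (f (snd p))) \<partial>\<mu>2)
  = of_real (av a powr (2 * s - 2) * (av a / (vol * av p0) * (LI \<xi>. indicator (cb 0 (p0 / a)) \<xi> * (norm (FT f \<xi>))\<^sup>2)))"
proof -
 have i: "integrable \<mu> f" by (rule I_integrable[OF XI[OF f]])
 have [measurable]: "f \<in> bm" by (rule I_measurable[OF XI[OF f]])
 have ci: "integrable \<mu> (%x. cnj (f x))" using i by simp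
 let ?g = "%p. f (fst p) * cnj (f (snd p))"
 have gi: "integrable \<mu>2 ?g" by (rule integral_prod_const(2)[OF i ci])
 have bi: "integrable \<mu>2 (%p. (if av (fst p - snd p) <= av a then 1 else 0) * ?g p)"
  by (rule Bochner_Integration.integrable_bound[OF gi]) (auto intro!: AE_I2)
 have z: "of_real (\<theta> a) * (\<integral>p. ?g p \<partial>\<mu>2) = 0" unfolding integral_prod_const(1)[OF i ci] using f by (auto simp: X_def \<theta>_def)
 have "(\<integral>p. of_real (Kern a (fst p - snd p)) * ?g p \<partial>\<mu>2)
   = (\<integral>p. of_real (av a powr (2 * s - 2)) * ((if av (fst p - snd p) <= av a then 1 else 0) * ?g p - of_real (\<theta> a) * ?g p) \<partial>\<mu>2)"
  by (rule Bochner_Integration.integral_cong[OF refl]) (simp add: Kern_def algebra_simps)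
 also have "... = of_real (av a powr (2 * s - 2)) * ((\<integral>p. (if av (fst p - snd p) <= av a then 1 else 0) * ?g p \<partial>\<mu>2) - of_real (\<theta> a) * (\<integral>p. ?g p \<partial>\<mu>2))"
  unfolding integral_mult_right_zero by (subst Bochner_Integration.integral_diff[OF bi integrable_mult_right[OF gi]]) simp
 finally show ?thesis unfolding z ball_form[OF i a] by simp
qed

text \<open>The integral of |a|^(2 s - 1) over the ball |a| <= |p0 / \<xi>| is |p0 / \<xi>|^(2 s)
  times the one over the unit ball. The factor |\<xi>|^(- 2 s) is the weight, everything else is
  collected here.\<close>

definition "cform = enn2real (NI a. ennreal (av a powr (2 * s - 1)) * indicator (cb 0 1) a) * av p0 powr (2 * s) / (vol * av p0)"

lemma near_const: "(NI a. ennreal (av a powr (2 * s - 1)) * indicator (cb 0 1) a)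
  = ennreal (enn2real (NI a. ennreal (av a powr (2 * s - 1)) * indicator (cb 0 1) a))"
 using nn_integral_powr_near[of "2 * s - 1" 1] s by simp

lemma cform_pos: "0 < cform"
proof -
 let ?N = "\<integral>\<^sup>+a. ennreal (av a powr (2 * s - 1)) * indicator (cb 0 1) a \<partial>\<mu>"
 have "?N ~= 0"
 proof
  assume "?N = 0"
  hence "AE a in \<mu>. ennreal (av a powr (2 * s - 1)) * indicator (cb 0 1) a = 0" by (subst (asm) nn_integral_0_iff_AE) auto
  hence "AE a in \<mu>. a \<notin> cb 0 1" using AE_neq[of 0] by eventually_elim (auto simp: indicator_def split: if_splits)
  hence "emeasure \<mu> (cb 0 1) = 0" by (subst (asm) AE_iff_measurable[of "cb 0 1"]) auto
  thus False using emeasure_cb[of 1 0] vol_pos by simp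
 qed
 moreover have "?N < \<infinity>" using nn_integral_powr_near[of "2 * s - 1" 1] s by simp
 ultimately have "0 < enn2real ?N" by (simp add: enn2real_positive_iff zero_less_iff_neq_zero)
 thus ?thesis using vol_pos p0(1) by (simp add: cform_def)
qed

lemma FT_form:
 assumes f: "f \<in> X"
 shows "FT f \<in> Lw" and "Q f = of_real (cform * (LI \<xi>. (norm (FT f \<xi>))\<^sup>2 * w \<xi>))"
proof -
 have fI: "f \<in> I" by (rule XI[OF f])
 have i: "integrable \<mu> f" by (rule I_integrable[OF fI])
 have fm: "f \<in> bm" by (rule I_measurable[OF fI])
 have Fm[measurable]: "FT f \<in> bm" by (rule fourier_measurable[OF fm])
 let ?I = "%a. \<integral>\<xi>. indicator (cb 0 (p0 / a)) \<xi> * (norm (FT f \<xi>))\<^sup>2 \<partial>\<mu>"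
 define h where "h a = av a powr (2 * s - 2) * (av a / (vol * av p0) * ?I a)" for a
 let ?P = "%a. \<integral>p. of_real (Kern a (fst p - snd p)) * (f (fst p) * cnj (f (snd p))) \<partial>\<mu>2"
 have hm[measurable]: "h \<in> bm"
 proof -
  have "(%a. \<integral>\<xi>. (if av \<xi> <= av (p0 / a) then 1 else 0) * (norm (FT f \<xi>))\<^sup>2 \<partial>\<mu>) \<in> bm"
   by (rule haar.borel_measurable_lebesgue_integral) measurable
  moreover have "?I = (%a. \<integral>\<xi>. (if av \<xi> <= av (p0 / a) then 1 else 0) * (norm (FT f \<xi>))\<^sup>2 \<partial>\<mu>)"
   by (intro ext Bochner_Integration.integral_cong) (auto simp: indicator_def cb_def)
  ultimately have "?I \<in> bm" by (simp only:)
  moreover have "(%a. av a powr (2 * s - 2)) \<in> bm" "(%a. av a / (vol * av p0)) \<in> bm" by measurable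
  ultimately show ?thesis unfolding h_def by (intro borel_measurable_times)
 qed
 have ae: "AE a in \<mu>. ?P a = of_real (h a)" using AE_neq[of 0]
 proof eventually_elim
  case (elim a)
  show ?case unfolding h_def by (rule slice_form[OF f elim])
 qed
 have Pi: "integrable \<mu> ?P" by (rule Q_eq(2)[OF fI])
 hence "integrable \<mu> (%a. of_real (h a) :: complex)"
  by (subst integrable_cong_AE[symmetric, OF _ _ ae]) (auto dest: borel_measurable_integrable)
 hence hi: "integrable \<mu> h" by (simp only: complex_of_real_integrable_eq)
 have Qh: "Q f = of_real (LI a. h a)"
 proof -
  have "Q f = (LI a. of_real (h a))"
   unfolding Q_eq(1)[OF fI] using Pi ae by (intro integral_cong_AE) (auto dest: borel_measurable_integrable)
  thus ?thesis by (simp only: integral_complex_of_real)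
 qed
 have I_nn: "0 <= ?I a" for a by (intro Bochner_Integration.integral_nonneg) simp
 have h_nn: "0 <= h a" for a using I_nn[of a] vol_pos by (simp add: h_def)
 \<comment> \<open>For nonzero arguments the condition |\<xi>| <= |p0 / a| is symmetric in
   \<open>a\<close> and \<open>\<xi>\<close>, so after the exchange a power of |a| is integrated
   over a ball.\<close>
 let ?G = "%a \<xi>. ennreal (av a powr (2 * s - 1) / (vol * av p0)) * (ennreal (if av \<xi> <= av (p0 / a) then 1 else 0) * ennreal ((norm (FT f \<xi>))\<^sup>2))"
 have "ennreal (LI a. h a) = (NI a. ennreal (h a))" by (rule nn_integral_eq_integral[symmetric, OF hi]) (simp add: h_nn)
 also have "... = (NI a. NI \<xi>. ?G a \<xi>)"
 proof (rule nn_integral_cong_AE)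
  show "AE a in \<mu>. ennreal (h a) = (NI \<xi>. ?G a \<xi>)" using AE_neq[of 0]
  proof eventually_elim
   case (elim a)
   hence pa: "p0 / a ~= 0" using p0 by simp
   have ii: "integrable \<mu> (%\<xi>. indicator (cb 0 (p0 / a)) \<xi> * (norm (FT f \<xi>))\<^sup>2)"
   proof (rule Bochner_Integration.integrable_bound)
    let ?B = "\<integral>y. norm (f y) \<partial>\<mu>"
    show "integrable \<mu> (%\<xi>. ?B\<^sup>2 * indicator (cb 0 (p0 / a)) \<xi>)" using integrable_indicator_cb[OF pa, of 0] by (rule integrable_mult_right)
    show "AE \<xi> in \<mu>. norm (indicator (cb 0 (p0 / a)) \<xi> * (norm (FT f \<xi>))\<^sup>2) <= norm (?B\<^sup>2 * indicator (cb 0 (p0 / a)) \<xi>)"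
    proof (rule AE_I2)
     fix \<xi>
     have "(norm (FT f \<xi>))\<^sup>2 <= ?B\<^sup>2" by (intro power_mono fourier_norm_le) simp
     thus "norm (indicator (cb 0 (p0 / a)) \<xi> * (norm (FT f \<xi>))\<^sup>2) <= norm (?B\<^sup>2 * indicator (cb 0 (p0 / a)) \<xi>)" by (simp add: indicator_def)
    qed
   qed simp
   have "ennreal (h a) = ennreal (av a powr (2 * s - 1) / (vol * av p0)) * ennreal (?I a)"
   proof -
    have "av a powr (2 * s - 2) * av a = av a powr (2 * s - 1)" using elim powr_add[of "av a" "2 * s - 2" 1] by simp
    hence "h a = (av a powr (2 * s - 1) / (vol * av p0)) * ?I a" by (simp add: h_def)
    moreover have "0 <= av a powr (2 * s - 1) / (vol * av p0)" using vol_pos by simp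
    ultimately show ?thesis by (simp only: ennreal_mult' mult.commute)
   qed
   also have "ennreal (?I a) = (NI \<xi>. ennreal (indicator (cb 0 (p0 / a)) \<xi> * (norm (FT f \<xi>))\<^sup>2))"
    by (rule nn_integral_eq_integral[symmetric, OF ii]) simp
   also have "... = (NI \<xi>. ennreal (if av \<xi> <= av (p0 / a) then 1 else 0) * ennreal ((norm (FT f \<xi>))\<^sup>2))"
    by (intro nn_integral_cong) (simp add: indicator_def cb_def)
   finally show ?case by (subst nn_integral_cmult) simp_all
  qed
 qed
 also have "... = (NI \<xi>. NI a. ?G a \<xi>)" by (rule haar2.Fubini') measurable
 also have "... = (NI \<xi>. ennreal (cform * ((norm (FT f \<xi>))\<^sup>2 * w \<xi>)))"
 proof (rule nn_integral_cong_AE)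
  show "AE \<xi> in \<mu>. (NI a. ?G a \<xi>) = ennreal (cform * ((norm (FT f \<xi>))\<^sup>2 * w \<xi>))" using AE_neq[of 0]
  proof eventually_elim
   case (elim \<xi>)
   hence pxi: "p0 / \<xi> ~= 0" using p0 by simp
   let ?c = "(norm (FT f \<xi>))\<^sup>2 / (vol * av p0)"
   have "(NI a. ?G a \<xi>) = (NI a. ennreal ?c * (ennreal (av a powr (2 * s - 1)) * indicator (cb 0 (p0 / \<xi>)) a))"
   proof (rule nn_integral_cong_AE)
    show "AE a in \<mu>. ?G a \<xi> = ennreal ?c * (ennreal (av a powr (2 * s - 1)) * indicator (cb 0 (p0 / \<xi>)) a)" using AE_neq[of 0]
    proof eventually_elim
     fix a :: 'k assume a: "a ~= 0"
     have iff: "av \<xi> <= av (p0 / a) \<longleftrightarrow> a \<in> cb 0 (p0 / \<xi>)" using a elim by (simp add: cb_def absval_divide field_simps)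
     show "?G a \<xi> = ennreal ?c * (ennreal (av a powr (2 * s - 1)) * indicator (cb 0 (p0 / \<xi>)) a)"
      unfolding iff using vol_pos by (simp add: indicator_def ennreal_mult'[symmetric] mult.commute)
    qed
   qed
   also have "... = ennreal ?c * (NI a. ennreal (av a powr (2 * s - 1)) * indicator (cb 0 (p0 / \<xi>)) a)"
    by (rule nn_integral_cmult) measurable
   also have "... = ennreal ?c * (ennreal (av (p0 / \<xi>) powr (2 * s - 1 + 1)) * (NI a. ennreal (av a powr (2 * s - 1)) * indicator (cb 0 1) a))"
    unfolding nn_integral_near_scale[OF pxi] ..
   also have "... = ennreal (cform * ((norm (FT f \<xi>))\<^sup>2 * w \<xi>))"
   proof -
    have "av (p0 / \<xi>) powr (2 * s - 1 + 1) = av p0 powr (2 * s) * w \<xi>"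
     unfolding absval_divide using elim p0(1) by (simp add: powr_divide powr_minus_divide)
    thus ?thesis using vol_pos by (subst near_const) (simp add: cform_def ennreal_mult'[symmetric] mult_ac)
   qed
   finally show ?case .
  qed
 qed
 finally have eq: "(NI \<xi>. ennreal (cform * ((norm (FT f \<xi>))\<^sup>2 * w \<xi>))) = ennreal (LI a. h a)" by (rule sym)
 have nn: "0 <= cform * ((norm (FT f \<xi>))\<^sup>2 * w \<xi>)" for \<xi> using cform_pos by simp
 have int: "integrable \<mu> (%\<xi>. cform * ((norm (FT f \<xi>))\<^sup>2 * w \<xi>))" using eq nn by (intro integrableI_bounded) (simp_all add: abs_of_nonneg)
 hence int': "integrable \<mu> (%\<xi>. (norm (FT f \<xi>))\<^sup>2 * w \<xi>)" using cform_pos integrable_mult_right[of "1 / cform", OF int] by simp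
 thus "FT f \<in> Lw" by (simp add: Lw_def)
 have "ennreal (LI \<xi>. cform * ((norm (FT f \<xi>))\<^sup>2 * w \<xi>)) = ennreal (LI a. h a)"
  unfolding eq[symmetric] by (rule nn_integral_eq_integral[OF int AE_I2[OF nn], symmetric])
 moreover have "0 <= (LI \<xi>. cform * ((norm (FT f \<xi>))\<^sup>2 * w \<xi>))" by (rule Bochner_Integration.integral_nonneg[OF nn])
 moreover have "0 <= (LI a. h a)" by (rule Bochner_Integration.integral_nonneg[OF h_nn])
 ultimately have "(LI \<xi>. cform * ((norm (FT f \<xi>))\<^sup>2 * w \<xi>)) = (LI a. h a)" by (simp only: ennreal_inj)
 thus "Q f = of_real (cform * (LI \<xi>. (norm (FT f \<xi>))\<^sup>2 * w \<xi>))" unfolding Qh by (simp only: integral_mult_right_zero)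
qed

lemma ker_cnj [simp]: "cnj (ker z) = ker z" unfolding ker_def Bochner_Integration.integral_cnj[symmetric] by simp

lemma ker_sub:
 assumes b: "b ~= 0"
 shows "ker (z * b) = (LI a. av b *\<^sub>R of_real (Kern (b * a) (z * b)))"
 unfolding ker_def by (rule cov_integral(1)[OF cov_scale[OF b], symmetric]) measurable

text \<open>Homogeneity is read off from the substitution a \<mapsto> b a; the value of the kernel
  at 1 stays unevaluated.\<close>

lemma ker_scale:
 assumes s2: "s < 1/2" and b: "b ~= 0"
 shows "ker b = of_real (av b powr (2 * s - 1)) * ker 1"
proof -
 have "av b *\<^sub>R of_real (Kern (b * a) (1 * b)) = (of_real (av b powr (2 * s - 1)) * of_real (Kern a 1) :: complex)" for a
 proof -
  have "av b * Kern (b * a) (1 * b) = (av b powr 1 * av b powr (2 * s - 2)) * Kern a 1"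
   using s2 b by (simp add: Kern_def \<theta>_def absval_mult powr_mult)
  also have "av b powr 1 * av b powr (2 * s - 2) = av b powr (2 * s - 1)" by (simp only: powr_add[symmetric]) simp
  finally show ?thesis by (simp add: scaleR_conv_of_real flip: of_real_mult)
 qed
 hence "ker (1 * b) = (LI a. of_real (av b powr (2 * s - 1)) * of_real (Kern a 1))" unfolding ker_sub[OF b] by simp
 thus ?thesis by (simp only: integral_mult_right_zero ker_def mult_1_left)
qed

text \<open>The substitution a \<mapsto> b a moves the cutoff from |a| >= 1 to |a| >= 1 / |b|. The
  difference is a second kernel value, and this is the functional equation of the logarithm.\<close>

lemma ker_add:
 assumes s2: "s = 1/2" and z: "z ~= 0" and b: "b ~= 0"
 shows "ker (z * b) = ker z + ker b" and "ker (inverse b) = - ker b"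
proof -
 have K12: "Kern a z = ((if av z <= av a then 1 else 0) - (if 1 <= av a then 1 else 0)) * av a powr (- 1)" for a z
  unfolding Kern_def \<theta>_def by (simp add: s2)
 have k1: "ker 1 = 0" unfolding ker_def by (simp add: K12)
 have *: "ker (z * b) = ker z - ker (inverse b)" if z: "z ~= 0" and b: "b ~= 0" for z b
 proof -
  have "av b * Kern (b * a) (z * b) = Kern a z - Kern a (inverse b)" for a
  proof -
   have "av (z * b) <= av (b * a) \<longleftrightarrow> av z <= av a" using b by (simp add: absval_mult mult.commute)
   moreover have "1 <= av (b * a) \<longleftrightarrow> av (inverse b) <= av a" unfolding absval_mult absval_inverse using b by (simp add: field_simps)
   moreover have "av b * av (b * a) powr (- 1) = av a powr (- 1)" using b by (simp add: absval_mult powr_mult powr_minus)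
   ultimately show ?thesis unfolding K12 by (simp add: left_diff_distrib)
  qed
  hence "av b *\<^sub>R of_real (Kern (b * a) (z * b)) = (of_real (Kern a z) - of_real (Kern a (inverse b)) :: complex)" for a
   by (simp add: scaleR_conv_of_real flip: of_real_mult of_real_diff)
  hence "ker (z * b) = (LI a. of_real (Kern a z) - of_real (Kern a (inverse b)))" unfolding ker_sub[OF b] by simp
  also have "... = ker z - ker (inverse b)" unfolding ker_def using b by (intro Bochner_Integration.integral_diff Kern_integrable z) simp
  finally show ?thesis .
 qed
 show 2: "ker (inverse b) = - ker b" using *[of 1 b] b k1 by simp
 show "ker (z * b) = ker z + ker b" using *[OF z b] 2 by simp
qed

lemma function_distribution_eq:
 assumes f: "f \<in> X" shows "fd f = Dst (FT f)"
proof
 fix \<phi> :: "'k => complex"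
 show "fd f \<phi> = Dst (FT f) \<phi>"
 proof (cases "\<phi> \<in> Cc")
  case True
  have "(LI x. f x * FT (Finv \<phi>) x) = (LI x. FT f x * Finv \<phi> x)"
   by (rule fourier_swap[OF I_integrable[OF XI[OF f]] Cc_integrable[OF Finv_Cc[OF True]]])
  thus ?thesis using True by (simp add: function_distribution_def as_distribution_def Dst_def fourier_Finv)
 qed (simp add: function_distribution_def as_distribution_def Dst_def)
qed

lemma Q_nrm: "f \<in> X ==> Q f = of_real (cform * (nrm (fd f))\<^sup>2)"
 by (simp add: FT_form function_distribution_eq hilb_norm_Dst(1))

text \<open>The Moebius map is substituted in both variables. For \<open>s < 1/2\<close> the
  identity |m x - m y|^2 = |x - y|^2 J x J y splits the homogeneous kernel into the powers of the
  Jacobian carried by \<open>F\<close>. For \<open>s = 1/2\<close> additivity leaves correction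
  terms in \<open>x\<close> alone or \<open>y\<close> alone, which integrate to 0 against
  \<open>F\<close>.\<close>

lemma Q_moebius:
 assumes f: "f \<in> X" and det: "a * d - b * c ~= 0"
 defines "F \<equiv> smooth_action K chi (of_real s) (inv\<^bsub>PGL2\<^esub> (pgl_class (mt a b c d))) f"
 shows "F \<in> X" and "Q F = Q f"
proof -
 have fI: "f \<in> I" by (rule XI[OF f])
 have FI: "F \<in> I" unfolding F_def by (rule smooth_action_in[OF _ fI]) (use det in simp)
 have [measurable]: "f \<in> bm" "F \<in> bm" using I_measurable fI FI by auto
 define D where "D = a * d - b * c"
 define den where "den x = a + b * x" for x
 define J where "J x = av D / (av (den x))\<^sup>2" for x
 define m where "m x = (c + d * x) / den x" for x
 define e where "e = mc 0 D"
 have D: "D ~= 0" using det by (simp add: D_def)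
 have e: "e * cnj e = 1" using mc0_cases[OF D] by (auto simp: e_def)
 have cov: "cov m J" using cov_moebius[OF det] by (simp add: m_def[abs_def] J_def[abs_def] D_def den_def[abs_def])
 have [measurable]: "m \<in> bm" "J \<in> bm" using cov by (auto simp: cov_def)
 have J0: "0 <= J x" for x by (simp add: J_def)
 have F: "F x = e * of_real (J x powr (s + 1/2)) * f (m x)" if "den x ~= 0" for x
  using smooth_action_moebius[OF fI det] that by (simp add: F_def e_def J_def m_def den_def D_def)
 have den_ae: "AE x in \<mu>. den x ~= 0" unfolding den_def by (rule AE_den_nz[OF det])
 have intF: "(LI x. F x) = 0" if s2: "s = 1/2"
 proof -
  have "(LI x. F x) = (LI x. e * (J x *\<^sub>R f (m x)))"
  proof (rule integral_cong_AE)
   show "AE x in \<mu>. F x = e * (J x *\<^sub>R f (m x))" using den_ae by eventually_elim (use F J0 in \<open>simp add: s2 scaleR_conv_of_real\<close>)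
  qed simp_all
  also have "... = e * (LI x. f x)" unfolding integral_mult_right_zero using cov_integral(1)[OF cov, of f] by simp
  also have "... = 0" using f unfolding X_def by (auto simp: s2)
  finally show ?thesis .
 qed
 have "s < 1/2 \<or> (LI x. F x) = 0" using intF s by (cases "s = 1/2") auto
 thus "F \<in> X" using FI unfolding X_def by blast
 define G where "G u v = ker (u - v) * (f u * cnj (f v))" for u v
 define H where "H u = (LI v. G u v)" for u
 have [measurable]: "H \<in> bm" unfolding H_def G_def by (rule haar.borel_measurable_lebesgue_integral) measurable
 define L where "L x = (LI y. ker (x - y) * (F x * cnj (F y)))" for x
 have Li: "integrable \<mu> L" unfolding L_def using haar2.integrable_fst'[OF Q_eq(3)[OF FI]] by simp
 have QF: "Q F = (LI x. L x)" by (simp add: Q_def L_def)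
 have "Q f = (LI u. H u)" by (simp add: Q_def H_def G_def)
 also have "... = (LI x. J x *\<^sub>R H (m x))" by (rule cov_integral(1)[OF cov, symmetric]) simp
 finally have Qf: "Q f = (LI x. J x *\<^sub>R H (m x))" .
 have inner: "J x *\<^sub>R H (m x) = (LI y. J y *\<^sub>R (J x *\<^sub>R G (m x) (m y)))" for x
 proof -
  have "(LI y. J y *\<^sub>R (J x *\<^sub>R G (m x) (m y))) = (LI v. J x *\<^sub>R G (m x) v)" by (rule cov_integral(1)[OF cov]) (simp add: G_def)
  thus ?thesis by (simp add: H_def)
 qed
 have mdiff: "m x - m y = (x - y) * (D * (inverse (den x) * inverse (den y)))" if "den x ~= 0" "den y ~= 0" for x y
 proof -
  have "(c + d * x) * den y - (c + d * y) * den x = (x - y) * D" by (simp add: den_def D_def algebra_simps)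
  moreover have "m x - m y = ((c + d * x) * den y - (c + d * y) * den x) / (den x * den y)" using that by (simp add: m_def diff_frac_eq)
  ultimately show ?thesis by (simp add: divide_inverse mult.assoc)
 qed
 show "Q F = Q f"
 proof (cases "s < 1/2")
  case s2: True
  have key: "J y *\<^sub>R (J x *\<^sub>R G (m x) (m y)) = ker (x - y) * (F x * cnj (F y))"
   if x: "den x ~= 0" and y: "den y ~= 0" and xy: "x ~= y" for x y
  proof -
   have pos: "0 < J x" "0 < J y" using D x y by (simp_all add: J_def)
   have nz: "x - y ~= 0" "m x - m y ~= 0" using xy D x y by (simp_all add: mdiff)
   have "(av (m x - m y))\<^sup>2 = (av (x - y))\<^sup>2 * (J x * J y)"
    unfolding mdiff[OF x y] J_def absval_mult absval_inverse using x y by (simp add: power_mult_distrib field_simps power2_eq_square)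
   moreover have "r powr (2 * s - 1) = (r\<^sup>2) powr (s - 1/2)" if "0 < r" for r
   proof -
    have "(r powr 2) powr (s - 1/2) = r powr (2 * (s - 1/2))" by (rule powr_powr)
    thus ?thesis using that by (simp add: algebra_simps)
   qed
   ultimately have "av (m x - m y) powr (2 * s - 1) = av (x - y) powr (2 * s - 1) * (J x powr (s - 1/2) * J y powr (s - 1/2))"
    using nz pos by (simp add: powr_mult)
   hence kk: "ker (m x - m y) = ker (x - y) * of_real (J x powr (s - 1/2) * J y powr (s - 1/2))"
    unfolding ker_scale[OF s2 nz(1)] ker_scale[OF s2 nz(2)] by simp
   have pw: "r * r powr (s - 1/2) = r powr (s + 1/2)" if "0 < r" for r using that powr_add[of r 1 "s - 1/2"] by (simp add: add.commute)
   have "J y *\<^sub>R (J x *\<^sub>R G (m x) (m y)) = ker (x - y) * of_real ((J x * J x powr (s - 1/2)) * (J y * J y powr (s - 1/2))) * (f (m x) * cnj (f (m y)))"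
    unfolding G_def kk by (simp add: scaleR_conv_of_real mult_ac)
   also have "... = ker (x - y) * of_real (J x powr (s + 1/2) * J y powr (s + 1/2)) * (f (m x) * cnj (f (m y))) * (e * cnj e)"
    unfolding pw[OF pos(1)] pw[OF pos(2)] e by simp
   also have "... = ker (x - y) * (F x * cnj (F y))" unfolding F[OF x] F[OF y] by (simp add: mult_ac)
   finally show ?thesis .
  qed
  have "Q f = (LI x. L x)" unfolding Qf
  proof (rule integral_cong_AE)
   show "AE x in \<mu>. J x *\<^sub>R H (m x) = L x" using den_ae
   proof eventually_elim
    case (elim x)
    show ?case unfolding inner L_def
    proof (rule integral_cong_AE)
     show "AE y in \<mu>. J y *\<^sub>R (J x *\<^sub>R G (m x) (m y)) = ker (x - y) * (F x * cnj (F y))"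
      using den_ae AE_neq[of x] by eventually_elim (rule key[OF elim], auto)
    qed (simp_all add: G_def)
   qed
  qed (use Li in \<open>auto dest: borel_measurable_integrable\<close>)
  thus ?thesis by (simp add: QF)
 next
  case False
  hence s2: "s = 1/2" using s by simp
  have iF: "integrable \<mu> F" by (rule I_integrable[OF FI])
  have kint: "integrable \<mu> (%y. ker (x - y) * cnj (F y))" for x
  proof -
   have "integrable \<mu> (%y. cnj (ker (x - y) * F y))" using ker_conv_integrable[OF FI, of x] by (rule integrable_cnj)
   thus ?thesis by (simp only: complex_cnj_mult ker_cnj)
  qed
  \<comment> \<open>Unless \<open>b = 0\<close>, \<open>den y\<close> is a constant times
    \<open>x0 - y\<close> with \<open>x0\<close> the pole, so additivity reduces the claim to
    \<open>kint\<close>. It allows the correction terms to be integrated one by one.\<close>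
  have dint: "integrable \<mu> (%y. ker (den y) * cnj (F y))"
  proof (cases "b = 0")
   case True
   thus ?thesis using iF by (simp add: den_def)
  next
   case b: False
   define x0 where "x0 = - a / b"
   have "integrable \<mu> (%y. ker (x0 - y) * cnj (F y) + ker (- b) * cnj (F y))" using kint[of x0] iF by simp
   moreover have "AE y in \<mu>. ker (x0 - y) * cnj (F y) + ker (- b) * cnj (F y) = ker (den y) * cnj (F y)" using AE_neq[of x0]
   proof eventually_elim
    case (elim y)
    have "den y = (x0 - y) * (- b)" using b by (simp add: den_def x0_def algebra_simps)
    moreover have "x0 - y ~= 0" using elim by simp
    ultimately have "ker (den y) = ker (x0 - y) + ker (- b)" using ker_add(1)[OF s2, of "x0 - y" "- b"] b by simp
    thus ?case by (simp add: distrib_right)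
   qed
   ultimately show ?thesis by (subst integrable_cong_AE[symmetric]) (auto simp: den_def)
  qed
  define M where "M = (LI y. ker (den y) * cnj (F y))"
  have cF0: "(LI y. cnj (F y)) = 0" using intF[OF s2] by (simp add: Bochner_Integration.integral_cnj)
  have key: "J y *\<^sub>R (J x *\<^sub>R G (m x) (m y)) = F x * (ker (x - y) * cnj (F y)) + F x * (ker D - ker (den x)) * cnj (F y) - F x * (ker (den y) * cnj (F y))"
   if x: "den x ~= 0" and y: "den y ~= 0" and xy: "x ~= y" for x y
  proof -
   have n: "x - y ~= 0" "inverse (den x) ~= 0" "inverse (den y) ~= 0" "inverse (den x) * inverse (den y) ~= 0"
    "D * (inverse (den x) * inverse (den y)) ~= 0" using xy x y D by auto
   have "ker (m x - m y) = ker (x - y) + (ker D + (- ker (den x) + - ker (den y)))"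
    unfolding mdiff[OF x y] ker_add(1)[OF s2 n(1) n(5)] ker_add(1)[OF s2 D n(4)] ker_add(1)[OF s2 n(2,3)]
     ker_add(2)[OF s2 n(1) x] ker_add(2)[OF s2 n(1) y] ..
   moreover have "F x * cnj (F y) = of_real (J x) * of_real (J y) * (f (m x) * cnj (f (m y))) * (e * cnj e)"
    using F[OF x] F[OF y] J0 by (simp add: s2 mult_ac)
   ultimately have "J y *\<^sub>R (J x *\<^sub>R G (m x) (m y)) = (ker (x - y) + (ker D + (- ker (den x) + - ker (den y)))) * (F x * cnj (F y))"
    unfolding G_def e by (simp add: scaleR_conv_of_real mult_ac)
   thus ?thesis by (simp add: algebra_simps)
  qed
  have "Q f = (LI x. L x - F x * M)" unfolding Qf
  proof (rule integral_cong_AE)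
   show "AE x in \<mu>. J x *\<^sub>R H (m x) = L x - F x * M" using den_ae
   proof eventually_elim
    case (elim x)
    have "J x *\<^sub>R H (m x) = (LI y. F x * (ker (x - y) * cnj (F y)) + F x * (ker D - ker (den x)) * cnj (F y) - F x * (ker (den y) * cnj (F y)))"
     unfolding inner
    proof (rule integral_cong_AE)
     show "AE y in \<mu>. J y *\<^sub>R (J x *\<^sub>R G (m x) (m y)) = F x * (ker (x - y) * cnj (F y)) + F x * (ker D - ker (den x)) * cnj (F y) - F x * (ker (den y) * cnj (F y))"
      using den_ae AE_neq[of x] by eventually_elim (rule key[OF elim], auto)
    qed (simp_all add: G_def den_def)
    also have "... = (LI y. F x * (ker (x - y) * cnj (F y))) + (LI y. F x * (ker D - ker (den x)) * cnj (F y)) - (LI y. F x * (ker (den y) * cnj (F y)))"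
    proof -
     have i1: "integrable \<mu> (%y. F x * (ker (x - y) * cnj (F y)))" using kint by (rule integrable_mult_right)
     have i2: "integrable \<mu> (%y. F x * (ker D - ker (den x)) * cnj (F y))" using iF by simp
     have i3: "integrable \<mu> (%y. F x * (ker (den y) * cnj (F y)))" using dint by (rule integrable_mult_right)
     show ?thesis unfolding Bochner_Integration.integral_diff[OF Bochner_Integration.integrable_add[OF i1 i2] i3]
       Bochner_Integration.integral_add[OF i1 i2] ..
    qed
    also have "(LI y. F x * (ker D - ker (den x)) * cnj (F y)) = 0" unfolding integral_mult_right_zero cF0 by simp
    also have "(LI y. F x * (ker (den y) * cnj (F y))) = F x * M" by (simp add: M_def)
    also have "(LI y. F x * (ker (x - y) * cnj (F y))) = L x" by (simp add: L_def mult_ac)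
    finally show ?case by simp
   qed
  qed (use Li in \<open>auto dest: borel_measurable_integrable\<close>)
  also have "... = Q F" using Li iF intF[OF s2] by (simp add: QF)
  finally show ?thesis by simp
 qed
qed

lemma smooth_action_X:
 assumes g: "g \<in> carrier PGL2" and f: "f \<in> X"
 shows "smooth_action K chi (of_real s) g f \<in> X"
  and "nrm (fd (smooth_action K chi (of_real s) g f)) = nrm (fd f)"
proof -
 obtain A where A: "det A ~= 0" "g = inv\<^bsub>PGL2\<^esub> (pgl_class A)" using g by (rule PGL2_cases_inv)
 obtain a b c d where A': "A = mt a b c d" by (rule mt_cases)
 have det: "a * d - b * c ~= 0" using A(1) A' by simp
 let ?F = "smooth_action K chi (of_real s) g f"
 show X: "?F \<in> X" using Q_moebius(1)[OF f det] A A' by simp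
 have "Q ?F = Q f" using Q_moebius(2)[OF f det] A A' by simp
 hence "cform * (nrm (fd ?F))\<^sup>2 = cform * (nrm (fd f))\<^sup>2"
  unfolding Q_nrm[OF X] Q_nrm[OF f] of_real_eq_iff .
 hence "(nrm (fd ?F))\<^sup>2 = (nrm (fd f))\<^sup>2" using cform_pos by simp
 moreover have "0 <= nrm (fd ?F)" "0 <= nrm (fd f)"
  using function_distribution_eq[OF X] function_distribution_eq[OF f] FT_form(1)[OF X] FT_form(1)[OF f] hilb_norm_Dst(2) by auto
 ultimately show "nrm (fd ?F) = nrm (fd f)" by (simp add: power2_eq_iff_nonneg)
qed

end

section \<open>The unitary representation and its irreducibility\<close>

lemma (in hspace) linear_diff:
 assumes L: "linear_between V W L" and T: "T \<in> V" "T' \<in> V"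
 shows "L (%x. T x - T' x) = (%x. L T x - L T' x)"
proof -
 have m: "(%x. (-1) * T' x) \<in> V" using T(2) by (rule cmult_mem)
 from L have a: "\<forall>f\<in>V. \<forall>g\<in>V. L (%x. f x + g x) = (%y. L f y + L g y)" and c: "\<forall>c. \<forall>f\<in>V. L (%x. c * f x) = (%y. c * L f y)"
  unfolding linear_between_def by blast+
 show ?thesis using bspec[OF bspec[OF a T(1)] m] bspec[OF spec[OF c, of "-1"] T(2)] by simp
qed

text \<open>Continuity at the identity suffices, because the distance of
  \<open>\<rho> (a b) T\<close> from \<open>\<rho> a T\<close> is that of \<open>\<rho> b T\<close>
  from \<open>T\<close>. Neighbourhoods are taken among matrices, since the topology is a
  quotient.\<close>

lemma (in hspace) unitary_rep_PGL2I:
 fixes \<rho> :: "('k::nonarch_local_field^2^2) set => ('a => complex) => 'a => complex"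
 assumes lin: "!!g. g \<in> carrier PGL2 ==> linear_between V V (\<rho> g)"
  and iso: "!!g T T'. g \<in> carrier PGL2 ==> T \<in> V ==> T' \<in> V ==> ip (\<rho> g T) (\<rho> g T') = ip T T'"
  and one: "!!T. T \<in> V ==> \<rho> \<one>\<^bsub>PGL2\<^esub> T = T"
  and mult: "!!g h T. g \<in> carrier PGL2 ==> h \<in> carrier PGL2 ==> T \<in> V ==> \<rho> (g \<otimes>\<^bsub>PGL2\<^esub> h) T = \<rho> g (\<rho> h T)"
  and cont: "!!T e. T \<in> V ==> 0 < e ==> \<exists>N. open N \<and> mat 1 \<in> N \<and>
   (\<forall>A\<in>N. det A ~= 0 \<and> dst (\<rho> (pgl_class A) T) T < e)"
 shows "unitary_rep PGL2 PGL2_topology V ip \<rho>" unfolding unitary_rep_def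
proof (intro conjI ballI allI impI hs lin iso one mult)
 fix T and g :: "('k^2^2) set" and e :: real assume T: "T \<in> V" and g: "g \<in> carrier PGL2" and e: "e > 0"
 \<comment> \<open>The full set of group elements with small displacement serves as the
   neighbourhood; its openness has to be checked at each of its points.\<close>
 let ?W = "{h \<in> carrier PGL2. dst (\<rho> h T) (\<rho> g T) < e}"
 have mem: "\<rho> h T' \<in> V" if "h \<in> carrier PGL2" "T' \<in> V" for h T' using lin[OF that(1)] that(2) by (simp add: linear_between_def)
 have "open {A. det A ~= 0 \<and> pgl_class A \<in> ?W}"
 proof (subst open_subopen, intro ballI)
  fix A assume "A \<in> {A. det A ~= 0 \<and> pgl_class A \<in> ?W}"
  hence A: "det A ~= 0" "dst (\<rho> (pgl_class A) T) (\<rho> g T) < e" by auto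
  let ?a = "pgl_class A"
  define e' where "e' = e - nrm (%x. \<rho> ?a T x - \<rho> g T x)"
  have "0 < e'" using A(2) by (simp add: e'_def)
  from cont[OF T this] obtain N where N: "open N" "mat 1 \<in> N"
   "!!B. B \<in> N ==> det B ~= 0 \<and> dst (\<rho> (pgl_class B) T) T < e'" by blast
  define I where "I = mat (1 / det A) ** adj A"
  have IA: "I ** A = mat 1" using A(1) unfolding I_def by (simp add: matrix_mul_assoc[symmetric] adj_mult mat_mult_mat)
  have AI: "A ** I = mat 1" using A(1) unfolding I_def mat_commute[of _ "adj A"] by (simp add: matrix_mul_assoc mult_adj mat_mult_mat)
  let ?N = "(%B. I ** B) -` N"
  have "open ?N" by (rule open_vimage[OF N(1) continuous_on_mult2])
  moreover have "A \<in> ?N" using N(2) IA by simp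
  moreover have "?N \<subseteq> {A. det A ~= 0 \<and> pgl_class A \<in> ?W}"
  proof
   fix A' assume "A' \<in> ?N"
   hence B: "det (I ** A') ~= 0" "dst (\<rho> (pgl_class (I ** A')) T) T < e'" using N(3) by auto
   let ?b = "pgl_class (I ** A')"
   have A': "det A' ~= 0" using B(1) by (simp add: det_mul)
   have "?a \<otimes>\<^bsub>PGL2\<^esub> ?b = pgl_class A'" using pgl_class_mult[OF A(1) B(1)] AI by (simp add: matrix_mul_assoc)
   hence "\<rho> (pgl_class A') T = \<rho> ?a (\<rho> ?b T)" using mult[of ?a ?b T] A(1) B(1) T by simp
   moreover have "(%x. \<rho> ?a (\<rho> ?b T) x - \<rho> ?a T x) = \<rho> ?a (%x. \<rho> ?b T x - T x)"
    using linear_diff[OF lin[of ?a] mem[of ?b T] T] A(1) B(1) T by simp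
   moreover have "nrm (\<rho> ?a (%x. \<rho> ?b T x - T x)) = nrm (%x. \<rho> ?b T x - T x)"
    using iso[of ?a "%x. \<rho> ?b T x - T x" "%x. \<rho> ?b T x - T x"] A(1) B(1) T mem by (simp add: inner_norm_def)
   ultimately have "nrm (%x. \<rho> (pgl_class A') T x - \<rho> ?a T x) < e'" using B(2) by simp
   moreover have "dst (\<rho> (pgl_class A') T) (\<rho> g T)
    <= nrm (%x. \<rho> (pgl_class A') T x - \<rho> ?a T x) + nrm (%x. \<rho> ?a T x - \<rho> g T x)" by (rule nrm_diff_triangle) (use A' A(1) g T mem in auto)
   ultimately show "A' \<in> {A. det A ~= 0 \<and> pgl_class A \<in> ?W}" using A' by (simp add: e'_def)
  qed
  ultimately show "\<exists>T. open T \<and> A \<in> T \<and> T \<subseteq> {A. det A ~= 0 \<and> pgl_class A \<in> ?W}" by blast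
 qed
 hence "openin PGL2_topology ?W" by (simp add: openin_PGL2)
 moreover have "g \<in> ?W" using g e by simp
 ultimately show "\<exists>W. openin PGL2_topology W \<and> g \<in> W \<and> (\<forall>h\<in>W. dst (\<rho> h T) (\<rho> g T) < e)" by blast
qed

section \<open>Pullbacks of test functions under Moebius maps\<close>

context local_field_data
begin

lemma absval_add_le: "av x <= r ==> av y <= r ==> av (x + y) <= r"
 and absval_diff_le: "av x <= r ==> av y <= r ==> av (x - y) <= r" using absval_add[of x y] absval_diff[of x y] by auto

lemma function_distribution_cong_AE:
 assumes "AE x in \<mu>. f x = g x" "f \<in> bm" "g \<in> bm"
 shows "fd f = fd g"
proof
 fix \<phi> :: "'k => complex"
 have "\<phi> \<in> Cc ==> (LI x. f x * \<phi> x) = (LI x. g x * \<phi> x)" using assms Cc_measurable[of \<phi>] by (intro integral_cong_AE) auto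
 thus "fd f \<phi> = fd g \<phi>" by (simp add: function_distribution_def as_distribution_def)
qed

lemma integrable_mult_Cc:
 assumes f: "integrable \<mu> f" and \<phi>: "\<phi> \<in> Cc" shows "integrable \<mu> (%x. f x * (\<phi> x :: complex))"
proof -
 obtain a B where B: "a ~= 0" "0 <= B" "!!x. norm (\<phi> x) <= B * indicator (cb 0 a) x" using \<phi> by (rule Cc_bounded) (rule that; assumption)
 have le: "norm (\<phi> x) <= B" for x
  using order_trans[OF B(3)[of x] mult_left_mono[of "indicator (cb 0 a) x" 1 B]] B(2) by (simp add: indicator_def)
 show ?thesis
 proof (rule Bochner_Integration.integrable_bound)
  show "integrable \<mu> (%x. of_real B * f x)" using f by simp
  show "(%x. f x * \<phi> x) \<in> borel_measurable \<mu>" using f Cc_measurable[OF \<phi>] by (auto dest: borel_measurable_integrable)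
  show "AE x in \<mu>. norm (f x * \<phi> x) <= norm (of_real B * f x)"
   using le B(2) by (intro AE_I2) (simp add: norm_mult mult.commute mult_right_mono)
 qed
qed

lemma fourier_inj:
 assumes f: "integrable \<mu> f" and z: "!!x. FT f x = 0" shows "AE x in \<mu>. f x = 0"
proof (rule AE_eq_0_Cc)
 fix \<phi> :: "'k => complex" assume \<phi>: "\<phi> \<in> Cc"
 show "integrable \<mu> (%x. f x * \<phi> x)" by (rule integrable_mult_Cc[OF f \<phi>])
 have "(LI x. f x * FT (Finv \<phi>) x) = (LI x. FT f x * Finv \<phi> x)" by (rule fourier_swap[OF f Cc_integrable[OF Finv_Cc[OF \<phi>]]])
 thus "(LI x. f x * \<phi> x) = 0" by (simp add: fourier_Finv \<phi> z)
qed

lemma loc_const_psi: "loc_const (%x. \<psi> (k * x))" unfolding loc_const_def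
proof
 fix x
 show "\<exists>b. b ~= 0 \<and> (\<forall>y. av (y - x) <= av b --> \<psi> (k * y) = \<psi> (k * x))"
 proof (cases "k = 0")
  case False
  have "\<psi> (k * y) = \<psi> (k * x)" if "av (y - x) <= av (p0 / k)" for y
  proof -
   have "av (k * (y - x)) <= av p0" using that False unfolding absval_mult absval_divide by (simp add: field_simps)
   hence "\<psi> (k * (y - x)) = 1" by (rule psi_eq_1)
   moreover have "k * y = k * (y - x) + k * x" by (simp add: algebra_simps)
   ultimately show ?thesis using psi_add[of "k * (y - x)" "k * x"] by simp
  qed
  moreover have "p0 / k ~= 0" using False p0(1) by simp
  ultimately show ?thesis by blast
 qed (auto intro: exI[of _ 1])
qed

lemma Cc_zero: "(%x::'k. 0) \<in> Cc" using Cc_cmult[OF Cc_indicator[of 1 0], of 0] by simp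

end

text \<open>For \<open>b ~= 0\<close> the point \<open>d / b\<close> is the image of infinity under
  x \<mapsto> (c + d x) / (a + b x); if \<open>\<phi>\<close> vanishes near it, the pullback
  vanishes for large \<open>x\<close>. For \<open>b = 0\<close> infinity is fixed, and compact
  support is enough.\<close>

lemma (in quad_char) transpose_Cc:
 assumes det: "a * d - b * c ~= 0" and \<phi>: "\<phi> \<in> Cc"
  and van: "b ~= 0 ==> \<exists>\<delta>. \<delta> ~= 0 \<and> (\<forall>x. av (x - d / b) <= av \<delta> --> \<phi> x = 0)"
 shows "smooth_action K chi (of_real r) (inv\<^bsub>PGL2\<^esub> (pgl_class (mt a b c d))) \<phi> \<in> Cc"
proof -
 let ?t = "smooth_action K chi (of_real r) (inv\<^bsub>PGL2\<^esub> (pgl_class (mt a b c d))) \<phi>"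
 have I: "\<phi> \<in> I_smooth K chi (of_real r)" by (rule Cc_I_smooth[OF \<phi>])
 have lc: "loc_const ?t" by (rule I_smooth_loc_const[OF smooth_action_in[OF _ I]]) (use det in simp)
 have "\<exists>R. R ~= 0 \<and> (\<forall>x. av x > av R --> a + b * x ~= 0 \<and> \<phi> ((c + d * x) / (a + b * x)) = 0)"
 proof (cases "b = 0")
  case True
  hence ad: "a ~= 0" "d ~= 0" using det by auto
  obtain A B where A: "A ~= 0" "B ~= 0" "!!x. av x > av A ==> \<phi> x = 0"
   "!!x y. av y <= av B ==> \<phi> (x + y) = \<phi> x" using \<phi> by (rule CcE) (rule that; assumption)
  obtain R where R: "R ~= 0" "max (av c) (av A * av a) / av d < av R" using ex_absval_gt by blast
  have "\<phi> ((c + d * x) / a) = 0" if x: "av x > av R" for x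
  proof (rule A(3))
   have "max (av c) (av A * av a) / av d < av x" using R(2) x by linarith
   hence "max (av c) (av A * av a) < av (d * x)" using ad unfolding absval_mult by (simp add: divide_less_eq mult.commute)
   moreover from this have "av (c + d * x) = av (d * x)" by (intro absval_add_eq) simp
   ultimately show "av ((c + d * x) / a) > av A" using ad unfolding absval_divide by (simp add: less_divide_eq)
  qed
  thus ?thesis using R(1) ad True by auto
 next
  case b: False
  from van[OF b] obtain \<delta> where \<delta>: "\<delta> ~= 0" "!!x. av (x - d / b) <= av \<delta> ==> \<phi> x = 0" by blast
  let ?D = "a * d - b * c"
  obtain R where R: "R ~= 0" "max (av a / av b) (av ?D / ((av b)\<^sup>2 * av \<delta>)) < av R" using ex_absval_gt by blast
  have "a + b * x ~= 0 \<and> \<phi> ((c + d * x) / (a + b * x)) = 0" if x: "av x > av R" for x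
  proof -
   have 1: "av a / av b < av x" and 2: "av ?D / ((av b)\<^sup>2 * av \<delta>) < av x" using R(2) x by auto
   have "av a < av (b * x)" using 1 b unfolding absval_mult by (simp add: divide_less_eq mult.commute)
   hence den: "av (a + b * x) = av b * av x" using absval_add_eq by (simp add: absval_mult)
   have x0: "0 < av x" using x absval_nonneg[of R] by linarith
   hence nz: "a + b * x ~= 0" using den b by (metis absval_0 absval_eq_0 absval_pos mult_eq_0_iff)
   have "(c + d * x) / (a + b * x) - d / b = - ?D / (b * (a + b * x))" using nz b by (simp add: diff_frac_eq algebra_simps)
   hence "av ((c + d * x) / (a + b * x) - d / b) = av ?D / (av b * (av b * av x))"
    unfolding den[symmetric] by (simp only: absval_divide absval_mult absval_minus)
   also have "... <= av \<delta>" using 2 b \<delta>(1) x0 by (simp add: field_simps power2_eq_square)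
   finally show ?thesis using \<delta>(2) nz by blast
  qed
  thus ?thesis using R(1) by blast
 qed
 then obtain R where R: "R ~= 0" "!!x. av x > av R ==> a + b * x ~= 0 \<and> \<phi> ((c + d * x) / (a + b * x)) = 0" by blast
 show ?thesis by (rule CcI_loc_const[OF lc _ R(1)]) (use R(2) smooth_action_moebius[OF I det] in auto)
qed

context half_line
begin

lemma hilb_Cc_linear:
 assumes S: "S \<in> hilb K s" and \<phi>: "\<phi> \<in> Cc" "\<theta> \<in> Cc"
 shows "S (%x. \<phi> x + c * \<theta> x) = S \<phi> + c * S \<theta>"
proof -
 have "S \<in> distributions" using S by (simp add: hilb_def)
 hence a: "\<forall>f\<in>Cc. \<forall>g\<in>Cc. S (%x. f x + g x) = S f + S g" and m: "\<forall>c. \<forall>f\<in>Cc. S (%x. c * f x) = c * S f"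
  unfolding distributions_def algebraic_dual_def by blast+
 show ?thesis using bspec[OF bspec[OF a \<phi>(1)] Cc_cmult[OF \<phi>(2), of c]] bspec[OF spec[OF m] \<phi>(2), of c] by simp
qed

lemma hilb_outside: "S \<in> hilb K s ==> \<phi> \<notin> Cc ==> S \<phi> = 0" by (rule distribution_zero) (simp_all add: hilb_def)

text \<open>Scaling by some |z| > 1 does not decrease the integral over |a| >= 1, because 1 - 2 s >=
  0. But the region loses a shell of positive mass, so the integral cannot be finite.\<close>

lemma weight_not_integrable: "\<not> integrable \<mu> w"
proof
 assume i: "integrable \<mu> w"
 let ?N = "%z. \<integral>\<^sup>+a. ennreal (av a powr (- 2 * s)) * indicator {a. av z <= av a} a \<partial>\<mu>"
 obtain z :: 'k where z: "z ~= 0" "1 < av z" using ex_absval_gt by blast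
 let ?P = "\<integral>\<^sup>+a. ennreal (av a powr (- 2 * s)) * indicator {a. 1 <= av a \<and> av a < av z} a \<partial>\<mu>"
 have "(NI a. ennreal (w a)) < \<infinity>" using i by (simp add: integrable_iff_bounded)
 hence fin: "?N 1 < \<infinity>" by (rule le_less_trans[rotated]) (auto intro!: nn_integral_mono simp: indicator_def)
 have "?N z = ennreal (av z powr (- 2 * s + 1)) * ?N 1" using nn_integral_far_scale[OF z(1), of "- 2 * s"] by simp
 moreover have "1 <= ennreal (av z powr (- 2 * s + 1))" using z s by (simp add: ge_one_powr_ge_zero)
 ultimately have "?N 1 <= ?N z" using mult_right_mono[of 1 "ennreal (av z powr (- 2 * s + 1))" "?N 1"] by simp
 moreover have "?N 1 = ?N z + ?P"
 proof -
  have "?N 1 = (NI a. ennreal (av a powr (- 2 * s)) * indicator {a. av z <= av a} a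
    + ennreal (av a powr (- 2 * s)) * indicator {a. 1 <= av a \<and> av a < av z} a)"
   using z by (intro nn_integral_cong) (auto simp: indicator_def)
  also have "... = ?N z + ?P" by (rule nn_integral_add) measurable
  finally show ?thesis .
 qed
 ultimately have "?N 1 + ?P <= ?N 1 + 0" using add_right_mono[of "?N 1" "?N z" ?P] by simp
 hence "?P = 0" using fin by (simp only: ennreal_add_left_cancel_le) auto
 hence *: "AE a in \<mu>. ennreal (av a powr (- 2 * s)) * indicator {a. 1 <= av a \<and> av a < av z} a = 0"
  by (subst (asm) nn_integral_0_iff_AE) auto
 obtain h :: 'k where h: "h ~= 0" "av h < 1" using ex_absval_less[of 1] by auto
 have "AE a in \<mu>. a \<notin> cb 1 h" using *
 proof eventually_elim
  case (elim a)
  show ?case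
  proof
   assume "a \<in> cb 1 h"
   hence "av (a - 1) < av 1" using h by (simp add: cb_def)
   hence a: "av a = 1" using absval_add_eq[of "a - 1" 1] by simp
   thus False using elim z by simp
  qed
 qed
 hence "emeasure \<mu> (cb 1 h) = 0" by (subst (asm) AE_iff_measurable[of "cb 1 h"]) auto
 thus False using emeasure_cb[OF h(1), of 1] h vol_pos by simp
qed

text \<open>A vector vanishing on all test functions supported away from \<open>p\<close> is a multiple of the Dirac
 distribution at \<open>p\<close>, whose Fourier transform has constant absolute value.\<close>

lemma hilb_eq_0_if_supported_at_point:
 assumes S: "S \<in> hilb K s"
  and van: "!!\<phi> \<delta>. \<phi> \<in> Cc ==> \<delta> ~= 0 ==> (!!x. av (x - p) <= av \<delta> ==> \<phi> x = 0) ==> S \<phi> = 0"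
 shows "S = (%\<phi>. 0)"
proof -
 obtain g where g: "g \<in> Lw" "S = Dst g" using S unfolding hilb_eq by blast
 \<comment> \<open>A test function that is 1 near \<open>p\<close>; subtracting
   \<open>\<phi> p\<close> times it makes \<open>\<phi>\<close> vanish near
   \<open>p\<close>.\<close>
 define i where "i x = (indicator (cb p 1) x :: complex)" for x
 have i: "i \<in> Cc" unfolding i_def by (rule Cc_indicator) simp
 define c where "c = S i"
 have Sc: "S \<phi> = \<phi> p * c" if \<phi>: "\<phi> \<in> Cc" for \<phi>
 proof -
  obtain A b where b: "A ~= 0" "b ~= 0" "!!x. av x > av A ==> \<phi> x = 0"
   "!!x y. av y <= av b ==> \<phi> (x + y) = \<phi> x" using \<phi> by (rule CcE) (rule that; assumption)
  obtain \<delta> :: 'k where \<delta>: "\<delta> ~= 0" "av \<delta> < min 1 (av b)" using ex_absval_less[of "min 1 (av b)"] b(2) by auto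
  have "S (%x. \<phi> x + (- \<phi> p) * i x) = 0"
  proof (rule van[OF _ \<delta>(1)])
   show "(%x. \<phi> x + (- \<phi> p) * i x) \<in> Cc" by (intro Cc_add \<phi> Cc_cmult i)
   fix x assume x: "av (x - p) <= av \<delta>"
   hence "\<phi> (p + (x - p)) = \<phi> p" using \<delta>(2) by (intro b(4)) simp
   moreover have "x \<in> cb p 1" using x \<delta>(2) by (simp add: cb_def)
   ultimately show "\<phi> x + (- \<phi> p) * i x = 0" by (simp add: i_def)
  qed
  thus ?thesis using hilb_Cc_linear[OF S \<phi> i, of "- \<phi> p"] by (simp add: c_def)
 qed
 have "given_by K (fourier_distribution K S) (%x. c * \<psi> (p * x))" unfolding given_by_def
 proof (intro conjI ballI)
  show "(%x. c * \<psi> (p * x)) \<in> bm" by measurable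
  show "integrable \<mu> (%x. c * \<psi> (p * x) * \<phi> x)" if "\<phi> \<in> Cc" for \<phi>
   using integrable_mult_right[of c, OF integrable_psi_mult'[OF Cc_integrable[OF that], of p]] by (simp add: mult.assoc)
  show "fourier_distribution K S = fd (%x. c * \<psi> (p * x))"
  proof
   fix \<phi> :: "'k => complex"
   show "fourier_distribution K S \<phi> = fd (%x. c * \<psi> (p * x)) \<phi>"
   proof (cases "\<phi> \<in> Cc")
    case True
    have "(LI x. c * \<psi> (p * x) * \<phi> x) = (LI x. c * (\<psi> (p * x) * \<phi> x))" by (simp only: mult.assoc)
    also have "... = c * FT \<phi> p" unfolding fourier_eq by (rule integral_mult_right_zero)
    finally show ?thesis using True Sc[OF fourier_Cc[OF True]]
     by (simp add: fourier_distribution_def function_distribution_def as_distribution_def)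
   qed (simp add: fourier_distribution_def function_distribution_def as_distribution_def)
  qed
 qed
 hence ae: "AE x in \<mu>. g x = c * \<psi> (p * x)" using given_by_unique given_by_Dst[OF g(1)] unfolding g(2) by blast
 have "c = 0"
 proof (rule ccontr)
  assume c: "c ~= 0"
  have [measurable]: "g \<in> bm" by (rule Lw_meas[OF g(1)])
  have "integrable \<mu> (%x. (norm c)\<^sup>2 * w x)"
  proof (subst integrable_cong_AE[symmetric, of "%x. (norm (g x))\<^sup>2 * w x"])
   show "AE x in \<mu>. (norm (g x))\<^sup>2 * w x = (norm c)\<^sup>2 * w x" using ae by eventually_elim (simp add: norm_mult)
  qed (use Lw_int[OF g(1)] in auto)
  from integrable_mult_right[of "1 / (norm c)\<^sup>2", OF this] have "integrable \<mu> w" using c by simp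
  thus False using weight_not_integrable by blast
 qed
 thus ?thesis using Sc hilb_outside[OF S] by (intro ext) (metis mult_zero_right)
qed

lemma Lw_scale:
 assumes g: "g \<in> Lw" and d: "d ~= 0" shows "(%x. g (d * x)) \<in> Lw"
proof -
 have [measurable]: "g \<in> bm" by (rule Lw_meas[OF g])
 have i: "integrable \<mu> (%x. of_real ((norm (g x))\<^sup>2 * w x) :: complex)" using Lw_int[OF g] by (simp only: complex_of_real_integrable_eq)
 have "integrable \<mu> (%x. av d *\<^sub>R (of_real ((norm (g (d * x)))\<^sup>2 * w (d * x)) :: complex))"
  by (rule iffD2[OF cov_integral(2)[OF cov_scale[OF d], of "%x. of_real ((norm (g x))\<^sup>2 * w x)"] i]) measurable
 also have "(%x. av d *\<^sub>R (of_real ((norm (g (d * x)))\<^sup>2 * w (d * x)) :: complex))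
  = (%x. of_real ((av d * w d) * ((norm (g (d * x)))\<^sup>2 * w x)))" by (simp add: fun_eq_iff absval_mult powr_mult scaleR_conv_of_real mult_ac)
 finally have "integrable \<mu> (%x. (av d * w d) * ((norm (g (d * x)))\<^sup>2 * w x))" by (simp only: complex_of_real_integrable_eq)
 from integrable_mult_right[of "1 / (av d * w d)", OF this]
 have "integrable \<mu> (%x. (norm (g (d * x)))\<^sup>2 * w x)" using d by simp
 thus ?thesis by (simp add: Lw_def)
qed

lemma Lw_psi: assumes g: "g \<in> Lw" shows "(%x. \<psi> (c * x) * g x) \<in> Lw" using Lw_meas[OF g] Lw_int[OF g] by (simp add: Lw_def norm_mult)

lemma hilb_nontrivial: "hilb K s ~= {%\<phi>. 0}"
proof
 assume eq: "hilb K s = {%\<phi>. 0}"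
 obtain h :: 'k where h: "h ~= 0" "av h < 1" using ex_absval_less[of 1] by auto
 let ?i = "%x. indicator (cb 1 h) x :: complex"
 have i: "?i \<in> Lw" by (rule Cc_Lw[OF Cc_indicator[OF h(1)]]) (use h in \<open>simp add: cb_def\<close>)
 have "Dst ?i = (%\<phi>. 0)" using i eq unfolding hilb_eq by auto
 hence "AE x in \<mu>. ?i x = 0" using Dst_eq_iff[OF i zero_Lw] Dst_zero by simp
 hence "AE x in \<mu>. x \<notin> cb 1 h" by eventually_elim (auto simp: indicator_def split: if_splits)
 hence "emeasure \<mu> (cb 1 h) = 0" by (subst (asm) AE_iff_measurable[of "cb 1 h"]) auto
 thus False using emeasure_cb[OF h(1), of 1] h vol_pos by simp
qed

end

context srep
begin

abbreviation "act \<equiv> smooth_action K chi (of_real s)"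

lemma fd_hilb: "f \<in> X ==> fd f \<in> hilb K s" using FT_form(1) function_distribution_eq unfolding hilb_eq by blast

lemma X_add: assumes "f \<in> X" "g \<in> X" shows "(%x. f x + g x) \<in> X"
 using assms I_smooth_add(1)[OF XI XI, OF assms] Bochner_Integration.integral_add[OF I_integrable I_integrable, OF XI XI, OF assms]
 unfolding X_def by auto

lemma X_cmult: assumes "f \<in> X" shows "(%x. c * f x) \<in> X" using assms I_smooth_cmult(1)[OF XI, OF assms] unfolding X_def by auto

lemma fd_add: assumes "f \<in> X" "g \<in> X" shows "fd (%x. f x + g x) = (%\<phi>. fd f \<phi> + fd g \<phi>)"
 unfolding function_distribution_eq[OF X_add[OF assms]] function_distribution_eq[OF assms(1)] function_distribution_eq[OF assms(2)]
  fourier_add[OF I_integrable[OF XI[OF assms(1)]] I_integrable[OF XI[OF assms(2)]]] by (rule Dst_add[OF FT_form(1) FT_form(1), OF assms])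

lemma fd_cmult: assumes "f \<in> X" shows "fd (%x. c * f x) = (%\<phi>. c * fd f \<phi>)"
 unfolding function_distribution_eq[OF X_cmult[OF assms]] function_distribution_eq[OF assms] fourier_cmult by (rule Dst_cmult)

lemma Cc_X: "\<phi> \<in> Cc ==> s < 1/2 \<or> (LI x. \<phi> x) = 0 ==> \<phi> \<in> X" by (simp add: X_def Cc_I_smooth)

lemma zero_X: "(%x. 0) \<in> X" by (rule Cc_X[OF Cc_zero]) simp

text \<open>The inverse transform of a test function that vanishes at 0 is a test function of
  integral 0, hence lies in \<open>X\<close> in both cases, and \<open>Dst_dense\<close>
  applies.\<close>

lemma X_Cc_dense:
 assumes T: "T \<in> hilb K s" and e: "0 < e"
 shows "\<exists>\<phi>\<in>X \<inter> Cc. dst T (fd \<phi>) < e"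
proof -
 have "\<exists>x\<in>fd ` (X \<inter> Cc). dst T x < e"
 proof (rule Dst_dense[OF _ _ _ T e])
  show "subspace_of_functions (fd ` (X \<inter> Cc))" unfolding subspace_of_functions_def
  proof (intro conjI ballI allI)
   have "fd (%x. 0) = (%\<phi>. 0)" by (simp add: function_distribution_def as_distribution_def fun_eq_iff)
   thus "(%\<phi>. 0) \<in> fd ` (X \<inter> Cc)" using zero_X Cc_zero by (metis IntI imageI)
  next
   fix F G assume "F \<in> fd ` (X \<inter> Cc)" "G \<in> fd ` (X \<inter> Cc)"
   then obtain f g where fg: "f \<in> X" "f \<in> Cc" "F = fd f" "g \<in> X" "g \<in> Cc" "G = fd g" by blast
   show "(%x. F x + G x) \<in> fd ` (X \<inter> Cc)" unfolding fg(3,6) fd_add[OF fg(1,4), symmetric] by (intro imageI IntI X_add Cc_add fg)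
  next
   fix c F assume "F \<in> fd ` (X \<inter> Cc)"
   then obtain f where f: "f \<in> X" "f \<in> Cc" "F = fd f" by blast
   show "(%x. c * F x) \<in> fd ` (X \<inter> Cc)" unfolding f(3) fd_cmult[OF f(1), symmetric] by (intro imageI IntI X_cmult Cc_cmult f)
  qed
  show "fd ` (X \<inter> Cc) \<subseteq> hilb K s" using fd_hilb by blast
  fix \<theta> :: "'k => complex" assume \<theta>: "\<theta> \<in> Cc" "\<theta> 0 = 0"
  have "(LI x. Finv \<theta> x) = FT (Finv \<theta>) 0" by (simp add: fourier_eq)
  hence "Finv \<theta> \<in> X" using \<theta> by (intro Cc_X Finv_Cc) (simp_all add: fourier_Finv)
  thus "Dst \<theta> \<in> fd ` (X \<inter> Cc)"
   using function_distribution_eq[of "Finv \<theta>"] \<theta>(1) Finv_Cc[OF \<theta>(1)] by (intro image_eqI[of _ _ "Finv \<theta>"]) (auto simp: fourier_Finv)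
 qed
 thus ?thesis by blast
qed



sublocale rep: dense_rep "hilb K s" "hilb_inner K s" PGL2 X "fd" "smooth_action K chi (of_real s)"
proof

 show "subspace_of_functions X" unfolding subspace_of_functions_def by (auto intro: X_add X_cmult zero_X)
 fix g h :: "('k^2^2) set" and f f' c T and e :: real
 show "f \<in> X ==> fd f \<in> hilb K s" by (rule fd_hilb)
 show "f \<in> X ==> f' \<in> X ==> fd (%x. f x + f' x) = (%y. fd f y + fd f' y)" by (rule fd_add)
 show "f \<in> X ==> fd (%x. c * f x) = (%y. c * fd f y)" by (rule fd_cmult)
 show "T \<in> hilb K s ==> 0 < e ==> \<exists>f\<in>X. dst T (fd f) < e" using X_Cc_dense by blast
 show "g \<in> carrier PGL2 ==> f \<in> X ==> act g f \<in> X" by (rule smooth_action_X)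
 show "g \<in> carrier PGL2 ==> f \<in> X ==> f' \<in> X ==> act g (%x. f x + f' x) = (%y. act g f y + act g f' y)"
  by (rule smooth_action_add[OF XI XI])
 show "g \<in> carrier PGL2 ==> f \<in> X ==> act g (%x. c * f x) = (%y. c * act g f y)" by (rule smooth_action_cmult[OF XI])
 show "f \<in> X ==> act \<one>\<^bsub>PGL2\<^esub> f = f" by (rule smooth_action_one[OF XI])
 show "g \<in> carrier PGL2 ==> h \<in> carrier PGL2 ==> f \<in> X ==> act (g \<otimes>\<^bsub>PGL2\<^esub> h) f = act g (act h f)" by (rule smooth_action_mult[OF _ _ XI])
 show "g \<in> carrier PGL2 ==> f \<in> X ==> nrm (fd (act g f)) = nrm (fd f)" by (rule smooth_action_X)
qed

section \<open>Continuity, transposes and irreducibility\<close>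

abbreviation "U \<equiv> rep.U"

lemma completed_action_eq: "completed_action K s X act = U" by (intro ext) (simp only: completed_action_def rep.U_def)

text \<open>A matrix close to the identity moves points of a ball containing the support by at most
  the radius of invariance of \<open>\<phi>\<close>, and it sends no outside point into that
  ball.\<close>

lemma fixed_near_one:
 assumes \<phi>: "\<phi> \<in> X" "\<phi> \<in> Cc"
 shows "\<exists>N. open N \<and> mat 1 \<in> N \<and> (\<forall>A\<in>N. det A ~= 0 \<and> U (pgl_class A) (fd \<phi>) = fd \<phi>)"
proof -
 obtain R B where R: "R ~= 0" "B ~= 0" "!!x. av x > av R ==> \<phi> x = 0"
  "!!x y. av y <= av B ==> \<phi> (x + y) = \<phi> x" using \<phi>(2) by (rule CcE) (rule that; assumption)
 from mc_near_1 obtain h where h: "h ~= 0" "av h < 1"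
  "!!u. av (u - 1) <= av h ==> u ~= 0 \<and> av u = 1 \<and> (\<forall>\<sigma>. mc \<sigma> u = 1)" by blast
 define M where "M = max 1 (av R)"
 have M: "1 <= M" "av R <= M" by (auto simp: M_def)
 \<comment> \<open>The factor \<open>M\<^sup>2\<close> accounts for the quadratic term
   \<open>b * x * x\<close> in the displacement of a point with |x| <= M.\<close>
 have "0 < min (min (av h) (av B)) (av R) / M\<^sup>2" using h(1) R(1,2) M by simp
 from ex_absval_less[OF this] obtain \<delta> :: 'k where \<delta>: "\<delta> ~= 0" "av \<delta> < min (min (av h) (av B)) (av R) / M\<^sup>2" by blast
 have M2: "av \<delta> * M\<^sup>2 < min (min (av h) (av B)) (av R)" using \<delta>(2) M by (simp add: less_divide_eq)
 have MM: "M <= M\<^sup>2" using M by (simp add: self_le_power)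
 have "av \<delta> * 1 <= av \<delta> * M" "av \<delta> * M <= av \<delta> * M\<^sup>2" "av \<delta> * av R <= av \<delta> * M" by (rule mult_left_mono, use M MM in auto)+
 hence d1: "av \<delta> < av h" "av \<delta> < av R" "av \<delta> * M < av h" "av \<delta> * av R < av h" "av \<delta> * M\<^sup>2 < av B" "av \<delta> < 1"
  "av \<delta> <= av \<delta> * M\<^sup>2" "av \<delta> * av R <= av \<delta> * M\<^sup>2" using M2 h(2) by auto
 let ?N = "{A :: 'k^2^2. A $ 1 $ 1 \<in> cb 1 \<delta>} \<inter> {A :: 'k^2^2. A $ 1 $ 2 \<in> cb 0 \<delta>} \<inter> {A :: 'k^2^2. A $ 2 $ 1 \<in> cb 0 \<delta>} \<inter> {A :: 'k^2^2. A $ 2 $ 2 \<in> cb 1 \<delta>}"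
 have op: "open {A :: 'k^2^2. A $ i $ j \<in> cb c \<delta>}" for i j :: 2 and c
  using open_vimage[OF open_cb[OF \<delta>(1), of c], of "%A :: 'k^2^2. A $ i $ j"] by (simp add: vimage_def continuous_intros)
 have "open ?N" by (intro open_Int op)
 moreover have "mat 1 \<in> ?N" by (simp add: mat_def)
 moreover have "det A ~= 0 \<and> U (pgl_class A) (fd \<phi>) = fd \<phi>" if A: "A \<in> ?N" for A
 proof -
  obtain a b c d where Am: "A = mt a b c d" by (rule mt_cases)
  have e: "av (a - 1) <= av \<delta>" "av b <= av \<delta>" "av c <= av \<delta>" "av (d - 1) <= av \<delta>" using A by (simp_all add: Am cb_def)
  let ?D = "a * d - b * c"
  have ad: "av a = 1" "av d = 1" using h(3)[of a] h(3)[of d] e d1 by auto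
  have "av (b * c) <= av \<delta> * 1" unfolding absval_mult using e d1(6) by (intro mult_mono) auto
  moreover have "av ((a - 1) * d) <= av \<delta>" using e(1) ad by (simp add: absval_mult)
  moreover have "?D - 1 = ((a - 1) * d + (d - 1)) - b * c" by (simp add: algebra_simps)
  ultimately have "av (?D - 1) <= av \<delta>" using e(4) by (simp only: absval_add_le absval_diff_le)
  hence D: "?D ~= 0" "av ?D = 1" "mc 0 ?D = 1" using h(3)[of ?D] d1(1) by auto
  let ?F = "act (inv\<^bsub>PGL2\<^esub> (pgl_class (mt a b c d))) \<phi>"
  have F: "?F x = \<phi> x" if den: "a + b * x ~= 0" for x
  proof -
   note m = smooth_action_moebius[OF XI[OF \<phi>(1)] D(1) den]
   show ?thesis
   proof (cases "av x <= av R")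
    case True
    have bx: "av (b * x) <= av \<delta> * av R" unfolding absval_mult using e True by (intro mult_mono) auto
    have "a + b * x - 1 = (a - 1) + b * x" by simp
    moreover have "av (a - 1) <= av h" "av (b * x) <= av h" using e(1) bx d1(1,4) by linarith+
    ultimately have "av (a + b * x - 1) <= av h" by (simp only: absval_add_le)
    hence den1: "av (a + b * x) = 1" using h(3) by blast
    \<comment> \<open>The numerator of (c + d x) / (a + b x) - x, grouped into terms that are small
      for a matrix near the identity.\<close>
    let ?n = "(c + (d - 1) * x) - ((a - 1) * x + b * x * x)"
    have "(c + d * x) / (a + b * x) = x + ?n / (a + b * x)" using den by (simp add: field_simps)
    moreover have "av (?n / (a + b * x)) <= av B"
    proof -
     have xM: "av x <= M" using True M by linarith
     have "av ((d - 1) * x) <= av \<delta> * M" "av ((a - 1) * x) <= av \<delta> * M" unfolding absval_mult using e xM by (auto intro!: mult_mono)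
     moreover have "av (b * x * x) <= av \<delta> * M * M" unfolding absval_mult using e xM M by (intro mult_mono) auto
     moreover have "av \<delta> * M <= av \<delta> * M\<^sup>2" by (rule mult_left_mono[OF MM]) simp
     moreover have "av \<delta> * M * M = av \<delta> * M\<^sup>2" by (simp add: power2_eq_square)
     ultimately have "av ((d - 1) * x) <= av \<delta> * M\<^sup>2" "av ((a - 1) * x) <= av \<delta> * M\<^sup>2" "av (b * x * x) <= av \<delta> * M\<^sup>2" "av c <= av \<delta> * M\<^sup>2"
      using e(3) d1(7) by linarith+
     hence "av ?n <= av \<delta> * M\<^sup>2" by (intro absval_diff_le absval_add_le)
     thus ?thesis unfolding absval_divide den1 using d1(5) by simp
    qed
    ultimately have "\<phi> ((c + d * x) / (a + b * x)) = \<phi> x" by (simp only: R(4))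
    thus ?thesis using m D den1 by simp
   next
    case False
    hence x: "av R < av x" by simp
    have "av c < av (d * x)" using e(3) d1(2) x ad by (simp add: absval_mult)
    hence num: "av (c + d * x) = av x" using absval_add_eq ad by (simp add: absval_mult)
    have "av R * av (a + b * x) < av x"
    proof -
     have "av (a + b * x) <= max 1 (av b * av x)" using absval_add[of a "b * x"] ad by (simp add: absval_mult)
     hence "av R * av (a + b * x) <= max (av R) (av R * (av b * av x))"
      using mult_left_mono[of "av (a + b * x)" "max 1 (av b * av x)" "av R"] by (simp add: max_mult_distrib_left)
     moreover have "av R * (av b * av x) < av x"
     proof -
      have "av R * av b <= av R * av \<delta>" by (intro mult_left_mono e) simp
      also have "... < 1" using d1(4) h(2) by (simp add: mult.commute)
      finally have "(av R * av b) * av x < 1 * av x" using x absval_nonneg[of R] by (intro mult_strict_right_mono) linarith+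
      thus ?thesis by (simp add: mult.assoc)
     qed
     ultimately show ?thesis using x by linarith
    qed
    hence "av ((c + d * x) / (a + b * x)) > av R" unfolding absval_divide num using den by (simp add: less_divide_eq)
    thus ?thesis using m R(3) x by simp
   qed
  qed
  let ?a = "pgl_class (mt a b c d)"
  have a: "?a \<in> carrier PGL2" using D(1) by simp
  hence ia: "inv\<^bsub>PGL2\<^esub> ?a \<in> carrier PGL2" by simp
  have "fd ?F = fd \<phi>"
  proof (rule function_distribution_cong_AE)
   show "AE x in \<mu>. ?F x = \<phi> x" using AE_den_nz[OF D(1)] by eventually_elim (rule F)
   show "?F \<in> bm" by (rule I_measurable[OF smooth_action_in[OF ia XI[OF \<phi>(1)]]])
   show "\<phi> \<in> bm" by (rule Cc_measurable[OF \<phi>(2)])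
  qed
  hence "U (inv\<^bsub>PGL2\<^esub> ?a) (fd \<phi>) = fd \<phi>" using rep.U_j[OF ia \<phi>(1)] by simp
  hence "U ?a (fd \<phi>) = U (?a \<otimes>\<^bsub>PGL2\<^esub> inv\<^bsub>PGL2\<^esub> ?a) (fd \<phi>)" using rep.U_mult[OF a ia fd_hilb[OF \<phi>(1)]] by simp
  also have "... = fd \<phi>" using a rep.U_one[OF fd_hilb[OF \<phi>(1)]] by simp
  finally show ?thesis using D(1) by (simp add: Am)
 qed
 ultimately show ?thesis by blast
qed

text \<open>An approximating test function is fixed by the operators of a whole neighbourhood, and
  these operators are isometric.\<close>

lemma near_one:
 assumes T: "T \<in> hilb K s" and e: "0 < e"
 shows "\<exists>N. open N \<and> mat 1 \<in> N \<and> (\<forall>A\<in>N. det A ~= 0 \<and> dst (U (pgl_class A) T) T < e)"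
proof -
 obtain \<phi> where \<phi>: "\<phi> \<in> X" "\<phi> \<in> Cc" "dst T (fd \<phi>) < e / 2" using X_Cc_dense[OF T, of "e / 2"] e by auto
 from fixed_near_one[OF \<phi>(1,2)] obtain N where N: "open N" "mat 1 \<in> N"
  "!!A. A \<in> N ==> det A ~= 0 \<and> U (pgl_class A) (fd \<phi>) = fd \<phi>" by blast
 have "dst (U (pgl_class A) T) T < e" if A: "A \<in> N" for A
 proof -
  have a: "pgl_class A \<in> carrier PGL2" using N(3)[OF A] by simp
  have V: "U (pgl_class A) T \<in> hilb K s" "fd \<phi> \<in> hilb K s" by (rule rep.U_mem[OF a T]) (rule fd_hilb[OF \<phi>(1)])
  have "dst (U (pgl_class A) T) (fd \<phi>) <= dst T (fd \<phi>)" using rep.U_bound[OF a T \<phi>(1)] rep.U_j[OF a \<phi>(1)] N(3)[OF A] by simp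
  thus ?thesis using nrm_diff_triangle[OF V T] nrm_diff_commute[OF V(2) T] \<phi>(3) by linarith
 qed
 thus ?thesis using N by blast
qed

lemma unitary: "unitary_rep PGL2 PGL2_topology (hilb K s) (hilb_inner K s) U"
 by (rule unitary_rep_PGL2I[OF rep.U_linear rep.U_inner rep.U_one rep.U_mult near_one])

text \<open>On smooth vectors this is a change of variables: the exponents s + 1/2 and - s + 1/2 add
  up to one Jacobian, and the two signs of the character cancel. Both sides are continuous in
  \<open>S\<close>, so the identity extends to the completion.\<close>

lemma U_dual:
 assumes det: "a * d - b * c ~= 0" and \<phi>: "\<phi> \<in> Cc" and S: "S \<in> hilb K s"
 defines "t \<equiv> smooth_action K chi (of_real (- s)) (inv\<^bsub>PGL2\<^esub> (pgl_class (mt a b c d))) \<phi>"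
 assumes t: "t \<in> Cc"
 shows "U (pgl_class (mt a b c d)) S \<phi> = S t"
proof -
 let ?g = "pgl_class (mt a b c d)" and ?D = "a * d - b * c"
 have g: "?g \<in> carrier PGL2" using det by simp
 have smooth: "fd (act ?g f) \<phi> = fd f t" if f: "f \<in> X" for f
 proof -
  define F where "F = act ?g f"
  have FX: "F \<in> X" unfolding F_def by (rule smooth_action_X(1)[OF g f])
  have fF: "f = act (inv\<^bsub>PGL2\<^esub> ?g) F"
   using smooth_action_mult[of "inv\<^bsub>PGL2\<^esub> ?g" ?g f K chi "of_real s"] smooth_action_one[OF XI[OF f]] g XI[OF f] by (simp add: F_def)
  define m where "m x = (c + d * x) / (a + b * x)" for x
  define J where "J x = av ?D / (av (a + b * x))\<^sup>2" for x
  have cov: "cov m J" using cov_moebius[OF det] by (simp add: m_def[abs_def] J_def[abs_def])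
  have [measurable]: "F \<in> bm" "f \<in> bm" "\<phi> \<in> bm" "t \<in> bm"
   "m \<in> bm" "J \<in> bm" using I_measurable XI FX f Cc_measurable \<phi> t cov by (auto simp: cov_def)
  have "(LI x. f x * t x) = (LI x. J x *\<^sub>R (F (m x) * \<phi> (m x)))"
  proof (rule integral_cong_AE)
   show "AE x in \<mu>. f x * t x = J x *\<^sub>R (F (m x) * \<phi> (m x))" using AE_den_nz[OF det]
   proof eventually_elim
    case (elim x)
    have J: "0 < J x" using elim det by (simp add: J_def)
    have 1: "f x = mc 0 ?D * of_real (J x powr (s + 1/2)) * F (m x)"
     by (subst fF, subst smooth_action_moebius[OF XI[OF FX] det elim]) (simp add: J_def m_def)
    have 2: "t x = mc 0 ?D * of_real (J x powr (- s + 1/2)) * \<phi> (m x)"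
     unfolding t_def by (subst smooth_action_moebius[OF Cc_I_smooth[OF \<phi>] det elim]) (simp add: J_def m_def)
    have ee: "mc 0 ?D * mc 0 ?D = 1" using mc0_cases[OF det] by auto
    have jj: "J x powr (s + 1/2) * J x powr (- s + 1/2) = J x" using J by (simp flip: powr_add)
    have "f x * t x = (mc 0 ?D * mc 0 ?D) * of_real (J x powr (s + 1/2) * J x powr (- s + 1/2)) * (F (m x) * \<phi> (m x))"
     unfolding 1 2 of_real_mult by (simp only: mult_ac)
    thus ?case unfolding ee jj by (simp add: scaleR_conv_of_real)
   qed
  qed measurable
  also have "... = (LI x. F x * \<phi> x)" by (rule cov_integral(1)[OF cov, of "%x. F x * \<phi> x"]) measurable
  finally show ?thesis using \<phi> t by (simp add: F_def function_distribution_def as_distribution_def)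
 qed
 from Dst_Cc_bounded[OF \<phi>] obtain C where C: "0 <= C" "!!T. T \<in> hilb K s ==> norm (T \<phi>) <= C * nrm T" by blast
 from Dst_Cc_bounded[OF t] obtain C' where C': "0 <= C'" "!!T. T \<in> hilb K s ==> norm (T t) <= C' * nrm T" by blast
 have "norm (U ?g S \<phi> - S t) <= 0 + e" if e: "e > 0" for e
 proof -
  define r where "r = e / (C + C' + 1)"
  have r: "0 < r" using C(1) C'(1) e by (simp add: r_def)
  have "(C + C') * r <= (C + C' + 1) * r" using r by (intro mult_right_mono) auto
  also have "... = e" using C(1) C'(1) by (simp add: r_def)
  finally have re: "(C + C') * r <= e" .
  obtain f where f: "f \<in> X" "dst S (fd f) < r" using rep.dense[OF S r] by blast
  have V: "U ?g S \<in> hilb K s" "fd (act ?g f) \<in> hilb K s" "fd f \<in> hilb K s"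
   using rep.U_mem[OF g S] fd_hilb smooth_action_X(1)[OF g f(1)] f(1) by auto
  have "U ?g S \<phi> - S t = (U ?g S \<phi> - fd (act ?g f) \<phi>) - (S t - fd f t)" using smooth[OF f(1)] by simp
  hence "norm (U ?g S \<phi> - S t) <= norm (U ?g S \<phi> - fd (act ?g f) \<phi>) + norm (S t - fd f t)" using norm_triangle_ineq4 by metis
  also have "... <= C * nrm (%y. U ?g S y - fd (act ?g f) y) + C' * dst S (fd f)"
   by (rule add_mono[OF C(2)[OF diff_mem[OF V(1,2)]] C'(2)[OF diff_mem[OF S V(3)]]])
  also have "... <= C * r + C' * r" using rep.U_bound[OF g S f(1)] f(2) C(1) C'(1) by (intro add_mono mult_left_mono) auto
  finally show ?thesis using re by (simp add: distrib_right)
 qed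
 hence "norm (U ?g S \<phi> - S t) <= 0" by (rule field_le_epsilon)
 thus ?thesis by simp
qed

text \<open>Affine maps fix infinity, so \<open>U_dual\<close> applies to every test function. On
  the Fourier side translations become multiplications by characters and dilations remain
  dilations.\<close>

lemma U_affine:
 assumes g: "g \<in> Lw" and d: "d ~= 0"
 shows "U (pgl_class (mt 1 0 c d)) (Dst g) = Dst (%x. (mc 0 d * of_real (av d powr (1/2 - s))) * (\<psi> (c * x) * g (d * x)))"
proof -
 let ?k = "mc 0 d * of_real (av d powr (1/2 - s))" and ?g = "pgl_class (mt 1 0 c d)"
 have S: "Dst g \<in> hilb K s" using g unfolding hilb_eq by blast
 have det: "1 * d - 0 * c ~= 0" using d by simp
 have gc: "?g \<in> carrier PGL2" using d by simp
 have [measurable]: "g \<in> bm" by (rule Lw_meas[OF g])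
 show ?thesis
 proof (rule distribution_eq_Dst)
  show "U ?g (Dst g) \<in> distributions" using rep.U_mem[OF gc S] by (simp add: hilb_def)
  fix \<phi> :: "'k => complex" assume \<phi>: "\<phi> \<in> Cc"
  have [measurable]: "\<phi> \<in> bm" by (rule Cc_measurable[OF \<phi>])
  define t where "t = smooth_action K chi (of_real (- s)) (inv\<^bsub>PGL2\<^esub> ?g) (FT \<phi>)"
  have t: "t \<in> Cc" unfolding t_def by (rule transpose_Cc[OF det fourier_Cc[OF \<phi>]]) simp
  \<comment> \<open>The test function whose transform is proportional to \<open>t\<close>: the
    affine substitution is moved through the Fourier transform.\<close>
  define \<theta> where "\<theta> y = \<psi> (c / d * y) * (of_real (1 / av d) * \<phi> (0 + 1 / d * y))" for y
  have \<theta>: "\<theta> \<in> Cc" unfolding \<theta>_def by (intro Cc_mult Cc_cmult Cc_affine \<phi> loc_const_psi) (use d in simp)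
  have [measurable]: "\<theta> \<in> bm" by (rule Cc_measurable[OF \<theta>])
  have th: "av d *\<^sub>R \<theta> (d * x) = \<psi> (c * x) * \<phi> x" for x using d by (simp add: \<theta>_def scaleR_conv_of_real)
  have "t u = ?k * FT \<theta> u" for u
  proof -
   have "t u = ?k * FT \<phi> (c + d * u)"
    unfolding t_def using smooth_action_moebius[OF Cc_I_smooth[OF fourier_Cc[OF \<phi>]] det, where s = "- s" and x = u] by simp
   moreover have "FT \<theta> u = (LI x. av d *\<^sub>R (\<psi> (u * (d * x)) * \<theta> (d * x)))"
    unfolding fourier_eq by (rule cov_integral(1)[OF cov_scale[OF d], of "%y. \<psi> (u * y) * \<theta> y", symmetric]) measurable
   moreover have "av d *\<^sub>R (\<psi> (u * (d * x)) * \<theta> (d * x)) = \<psi> ((c + d * u) * x) * \<phi> x" for x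
   proof -
    have "av d *\<^sub>R (\<psi> (u * (d * x)) * \<theta> (d * x)) = \<psi> (u * (d * x)) * (av d *\<^sub>R \<theta> (d * x))" by simp
    also have "... = \<psi> (u * (d * x)) * \<psi> (c * x) * \<phi> x" unfolding th by simp
    also have "\<psi> (u * (d * x)) * \<psi> (c * x) = \<psi> ((c + d * u) * x)" unfolding psi_add[symmetric] by (simp add: algebra_simps)
    finally show ?thesis .
   qed
   ultimately show ?thesis by (simp add: fourier_eq)
  qed
  hence t_eq: "t = (%u. ?k * FT \<theta> u)" by (rule ext)
  have "U ?g (Dst g) (FT \<phi>) = Dst g t" unfolding t_def by (rule U_dual[OF det fourier_Cc[OF \<phi>] S t[unfolded t_def]])
  \<comment> \<open>With coefficient -1 at the zero function, \<open>hilb_Cc_linear\<close> shows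
    that the distribution vanishes at 0; this turns its affine rule into homogeneity.\<close>
  also have "... = ?k * Dst g (FT \<theta>)"
   using hilb_Cc_linear[OF S Cc_zero fourier_Cc[OF \<theta>], of ?k] hilb_Cc_linear[OF S Cc_zero Cc_zero, of "-1"] unfolding t_eq by simp
  also have "Dst g (FT \<theta>) = (LI x. g x * \<theta> x)" by (rule Dst_fourier[OF \<theta>])
  also have "... = (LI x. av d *\<^sub>R (g (d * x) * \<theta> (d * x)))"
   by (rule cov_integral(1)[OF cov_scale[OF d], of "%x. g x * \<theta> x", symmetric]) measurable
  also have "... = (LI x. g (d * x) * (av d *\<^sub>R \<theta> (d * x)))" by simp
  also have "?k * ... = (LI x. ?k * (\<psi> (c * x) * g (d * x)) * \<phi> x)" unfolding th integral_mult_right_zero[symmetric] by (simp only: mult_ac)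
  finally show "U ?g (Dst g) (FT \<phi>) = (LI x. ?k * (\<psi> (c * x) * g (d * x)) * \<phi> x)" .
 qed
qed

text \<open>If \<open>h\<close> is orthogonal to the translates of \<open>g\<close> under the affine group, then the Fourier
 transform of \<open>x \<mapsto> g (d * x) * cnj (h x) * w x\<close> vanishes for all \<open>d\<close>, so \<open>g = 0\<close> or \<open>h = 0\<close>.\<close>

lemma irreducible: "irreducible_unitary_rep PGL2 PGL2_topology (hilb K s) (hilb_inner K s) U" unfolding irreducible_unitary_rep_def
proof (intro conjI allI impI unitary hilb_nontrivial)
 fix W assume W: "closed_subspace (hilb K s) (hilb_inner K s) W \<and> invariant_subspace PGL2 U W"
 show "W = {%x. 0} \<or> W = hilb K s"
 proof (rule ccontr)
  assume n: "\<not> (W = {%x. 0} \<or> W = hilb K s)"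
  from closed_subspace_orthogonal[of W] W n obtain T where T: "T \<in> hilb K s" "T ~= (%x. 0)"
   "!!S. S \<in> W ==> hilb_inner K s T S = 0" by blast
  have Wsub: "W \<subseteq> hilb K s" "(%x. 0) \<in> W" using W by (auto simp: closed_subspace_def subspace_of_functions_def)
  then obtain S where S: "S \<in> W" "S ~= (%x. 0)" using n by blast
  obtain h where h: "h \<in> Lw" "T = Dst h" using T(1) unfolding hilb_eq by blast
  obtain g where g: "g \<in> Lw" "S = Dst g" using S(1) Wsub unfolding hilb_eq by blast
  have [measurable]: "g \<in> bm" "h \<in> bm" using Lw_meas g h by auto
  have *: "AE x in \<mu>. h x * cnj (g (d * x)) = 0" if d: "d ~= 0" for d
  proof -
   have gd: "(%x. g (d * x)) \<in> Lw" by (rule Lw_scale[OF g(1) d])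
   let ?f = "%x. h x * cnj (g (d * x)) * of_real (w x)" and ?k = "mc 0 d * of_real (av d powr (1/2 - s))"
   have k: "?k ~= 0" using mc_nz[OF d] d by simp
   have i: "integrable \<mu> ?f" by (rule Lw_prod_integrable[OF h(1) gd])
   have "FT ?f c = 0" for c
   proof -
    have L: "(%x. ?k * (\<psi> ((- c) * x) * g (d * x))) \<in> Lw" by (intro Lw_cmult Lw_psi gd)
    have "pgl_class (mt 1 0 (- c) d) \<in> carrier PGL2" using d by simp
    hence "U (pgl_class (mt 1 0 (- c) d)) S \<in> W" using W S(1) by (simp add: invariant_subspace_def)
    hence "hilb_inner K s (Dst h) (Dst (%x. ?k * (\<psi> ((- c) * x) * g (d * x)))) = 0"
     using T(3) unfolding h(2) g(2) U_affine[OF g(1) d] by blast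
    hence "(LI x. h x * cnj (?k * (\<psi> ((- c) * x) * g (d * x))) * of_real (w x)) = 0" unfolding hilb_inner_Dst[OF h(1) L] .
    moreover have "h x * cnj (?k * (\<psi> ((- c) * x) * g (d * x))) * of_real (w x) = cnj ?k * (\<psi> (c * x) * ?f x)" for x
     using psi_minus[of "c * x"] by (simp add: mult_ac)
    ultimately have "cnj ?k * FT ?f c = 0" unfolding fourier_eq by (simp only: integral_mult_right_zero)
    moreover have "cnj ?k ~= 0" using k by (simp only: complex_cnj_zero_iff not_False_eq_True)
    ultimately show ?thesis by (simp only: mult_eq_0_iff) blast
   qed
   from fourier_inj[OF i this] show ?thesis using AE_neq[of 0] by eventually_elim simp
  qed
  \<comment> \<open>The exceptional null set depends on \<open>d\<close>. Exchanging the two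
    quantifiers yields one \<open>x\<close> with \<open>h x\<close> nonzero such that
    \<open>g (d * x) = 0\<close> for almost all \<open>d\<close>, and dilation by \<open>x\<close>
    carries this to almost every point.\<close>
  have "AE d in \<mu>. AE x in \<mu>. h x * cnj (g (d * x)) = 0" using AE_neq[of 0] by eventually_elim (rule *)
  hence ae: "AE x in \<mu>. AE d in \<mu>. h x * cnj (g (d * x)) = 0" by (subst (asm) haar2.AE_commute) measurable
  have "\<not> (AE x in \<mu>. h x = 0)" using T(2) Dst_eq_iff[OF h(1) zero_Lw] h(2) Dst_zero by simp
  then obtain x where x: "h x ~= 0" "x ~= 0" "AE d in \<mu>. h x * cnj (g (d * x)) = 0"
  proof -
   have "\<exists>x. h x ~= 0 \<and> x ~= 0 \<and> (AE d in \<mu>. h x * cnj (g (d * x)) = 0)"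
   proof (rule ccontr)
    assume c: "\<not> ?thesis"
    have "AE x in \<mu>. h x = 0" using ae AE_neq[of 0] by eventually_elim (use c in blast)
    thus False using \<open>\<not> (AE x in \<mu>. h x = 0)\<close> by blast
   qed
   thus ?thesis using that by blast
  qed
  let ?Z = "{y. g y ~= 0}"
  have "AE d in \<mu>. (indicator ?Z (x * d) :: ennreal) = 0" using x(3) by eventually_elim (use x(1) in \<open>simp add: mult.commute\<close>)
  hence "(NI d. indicator ?Z (x * d)) = 0" by (subst nn_integral_0_iff_AE) auto
  hence "(NI y. indicator ?Z y) = 0" using nn_integral_scale[OF x(2), of "indicator ?Z"] by simp
  hence "AE y in \<mu>. (indicator ?Z y :: ennreal) = 0" by (subst (asm) nn_integral_0_iff_AE) auto
  hence "AE y in \<mu>. g y = 0" by eventually_elim (auto simp: indicator_def split: if_splits)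
  hence "S = (%x. 0)" using Dst_eq_iff[OF g(1) zero_Lw] g(2) Dst_zero by simp
  thus False using S(2) by blast
 qed
qed

end

section \<open>Quadratic extensions\<close>

locale local_extension =
 fixes \<iota> :: "'f::nonarch_local_field => 'e::nonarch_local_field" and \<alpha> \<pi> :: 'e and F :: "'f field_data"
 assumes quadratic_extension: "quadratic_extension \<iota> \<alpha>" and F: "field_data F" and \<pi>: "uniformizer \<pi>"
begin

sublocale F: local_field_data F by standard (rule F)

abbreviation "E \<equiv> extension_data \<iota> \<alpha> F \<pi>"

lemma iota_add [simp]: "\<iota> (x + y) = \<iota> x + \<iota> y"
 and iota_mult [simp]: "\<iota> (x * y) = \<iota> x * \<iota> y"
 and iota_1 [simp]: "\<iota> 1 = 1"
 and iota_continuous: "continuous_on UNIV \<iota>"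
 and ex_coords: "\<exists>x1 x2. z = \<iota> x1 + \<iota> x2 * \<alpha>"
 and alpha_notin: "\<alpha> \<notin> range \<iota>" using quadratic_extension by (simp_all add: quadratic_extension_def)

lemma iota_0 [simp]: "\<iota> 0 = 0" by (metis add.right_neutral add_left_cancel iota_add)
lemma iota_minus [simp]: "\<iota> (- x) = - \<iota> x" using iota_add[of x "- x"] by (simp add: eq_neg_iff_add_eq_0 add.commute del: iota_add)
lemma iota_diff [simp]: "\<iota> (x - y) = \<iota> x - \<iota> y" using iota_add[of x "- y"] by simp

lemma iota_inverse [simp]: "\<iota> (inverse x) = inverse (\<iota> x)"
proof (cases "x = 0")
 case False
 hence "\<iota> x * \<iota> (inverse x) = 1" by (simp flip: iota_mult)
 thus ?thesis by (metis inverse_unique)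
qed simp

lemma iota_eq_0 [simp]: "\<iota> x = 0 \<longleftrightarrow> x = 0"
proof
 assume 0: "\<iota> x = 0"
 show "x = 0"
 proof (rule ccontr)
  assume "x ~= 0"
  hence "\<iota> x * \<iota> (inverse x) = 1" by (simp flip: iota_mult del: iota_inverse)
  thus False using 0 by simp
 qed
qed simp

lemma iota_divide [simp]: "\<iota> (x / y) = \<iota> x / \<iota> y" by (simp add: divide_inverse)
lemma iota_power [simp]: "\<iota> (x ^ n) = \<iota> x ^ n" by (induction n) simp_all
lemma iota_powi [simp]: "\<iota> (x powi n) = \<iota> x powi n" by (simp add: power_int_def)

text \<open>Powers of a unit stay in the compact ring of integers, whose image is bounded, so units
  go to units. Positivity of the factor, the ramification index, comes from continuity at 0.\<close>

lemma val_iota: "\<exists>e>0. \<forall>x. x ~= 0 --> val (\<iota> x) = e * val x"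
proof -
 have "compact (\<iota> ` vball 0)" using compact_vball by (intro compact_continuous_image continuous_on_subset[OF iota_continuous]) auto
 then obtain N where N: "\<iota> ` vball 0 \<subseteq> vball N" using compact_subset_vball by blast
 have nn: "0 <= val (\<iota> u)" if u: "u ~= 0" "val u = 0" for u
 proof (rule ccontr)
  assume neg: "\<not> 0 <= val (\<iota> u)"
  \<comment> \<open>Since \<open>n > |N|\<close>, a negative valuation of \<open>\<iota> u\<close>
    would push \<open>\<iota> (u ^ n)\<close> below the bound \<open>N\<close>.\<close>
  define n where "n = Suc (nat \<bar>N\<bar>)"
  have "u ^ n \<in> vball 0" using u by (simp add: vball_def val_power)
  hence "\<iota> (u ^ n) \<in> vball N" using N by blast
  hence "N <= int n * val (\<iota> u)" using u by (simp add: vball_def val_power)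
  also have "... <= int n * (- 1)" using neg by (intro mult_left_mono) auto
  finally show False by (simp add: n_def)
 qed
 have unit: "val (\<iota> u) = 0" if u: "u ~= 0" "val u = 0" for u using nn[OF u] nn[of "inverse u"] u by (simp add: val_inverse)
 obtain p :: 'f where p: "p ~= 0" "val p = 1" using val_normalized by blast
 have eq: "val (\<iota> x) = val (\<iota> p) * val x" if x: "x ~= 0" for x
 proof -
  have "val (\<iota> (x * p powi (- val x))) = 0" using unit[of "x * p powi (- val x)"] x p by (simp add: val_mult val_powi)
  thus ?thesis using x p by (simp add: val_mult val_powi mult.commute)
 qed
 have "open (\<iota> -` vball 1)" by (rule open_vimage[OF open_vball iota_continuous])
 moreover have "0 \<in> \<iota> -` vball 1" by simp
 ultimately obtain n where n: "!!y. y - 0 \<in> vball n ==> y \<in> \<iota> -` vball 1" unfolding open_iff_vball by blast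
 have "p ^ Suc (nat n) \<in> vball n" using p by (simp add: vball_def val_power val_mult del: power_Suc)
 hence "\<iota> (p ^ Suc (nat n)) \<in> vball 1" using n[of "p ^ Suc (nat n)"] by (simp only: diff_0_right vimage_eq)
 hence "1 <= int (Suc (nat n)) * val (\<iota> p)" using p by (simp add: vball_def val_power del: power_Suc of_nat_Suc)
 hence "0 < val (\<iota> p)" by (smt (verit) mult_nonneg_nonpos of_nat_0_le_iff)
 thus ?thesis using eq by blast
qed

definition "ram = (SOME e. 0 < e \<and> (\<forall>x. x ~= 0 --> val (\<iota> x) = e * val x))"

lemma ram: "0 < ram" "x ~= 0 ==> val (\<iota> x) = ram * val x"
proof -
 have "\<exists>e. 0 < e \<and> (\<forall>x. x ~= 0 --> val (\<iota> x) = e * val x)" using val_iota by blast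
 from someI_ex[OF this] show "0 < ram" "x ~= 0 ==> val (\<iota> x) = ram * val x" unfolding ram_def by blast+
qed

lemma iota_vball: "\<iota> x \<in> vball (ram * k) \<longleftrightarrow> x \<in> vball k" using ram by (cases "x = 0") (auto simp: vball_def)

section \<open>Coordinates over the smaller field\<close>

definition "fc = from_coords \<iota> \<alpha>"

lemma fc_eq: "fc (x1, x2) = \<iota> x1 + \<iota> x2 * \<alpha>" by (simp add: fc_def from_coords_def)

lemma fc_eq': "fc p = \<iota> (fst p) + \<iota> (snd p) * \<alpha>" by (simp add: fc_def from_coords_def split_beta)

lemma fc_0_iff: "\<iota> x1 + \<iota> x2 * \<alpha> = 0 \<longleftrightarrow> x1 = 0 \<and> x2 = 0"
proof
 assume eq: "\<iota> x1 + \<iota> x2 * \<alpha> = 0"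
 have "x2 = 0"
 proof (rule ccontr)
  assume "x2 ~= 0"
  hence "\<alpha> = \<iota> (- x1 / x2)" using eq by (simp add: field_simps eq_neg_iff_add_eq_0)
  thus False using alpha_notin by blast
 qed
 thus "x1 = 0 \<and> x2 = 0" using eq by simp
qed simp

lemma inj_fc: "inj fc"
proof (rule injI)
 fix p p' assume "fc p = fc p'"
 hence "\<iota> (fst p - fst p') + \<iota> (snd p - snd p') * \<alpha> = 0" by (simp add: fc_eq' algebra_simps)
 thus "p = p'" unfolding fc_0_iff by (simp add: prod_eq_iff)
qed

definition "c1 y = fst (inv_into UNIV fc y)"
definition "c2 y = snd (inv_into UNIV fc y)"

lemma c_fc [simp]: "c1 (\<iota> x1 + \<iota> x2 * \<alpha>) = x1" "c2 (\<iota> x1 + \<iota> x2 * \<alpha>) = x2"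
 using inv_into_f_f[OF inj_fc, of "(x1, x2)"] by (simp_all add: c1_def c2_def fc_eq)

lemma coords: "y = \<iota> (c1 y) + \<iota> (c2 y) * \<alpha>" using ex_coords[of y] by auto

lemma c1_add: "c1 (x + y) = c1 x + c1 y"
proof -
 have "x + y = \<iota> (c1 x + c1 y) + \<iota> (c2 x + c2 y) * \<alpha>" using coords[of x] coords[of y] by (simp add: algebra_simps)
 thus ?thesis by (metis c_fc(1))
qed

lemma c1_iota_mult: "c1 (\<iota> a * y) = a * c1 y"
proof -
 have "\<iota> a * y = \<iota> (a * c1 y) + \<iota> (a * c2 y) * \<alpha>" by (subst coords[of y]) (simp add: algebra_simps)
 thus ?thesis by (metis c_fc(1))
qed

lemma fc_continuous: "continuous_on UNIV fc" unfolding fc_eq'[abs_def]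
 by (intro continuous_intros continuous_on_compose2[OF iota_continuous]) auto

lemma fc_measurable [measurable]: "fc \<in> borel_measurable (borel \<Otimes>\<^sub>M borel)"
 unfolding borel_prod by (rule borel_measurable_continuous_onI[OF fc_continuous])

text \<open>After division by the larger coordinate the pair lies in the compact set
  \<open>?S\<close>, whose image omits 0 and hence a ball around 0. Scaling back gives a bound that
  is uniform in \<open>m\<close>.\<close>

lemma ex_coords_bound: "\<exists>n. \<forall>x1 x2 m. \<iota> x1 + \<iota> x2 * \<alpha> \<in> vball m --> \<iota> x1 \<in> vball (m - n) \<and> \<iota> x2 \<in> vball (m - n)"
proof -
 let ?S = "{1} \<times> vball 0 \<union> vball 0 \<times> {1}"
 have "compact (fc ` ?S)"
  by (intro compact_continuous_image continuous_on_subset[OF fc_continuous] compact_Un compact_Times compact_vball) auto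
 hence "open (- (fc ` ?S))" by (intro open_Compl compact_imp_closed)
 moreover have "0 \<in> - (fc ` ?S)" using fc_0_iff by (force simp: fc_eq)
 ultimately obtain n where n: "!!y. y - 0 \<in> vball n ==> y \<in> - (fc ` ?S)" unfolding open_iff_vball by blast
 have main: "\<iota> l \<in> vball (m - n)" if l: "l ~= 0" and S: "(a, b) \<in> ?S" and m: "\<iota> l * fc (a, b) \<in> vball m" for l a b m
 proof -
  have "fc (a, b) \<in> vball (m - val (\<iota> l))" using m l vball_smult_iff[of "\<iota> l" "fc (a, b)" m] by simp
  moreover have "fc (a, b) \<notin> vball n" using n[of "fc (a, b)"] S by auto
  ultimately have "\<not> n <= m - val (\<iota> l)" using vball_mono[of n "m - val (\<iota> l)"] by blast
  thus ?thesis using l by (simp add: vball_def)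
 qed
 have sc: "\<iota> (l * a) \<in> vball k" if "\<iota> l \<in> vball k" "a \<in> vball 0" for l a k
  using vball_mult[OF that(1), of "\<iota> a" 0] iota_vball[of a 0] that(2) by simp
 have "\<iota> x1 \<in> vball (m - n) \<and> \<iota> x2 \<in> vball (m - n)" if m: "\<iota> x1 + \<iota> x2 * \<alpha> \<in> vball m" for x1 x2 m
 proof -
  consider "x1 = 0 \<and> x2 = 0" | "x1 ~= 0" "x2 / x1 \<in> vball 0" | "x2 ~= 0" "x1 / x2 \<in> vball 0"
   by (cases "x1 = 0"; cases "x2 = 0"; cases "val x1 <= val x2") (auto simp: vball_def val_divide)
  thus ?thesis
  proof cases
   case 2
   hence "\<iota> x1 * fc (1, x2 / x1) = \<iota> x1 + \<iota> x2 * \<alpha>" by (simp add: fc_eq distrib_left)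
   hence "\<iota> x1 \<in> vball (m - n)" using main[OF 2(1), of 1 "x2 / x1" m] 2(2) m by simp
   thus ?thesis using sc[of x1 "m - n" "x2 / x1"] 2 by simp
  next
   case 3
   hence "\<iota> x2 * fc (x1 / x2, 1) = \<iota> x1 + \<iota> x2 * \<alpha>" by (simp add: fc_eq distrib_left)
   hence "\<iota> x2 \<in> vball (m - n)" using main[OF 3(1), of "x1 / x2" 1 m] 3(2) m by simp
   thus ?thesis using sc[of x2 "m - n" "x1 / x2"] 3 by simp
  qed simp
 qed
 thus ?thesis by blast
qed

lemma ex_vball_coords: "\<exists>k. \<forall>y\<in>vball m. c1 y \<in> vball k \<and> c2 y \<in> vball k"
proof -
 obtain n where n: "!!x1 x2 m. \<iota> x1 + \<iota> x2 * \<alpha> \<in> vball m ==> \<iota> x1 \<in> vball (m - n) \<and> \<iota> x2 \<in> vball (m - n)" using ex_coords_bound by blast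
 let ?k = "- \<bar>m - n\<bar>"
 have "ram * ?k <= 1 * ?k" using ram(1) by (intro mult_right_mono_neg) auto
 hence "vball (m - n) \<subseteq> (vball (ram * ?k) :: 'e set)" by (intro vball_mono) auto
 hence "c1 y \<in> vball ?k \<and> c2 y \<in> vball ?k" if "y \<in> vball m" for y using n[of "c1 y" "c2 y" m] that coords[of y] iota_vball[of _ ?k] by auto
 thus ?thesis by blast
qed

lemma c1_continuous: "continuous_on UNIV c1"
proof (subst continuous_on_open_vimage[OF open_UNIV], intro allI impI)
 fix U :: "'f set" assume U: "open U"
 obtain n where n: "!!x1 x2 m. \<iota> x1 + \<iota> x2 * \<alpha> \<in> vball m ==> \<iota> x1 \<in> vball (m - n) \<and> \<iota> x2 \<in> vball (m - n)" using ex_coords_bound by blast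
 have "open (c1 -` U)" unfolding open_iff_vball
 proof
  fix y assume "y \<in> c1 -` U"
  then obtain k where k: "!!x. x - c1 y \<in> vball k ==> x \<in> U" using U unfolding open_iff_vball by blast
  have "z \<in> c1 -` U" if z: "z - y \<in> vball (n + ram * k)" for z
  proof -
   have "\<iota> (c1 (z - y)) \<in> vball (ram * k)" using n[of "c1 (z - y)" "c2 (z - y)" "n + ram * k"] z coords[of "z - y"] by simp
   hence "c1 (z - y) \<in> vball k" by (simp only: iota_vball)
   moreover have "c1 (z - y) + c1 y = c1 z" using c1_add[of "z - y" y] by simp
   ultimately show ?thesis using k[of "c1 z"] by (simp add: eq_diff_eq[symmetric])
  qed
  thus "\<exists>m. \<forall>z. z - y \<in> vball m --> z \<in> c1 -` U" by blast
 qed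
 thus "open (c1 -` U \<inter> UNIV)" by simp
qed

lemma c1_measurable [measurable]: "c1 \<in> bm" by (rule borel_measurable_continuous_onI[OF c1_continuous])

section \<open>Haar measure and absolute value of the extension\<close>

lemma haar_E: "haar E = distr (F.\<mu> \<Otimes>\<^sub>M F.\<mu>) borel fc" by (simp add: extension_data_def fc_def)

lemma nn_integral_E:
 assumes [measurable]: "f \<in> bm"
 shows "(\<integral>\<^sup>+y. f y \<partial>haar E) = (\<integral>\<^sup>+x1. \<integral>\<^sup>+x2. f (\<iota> x1 + \<iota> x2 * \<alpha>) \<partial>F.\<mu> \<partial>F.\<mu>)"
proof -
 have "(\<integral>\<^sup>+y. f y \<partial>haar E) = (\<integral>\<^sup>+p. f (fc p) \<partial>(F.\<mu> \<Otimes>\<^sub>M F.\<mu>))" unfolding haar_E by (rule nn_integral_distr) measurable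
 also have "... = (\<integral>\<^sup>+x1. \<integral>\<^sup>+x2. f (fc (x1, x2)) \<partial>F.\<mu> \<partial>F.\<mu>)" by (rule F.haar.nn_integral_fst[symmetric]) measurable
 finally show ?thesis by (simp only: fc_eq)
qed

lemma iota_measurable [measurable]: "\<iota> \<in> bm" by (rule borel_measurable_continuous_onI[OF iota_continuous])

text \<open>A translation acts in each coordinate separately. Finiteness on compact sets uses
  bounded coordinates, positivity on open sets the continuity of \<open>fc\<close>.\<close>

lemma haar_measure_E: "haar_measure (haar E)" unfolding haar_measure_def
proof (intro conjI allI impI ballI)
 show "sets (haar E) = sets borel" by (simp add: haar_E)
 fix a :: 'e and A :: "'e set" assume A: "A \<in> sets borel"
 have [measurable]: "A \<in> sets borel" by (rule A)
 have im: "(+) a ` A = {y. y - a \<in> A}" by (force simp: image_iff)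
 have sm: "(+) a ` A \<in> sets borel" unfolding im by measurable
 have e: "emeasure (haar E) B = (\<integral>\<^sup>+x1. \<integral>\<^sup>+x2. indicator B (\<iota> x1 + \<iota> x2 * \<alpha>) \<partial>F.\<mu> \<partial>F.\<mu>)" if "B \<in> sets borel" for B
  using nn_integral_E[of "indicator B"] that by (simp add: haar_E)
 have "emeasure (haar E) ((+) a ` A)
  = (\<integral>\<^sup>+x1. \<integral>\<^sup>+x2. indicator A (\<iota> (- c1 a + x1) + \<iota> (- c2 a + x2) * \<alpha>) \<partial>F.\<mu> \<partial>F.\<mu>)" unfolding e[OF sm]
 proof (intro nn_integral_cong)
  fix x1 x2
  have "\<iota> x1 + \<iota> x2 * \<alpha> - a = \<iota> (- c1 a + x1) + \<iota> (- c2 a + x2) * \<alpha>" by (subst coords[of a]) (simp add: algebra_simps)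
  thus "indicator ((+) a ` A) (\<iota> x1 + \<iota> x2 * \<alpha>) = (indicator A (\<iota> (- c1 a + x1) + \<iota> (- c2 a + x2) * \<alpha>) :: ennreal)"
   unfolding im by (simp only: indicator_def mem_Collect_eq)
 qed
 also have "... = (\<integral>\<^sup>+x1. \<integral>\<^sup>+x2. indicator A (\<iota> (- c1 a + x1) + \<iota> x2 * \<alpha>) \<partial>F.\<mu> \<partial>F.\<mu>)"
  by (intro nn_integral_cong F.nn_integral_translate[where f = "%x2. indicator A (\<iota> (- c1 a + _) + \<iota> x2 * \<alpha>)"]) measurable
 also have "... = (\<integral>\<^sup>+x1. \<integral>\<^sup>+x2. indicator A (\<iota> x1 + \<iota> x2 * \<alpha>) \<partial>F.\<mu> \<partial>F.\<mu>)"
  by (rule F.nn_integral_translate[where f = "%x1. \<integral>\<^sup>+x2. indicator A (\<iota> x1 + \<iota> x2 * \<alpha>) \<partial>F.\<mu>"]) measurable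
 finally show "emeasure (haar E) ((+) a ` A) = emeasure (haar E) A" unfolding e[OF A] .
next
 have e: "emeasure (haar E) B = emeasure (F.\<mu> \<Otimes>\<^sub>M F.\<mu>) (fc -` B)" if "B \<in> sets borel" for B
  unfolding haar_E by (subst emeasure_distr) (use that in \<open>simp_all add: space_pair_measure\<close>)
 fix C :: "'e set" assume C: "compact C"
 then obtain m where m: "C \<subseteq> vball m" using compact_subset_vball by blast
 obtain k where k: "\<forall>y\<in>vball m. c1 y \<in> vball k \<and> c2 y \<in> vball k" using ex_vball_coords by blast
 have "fc -` C \<subseteq> vball k \<times> vball k"
 proof
  fix p assume p: "p \<in> fc -` C"
  hence "c1 (fc p) \<in> vball k \<and> c2 (fc p) \<in> vball k" using k m by blast
  thus "p \<in> vball k \<times> vball k" unfolding fc_eq' c_fc by (simp add: mem_Times_iff)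
 qed
 moreover have vb: "vball k \<in> sets F.\<mu>" by (simp add: borel_open open_vball)
 ultimately have "emeasure (F.\<mu> \<Otimes>\<^sub>M F.\<mu>) (fc -` C) <= emeasure (F.\<mu> \<Otimes>\<^sub>M F.\<mu>) (vball k \<times> vball k)" by (intro emeasure_mono) auto
 also have "... = emeasure F.\<mu> (vball k) * emeasure F.\<mu> (vball k)" by (rule F.haar.emeasure_pair_measure_Times[OF vb vb])
 also have "... < \<infinity>" using haar_vball_finite[OF F.haar, of k] by (simp add: ennreal_mult_less_top)
 finally show "emeasure (haar E) C < \<infinity>" using e compact_imp_closed[OF C] by simp
next
 have e: "emeasure (haar E) B = emeasure (F.\<mu> \<Otimes>\<^sub>M F.\<mu>) (fc -` B)" if "B \<in> sets borel" for B
  unfolding haar_E by (subst emeasure_distr) (use that in \<open>simp_all add: space_pair_measure\<close>)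
 fix V :: "'e set" assume V: "open V \<and> V ~= {}"
 then obtain y where y: "y \<in> V" by blast
 have op: "open (fc -` V)" using V by (intro open_vimage fc_continuous) auto
 have "(c1 y, c2 y) \<in> fc -` V" using y coords[of y] by (simp add: fc_eq)
 then obtain A B where AB: "open A" "open B" "c1 y \<in> A" "c2 y \<in> B" "A \<times> B \<subseteq> fc -` V" using op by (auto elim!: open_prod_elim)
 have "0 < emeasure F.\<mu> A * emeasure F.\<mu> B" using F.haar AB by (auto simp: haar_measure_def ennreal_zero_less_mult_iff)
 also have "... = emeasure (F.\<mu> \<Otimes>\<^sub>M F.\<mu>) (A \<times> B)" using AB by (intro F.haar.emeasure_pair_measure_Times[symmetric]) auto
 also have "... <= emeasure (F.\<mu> \<Otimes>\<^sub>M F.\<mu>) (fc -` V)"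
 proof (rule emeasure_mono[OF AB(5)])
  have "fc -` V \<inter> space (borel \<Otimes>\<^sub>M borel) \<in> sets (borel \<Otimes>\<^sub>M borel)" by (rule measurable_sets[OF fc_measurable]) (use V in auto)
  hence "fc -` V \<in> sets (borel \<Otimes>\<^sub>M borel)" by (simp add: space_pair_measure)
  moreover have "sets (F.\<mu> \<Otimes>\<^sub>M F.\<mu>) = sets (borel \<Otimes>\<^sub>M borel)" by (intro sets_pair_measure_cong) simp_all
  ultimately show "fc -` V \<in> sets (F.\<mu> \<Otimes>\<^sub>M F.\<mu>)" by simp
 qed
 finally show "emeasure (haar E) V > 0" using e V by simp
qed

lemma addchar_E: "addchar E y = F.\<psi> (c1 y)" by (simp add: extension_data_def c1_def fc_def)

lemma field_data_E: "field_data E" unfolding field_data_def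
proof (intro conjI haar_measure_E)
 show "additive_character (addchar E)" unfolding additive_character_def addchar_E[abs_def]
  by (auto simp: c1_add F.psi_add intro!: continuous_on_compose2[OF F.psi_continuous] c1_continuous)
 obtain x where "F.\<psi> x ~= 1" using F by (auto simp: field_data_def)
 hence "addchar E (\<iota> x + \<iota> 0 * \<alpha>) ~= 1" unfolding addchar_E c_fc .
 thus "\<exists>y. addchar E y ~= 1" by blast
 show "uniformizer (unif E)" using \<pi> by (simp add: extension_data_def)
qed

sublocale E: local_field_data E by standard (rule field_data_E)

text \<open>The integral of the indicator of the unit ball is rescaled once over the extension and
  once in each coordinate. The remaining integral is finite and nonzero, so the factors
  agree.\<close>

lemma absval_iota: "absval (\<iota> a) = (absval a)\<^sup>2"
proof (cases "a = 0")
 case False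
 hence a: "a ~= 0" "\<iota> a ~= 0" by auto
 let ?f = "%y. indicator (E.cb 0 1) y :: ennreal"
 let ?I = "\<integral>\<^sup>+y. ?f y \<partial>haar E"
 have fin: "0 < ?I" "?I < \<infinity>" using E.emeasure_cb[of 1 0] E.vol_pos by (simp_all add: ennreal_zero_less_one)
 have "?I = ennreal (absval (\<iota> a)) * (\<integral>\<^sup>+y. ?f (\<iota> a * y) \<partial>haar E)" by (rule E.nn_integral_scale[OF a(2), symmetric]) measurable
 also have "(\<integral>\<^sup>+y. ?f (\<iota> a * y) \<partial>haar E) = (\<integral>\<^sup>+x1. \<integral>\<^sup>+x2. ?f (\<iota> (a * x1) + \<iota> (a * x2) * \<alpha>) \<partial>F.\<mu> \<partial>F.\<mu>)"
  by (subst nn_integral_E) (measurable, simp add: distrib_left mult.assoc)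
 finally have 1: "?I = ennreal (absval (\<iota> a)) * (\<integral>\<^sup>+x1. \<integral>\<^sup>+x2. ?f (\<iota> (a * x1) + \<iota> (a * x2) * \<alpha>) \<partial>F.\<mu> \<partial>F.\<mu>)" .
 have "?I = (\<integral>\<^sup>+x1. \<integral>\<^sup>+x2. ?f (\<iota> x1 + \<iota> x2 * \<alpha>) \<partial>F.\<mu> \<partial>F.\<mu>)" by (rule nn_integral_E) measurable
 also have "... = ennreal (absval a) * (\<integral>\<^sup>+x1. \<integral>\<^sup>+x2. ?f (\<iota> (a * x1) + \<iota> x2 * \<alpha>) \<partial>F.\<mu> \<partial>F.\<mu>)"
  by (rule F.nn_integral_scale[OF a(1), where f = "%x1. \<integral>\<^sup>+x2. ?f (\<iota> x1 + \<iota> x2 * \<alpha>) \<partial>F.\<mu>", symmetric]) measurable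
 also have "(\<integral>\<^sup>+x1. \<integral>\<^sup>+x2. ?f (\<iota> (a * x1) + \<iota> x2 * \<alpha>) \<partial>F.\<mu> \<partial>F.\<mu>)
  = (\<integral>\<^sup>+x1. ennreal (absval a) * (\<integral>\<^sup>+x2. ?f (\<iota> (a * x1) + \<iota> (a * x2) * \<alpha>) \<partial>F.\<mu>) \<partial>F.\<mu>)"
  by (intro nn_integral_cong F.nn_integral_scale[OF a(1), where f = "%x2. ?f (\<iota> (a * _) + \<iota> x2 * \<alpha>)", symmetric]) measurable
 also have "... = ennreal (absval a) * (\<integral>\<^sup>+x1. \<integral>\<^sup>+x2. ?f (\<iota> (a * x1) + \<iota> (a * x2) * \<alpha>) \<partial>F.\<mu> \<partial>F.\<mu>)" by (rule nn_integral_cmult) measurable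
 finally have 2: "?I = ennreal ((absval a)\<^sup>2) * (\<integral>\<^sup>+x1. \<integral>\<^sup>+x2. ?f (\<iota> (a * x1) + \<iota> (a * x2) * \<alpha>) \<partial>F.\<mu> \<partial>F.\<mu>)"
  by (simp add: power2_eq_square ennreal_mult' mult.assoc)
 let ?J = "\<integral>\<^sup>+x1. \<integral>\<^sup>+x2. ?f (\<iota> (a * x1) + \<iota> (a * x2) * \<alpha>) \<partial>F.\<mu> \<partial>F.\<mu>"
 have "?J ~= 0" using 1 fin(1) by (metis mult_zero_right less_irrefl)
 moreover have "?J ~= \<infinity>" using 1 fin(2) a(2) by (auto simp: ennreal_mult_eq_top_iff)
 moreover have "?J * ennreal (absval (\<iota> a)) = ?J * ennreal ((absval a)\<^sup>2)" unfolding mult.commute[of ?J] using 1 2 by (rule trans[OF sym])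
 ultimately have "ennreal (absval (\<iota> a)) = ennreal ((absval a)\<^sup>2)" unfolding ennreal_mult_cancel_left by simp
 thus ?thesis by (simp add: ennreal_inj)
qed simp

lemma ex_absval_coords_bound: "\<exists>C>0. \<forall>x1 x2. (absval x1)\<^sup>2 <= C * absval (\<iota> x1 + \<iota> x2 * \<alpha>) \<and> (absval x2)\<^sup>2 <= C * absval (\<iota> x1 + \<iota> x2 * \<alpha>)"
proof -
 obtain n where n: "!!x1 x2 m. \<iota> x1 + \<iota> x2 * \<alpha> \<in> vball m ==> \<iota> x1 \<in> vball (m - n) \<and> \<iota> x2 \<in> vball (m - n)" using ex_coords_bound by blast
 obtain z :: 'e where z: "z ~= 0" "val z = - n" using ex_val by blast
 have "(absval x1)\<^sup>2 <= absval z * absval y \<and> (absval x2)\<^sup>2 <= absval z * absval y"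
  if y: "y = \<iota> x1 + \<iota> x2 * \<alpha>" for x1 x2 y
 proof (cases "y = 0")
  case True
  thus ?thesis using fc_0_iff[of x1 x2] y by simp
 next
  case False
  hence "\<iota> x1 \<in> vball (val y - n) \<and> \<iota> x2 \<in> vball (val y - n)" using n[of x1 x2 "val y"] y by (simp add: vball_def)
  moreover have "val (z * y) = val y - n" using z False by (simp add: val_mult)
  ultimately have "absval (\<iota> x1) <= absval (z * y) \<and> absval (\<iota> x2) <= absval (z * y)" using E.absval_le_iff[of "z * y"] z False by simp
  thus ?thesis unfolding absval_iota E.absval_mult .
 qed
 moreover have "0 < absval z" using z by simp
 ultimately show ?thesis by blast
qed

lemma Cc_comp_iota: assumes \<phi>: "\<phi> \<in> Cc" shows "\<phi> \<circ> \<iota> \<in> Cc"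
proof -
 obtain A B :: 'e where A: "A ~= 0" "B ~= 0" "!!x. absval x > absval A ==> \<phi> x = 0"
  "!!x y. absval y <= absval B ==> \<phi> (x + y) = \<phi> x" using \<phi> by (rule E.CcE) (rule that; assumption)
 obtain a :: 'f where a: "a ~= 0" "max 1 (absval A) < absval a" using F.ex_absval_gt by blast
 obtain b :: 'f where b: "b ~= 0" "absval b < min 1 (absval B)" using F.ex_absval_less[of "min 1 (absval B)"] A(2) by auto
 have "\<phi> (\<iota> x) = 0" if x: "absval x > absval a" for x
 proof (rule A(3))
  have "absval A < absval x" "1 < absval x" using a x by auto
  moreover from this have "absval x * 1 <= absval x * absval x" by (intro mult_left_mono) auto
  ultimately show "absval (\<iota> x) > absval A" unfolding absval_iota power2_eq_square by linarith
 qed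
 moreover have "\<phi> (\<iota> (x + y)) = \<phi> (\<iota> x)" if y: "absval y <= absval b" for x y
 proof -
  have "absval y * absval y <= absval B * 1" using y b by (intro mult_mono) auto
  thus ?thesis unfolding iota_add by (intro A(4)) (simp add: absval_iota power2_eq_square)
 qed
 ultimately show ?thesis unfolding F.Cc_iff comp_def using a(1) b(1) by blast
qed

section \<open>Matrices and PGL(2) under the field embedding\<close>

definition mmap :: "'f^2^2 => 'e^2^2" where "mmap A = (\<chi> i j. \<iota> (A $ i $ j))"

lemma mmap_mt [simp]: "mmap (mt a b c d) = mt (\<iota> a) (\<iota> b) (\<iota> c) (\<iota> d)" by (simp add: mmap_def vec_eq_iff forall_2)

lemma mmap_mult: "mmap (A ** B) = mmap A ** mmap B" by (cases A rule: mt_cases; cases B rule: mt_cases) simp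

lemma det_mmap [simp]: "det (mmap A) = \<iota> (det A)" by (cases A rule: mt_cases) simp

lemma mmap_mat [simp]: "mmap (mat c) = mat (\<iota> c)" by (simp add: mat_mt)

lemma continuous_on_mmap: "continuous_on UNIV mmap"
 unfolding mmap_def by (intro continuous_intros continuous_on_compose2[OF iota_continuous]) auto

text \<open>The image of a class is only stable under scalars of the smaller field; the product with
  all scalars in \<open>pgl_map\<close> completes it to a class.\<close>

lemma pgl_map_class: "pgl_map \<iota> (pgl_class A) = pgl_class (mmap A)"
proof (rule Set.set_eqI)
 fix B
 have "B \<in> pgl_map \<iota> (pgl_class A) \<longleftrightarrow> (\<exists>S\<in>scalar_matrices. \<exists>A'\<in>pgl_class A. B = S ** mmap A')"
  unfolding pgl_map_def set_mult_def mmap_def GL2_simps by blast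
 also have "... \<longleftrightarrow> (\<exists>c d. c ~= 0 \<and> d ~= 0 \<and> B = mat c ** mmap (mat d ** A))"
  unfolding scalar_matrices_def Bex_def mem_pgl_class mem_Collect_eq by blast
 also have "... \<longleftrightarrow> (\<exists>c d. c ~= 0 \<and> d ~= 0 \<and> B = mat (c * \<iota> d) ** mmap A)" by (simp add: mmap_mult matrix_mul_assoc mat_mult_mat)
 also have "... \<longleftrightarrow> B \<in> pgl_class (mmap A)"
 proof
  assume "\<exists>c d. c ~= 0 \<and> d ~= 0 \<and> B = mat (c * \<iota> d) ** mmap A"
  then obtain c d where "c ~= 0" "d ~= 0" "B = mat (c * \<iota> d) ** mmap A" by blast
  thus "B \<in> pgl_class (mmap A)" unfolding mem_pgl_class by (intro exI[of _ "c * \<iota> d"]) simp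
 next
  assume "B \<in> pgl_class (mmap A)"
  then obtain c where "c ~= 0" "B = mat c ** mmap A" unfolding mem_pgl_class by blast
  thus "\<exists>c d. c ~= 0 \<and> d ~= 0 \<and> B = mat (c * \<iota> d) ** mmap A" by (intro exI[of _ c] exI[of _ 1]) simp
 qed
 finally show "B \<in> pgl_map \<iota> (pgl_class A) \<longleftrightarrow> B \<in> pgl_class (mmap A)" .
qed

lemma pgl_map_in: "g \<in> carrier PGL2 ==> pgl_map \<iota> g \<in> carrier PGL2" by (erule PGL2_cases) (simp add: pgl_map_class)

lemma pgl_map_one: "pgl_map \<iota> \<one>\<^bsub>PGL2\<^esub> = \<one>\<^bsub>PGL2\<^esub>" by (simp add: pgl_one pgl_map_class)

lemma pgl_map_mult:
 assumes "g \<in> carrier PGL2" "h \<in> carrier PGL2"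
 shows "pgl_map \<iota> (g \<otimes>\<^bsub>PGL2\<^esub> h) = pgl_map \<iota> g \<otimes>\<^bsub>PGL2\<^esub> pgl_map \<iota> h"
proof -
 obtain A where A: "det A ~= 0" "g = pgl_class A" using assms(1) by (rule PGL2_cases)
 obtain B where B: "det B ~= 0" "h = pgl_class B" using assms(2) by (rule PGL2_cases)
 show ?thesis using A(1) B(1) by (simp add: A(2) B(2) pgl_map_class pgl_class_mult mmap_mult)
qed

end

section \<open>Restriction of characters and of smooth vectors\<close>

locale character_extension = local_extension \<iota> \<alpha> \<pi> F
 for \<iota> :: "'f::nonarch_local_field => 'e::nonarch_local_field" and \<alpha> \<pi> :: 'e and F :: "'f field_data" +
 fixes chi :: "'e => complex"
 assumes chi: "unit_character chi" and quadratic: "\<forall>u\<in>unit_group. (chi u)\<^sup>2 = 1"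
  and uniformizers: "mult_char E chi 0 (\<iota> (unif F)) = 1"
begin

abbreviation "eta \<equiv> chi \<circ> \<iota>"

sublocale E: quad_char E chi by standard (rule chi, rule quadratic)

lemma iota_unit: "u \<in> unit_group ==> \<iota> u \<in> unit_group" using ram(2) by (auto simp: unit_group_def)

sublocale F: quad_char F eta
proof
 have "continuous_on unit_group eta" unfolding comp_def
  by (rule continuous_on_compose2[OF E.chi_cont continuous_on_subset[OF iota_continuous]]) (auto intro: iota_unit)
 thus "unit_character eta" using E.chi_mult E.chi_norm iota_unit by (simp add: unit_character_def)
 show "\<forall>u\<in>unit_group. (eta u)\<^sup>2 = 1" using quadratic iota_unit by simp
qed

text \<open>On units this is the definition of \<open>eta\<close>; by the compatibility of the
  uniformizers, powers of \<open>unif F\<close> contribute 1.\<close>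

lemma mc0_iota: assumes a: "a ~= 0" shows "E.mc 0 (\<iota> a) = F.mc 0 a"
proof -
 let ?p = "unif F"
 have p: "?p ~= 0" "\<iota> ?p ~= 0" using F.unif by auto
 have pw: "E.mc 0 (\<iota> ?p ^ n) = 1" for n using p uniformizers by (induction n) (simp_all add: E.mc_mult)
 have pi: "E.mc 0 (\<iota> ?p powi n) = 1" for n using p pw by (simp add: power_int_def E.mc_inverse power_inverse)
 have u: "F.un a \<in> unit_group" by (rule F.un_unit[OF a])
 have "\<iota> a = \<iota> ?p powi (val a) * \<iota> (F.un a)" using p by (simp add: F.un_def power_int_minus flip: mult.assoc)
 hence "E.mc 0 (\<iota> a) = E.mc 0 (\<iota> (F.un a))" using p a u by (simp add: E.mc_mult pi unit_group_def)
 also have "... = chi (\<iota> (F.un a))" using iota_unit[OF u] u by (simp add: E.mc_eq E.un_val_0 unit_group_def)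
 finally show ?thesis using a by (simp add: F.mc_eq)
qed

lemma mc_iota: assumes a: "a ~= 0" shows "E.mc (of_real r) (\<iota> a) = F.mc (of_real (2 * r)) a"
proof -
 have "(absval a)\<^sup>2 powr r = absval a powr (2 * r)" using a powr_powr[of "absval a" 2 r] by simp
 moreover have nz: "\<iota> a ~= 0" using a by simp
 ultimately show ?thesis unfolding E.mc_real[OF nz] F.mc_real[OF a] mc0_iota[OF a] absval_iota by simp
qed

text \<open>Since |\<iota> a| = |a|^2, the exponent r + 1/2 of the equivariance becomes 2 r + 1 = (2
  r + 1/2) + 1/2.\<close>

lemma I_smooth_comp_iota:
 assumes f: "f \<in> I_smooth E chi (of_real r)"
 shows "f \<circ> \<iota> \<in> I_smooth F eta (of_real (2 * r + 1/2))"
proof -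
 obtain F0 where F0: "F0 \<in> Ind E chi (of_real r)" "f = nbar_restrict F0" using f by (auto simp: I_smooth_def)
 define G where "G = restrict (%g. F0 (pgl_map \<iota> g)) (carrier PGL2)"
 have lc: "pgl_lc F0" and eqv: "!!A a b. det A ~= 0 ==> a ~= 0 ==>
   F0 (pgl_class (A ** mt a b 0 1)) = inverse (E.mc (of_real r + 1/2) a) * F0 (pgl_class A)" using F0(1) unfolding Ind_iff by auto
 have Gc: "G (pgl_class A) = F0 (pgl_class (mmap A))" if "det A ~= 0" for A using that by (simp add: G_def pgl_map_class)
 have m: "E.mc (of_real r + 1/2) (\<iota> a) = F.mc (of_real (2 * r + 1/2) + 1/2) a" if "a ~= 0" for a
  using mc_iota[OF that, of "r + 1/2"] by (simp add: algebra_simps)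
 have "G \<in> Ind F eta (of_real (2 * r + 1/2))" unfolding Ind_iff
 proof (intro conjI allI impI)
  show "G \<in> extensional (carrier PGL2)" by (simp add: G_def)
  show "pgl_lc G"
  proof (rule pgl_lcI)
   fix A :: "'f^2^2" assume A: "det A ~= 0"
   hence "det (mmap A) ~= 0" by simp
   from pgl_lcD[OF lc this] obtain N where N: "open N" "mmap A \<in> N"
    "\<forall>B\<in>N. det B ~= 0 \<and> F0 (pgl_class B) = F0 (pgl_class (mmap A))" by blast
   have "open (mmap -` N)" by (rule open_vimage[OF N(1) continuous_on_mmap])
   moreover have "G (pgl_class B) = G (pgl_class A)" if "B \<in> mmap -` N" "det B ~= 0" for B
    unfolding Gc[OF that(2)] Gc[OF A] using N(3) that(1) by blast
   ultimately show "\<exists>N. open N \<and> A \<in> N \<and> (\<forall>B\<in>N. det B ~= 0 --> G (pgl_class B) = G (pgl_class A))" using N(2) by blast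
  qed
  fix A :: "'f^2^2" and a b :: 'f assume A: "det A ~= 0" and a: "a ~= 0"
  have d: "det (A ** mt a b 0 1) ~= 0" using A a by (simp add: det_mul)
  have "G (pgl_class (A ** mt a b 0 1)) = F0 (pgl_class (mmap A ** mt (\<iota> a) (\<iota> b) 0 1))"
   unfolding Gc[OF d] by (simp only: mmap_mult mmap_mt iota_0 iota_1)
  also have "... = inverse (F.mc (of_real (2 * r + 1/2) + 1/2) a) * F0 (pgl_class (mmap A))"
   unfolding m[OF a, symmetric] using A a by (intro eqv) simp_all
  finally show "G (pgl_class (A ** mt a b 0 1)) = inverse (F.mc (of_real (2 * r + 1/2) + 1/2) a) * G (pgl_class A)" unfolding Gc[OF A] .
 qed
 moreover have "f \<circ> \<iota> = nbar_restrict G" by (rule ext) (simp add: F0(2) nbar_restrict_def nbar_mt Gc)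
 ultimately show ?thesis by (simp add: I_smooth_def)
qed

end

section \<open>The isometric embedding\<close>

text \<open>A convergent sequence in the image has a Cauchy sequence of preimages, which converges
  because \<open>V\<close> is complete.\<close>

lemma (in hspace) closed_isometric_image:
 assumes V': "hspace V' ip'" and L: "linear_between V V' L"
  and iso: "!!f. f \<in> V ==> inner_norm ip' (L f) = nrm f"
 shows "closed_subspace V' ip' (L ` V)" unfolding closed_subspace_def subspace_of_functions_def
proof (intro conjI allI ballI impI)
 interpret V': hspace V' ip' by (rule V')
 have LV: "L f \<in> V'" if "f \<in> V" for f using L that by (simp add: linear_between_def)
 have add: "L (%x. f x + g x) = (%y. L f y + L g y)" if "f \<in> V" "g \<in> V" for f g using L that unfolding linear_between_def by blast
 have cmult: "L (%x. c * f x) = (%y. c * L f y)" if "f \<in> V" for c f using L that unfolding linear_between_def by blast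
 show "L ` V \<subseteq> V'" using LV by blast
 show "(%x. 0) \<in> L ` V" using cmult[OF zero_mem, of 0] by (intro image_eqI[of _ _ "%x. 0"]) auto
 show "(%x. f x + g x) \<in> L ` V" if fg: "f \<in> L ` V" "g \<in> L ` V" for f g
 proof -
  obtain f' g' where "f' \<in> V" "g' \<in> V" "f = L f'" "g = L g'" using fg by blast
  thus ?thesis using add by (intro image_eqI[of _ _ "%x. f' x + g' x"]) auto
 qed
 show "(%x. c * f x) \<in> L ` V" if f: "f \<in> L ` V" for c f
 proof -
  obtain f' where "f' \<in> V" "f = L f'" using f by blast
  thus ?thesis using cmult by (intro image_eqI[of _ _ "%x. c * f' x"]) auto
 qed
 fix u f assume f: "f \<in> V'" and u: "(\<forall>n::nat. u n \<in> L ` V) \<and> (%n. V'.dst (u n) f) \<longlonglongrightarrow> 0"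
 hence "\<forall>n. \<exists>v. v \<in> V \<and> u n = L v" by blast
 then obtain v where v: "!!n. v n \<in> V" "!!n. u n = L (v n)" by metis
 have lim: "(%n. V'.dst (L (v n)) f) \<longlonglongrightarrow> 0" using u v(2) by simp
 have small: "\<exists>N. \<forall>n\<ge>N. V'.dst (L (v n)) f < e" if "e > 0" for e using LIMSEQ_D[OF lim that] by (auto simp: abs_less_iff)
 have d: "V'.dst (L g) (L h) = dst g h" if "g \<in> V" "h \<in> V" for g h using iso[OF diff_mem[OF that]] linear_diff[OF L that] by simp
 have "\<exists>N. \<forall>m\<ge>N. \<forall>n\<ge>N. dst (v m) (v n) < e" if e: "e > 0" for e
 proof -
  obtain N where N: "!!n. n >= N ==> V'.dst (L (v n)) f < e / 2" using small[of "e / 2"] e by auto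
  have "dst (v m) (v n) < e" if mn: "m >= N" "n >= N" for m n
   using V'.nrm_diff_triangle[OF LV[OF v(1)[of m]] f LV[OF v(1)[of n]]] V'.nrm_diff_commute[OF f LV[OF v(1)[of n]]]
    N[OF mn(1)] N[OF mn(2)] d[OF v(1) v(1), of m n] by linarith
  thus ?thesis by blast
 qed
 from complete_nrm[OF v(1) this] obtain h where h: "h \<in> V" "(%n. dst (v n) h) \<longlonglongrightarrow> 0" by blast
 have "f = L h"
 proof (rule V'.eq_if_small[OF f LV[OF h(1)]])
  fix e :: real assume e: "e > 0"
  obtain N where N: "!!n. n >= N ==> V'.dst (L (v n)) f < e / 2" using small[of "e / 2"] e by auto
  have "\<exists>M. \<forall>n\<ge>M. dst (v n) h < r" if "r > 0" for r using LIMSEQ_D[OF h(2) that] by (auto simp: abs_less_iff)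
  from this[of "e / 2"] obtain M where M: "!!n. n >= M ==> dst (v n) h < e / 2" using e by auto
  let ?n = "max N M"
  show "V'.dst f (L h) <= e" using V'.nrm_diff_triangle[OF f LV[OF v(1)[of ?n]] LV[OF h(1)]] V'.nrm_diff_commute[OF f LV[OF v(1)[of ?n]]]
    N[of ?n] M[of ?n] d[OF v(1) h(1), of ?n] by simp
 qed
 thus "f \<in> L ` V" using h(1) by blast
qed

text \<open>Functions equal almost everywhere have the same Fourier transform at every point, and
  inversion recovers a test function pointwise.\<close>

lemma (in local_field_data) Cc_eqI_AE:
 assumes "\<phi> \<in> Cc" "\<theta> \<in> Cc" "AE x in \<mu>. \<phi> x = \<theta> x" shows "\<phi> = \<theta>"
proof -
 have "FT \<phi> x = FT \<theta> x" for x unfolding fourier_eq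
 proof (rule integral_cong_AE)
  show "AE y in \<mu>. \<psi> (x * y) * \<phi> y = \<psi> (x * y) * \<theta> y" using assms(3) by eventually_elim simp
 qed (use assms Cc_measurable in auto)
 hence "Finv \<phi> = Finv \<theta>" by (simp add: Finv_def)
 thus ?thesis using fourier_Finv[OF assms(1)] fourier_Finv[OF assms(2)] by metis
qed

context quad_char
begin

text \<open>\<open>I_dual\<close> is formed with the conjugate character; a quadratic character
  takes real values on units.\<close>

lemma I_smooth_cnj: "I_smooth K (%x. cnj (chi x)) \<sigma> = I_smooth K chi \<sigma>"
proof -
 have m: "mult_char K (%x. cnj (chi x)) \<sigma> a = mc \<sigma> a" if "a ~= 0" for a \<sigma>
  using chi_cases[OF un_unit[OF that]] by (auto simp: mult_char_def un_def)
 have "F \<in> Ind K (%x. cnj (chi x)) \<sigma> \<longleftrightarrow> F \<in> Ind K chi \<sigma>" for F unfolding Ind_iff using m by metis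
 thus ?thesis unfolding I_smooth_def by (metis (no_types) Set.set_eqI)
qed

lemma I_dual_eq: "I_dual K chi (of_real r) = algebraic_dual (I_smooth K chi (of_real (- r)))" by (simp add: I_dual_def I_smooth_cnj)

end

context srep
begin

lemma complementary_action_eq: "s < 1/2 ==> complementary_action K chi s = U"
 using completed_action_eq by (simp add: complementary_action_def X_def)

lemma steinberg_action_eq: assumes "s = 1/2" shows "steinberg_action K chi = U"
proof -
 have r: "complex_of_real s = 1/2" by (subst assms) simp
 have "\<not> s < 1/2" using assms by simp
 hence X0: "X = I_smooth0 K chi" unfolding X_def I_smooth0_def r by simp
 have "steinberg_action K chi = completed_action K s X act" unfolding steinberg_action_def X0 r by (simp only: assms)
 thus ?thesis unfolding completed_action_eq .
qed

end

section \<open>Norm of the embedding on the Fourier side\<close>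

locale rep_extension = character_extension \<iota> \<alpha> \<pi> F chi
 for \<iota> :: "'f::nonarch_local_field => 'e::nonarch_local_field" and \<alpha> \<pi> :: 'e and F :: "'f field_data" and chi +
 fixes s t :: real
 assumes s: "1/4 < s" "s <= 1/2" and t: "t = 2 * s - 1/2"
begin

sublocale E: srep E s chi by unfold_locales (use s in auto)
sublocale F: srep F t eta by unfold_locales (use s t in auto)

definition "N u = absval (1 + \<iota> u * \<alpha>)"
text \<open>The square of the scaling factor of the embedding.\<close>

definition "c0 = (\<integral>\<^sup>+u. ennreal (N u powr (- 2 * s)) \<partial>haar F)"

lemma N_pos: "0 < N u" using fc_0_iff[of 1 u] by (simp add: N_def)

lemma N_measurable [measurable]: "N \<in> bm" unfolding N_def by measurable

text \<open>The coordinate bound gives both 1 <= C N(u) and |u|^2 <= C N(u). So the integrand is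
  bounded on the unit ball and at most a multiple of |u|^(- 4 s) outside it, where 4 s > 1.\<close>

lemma c0_finite: "c0 < \<infinity>"
proof -
 obtain C where C: "0 < C" "!!x1 x2. (absval x1)\<^sup>2 <= C * absval (\<iota> x1 + \<iota> x2 * \<alpha>) \<and> (absval x2)\<^sup>2 <= C * absval (\<iota> x1 + \<iota> x2 * \<alpha>)"
  using ex_absval_coords_bound by blast
 have n: "1 <= C * N u" "(absval u)\<^sup>2 <= C * N u" for u using C(2)[of 1 u] by (simp_all add: N_def)
 let ?k = "C powr (2 * s)"
 have b: "N u powr (- 2 * s) <= ?k * (r powr (- 2 * s))" if "0 < r" "r <= C * N u" for r u
 proof -
  have "(C * N u) powr (- 2 * s) <= r powr (- 2 * s)" using that s by (intro powr_mono2') auto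
  hence "?k * ((C * N u) powr (- 2 * s)) <= ?k * r powr (- 2 * s)" by (rule mult_left_mono) simp
  moreover have "?k * ((C * N u) powr (- 2 * s)) = N u powr (- 2 * s)"
   using C(1) N_pos[of u] by (simp add: powr_mult powr_minus field_simps)
  ultimately show ?thesis by simp
 qed
 have "c0 <= (\<integral>\<^sup>+u. ennreal ?k * indicator (F.cb 0 1) u
   + ennreal ?k * (ennreal (absval u powr (- 4 * s)) * indicator {u. absval (1::'f) <= absval u} u) \<partial>haar F)" unfolding c0_def
 proof (intro nn_integral_mono)
  fix u
  show "ennreal (N u powr (- 2 * s)) <= ennreal ?k * indicator (F.cb 0 1) u
   + ennreal ?k * (ennreal (absval u powr (- 4 * s)) * indicator {u. absval (1::'f) <= absval u} u)"
  proof (cases "u \<in> F.cb 0 1")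
   case True
   have "N u powr (- 2 * s) <= ?k" using b[of 1 u] n by simp
   hence "ennreal (N u powr (- 2 * s)) <= ennreal ?k * indicator (F.cb 0 1) u" using True by (simp add: ennreal_leI)
   thus ?thesis by (rule order_trans) simp
  next
   case False
   hence u: "1 < absval u" by (simp add: F.cb_def)
   have "0 < (absval u)\<^sup>2" using u by (intro zero_less_power) linarith
   hence "N u powr (- 2 * s) <= ?k * ((absval u)\<^sup>2 powr (- 2 * s))" by (rule b) (rule n)
   also have "(absval u)\<^sup>2 powr (- 2 * s) = absval u powr (- 4 * s)" using u powr_powr[of "absval u" 2 "- 2 * s"] by simp
   finally have "ennreal (N u powr (- 2 * s)) <= ennreal ?k * (ennreal (absval u powr (- 4 * s)) * indicator {u. absval (1::'f) <= absval u} u)"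
    using u by (simp add: ennreal_mult'[symmetric] ennreal_leI)
   thus ?thesis by (rule order_trans) simp
  qed
 qed
 also have "... = ennreal ?k * (\<integral>\<^sup>+u. indicator (F.cb 0 1) u \<partial>haar F)
   + ennreal ?k * (\<integral>\<^sup>+u. ennreal (absval u powr (- 4 * s)) * indicator {u. absval (1::'f) <= absval u} u \<partial>haar F)"
  by (subst nn_integral_add, measurable) (subst nn_integral_cmult, measurable, subst nn_integral_cmult, measurable)
 also have "... < \<infinity>" using F.nn_integral_powr_far[of "- 4 * s" 1] s F.emeasure_cb[of 1 0] by (simp add: ennreal_mult_less_top)
 finally show ?thesis .
qed

lemma c0_pos: "0 < c0"
proof (rule ccontr)
 assume "\<not> 0 < c0"
 hence "c0 = 0" by (simp add: not_gr_zero)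
 hence "AE u in haar F. ennreal (N u powr (- 2 * s)) = 0" unfolding c0_def by (subst (asm) nn_integral_0_iff_AE) auto
 hence "AE u in haar F. u \<notin> F.cb 0 1" by eventually_elim (use N_pos in \<open>auto simp: less_imp_neq[symmetric]\<close>)
 hence "emeasure (haar F) (F.cb 0 1) = 0" by (subst (asm) AE_iff_measurable[of "F.cb 0 1"]) auto
 thus False using F.emeasure_cb[of 1 0] F.vol_pos by simp
qed

definition "c = sqrt (enn2real c0)"

lemma c_pos: "0 < c" and c0_eq: "c0 = ennreal (c\<^sup>2)" using c0_pos c0_finite by (simp_all add: c_def enn2real_positive_iff)

lemma nn_integral_weight:
 assumes [measurable]: "g \<in> bm"
 shows "(\<integral>\<^sup>+y. ennreal ((norm (g (c1 y)))\<^sup>2 * E.w y) \<partial>haar E)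
  = c0 * (\<integral>\<^sup>+x. ennreal ((norm (g x :: complex))\<^sup>2 * F.w x) \<partial>haar F)"
proof -
 have "(\<integral>\<^sup>+y. ennreal ((norm (g (c1 y)))\<^sup>2 * E.w y) \<partial>haar E)
  = (\<integral>\<^sup>+x1. \<integral>\<^sup>+x2. ennreal ((norm (g x1))\<^sup>2 * E.w (\<iota> x1 + \<iota> x2 * \<alpha>)) \<partial>haar F \<partial>haar F)"
 proof -
  have m: "(%y. ennreal ((norm (g (c1 y)))\<^sup>2 * E.w y)) \<in> bm" by measurable
  show ?thesis unfolding nn_integral_E[OF m] c_fc ..
 qed
 also have "... = (\<integral>\<^sup>+x1. ennreal ((norm (g x1))\<^sup>2 * F.w x1) * c0 \<partial>haar F)"
 proof (rule nn_integral_cong_AE)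
  show "AE x1 in haar F. (\<integral>\<^sup>+x2. ennreal ((norm (g x1))\<^sup>2 * E.w (\<iota> x1 + \<iota> x2 * \<alpha>)) \<partial>haar F)
   = ennreal ((norm (g x1))\<^sup>2 * F.w x1) * c0" using F.AE_neq[of 0]
  proof eventually_elim
   case (elim x)
   have "(\<integral>\<^sup>+x2. ennreal ((norm (g x))\<^sup>2 * E.w (\<iota> x + \<iota> x2 * \<alpha>)) \<partial>haar F)
    = ennreal (absval x) * (\<integral>\<^sup>+u. ennreal ((norm (g x))\<^sup>2 * E.w (\<iota> x + \<iota> (x * u) * \<alpha>)) \<partial>haar F)"
    by (rule F.nn_integral_scale[OF elim, where f = "%x2. ennreal ((norm (g x))\<^sup>2 * E.w (\<iota> x + \<iota> x2 * \<alpha>))", symmetric]) measurable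
   also have "(\<integral>\<^sup>+u. ennreal ((norm (g x))\<^sup>2 * E.w (\<iota> x + \<iota> (x * u) * \<alpha>)) \<partial>haar F)
    = (\<integral>\<^sup>+u. ennreal ((norm (g x))\<^sup>2 * absval x powr (- 4 * s)) * ennreal (N u powr (- 2 * s)) \<partial>haar F)"
   proof (intro nn_integral_cong)
    fix u
    have "\<iota> x + \<iota> (x * u) * \<alpha> = \<iota> x * (1 + \<iota> u * \<alpha>)" by (simp add: distrib_left mult.assoc)
    hence "absval (\<iota> x + \<iota> (x * u) * \<alpha>) = (absval x)\<^sup>2 * N u" by (simp only: E.absval_mult absval_iota N_def)
    moreover have "(absval x)\<^sup>2 powr (- 2 * s) = absval x powr (- 4 * s)" using elim powr_powr[of "absval x" 2 "- 2 * s"] by simp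
    ultimately have "E.w (\<iota> x + \<iota> (x * u) * \<alpha>) = absval x powr (- 4 * s) * N u powr (- 2 * s)" using N_pos[of u] by (simp only: powr_mult)
    thus "ennreal ((norm (g x))\<^sup>2 * E.w (\<iota> x + \<iota> (x * u) * \<alpha>))
     = ennreal ((norm (g x))\<^sup>2 * absval x powr (- 4 * s)) * ennreal (N u powr (- 2 * s))"
     by (simp only: ennreal_mult'[symmetric, of "N u powr (- 2 * s)"] ennreal_mult''[symmetric] powr_ge_zero mult.assoc)
   qed
   also have "... = ennreal ((norm (g x))\<^sup>2 * absval x powr (- 4 * s)) * c0" unfolding c0_def by (rule nn_integral_cmult) measurable
   also have "ennreal (absval x) * ... = ennreal (absval x * ((norm (g x))\<^sup>2 * absval x powr (- 4 * s))) * c0"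
    by (simp add: ennreal_mult' mult.assoc)
   \<comment> \<open>The exponent 1 - 4 s equals - 2 t; this is where the relation between
     \<open>s\<close> and \<open>t\<close> comes from.\<close>
   also have "absval x * ((norm (g x))\<^sup>2 * absval x powr (- 4 * s)) = (norm (g x))\<^sup>2 * F.w x"
    using elim powr_add[of "absval x" 1 "- 4 * s"] by (simp add: t algebra_simps)
   finally show ?case .
  qed
 qed
 also have "... = c0 * (\<integral>\<^sup>+x. ennreal ((norm (g x))\<^sup>2 * F.w x) \<partial>haar F)" by (subst nn_integral_multc) (measurable, simp add: mult.commute)
 finally show ?thesis .
qed

lemma c1_Lw:
 assumes g: "g \<in> F.Lw"
 shows "(%y. g (c1 y)) \<in> E.Lw" and "E.nrm (E.Dst (%y. g (c1 y))) = c * F.nrm (F.Dst g)"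
proof -
 have [measurable]: "g \<in> bm" by (rule F.Lw_meas[OF g])
 have eq: "(\<integral>\<^sup>+y. ennreal ((norm (g (c1 y)))\<^sup>2 * E.w y) \<partial>haar E) = ennreal ((c * F.nrm (F.Dst g))\<^sup>2)"
  unfolding nn_integral_weight[OF \<open>g \<in> bm\<close>] F.nn_norm_Dst[OF g] c0_eq
  by (simp add: ennreal_mult' power_mult_distrib)
 have "integrable (haar E) (%y. (norm (g (c1 y)))\<^sup>2 * E.w y)" by (intro integrableI_bounded) (use eq in simp_all)
 thus L: "(%y. g (c1 y)) \<in> E.Lw" by (simp add: E.Lw_def)
 have "(E.nrm (E.Dst (%y. g (c1 y))))\<^sup>2 = (c * F.nrm (F.Dst g))\<^sup>2" using eq E.nn_norm_Dst[OF L] by (simp add: ennreal_inj)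
 thus "E.nrm (E.Dst (%y. g (c1 y))) = c * F.nrm (F.Dst g)"
  using E.hilb_norm_Dst(2)[OF L] F.hilb_norm_Dst(2)[OF g] c_pos by (simp add: power2_eq_iff_nonneg)
qed

section \<open>The tensor product with the Dirac distribution\<close>

definition "tens T = (%\<phi>. if \<phi> \<in> Cc then T (\<phi> \<circ> \<iota>) else 0)"

lemma integral_E:
 fixes f :: "'e => complex"
 assumes f: "integrable (haar E) f"
 shows "(\<integral>y. f y \<partial>haar E) = (\<integral>x1. \<integral>x2. f (\<iota> x1 + \<iota> x2 * \<alpha>) \<partial>haar F \<partial>haar F)"
proof -
 have m: "fc \<in> F.\<mu> \<Otimes>\<^sub>M F.\<mu> \<rightarrow>\<^sub>M borel" by measurable
 have [measurable]: "f \<in> bm" using f by (auto dest: borel_measurable_integrable)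
 have "integrable (F.\<mu> \<Otimes>\<^sub>M F.\<mu>) (%p. f (fc p))" using f unfolding haar_E by (subst (asm) integrable_distr_eq[OF m]) auto
 from F.haar2.integral_fst'[OF this] have "(\<integral>x1. \<integral>x2. f (fc (x1, x2)) \<partial>haar F \<partial>haar F) = (\<integral>p. f (fc p) \<partial>(F.\<mu> \<Otimes>\<^sub>M F.\<mu>))" by simp
 also have "... = (\<integral>y. f y \<partial>haar E)" unfolding haar_E by (rule integral_distr[OF m, symmetric]) measurable
 finally show ?thesis by (simp only: fc_eq)
qed

lemma fiber_Cc:
 assumes \<phi>: "\<phi> \<in> Cc"
 shows "(%x1. \<integral>x2. \<phi> (\<iota> x1 + \<iota> x2 * \<alpha>) \<partial>haar F) \<in> Cc"
proof -
 obtain A B :: 'e where A: "A ~= 0" "B ~= 0" "!!x. absval x > absval A ==> \<phi> x = 0"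
  "!!x y. absval y <= absval B ==> \<phi> (x + y) = \<phi> x" using \<phi> by (rule E.CcE) (rule that; assumption)
 obtain C where C: "0 < C" "!!x1 x2. (absval x1)\<^sup>2 <= C * absval (\<iota> x1 + \<iota> x2 * \<alpha>) \<and> (absval x2)\<^sup>2 <= C * absval (\<iota> x1 + \<iota> x2 * \<alpha>)"
  using ex_absval_coords_bound by blast
 obtain a :: 'f where a: "a ~= 0" "max 1 (C * absval A) < absval a" using F.ex_absval_gt by blast
 obtain b :: 'f where b: "b ~= 0" "absval b < min 1 (absval B)" using F.ex_absval_less[of "min 1 (absval B)"] A(2) by auto
 have "\<phi> (\<iota> x + \<iota> x2 * \<alpha>) = 0" if x: "absval x > absval a" for x x2
 proof (rule A(3))
  have 1: "C * absval A < absval x" "1 < absval x" using a x by auto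
  hence "absval x * 1 <= absval x * absval x" by (intro mult_left_mono) auto
  hence "C * absval A < C * absval (\<iota> x + \<iota> x2 * \<alpha>)" using 1 C(2)[of x x2] unfolding power2_eq_square by linarith
  thus "absval (\<iota> x + \<iota> x2 * \<alpha>) > absval A" using C(1) by simp
 qed
 moreover have "\<phi> (\<iota> (x + y) + \<iota> x2 * \<alpha>) = \<phi> (\<iota> x + \<iota> x2 * \<alpha>)" if y: "absval y <= absval b" for x y x2
 proof -
  have "absval y * absval y <= absval B * 1" using y b by (intro mult_mono) auto
  hence "\<phi> ((\<iota> x + \<iota> x2 * \<alpha>) + \<iota> y) = \<phi> (\<iota> x + \<iota> x2 * \<alpha>)" by (intro A(4)) (simp add: absval_iota power2_eq_square)
  moreover have "\<iota> (x + y) + \<iota> x2 * \<alpha> = (\<iota> x + \<iota> x2 * \<alpha>) + \<iota> y" by simp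
  ultimately show ?thesis by (simp only:)
 qed
 ultimately show ?thesis unfolding F.Cc_iff by (intro exI[of _ a] exI[of _ b] conjI a b allI impI) simp_all
qed

text \<open>The projection-slice principle: \<open>addchar E\<close> sees only the first coordinate,
  so restricting a transform to the subfield transforms the integral over the fibres.\<close>

lemma fourier_comp_iota:
 assumes \<phi>: "\<phi> \<in> Cc"
 shows "E.FT \<phi> \<circ> \<iota> = F.FT (%x1. \<integral>x2. \<phi> (\<iota> x1 + \<iota> x2 * \<alpha>) \<partial>haar F)"
proof (rule ext)
 fix x
 have "(E.FT \<phi> \<circ> \<iota>) x = (\<integral>y. F.\<psi> (c1 (\<iota> x * y)) * \<phi> y \<partial>haar E)" by (simp only: comp_def E.fourier_eq addchar_E)
 also have "... = (\<integral>x1. \<integral>x2. F.\<psi> (c1 (\<iota> x * (\<iota> x1 + \<iota> x2 * \<alpha>))) * \<phi> (\<iota> x1 + \<iota> x2 * \<alpha>) \<partial>haar F \<partial>haar F)"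
  by (rule integral_E) (use E.integrable_psi_mult'[OF E.Cc_integrable[OF \<phi>], of "\<iota> x"] in \<open>simp only: addchar_E\<close>)
 also have "... = F.FT (%x1. \<integral>x2. \<phi> (\<iota> x1 + \<iota> x2 * \<alpha>) \<partial>haar F) x" unfolding c1_iota_mult c_fc F.fourier_eq by simp
 finally show "(E.FT \<phi> \<circ> \<iota>) x = F.FT (%x1. \<integral>x2. \<phi> (\<iota> x1 + \<iota> x2 * \<alpha>) \<partial>haar F) x" .
qed

lemma comp_iota_linear: "(%x. f x + g x) \<circ> \<iota> = (%x. (f \<circ> \<iota>) x + (g \<circ> \<iota>) x)" "(%x. k * f x) \<circ> \<iota> = (%x. k * (f \<circ> \<iota>) x)"
 by (simp_all add: comp_def)

text \<open>Evaluated at a transform, the left side pairs \<open>g\<close> with a fibre integral by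
  the slice principle, and Fubini reads this as an integral over the extension.\<close>

lemma tens_Dst:
 assumes g: "g \<in> F.Lw" shows "tens (F.Dst g) = E.Dst (%y. g (c1 y))"
proof (rule E.distribution_eq_Dst)
 have H: "F.Dst g \<in> hilb F t" using g unfolding F.hilb_eq by blast
 have "F.Dst g (%x. \<phi> x + 1 * \<theta> x) = F.Dst g \<phi> + 1 * F.Dst g \<theta>" if "\<phi> \<in> Cc" "\<theta> \<in> Cc" for \<phi> \<theta> by (rule F.hilb_Cc_linear[OF H that])
 moreover have "F.Dst g (%x. k * \<phi> x) = k * F.Dst g \<phi>" if "\<phi> \<in> Cc" for k \<phi>
  using F.hilb_Cc_linear[OF H F.Cc_zero that, of k] F.hilb_Cc_linear[OF H F.Cc_zero F.Cc_zero, of "-1"] by simp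
 moreover note E.Cc_add E.Cc_cmult Cc_comp_iota
 ultimately show "tens (F.Dst g) \<in> distributions" unfolding distributions_def algebraic_dual_def mem_Collect_eq tens_def
  by (intro conjI allI ballI impI) (simp_all only: if_True if_False comp_iota_linear mult_1)
 fix \<phi> :: "'e => complex" assume \<phi>: "\<phi> \<in> Cc"
 let ?P = "%x1. \<integral>x2. \<phi> (\<iota> x1 + \<iota> x2 * \<alpha>) \<partial>haar F"
 have "tens (F.Dst g) (E.FT \<phi>) = F.Dst g (F.FT ?P)" using E.fourier_Cc[OF \<phi>] fourier_comp_iota[OF \<phi>] by (simp add: tens_def)
 also have "... = (\<integral>x. g x * ?P x \<partial>haar F)" by (rule F.Dst_fourier[OF fiber_Cc[OF \<phi>]])
 also have "... = (\<integral>x1. \<integral>x2. g (c1 (\<iota> x1 + \<iota> x2 * \<alpha>)) * \<phi> (\<iota> x1 + \<iota> x2 * \<alpha>) \<partial>haar F \<partial>haar F)" by simp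
 also have "... = (\<integral>y. g (c1 y) * \<phi> y \<partial>haar E)" by (rule integral_E[OF E.Lw_Cc_integrable[OF c1_Lw(1)[OF g] \<phi>], symmetric])
 finally show "tens (F.Dst g) (E.FT \<phi>) = (\<integral>y. g (c1 y) * \<phi> y \<partial>haar E)" .
qed

lemma tens_hilb:
 assumes T: "T \<in> hilb F t" shows "tens T \<in> hilb E s" and "E.nrm (tens T) = c * F.nrm T"
proof -
 obtain g where g: "g \<in> F.Lw" "T = F.Dst g" using T unfolding F.hilb_eq by blast
 show "tens T \<in> hilb E s" "E.nrm (tens T) = c * F.nrm T" using c1_Lw[OF g(1)] unfolding g(2) tens_Dst[OF g(1)] E.hilb_eq by auto
qed

lemma restriction_index: "complex_of_real (2 * (- s) + 1/2) = of_real (- t)" by (simp add: t)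

lemma restricts:
 "restricts_to_scaled_isometry (restriction_transpose \<iota> E (%x. cnj (chi x)) (of_real (- s)))
  (I_dual F eta (of_real t)) (I_dual E chi (of_real s)) (hilb F t) (hilb_inner F t) (hilb E s) (hilb_inner E s)"
 unfolding restricts_to_scaled_isometry_def E.I_dual_eq F.I_dual_eq
proof (intro conjI ballI exI[of _ c] c_pos impI)
 let ?IE = "I_smooth E chi (of_real (- s))" and ?IF = "I_smooth F eta (of_real (- t))"
 let ?A = "restriction_transpose \<iota> E (%x. cnj (chi x)) (of_real (- s))"
 have A: "?A T f = (if f \<in> ?IE then T (f \<circ> \<iota>) else 0)" for T f by (simp only: restriction_transpose_def E.I_smooth_cnj)
 \<comment> \<open>The parameter of the restricted functions is 2 (- s) + 1/2 = - t, so a functional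
   on the smaller smooth space can be applied to them.\<close>
 have rest: "f \<circ> \<iota> \<in> ?IF" if "f \<in> ?IE" for f using I_smooth_comp_iota[OF that] unfolding restriction_index .
 show "?A T \<in> algebraic_dual ?IE" if T: "T \<in> algebraic_dual ?IF" for T
 proof -
  from T have Ta: "\<forall>f\<in>?IF. \<forall>g\<in>?IF. T (%x. f x + g x) = T f + T g" and Tm: "\<forall>k. \<forall>f\<in>?IF. T (%x. k * f x) = k * T f"
   unfolding algebraic_dual_def by blast+
  show ?thesis unfolding algebraic_dual_def mem_Collect_eq
  proof (intro conjI ballI allI impI)
   show "?A T f = 0" if "f \<notin> ?IE" for f using that by (simp only: A if_False)
   show "?A T (%x. f x + g x) = ?A T f + ?A T g" if "f \<in> ?IE" "g \<in> ?IE" for f g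
    using bspec[OF bspec[OF Ta rest[OF that(1)]] rest[OF that(2)]] I_smooth_add(1)[OF that] that by (simp only: A if_True comp_iota_linear)
   show "?A T (%x. k * f x) = k * ?A T f" if "f \<in> ?IE" for k f
    using bspec[OF spec[OF Tm] rest[OF that], of k] I_smooth_cmult(1)[OF that, of k] that by (simp only: A if_True comp_iota_linear)
  qed
 qed
 \<comment> \<open>Elements of the Hilbert space are functionals on test functions only;
   \<open>extend_distribution\<close> continues them to all smooth vectors.\<close>
 show "hilb F t \<subseteq> as_distribution ` algebraic_dual ?IF"
 proof
  fix T assume "T \<in> hilb F t"
  hence "T \<in> distributions" by (simp add: hilb_def)
  from F.extend_distribution[OF this] show "T \<in> as_distribution ` algebraic_dual ?IF" by blast
 qed
 fix T assume "T \<in> algebraic_dual ?IF" and T: "as_distribution T \<in> hilb F t"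
 have "as_distribution (?A T) = tens (as_distribution T)"
 proof
  fix \<phi> :: "'e => complex"
  show "as_distribution (?A T) \<phi> = tens (as_distribution T) \<phi>"
   using E.Cc_I_smooth[of \<phi> "of_real (- s)"] Cc_comp_iota[of \<phi>] unfolding as_distribution_def tens_def A by simp
 qed
 thus "as_distribution (?A T) \<in> hilb E s" "E.nrm (as_distribution (?A T)) = c * F.nrm (as_distribution T)" using tens_hilb[OF T] by simp_all
qed

text \<open>Both sides of the intertwining relation are compared on test functions vanishing near the point
 that the Moebius transformation sends to infinity.\<close>

lemma tens_equivariant:
 assumes g: "g \<in> carrier PGL2" and T: "T \<in> hilb F t"
 shows "tens (F.U g T) = E.U (pgl_map \<iota> g) (tens T)"
proof -
 obtain A where A: "det A ~= 0" "g = pgl_class A" using g by (rule PGL2_cases)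
 obtain a b c' d where Am: "A = mt a b c' d" by (rule mt_cases)
 let ?c = c'
 have det: "a * d - b * ?c ~= 0" using A(1) Am by simp
 have iD: "\<iota> a * \<iota> d - \<iota> b * \<iota> ?c = \<iota> (a * d - b * ?c)" by simp
 hence detE: "\<iota> a * \<iota> d - \<iota> b * \<iota> ?c ~= 0" using det iota_eq_0 by metis
 let ?h = "pgl_class (mt (\<iota> a) (\<iota> b) (\<iota> ?c) (\<iota> d))"
 have gh: "pgl_map \<iota> g = ?h" using A Am by (simp add: pgl_map_class)
 have gA: "g = pgl_class (mt a b ?c d)" using A Am by simp
 have UT: "F.U g T \<in> hilb F t" by (rule F.rep.U_mem[OF g T])
 have S: "(%\<phi>. E.U ?h (tens T) \<phi> - tens (F.U g T) \<phi>) \<in> hilb E s" by (intro E.diff_mem E.rep.U_mem tens_hilb(1) T UT) (use detE in simp)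
 have "(%\<phi>. E.U ?h (tens T) \<phi> - tens (F.U g T) \<phi>) = (%\<phi>. 0)"
 proof (rule E.hilb_eq_0_if_supported_at_point[OF S, of "\<iota> (d / b)"])
  fix \<phi> :: "'e => complex" and \<delta> :: 'e
  assume \<phi>: "\<phi> \<in> Cc" and \<delta>: "\<delta> ~= 0" and van: "!!x. absval (x - \<iota> (d / b)) <= absval \<delta> ==> \<phi> x = 0"
  have \<phi>F: "\<phi> \<circ> \<iota> \<in> Cc" by (rule Cc_comp_iota[OF \<phi>])
  define tE where "tE = smooth_action E chi (of_real (- s)) (inv\<^bsub>PGL2\<^esub> ?h) \<phi>"
  define tF where "tF = smooth_action F eta (of_real (- t)) (inv\<^bsub>PGL2\<^esub> (pgl_class (mt a b ?c d))) (\<phi> \<circ> \<iota>)"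
  have tE: "tE \<in> Cc" unfolding tE_def
   by (rule E.transpose_Cc[OF detE \<phi>]) (use \<delta> van in \<open>auto simp: iota_divide[symmetric] simp del: iota_divide\<close>)
  have tF: "tF \<in> Cc" unfolding tF_def
  proof (rule F.transpose_Cc[OF det \<phi>F])
   \<comment> \<open>Since |\<iota> z| = |z|^2, a radius below both 1 and |\<delta>| stays within
     |\<delta>| after the embedding.\<close>
   obtain \<delta>' :: 'f where \<delta>': "\<delta>' ~= 0" "absval \<delta>' < min 1 (absval \<delta>)" using F.ex_absval_less[of "min 1 (absval \<delta>)"] \<delta> by auto
   have vz: "(\<phi> \<circ> \<iota>) x = 0" if x: "absval (x - d / b) <= absval \<delta>'" for x
   proof -
    have "absval (x - d / b) * absval (x - d / b) <= absval \<delta> * 1" using x \<delta>' by (intro mult_mono) auto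
    hence "absval (\<iota> (x - d / b)) <= absval \<delta>" unfolding absval_iota power2_eq_square by simp
    thus ?thesis using van[of "\<iota> x"] by (simp only: iota_diff comp_def)
   qed
   show "\<exists>\<delta>::'f. \<delta> ~= 0 \<and> (\<forall>x. absval (x - d / b) <= absval \<delta> --> (\<phi> \<circ> \<iota>) x = 0)" by (intro exI[of _ \<delta>'] conjI allI impI \<delta>'(1)) (rule vz)
  qed
  \<comment> \<open>The two formulas agree off the pole, hence almost everywhere, and both sides are
    test functions.\<close>
  have "tE \<circ> \<iota> = tF"
  proof (rule F.Cc_eqI_AE[OF Cc_comp_iota[OF tE] tF])
   show "AE x in haar F. (tE \<circ> \<iota>) x = tF x" using F.AE_den_nz[OF det]
   proof eventually_elim
    case (elim x)
    have iden: "\<iota> a + \<iota> b * \<iota> x = \<iota> (a + b * x)" by simp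
    have denE: "\<iota> a + \<iota> b * \<iota> x ~= 0" unfolding iden iota_eq_0 by (rule elim)
    have imob: "(\<iota> ?c + \<iota> d * \<iota> x) / (\<iota> a + \<iota> b * \<iota> x) = \<iota> ((?c + d * x) / (a + b * x))" by simp
    \<comment> \<open>At a point of the subfield the Jacobian over the extension is the square of
      \<open>J\<close>, which matches 2 (- s + 1/2) = - t + 1/2.\<close>
    define J where "J = absval (a * d - b * ?c) / (absval (a + b * x))\<^sup>2"
    have J: "0 < J" using det elim by (simp add: J_def)
    have "(absval (a * d - b * ?c))\<^sup>2 / ((absval (a + b * x))\<^sup>2)\<^sup>2 = J\<^sup>2" by (simp add: J_def power_divide)
    moreover have "(J\<^sup>2) powr (- s + 1/2) = J powr (- t + 1/2)" using J powr_powr[of J 2 "- s + 1/2"] by (simp add: t)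
    ultimately have "tE (\<iota> x) = F.mc 0 (a * d - b * ?c) * of_real (J powr (- t + 1/2)) * \<phi> (\<iota> ((?c + d * x) / (a + b * x)))"
     unfolding tE_def E.smooth_action_moebius[OF E.Cc_I_smooth[OF \<phi>] detE denE] imob
     unfolding iden iD mc0_iota[OF det] absval_iota by (simp only:)
    moreover have "tF x = F.mc 0 (a * d - b * ?c) * of_real (J powr (- t + 1/2)) * \<phi> (\<iota> ((?c + d * x) / (a + b * x)))"
     unfolding tF_def F.smooth_action_moebius[OF F.Cc_I_smooth[OF \<phi>F] det elim] J_def o_apply ..
    ultimately show ?case by (simp only: comp_def)
   qed
  qed
  have "E.U ?h (tens T) \<phi> = tens T tE" unfolding tE_def by (rule E.U_dual[OF detE \<phi> tens_hilb(1)[OF T] tE[unfolded tE_def]])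
  also have "... = T tF" using tE \<open>tE \<circ> \<iota> = tF\<close> by (simp add: tens_def)
  also have "... = F.U g T (\<phi> \<circ> \<iota>)" unfolding gA tF_def by (rule F.U_dual[OF det \<phi>F T tF[unfolded tF_def], symmetric])
  also have "... = tens (F.U g T) \<phi>" using \<phi> by (simp add: tens_def)
  finally show "E.U ?h (tens T) \<phi> - tens (F.U g T) \<phi> = 0" by simp
 qed
 thus ?thesis unfolding gh by (simp add: fun_eq_iff)
qed

text \<open>Continuity is inherited by pulling a matrix neighbourhood of the identity back along the
  continuous map \<open>mmap\<close>.\<close>

lemma unitary_restricted: "unitary_rep PGL2 PGL2_topology (hilb E s) (hilb_inner E s) (%g. E.U (pgl_map \<iota> g))"
proof (rule E.unitary_rep_PGL2I)
 fix g h :: "('f^2^2) set" and T T' and e :: real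
 show "g \<in> carrier PGL2 ==> linear_between (hilb E s) (hilb E s) (E.U (pgl_map \<iota> g))" by (intro E.rep.U_linear pgl_map_in)
 show "g \<in> carrier PGL2 ==> T \<in> hilb E s ==> T' \<in> hilb E s ==> hilb_inner E s (E.U (pgl_map \<iota> g) T) (E.U (pgl_map \<iota> g) T') = hilb_inner E s T T'"
  by (intro E.rep.U_inner pgl_map_in)
 show "T \<in> hilb E s ==> E.U (pgl_map \<iota> \<one>\<^bsub>PGL2\<^esub>) T = T" unfolding pgl_map_one by (rule E.rep.U_one)
 show "g \<in> carrier PGL2 ==> h \<in> carrier PGL2 ==> T \<in> hilb E s ==>
  E.U (pgl_map \<iota> (g \<otimes>\<^bsub>PGL2\<^esub> h)) T = E.U (pgl_map \<iota> g) (E.U (pgl_map \<iota> h) T)" by (simp add: pgl_map_mult E.rep.U_mult pgl_map_in)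
 assume T: "T \<in> hilb E s" and e: "0 < e"
 from E.near_one[OF T e] obtain N where N: "open N" "mat 1 \<in> N"
  "!!A. A \<in> N ==> det A ~= 0 \<and> E.dst (E.U (pgl_class A) T) T < e" by blast
 have "open (mmap -` N)" by (rule open_vimage[OF N(1) continuous_on_mmap])
 moreover have "mat 1 \<in> mmap -` N" using N(2) by simp
 moreover have "det A ~= 0 \<and> E.dst (E.U (pgl_map \<iota> (pgl_class A)) T) T < e" if "A \<in> mmap -` N" for A
  using N(3)[of "mmap A"] that by (simp add: pgl_map_class)
 ultimately show "\<exists>N. open N \<and> mat 1 \<in> N \<and> (\<forall>A\<in>N. det A ~= 0 \<and> E.dst (E.U (pgl_map \<iota> (pgl_class A)) T) T < e)" by blast
qed

lemma summand:
 "contains_summand PGL2 PGL2_topology (hilb E s) (hilb_inner E s) (%g. E.U (pgl_map \<iota> g))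
  (hilb F t) (hilb_inner F t) F.U" unfolding contains_summand_def
proof (intro conjI unitary_restricted F.unitary)
 \<comment> \<open>Dividing by \<open>c\<close> makes the embedding isometric. It then preserves
   inner products by polarization, and its image is closed because its source is complete.\<close>
 define L :: "(('f => complex) => complex) => ('e => complex) => complex" where "L T = (%\<phi>. of_real (1 / c) * tens T \<phi>)" for T
 have LE: "L T \<in> hilb E s" if "T \<in> hilb F t" for T unfolding L_def by (rule E.cmult_mem[OF tens_hilb(1)[OF that]])
 have lin: "linear_between (hilb F t) (hilb E s) L" unfolding linear_between_def
 proof (intro conjI ballI allI LE)
  show "L (%x. T x + T' x) = (%y. L T y + L T' y)" for T T' by (auto simp: L_def tens_def fun_eq_iff add_divide_distrib)
  show "L (%x. k * T x) = (%y. k * L T y)" for k T by (auto simp: L_def tens_def fun_eq_iff)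
 qed
 have iso: "E.nrm (L T) = F.nrm T" if T: "T \<in> hilb F t" for T
 proof -
  have "E.nrm (L T) = norm (complex_of_real (1 / c)) * E.nrm (tens T)" unfolding L_def by (rule E.nrm_cmult[OF tens_hilb(1)[OF T]])
  also have "... = F.nrm T" using c_pos by (simp add: tens_hilb(2)[OF T] norm_divide)
  finally show ?thesis .
 qed
 have inner: "hilb_inner E s (L T) (L T') = hilb_inner F t T T'" if "T \<in> hilb F t" "T' \<in> hilb F t" for T T'
  by (rule isometry_preserves_inner[OF F.hspace_axioms E.hspace_axioms lin iso that])
 have inj: "inj_on L (hilb F t)"
 proof (rule inj_onI)
  fix T T' assume T: "T \<in> hilb F t" "T' \<in> hilb F t" and eq: "L T = L T'"
  have "F.dst T T' = E.nrm (L (%x. T x - T' x))" using iso[OF F.diff_mem[OF T]] by simp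
  also have "L (%x. T x - T' x) = (%x. 0)" using F.linear_diff[OF lin T] eq by simp
  finally have "F.dst T T' = 0" by simp
  hence "(%x. T x - T' x) = (%x. 0)" by (rule F.nrm_eq_0[OF F.diff_mem[OF T]])
  thus "T = T'" by (simp add: fun_eq_iff)
 qed
 have equi: "L (F.U g T) = E.U (pgl_map \<iota> g) (L T)" if g: "g \<in> carrier PGL2" and T: "T \<in> hilb F t" for g :: "('f^2^2) set" and T
 proof -
  have "\<forall>k. \<forall>f\<in>hilb E s. E.U (pgl_map \<iota> g) (%x. k * f x) = (%y. k * E.U (pgl_map \<iota> g) f y)"
   using E.rep.U_linear[OF pgl_map_in[OF g]] unfolding linear_between_def by blast
  from bspec[OF spec[OF this] tens_hilb(1)[OF T]] show ?thesis unfolding L_def tens_equivariant[OF g T] by (rule sym)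
 qed
 show "\<exists>W L. closed_subspace (hilb E s) (hilb_inner E s) W \<and> invariant_subspace PGL2 (%g. E.U (pgl_map \<iota> g)) W
   \<and> linear_between (hilb F t) W L \<and> bij_betw L (hilb F t) W
   \<and> (\<forall>f\<in>hilb F t. \<forall>h\<in>hilb F t. hilb_inner E s (L f) (L h) = hilb_inner F t f h)
   \<and> (\<forall>g\<in>carrier PGL2. \<forall>f\<in>hilb F t. L (F.U g f) = E.U (pgl_map \<iota> g) (L f))"
 proof (intro exI[of _ "L ` hilb F t"] exI[of _ L] conjI ballI inner equi)
  show "closed_subspace (hilb E s) (hilb_inner E s) (L ` hilb F t)" by (rule F.closed_isometric_image[OF E.hspace_axioms lin iso])
  show "invariant_subspace PGL2 (%g. E.U (pgl_map \<iota> g)) (L ` hilb F t)" unfolding invariant_subspace_def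
  proof (intro ballI)
   fix g :: "('f^2^2) set" and f assume g: "g \<in> carrier PGL2" and "f \<in> L ` hilb F t"
   then obtain T where T: "T \<in> hilb F t" "f = L T" by blast
   show "E.U (pgl_map \<iota> g) f \<in> L ` hilb F t" unfolding T(2) equi[OF g T(1), symmetric] by (intro imageI F.rep.U_mem g T(1))
  qed
  show "linear_between (hilb F t) (L ` hilb F t) L" using lin unfolding linear_between_def by blast
  show "bij_betw L (hilb F t) (L ` hilb F t)" by (rule inj_on_imp_bij_betw[OF inj])
 qed
qed

end

theorem theorem6p1:
  fixes \<iota> :: "'f::nonarch_local_field \<Rightarrow> 'e::nonarch_local_field"
    and \<alpha> w :: 'e and F :: "'f field_data" and E :: "'e field_data"
    and chi :: "'e \<Rightarrow> complex" and eta :: "'f \<Rightarrow> complex"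
  assumes ext: "quadratic_extension \<iota> \<alpha>"
    and F: "field_data F"
    and w: "uniformizer w"
    and E: "E = extension_data \<iota> \<alpha> F w"
    and chi: "unit_character chi"
    and quadratic: "\<forall>u\<in>unit_group. (chi u)\<^sup>2 = 1"
    and eta: "eta = chi \<circ> \<iota>"
    and uniformizers: "mult_char E chi 0 (\<iota> (unif F)) = 1"
  shows
    "(\<forall>s t :: real. 1/4 < s \<and> s < 1/2 \<and> t = 2 * s - 1/2 \<longrightarrow>
        restricts_to_scaled_isometry
          (restriction_transpose \<iota> E (\<lambda>x. cnj (chi x)) (of_real (- s)))
          (I_dual F eta (of_real t)) (I_dual E chi (of_real s))
          (hilb F t) (hilb_inner F t) (hilb E s) (hilb_inner E s)
        \<and> irreducible_unitary_rep PGL2 PGL2_topology (hilb E s) (hilb_inner E s)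
            (complementary_action E chi s)
        \<and> contains_summand PGL2 PGL2_topology
            (hilb E s) (hilb_inner E s) (\<lambda>g. complementary_action E chi s (pgl_map \<iota> g))
            (hilb F t) (hilb_inner F t) (complementary_action F eta t))
     \<and>
     (\<forall>s t :: real. s = 1/2 \<and> t = 1/2 \<longrightarrow>
        restricts_to_scaled_isometry
          (restriction_transpose \<iota> E (\<lambda>x. cnj (chi x)) (of_real (- s)))
          (I_dual F eta (of_real t)) (I_dual E chi (of_real s))
          (hilb F t) (hilb_inner F t) (hilb E s) (hilb_inner E s)
        \<and> irreducible_unitary_rep PGL2 PGL2_topology (hilb E s) (hilb_inner E s)
            (steinberg_action E chi)
        \<and> contains_summand PGL2 PGL2_topology
            (hilb E s) (hilb_inner E s) (\<lambda>g. steinberg_action E chi (pgl_map \<iota> g))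
            (hilb F t) (hilb_inner F t) (steinberg_action F eta))"
proof ((rule conjI; intro allI impI), goal_cases)
 \<comment> \<open>At \<open>s = 1/2\<close> the relation \<open>t = 2 * s - 1/2\<close> gives
   \<open>t = 1/2\<close>, so both parts are instances of the same locale.\<close>
 have loc: "rep_extension \<iota> \<alpha> w F chi s t" if "1/4 < s" "s \<le> 1/2" "t = 2 * s - 1/2" for s t :: real
  by unfold_locales (use ext F w chi quadratic uniformizers E that in auto)
 {
  case (1 s t)
  hence st: "1/4 < s" "s < 1/2" "t = 2 * s - 1/2" "t < 1/2" by auto
  interpret rep_extension \<iota> \<alpha> w F chi s t by (rule loc) (use st in auto)
  show ?case
   unfolding E eta E.complementary_action_eq[OF st(2)] F.complementary_action_eq[OF st(4)]
   by (intro conjI restricts E.irreducible summand)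
 next
  case (2 s t)
  hence st: "s = 1/2" "t = 1/2" by auto
  interpret rep_extension \<iota> \<alpha> w F chi s t by (rule loc) (use st in auto)
  show ?case
   unfolding E eta E.steinberg_action_eq[OF st(1)] F.steinberg_action_eq[OF st(2)]
   by (intro conjI restricts E.irreducible summand)
 }
qed

end
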